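(* Let $d\ge1$, $\delta>0$, $\gamma>0$ and assume that $\gamma+\delta-d>0$. Let $V(x,\omega)=\sum_{i}r_i^{-\gamma}\mathbf 1_{B(\omega_i,r_i)}(x)$ be Lacoin's potential with parameters $\delta,\gamma$. Then: (1) $\sup_{x\in B(0)}V(x,\cdot)\in L_{\mathbb{P}}(d,1)$; (2) there exist positive constants $\rho,\varepsilon$ and a measurable function $u:\Omega\to\mathbb{R}^d$ such that $\mathbb{P}$-a.s. $\mathrm{Leb}(\{x\in\mathbb{R}^d:V(x,\omega)>\varepsilon\}\cap B(u(\omega),\rho))>\varepsilon$, and $\mathbb{E}(|u(\cdot)|^d)<\infty$; (3) $\lambda_V=\inf_\Omega V=0$; (4) the Lyapunov exponent $\alpha(\cdot)$ is a norm on $\mathbb{R}^d$.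
   Context: Lacoin's potential. $\omega=(\omega_i,r_i)_i$ is a Poisson point process on $\mathbb{R}^d\times[0,\infty)$ (under a probability $\mathbb{P}$ on the configuration space $\Omega$ of such locally finite point configurations with $r_i\ge1$) with intensity measure $\mathrm{Leb}\times\nu$, where $\nu$ is the probability measure with $\nu([r,\infty))=r^{-\delta}$ for $r\ge1$. $\mathbb{E}$ is the expectation under $\mathbb{P}$. $\inf_\Omega V$ denotes $\inf_{\omega\in\Omega}V(0,\omega)$. Notation. $\mathrm{Leb}$ is Lebesgue measure on $\mathbb{R}^d$; $B(y,R)=\{x:|x-y|<R\}$, $B(y)=B(y,1)$, $\overline B(y)$ its closure. $L_{\mathbb{P}}(d,1)$ is the Lorentz space of real random variables $f$ with $\int_0^1 f^*(s)s^{(1/d)-1}ds<\infty$, where $f^*:[0,1]\to\mathbb{R}^+$ is the non-increasing right-continuous function having the same distribution as $|f|$. $\lambda_V:=\inf\{\int_{\mathbb{R}^d}(\frac12|\nabla\varphi|^2+V\varphi^2)dx:\varphi\in C_c^\infty(\mathbb{R}^d),\int\varphi^2dx=1\}$, which is $\mathbb{P}$-a.s. constant by ergodicity. Lyapunov exponent. With $(Z_s)$ standard Brownian motion on $\mathbb{R}^d$ started at $0$ under $P_0$ (expectation $E_0$) and $H(y):=\inf\{t\ge0:Z_t\in\overline B(y)\}$, $\alpha(x)$ is the non-random $\mathbb{P}$-a.s. limit $$\alpha(x)=\lim_{r\to\infty}-\frac1r\log E_0\Big[\exp\Big(-\int_0^{H(rx)}V(Z_s,\omega)ds\Big)\mathbf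 1_{\{H(rx)<\infty\}}\Big],\qquad x\in\mathbb{R}^d.$$ *)

theory Defs
  imports "HOL-Probability.Probability"
begin

text \<open>
  A configuration is a locally finite set of pairs (centre, radius) with radii at least 1.
  Configurations are simple (sets, not multisets), which costs nothing: a Poisson process whose
  intensity is \<open>Leb \<times> \<nu>\<close> has almost surely no multiple points.
\<close>

definition configs :: "('a::euclidean_space \<times> real) set set" where
  "configs = {\<omega>. \<omega> \<subseteq> UNIV \<times> {1..} \<and> (\<forall>K. compact K \<longrightarrow> finite (\<omega> \<inter> K))}"

definition npoints :: "'p set \<Rightarrow> 'p set \<Rightarrow> enat" where
  "npoints A \<omega> = (if finite (\<omega> \<inter> A) then enat (card (\<omega> \<inter> A)) else \<infinity>)"

definition config_space :: "('a::euclidean_space \<times> real) set measure" where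
  "config_space = sigma configs {npoints A -` {k} \<inter> configs | A k. A \<in> sets borel}"

definition poisson_process ::
  "('a::euclidean_space \<times> real) measure \<Rightarrow> ('a \<times> real) set measure \<Rightarrow> bool" where
  "poisson_process \<Lambda> P \<longleftrightarrow>
     prob_space P \<and> sets P = sets config_space \<and>
     (\<forall>A\<in>sets borel. emeasure \<Lambda> A < \<infinity> \<longrightarrow>
        (\<forall>k. measure P {\<omega> \<in> space P. npoints A \<omega> = enat k} =
             measure \<Lambda> A ^ k / fact k * exp (- measure \<Lambda> A))) \<and>
     (\<forall>A :: nat \<Rightarrow> ('a \<times> real) set. range A \<subseteq> sets borel \<longrightarrow> disjoint_family A \<longrightarrow>
        prob_space.indep_vars P (\<lambda>_. count_space UNIV) (\<lambda>i. npoints (A i)) UNIV)"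

text \<open>The tail formula on \<open>[1,\<infinity>)\<close> determines the law of the radii.\<close>

definition radius_law :: "real \<Rightarrow> real measure \<Rightarrow> bool" where
  "radius_law \<delta> \<nu> \<longleftrightarrow>
     prob_space \<nu> \<and> sets \<nu> = sets borel \<and> (\<forall>r\<ge>1. measure \<nu> {r..} = r powr (-\<delta>))"

text \<open>
  The sum over the points of the configuration, as an integral against counting measure. It is
  taken in \<open>[0,\<infinity>]\<close> because it diverges for some locally finite configurations.
\<close>

definition lacoin :: "real \<Rightarrow> 'a::euclidean_space \<Rightarrow> ('a \<times> real) set \<Rightarrow> ennreal" where
  "lacoin \<gamma> x \<omega> =
     (\<integral>\<^sup>+ (y, r). ennreal (r powr (-\<gamma>)) * indicator (ball y r) x \<partial>count_space \<omega>)"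

text \<open>
  The non-increasing right-continuous function \<open>g\<close> with the distribution of \<open>\<bar>f\<bar>\<close>. It is
  considered on the open unit interval: the end points are Lebesgue-null, and for unbounded \<open>f\<close>
  no real value at 0 is compatible with monotonicity.
\<close>

definition decreasing_rearrangement :: "'w measure \<Rightarrow> ('w \<Rightarrow> real) \<Rightarrow> (real \<Rightarrow> real) \<Rightarrow> bool" where
  "decreasing_rearrangement M f g \<longleftrightarrow>
     (\<forall>s\<in>{0<..<1}. 0 \<le> g s) \<and>
     antimono_on {0<..<1} g \<and>
     (\<forall>s\<in>{0<..<1}. continuous (at_right s) g) \<and>
     distr (restrict_space lborel {0<..<1}) borel g = distr M borel (\<lambda>\<omega>. \<bar>f \<omega>\<bar>)"

definition lorentz :: "'w measure \<Rightarrow> nat \<Rightarrow> ('w \<Rightarrow> real) set" where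
  "lorentz M d = {f \<in> borel_measurable M. \<exists>g. decreasing_rearrangement M f g \<and>
     (\<integral>\<^sup>+ s\<in>{0<..<1}. ennreal (g s * s powr (1 / real d - 1)) \<partial>lborel) < \<infinity>}"

primrec continuously_differentiable :: "nat \<Rightarrow> ('a::euclidean_space \<Rightarrow> real) \<Rightarrow> bool" where
  "continuously_differentiable 0 f \<longleftrightarrow> continuous_on UNIV f"
| "continuously_differentiable (Suc k) f \<longleftrightarrow>
     (\<forall>x. f differentiable (at x)) \<and>
     (\<forall>b\<in>Basis. continuously_differentiable k (\<lambda>x. frechet_derivative f (at x) b))"

definition test_functions :: "('a::euclidean_space \<Rightarrow> real) set" where
  "test_functions =
     {\<phi>. (\<forall>k. continuously_differentiable k \<phi>) \<and> compact (closure {x. \<phi> x \<noteq> 0})}"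

definition gradient :: "('a::euclidean_space \<Rightarrow> real) \<Rightarrow> 'a \<Rightarrow> 'a" where
  "gradient f x = (\<Sum>b\<in>Basis. frechet_derivative f (at x) b *\<^sub>R b)"

definition principal_eigenvalue :: "('a::euclidean_space \<Rightarrow> ennreal) \<Rightarrow> ennreal" where
  "principal_eigenvalue v =
     (INF \<phi>\<in>{\<phi> \<in> test_functions. (LINT x|lborel. (\<phi> x)\<^sup>2) = 1}.
        \<integral>\<^sup>+ x. ennreal ((norm (gradient \<phi> x))\<^sup>2 / 2) + v x * ennreal ((\<phi> x)\<^sup>2) \<partial>lborel)"

definition brownian_motion :: "'w measure \<Rightarrow> (real \<Rightarrow> 'w \<Rightarrow> 'a::euclidean_space) \<Rightarrow> bool" where
  "brownian_motion W Z \<longleftrightarrow>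
     prob_space W \<and>
     (\<forall>t\<ge>0. Z t \<in> borel_measurable W) \<and>
     (\<forall>w\<in>space W. Z 0 w = 0 \<and> continuous_on {0..} (\<lambda>t. Z t w)) \<and>
     (\<forall>s t. 0 \<le> s \<longrightarrow> s < t \<longrightarrow>
        distr W borel (\<lambda>w. Z t w - Z s w) =
        density lborel (\<lambda>x. ennreal (\<Prod>b\<in>Basis. normal_density 0 (sqrt (t - s)) (x \<bullet> b)))) \<and>
     (\<forall>(n::nat) t. 0 \<le> t 0 \<longrightarrow> mono t \<longrightarrow>
        prob_space.indep_vars W (\<lambda>_. borel) (\<lambda>i w. Z (t (Suc i)) w - Z (t i) w) {..<n})"

definition hitting_time :: "(real \<Rightarrow> 'w \<Rightarrow> 'a::euclidean_space) \<Rightarrow> 'a \<Rightarrow> 'w \<Rightarrow> ereal" where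
  "hitting_time Z y w = (INF t\<in>{t. 0 \<le> t \<and> Z t w \<in> cball y 1}. ereal t)"

definition exp_neg :: "ennreal \<Rightarrow> real" where
  "exp_neg a = (if a = \<infinity> then 0 else exp (- enn2real a))"

definition neg_log :: "real \<Rightarrow> ereal" where
  "neg_log p = (if p \<le> 0 then \<infinity> else ereal (- ln p))"

definition travel_weight ::
  "'w measure \<Rightarrow> (real \<Rightarrow> 'w \<Rightarrow> 'a::euclidean_space) \<Rightarrow> ('a \<Rightarrow> ennreal) \<Rightarrow> 'a \<Rightarrow> real" where
  "travel_weight W Z v y =
     (LINT w|W. exp_neg (\<integral>\<^sup>+ s\<in>{s. 0 \<le> s \<and> ereal s \<le> hitting_time Z y w}. v (Z s w) \<partial>lborel)
                * indicator {w. hitting_time Z y w < \<infinity>} w)"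

text \<open>
  The real function \<open>\<alpha>\<close> is the almost sure non-random limit; the exceptional null set may depend
  on the direction \<open>x\<close>. Such an \<open>\<alpha>\<close> is unique when \<open>P\<close> is a probability measure. The convergence
  is stated in the extended reals, so that a vanishing expectation counts as \<open>\<infinity>\<close>.
\<close>

definition is_lyapunov_exponent ::
  "'c measure \<Rightarrow> 'w measure \<Rightarrow> (real \<Rightarrow> 'w \<Rightarrow> 'a::euclidean_space) \<Rightarrow> ('a \<Rightarrow> 'c \<Rightarrow> ennreal) \<Rightarrow>
   ('a \<Rightarrow> real) \<Rightarrow> bool" where
  "is_lyapunov_exponent P W Z V \<alpha> \<longleftrightarrow>
     (\<forall>x. AE \<omega> in P.
        ((\<lambda>r. neg_log (travel_weight W Z (\<lambda>z. V z \<omega>) (r *\<^sub>R x)) / ereal r) \<longlongrightarrow> ereal (\<alpha> x)) at_top)"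

definition is_norm :: "('a::real_vector \<Rightarrow> real) \<Rightarrow> bool" where
  "is_norm N \<longleftrightarrow>
     (\<forall>x. 0 \<le> N x) \<and> (\<forall>x. N x = 0 \<longleftrightarrow> x = 0) \<and>
     (\<forall>c x. N (c *\<^sub>R x) = \<bar>c\<bar> * N x) \<and> (\<forall>x y. N (x + y) \<le> N x + N y)"

end

theory Submission
  imports Defs "HOL-Real_Asymp.Real_Asymp"
begin

text \<open>Near the origin the potential is dominated by a far field: a sum over dyadic shells of the weights
\<open>2\<^sup>-\<^sup>n\<^sup>\<gamma>\<close> times independent Poisson counts. Its exponential moments are finite because \<open>\<gamma> + \<delta> > d\<close>, which
bounds the supremum over a ball; with positive probability the potential is small on a large ball, and by ergodicity
such a ball exists somewhere, so a bump function placed there makes the energy as small as desired.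

For the Lyapunov exponent, let the hop weight from \<open>x\<close> to \<open>y\<close> in time \<open>n\<close> be the smallest Feynman-Kac weight, over
starting points near \<open>x\<close>, of being near \<open>y\<close> at the integer time \<open>n\<close>. Its supremum over \<open>n\<close> is supermultiplicative
by the simple Markov property at integer times, so minus its logarithm is subadditive along rays and has an ergodic
limit. Up to subexponential factors, the weight of reaching a distant ball is a sum of hop weights over the integer
times up to a power of the distance, because longer survival has a negligible weight. The limit is positive since
every time a coordinate of the path reaches a new integer level, the path enters a cell whose Poisson points are
independent of the past, so the annealed weight decays exponentially in the number of levels.\<close>

text \<open>Balls of all sizes overlap, so the potential has dependence of unbounded range and is
  neither bounded nor bounded away from zero. Upper bounds go through a Poisson functional with
  independent shells. Lower bounds keep only the points with radii in a fixed window: every term is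
  nonnegative, so dropping the others is harmless and leaves independent cells. The path is an
  arbitrary Brownian motion on an arbitrary space. The Markov property is obtained by gluing two
  independent copies at an integer time and comparing path laws on dyadic grids; hitting times are
  compared with integer times at the price of an oscillation bound. The infimum over starting points
  inside a hop lets glued hops multiply without a Harnack inequality; an explicit comparison of
  Gaussian densities recovers the start at 0 at the end. A single one-sided ergodic statement
  carries the limits: a lower bound for subadditive sequences, which for negated sums is also the
  upper half of Birkhoff's theorem. The upper bound on passage costs uses additive chains along
  multiples of one long vector, and homogeneity under real factors is read off from the limit along
  the ray.\<close>

abbreviation enpoints :: "'b set \<Rightarrow> 'b set \<Rightarrow> ennreal" where
 "enpoints A \<eta> \<equiv> ennreal_of_enat (npoints A \<eta>)"

lemma sets_Collect_ball_vimage: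
 assumes "finite I" "\<And>i. i \<in> I \<Longrightarrow> f i \<in> measurable M N" "\<And>i. i \<in> I \<Longrightarrow> A i \<in> sets N"
 shows "{w \<in> space M. \<forall>i\<in>I. f i w \<in> A i} \<in> sets M"
proof (rule sets.sets_Collect_finite_All[OF _ assms(1)])
 fix i assume "i \<in> I"
 then have "f i -` A i \<inter> space M \<in> sets M" using assms by (intro measurable_sets) auto
 then show "{w \<in> space M. f i w \<in> A i} \<in> sets M" by (simp add: vimage_def Int_def conj_commute)
qed

section \<open>Measurability on the space of configurations\<close>

lemma space_config_space [simp]: "space config_space = configs"
 unfolding config_space_def by (rule space_measure_of) auto

lemma sets_config_space:
 "sets config_space = sigma_sets configs {npoints A -` {k} \<inter> configs | A k. A \<in> sets borel}"
 unfolding config_space_def by (rule sets_measure_of) auto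

lemma measurable_npoints [measurable]:
 assumes "A \<in> sets borel"
 shows "npoints A \<in> measurable config_space (count_space UNIV)" using assms
 by (subst measurable_count_space_eq2_countable) (auto simp: sets_config_space intro!: sigma_sets.Basic)

lemma nn_integral_count_space_indicator_npoints:
 "(\<integral>\<^sup>+p. indicator A p \<partial>count_space \<eta>) = enpoints A \<eta>"
proof -
 have "(\<integral>\<^sup>+p. indicator A p \<partial>count_space \<eta>) = (\<integral>\<^sup>+p. indicator (A \<inter> \<eta>) p \<partial>count_space \<eta>)"
  by (rule nn_integral_cong) (auto simp: indicator_def)
 also have "\<dots> = emeasure (count_space \<eta>) (\<eta> \<inter> A)" by (subst nn_integral_indicator) (auto simp: Int_commute)
 also have "\<dots> = enpoints A \<eta>" by (simp add: emeasure_count_space npoints_def)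
 finally show ?thesis .
qed

lemma configs_finite: "\<eta> \<in> configs \<Longrightarrow> compact K \<Longrightarrow> finite (\<eta> \<inter> K)" by (auto simp: configs_def)

lemma measurable_ennreal_npoints [measurable]:
 assumes "A \<in> sets borel"
 shows "(\<lambda>\<eta>. enpoints A \<eta>) \<in> borel_measurable config_space"
 using measurable_npoints[OF assms] by (rule measurable_compose) simp

text \<open>Indicators give counts, which generate the sigma-algebra; linearity and monotone limits
  give all sums of a nonnegative Borel function over the points.\<close>

lemma borel_measurable_count_integral:
 fixes g :: "'a::euclidean_space \<times> real \<Rightarrow> ennreal"
 assumes "g \<in> borel_measurable borel"
 shows "(\<lambda>\<eta>. \<integral>\<^sup>+p. g p \<partial>count_space \<eta>) \<in> borel_measurable config_space" using assms
proof (induction rule: borel_measurable_induct)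
 case (cong f g)
 then show ?case by (simp add: ext[of f g])
next
 case (set A)
 then show ?case by (simp add: nn_integral_count_space_indicator_npoints)
next
 case (seq U)
 have "(\<integral>\<^sup>+p. (\<Squnion> (range U)) p \<partial>count_space \<eta>) = (SUP n. \<integral>\<^sup>+p. U n p \<partial>count_space \<eta>)" for \<eta>
  using seq(3) by (simp add: nn_integral_monotone_convergence_SUP image_comp)
 then show ?case using seq by (simp add: borel_measurable_SUP)
qed (simp_all add: nn_integral_cmult nn_integral_add)

text \<open>Whether a ball of the configuration contains \<open>x\<close> is decided by countably many test balls;
 the first \<open>n\<close> of them leave only finitely many functions of the configuration alone.\<close>

lemma borel_measurable_lacoin_pair:
 "(\<lambda>(x::'a::euclidean_space, \<eta>). lacoin \<gamma> x \<eta>) \<in> borel_measurable (borel \<Otimes>\<^sub>M config_space)"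
proof -
 obtain D :: "'a set" where D: "countable D" "\<And>U. open U \<Longrightarrow> U \<noteq> {} \<Longrightarrow> \<exists>d\<in>D. d \<in> U"
  using countable_dense_exists[where 'a = 'a] by blast
 then have "D \<noteq> {}" by blast
 define e :: "nat \<Rightarrow> 'a \<times> real" where "e = from_nat_into (D \<times> \<rat>)"
 have "D \<times> \<rat> \<noteq> ({} :: ('a \<times> real) set)" "countable (D \<times> (\<rat> :: real set))" using \<open>D \<noteq> {}\<close> D(1) countable_rat by auto
 then have e: "range e = D \<times> \<rat>" unfolding e_def by (rule range_from_nat_into)
 define U where "U i = ball (fst (e i)) (snd (e i))" for i
 define T where "T n x = {i. i < n \<and> x \<in> U i}" for n :: nat and x
 \<comment> \<open>A point contributes to \<open>g I\<close> if its ball contains one of the test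
   balls with index in \<open>I\<close>. For a fixed finite \<open>I\<close> this is a condition on
   the point alone, while \<open>T n x\<close> selects the test balls that contain
   \<open>x\<close>.\<close>
 define g where "g I p = ennreal (snd p powr (-\<gamma>)) * (if \<exists>i\<in>I. dist (fst p) (fst (e i)) + snd (e i) \<le> snd p then 1 else 0)" for I and p :: "'a \<times> real"
 have g: "g I \<in> borel_measurable borel" if "finite I" for I
  unfolding g_def[abs_def] borel_prod[symmetric] using that by measurable
 have T: "(\<lambda>q. T n (fst q)) \<in> measurable (borel \<Otimes>\<^sub>M config_space) (count_space (Pow {..<n}))" for n
 proof (rule measurable_compose[OF measurable_fst])
  have "T n -` {I} \<inter> space borel \<in> sets borel" if I: "I \<subseteq> {..<n}" for I
  proof -
   have "{x \<in> space borel. \<forall>i\<in>{..<n}. (i \<in> I) = (x \<in> U i)} \<in> sets borel"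
   proof (rule sets.sets_Collect_finite_All)
    fix i
    have "U i \<in> sets borel" "- U i \<in> sets borel" by (auto simp: U_def Compl_eq_Diff_UNIV)
    then show "{x \<in> space borel. (i \<in> I) = (x \<in> U i)} \<in> sets borel"
     by (cases "i \<in> I") (simp_all add: Compl_eq)
   qed simp
   also have "{x \<in> space borel. \<forall>i\<in>{..<n}. (i \<in> I) = (x \<in> U i)} = T n -` {I} \<inter> space borel"
    using I unfolding T_def by blast
   finally show ?thesis .
  qed
  then show "T n \<in> measurable borel (count_space (Pow {..<n}))"
   by (subst measurable_count_space_eq2) (auto simp: T_def)
 qed
 have "(\<lambda>q. \<integral>\<^sup>+p. g (T n (fst q)) p \<partial>count_space (snd q)) \<in> borel_measurable (borel \<Otimes>\<^sub>M config_space)" for n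
 proof (rule measurable_compose_countable'[OF _ T])
  fix I assume "I \<in> Pow {..<n}"
  then have "finite I" using finite_subset by blast
  then show "(\<lambda>q. \<integral>\<^sup>+p. g I p \<partial>count_space (snd q)) \<in> borel_measurable (borel \<Otimes>\<^sub>M config_space)"
   by (rule measurable_compose[OF measurable_snd borel_measurable_count_integral[OF g]])
 qed (simp add: countable_finite)
 then have "(\<lambda>q. SUP n. \<integral>\<^sup>+p. g (T n (fst q)) p \<partial>count_space (snd q)) \<in> borel_measurable (borel \<Otimes>\<^sub>M config_space)"
  by (intro borel_measurable_SUP) auto
 moreover have "(SUP n. \<integral>\<^sup>+p. g (T n x) p \<partial>count_space \<eta>) = lacoin \<gamma> x \<eta>" for x and \<eta> :: "('a \<times> real) set"
 proof -
  have "(SUP n. g (T n x) (y, r)) = ennreal (r powr (-\<gamma>)) * indicator (ball y r) x" for y r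
  proof (cases "x \<in> ball y r")
   case True
   \<comment> \<open>A third of the slack: the centre \<open>d\<close> lies within \<open>h\<close>
     of \<open>x\<close> and the rational radius between \<open>h\<close> and \<open>2 * h\<close>,
     so the test ball contains \<open>x\<close> and still fits into \<open>ball y r\<close>.\<close>
   define h where "h = (r - dist y x) / 3"
   have h: "0 < h" using True by (simp add: h_def)
   obtain d where d: "d \<in> D" "dist x d < h" using D(2)[of "ball x h"] h by auto
   obtain s where s: "s \<in> \<rat>" "h < s" "s < 2 * h" using Rats_dense_in_real[of h "2 * h"] h by auto
   have "(d, s) \<in> range e" unfolding e using d s by simp
   then obtain i where i: "e i = (d, s)" by (metis rangeE)
   have "dist y d + s \<le> r" using dist_triangle[of y d x] d(2) s(3) by (simp add: h_def)
   moreover have "i \<in> T (Suc i) x" using d(2) s(2) by (simp add: T_def U_def i dist_commute)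
   ultimately have "g (T (Suc i) x) (y, r) = ennreal (r powr (-\<gamma>))" using bexI[of _ i] by (auto simp: g_def i)
   then show ?thesis using True by (intro antisym SUP_least) (auto simp: g_def intro!: SUP_upper2[of "Suc i"])
  next
   case False
   have "g (T n x) (y, r) = 0" for n
   proof -
    have "\<not> (dist y (fst (e i)) + snd (e i) \<le> r)" if "x \<in> ball (fst (e i)) (snd (e i))" for i
     using that False dist_triangle[of y x "fst (e i)"] by auto
    then show ?thesis by (auto simp: g_def T_def U_def)
   qed
   then show ?thesis using False by simp
  qed
  moreover have "incseq (\<lambda>n. g (T n x))"
   by (rule incseq_SucI) (auto simp: le_fun_def g_def T_def intro!: mult_left_mono)
  ultimately show ?thesis
   unfolding lacoin_def by (subst nn_integral_monotone_convergence_SUP[symmetric]) (auto intro!: nn_integral_cong)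
 qed
 ultimately show ?thesis by (simp add: split_beta')
qed

lemma borel_measurable_lacoin [measurable]:
 assumes [measurable]: "f \<in> measurable M borel" "g \<in> measurable M config_space"
 shows "(\<lambda>z. lacoin \<gamma> (f z :: 'a::euclidean_space) (g z)) \<in> borel_measurable M"
 using measurable_compose[OF measurable_Pair[OF assms] borel_measurable_lacoin_pair] by simp

section \<open>Events of finitely many counts as a generating pi-system\<close>

text \<open>The class \<A> of admissible test sets is a parameter: bounded sets serve for uniqueness
  and mixing, subsets of a region for independence of regions.\<close>

definition count_events :: "('a::euclidean_space \<times> real) set set \<Rightarrow> ('a \<times> real) set set set" where
 "count_events \<A> = {{\<eta> \<in> configs. \<forall>i<n. npoints (A i) \<eta> = k i} | n A k. \<forall>i<(n::nat). A i \<in> \<A>}"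

lemma count_eventsI:
 "(\<And>i. i < (n::nat) \<Longrightarrow> A i \<in> \<A>) \<Longrightarrow> {\<eta> \<in> configs. \<forall>i<n. npoints (A i) \<eta> = k i} \<in> count_events \<A>"
 unfolding count_events_def by blast

lemma count_eventsE:
 assumes "E \<in> count_events \<A>"
 obtains n :: nat and A k where "\<forall>i<n. A i \<in> \<A>"
  "E = {\<eta> \<in> configs. \<forall>i<n. npoints (A i) \<eta> = k i}" using assms unfolding count_events_def by blast

lemma Int_stable_count_events:
 "Int_stable (count_events (\<A> :: ('a::euclidean_space \<times> real) set set))"
proof (rule Int_stableI)
 fix E F :: "('a \<times> real) set set" assume "E \<in> count_events \<A>" "F \<in> count_events \<A>"
 from \<open>E \<in> count_events \<A>\<close> obtain n :: nat and A k where 1: "\<forall>i<n. A i \<in> \<A>"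
  "E = {\<eta> \<in> configs. \<forall>i<n. npoints (A i) \<eta> = k i}" by (rule count_eventsE)
 from \<open>F \<in> count_events \<A>\<close> obtain m :: nat and B l where 2: "\<forall>i<m. B i \<in> \<A>"
  "F = {\<eta> \<in> configs. \<forall>i<m. npoints (B i) \<eta> = l i}" by (rule count_eventsE)
 have "E \<inter> F = {\<eta> \<in> configs. \<forall>i<n+m. npoints (if i < n then A i else B (i - n)) \<eta>
   = (if i < n then k i else l (i - n))}"
 proof -
  have all: "(\<forall>i<n+m. Q i) \<longleftrightarrow> (\<forall>i<n. Q i) \<and> (\<forall>i<m. Q (n + i))" for Q
   by (metis le_add_diff_inverse nat_add_left_cancel_less not_le trans_less_add1)
  show ?thesis unfolding 1 2 all by auto
 qed
 also have "\<dots> \<in> count_events \<A>" by (rule count_eventsI) (use 1(1) 2(1) in auto)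
 finally show "E \<inter> F \<in> count_events \<A>" .
qed

lemma count_events_sets:
 assumes "\<A> \<subseteq> sets borel" shows "count_events \<A> \<subseteq> sets config_space"
proof
 fix E assume "E \<in> count_events \<A>"
 then obtain n :: nat and A k where 1: "\<forall>i<n. A i \<in> \<A>"
  and E: "E = {\<eta> \<in> configs. \<forall>i<n. npoints (A i) \<eta> = k i}" by (rule count_eventsE)
 have "{\<eta> \<in> space config_space. \<forall>i\<in>{..<n}. npoints (A i) \<eta> \<in> {k i}} \<in> sets config_space"
  by (rule sets_Collect_ball_vimage[OF _ measurable_npoints]) (use 1 assms in auto)
 moreover have "E = {\<eta> \<in> space config_space. \<forall>i\<in>{..<n}. npoints (A i) \<eta> \<in> {k i}}"
  unfolding E space_config_space by blast
 ultimately show "E \<in> sets config_space" by (simp only:)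
qed

lemma ennreal_of_enat_npoints_suminf:
 assumes "disjoint_family E"
 shows "enpoints (\<Union>n. E n) \<eta> = (\<Sum>n. enpoints (E n) \<eta>)"
proof -
 have "(\<integral>\<^sup>+p. indicator (\<Union>n. E n) p \<partial>count_space \<eta>) = (\<integral>\<^sup>+p. (\<Sum>n. indicator (E n) p) \<partial>count_space \<eta>)"
  by (rule nn_integral_cong) (rule suminf_indicator[OF assms, symmetric])
 also have "\<dots> = (\<Sum>n. \<integral>\<^sup>+p. indicator (E n) p \<partial>count_space \<eta>)" by (rule nn_integral_suminf) simp
 finally show ?thesis by (simp only: nn_integral_count_space_indicator_npoints)
qed

lemma ennreal_of_enat_npoints_sum:
 assumes "finite J" "disjoint_family_on B J"
 shows "enpoints (\<Union>j\<in>J. B j) \<eta> = (\<Sum>j\<in>J. enpoints (B j) \<eta>)"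
proof -
 have "(\<integral>\<^sup>+p. indicator (\<Union>j\<in>J. B j) p \<partial>count_space \<eta>) = (\<integral>\<^sup>+p. (\<Sum>j\<in>J. indicator (B j) p) \<partial>count_space \<eta>)"
  by (rule nn_integral_cong) (rule indicator_UN_disjoint[OF assms])
 also have "\<dots> = (\<Sum>j\<in>J. \<integral>\<^sup>+p. indicator (B j) p \<partial>count_space \<eta>)" by (rule nn_integral_sum) simp
 finally show ?thesis by (simp only: nn_integral_count_space_indicator_npoints)
qed

text \<open>The count of any Borel set is the countable sum of its counts in the pieces
  \<open>E n\<close>, so \<A> has to contain the localised sets only. The sums are taken in
  \<open>ennreal\<close>, into which \<open>enat\<close> embeds injectively.\<close>

lemma sigma_sets_count_events:
 assumes \<A>: "\<A> \<subseteq> sets (borel :: ('a::euclidean_space \<times> real) measure)"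
  and E: "disjoint_family E" "(\<Union>n::nat. E n) = UNIV" "\<And>n A. A \<in> sets borel \<Longrightarrow> A \<inter> E n \<in> \<A>"
 shows "sigma_sets configs (count_events \<A>) = sets config_space"
proof (rule antisym)
 show "sigma_sets configs (count_events \<A>) \<subseteq> sets config_space"
  using sets.sigma_sets_subset[OF count_events_sets[OF \<A>]] by simp
 define S where "S = sigma configs (count_events \<A>)"
 have sub: "count_events \<A> \<subseteq> Pow configs" unfolding count_events_def by auto
 have sp: "space S = configs" and st: "sets S = sigma_sets configs (count_events \<A>)"
  unfolding S_def using sub by (auto intro: space_measure_of)
 have m: "npoints B \<in> measurable S (count_space UNIV)" if "B \<in> \<A>" for B
 proof -
  have "npoints B -` {k} \<inter> space S \<in> sets S" for k
  proof -
   have "{\<eta> \<in> configs. \<forall>i<Suc 0. npoints B \<eta> = k} \<in> count_events \<A>" by (rule count_eventsI) (rule that)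
   moreover have "{\<eta> \<in> configs. \<forall>i<Suc 0. npoints B \<eta> = k} = npoints B -` {k} \<inter> configs" by auto
   ultimately show ?thesis unfolding st sp by (auto intro: sigma_sets.Basic)
  qed
  then show ?thesis by (subst measurable_count_space_eq2_countable) auto
 qed
 have "{npoints A -` {k} \<inter> configs | A k. A \<in> sets borel} \<subseteq> sets S"
 proof safe
  fix A :: "('a \<times> real) set" and k assume A: "A \<in> sets borel"
  have A_eq: "A = (\<Union>n. A \<inter> E n)" using E(2) by auto
  have dis: "disjoint_family (\<lambda>n. A \<inter> E n)" using E(1) by (auto simp: disjoint_family_on_def)
  have [measurable]: "(\<lambda>\<eta>. enpoints (A \<inter> E n) \<eta>) \<in> borel_measurable S" for n
   by (rule measurable_compose[OF m[OF E(3)[OF A]]]) simp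
  have "npoints A -` {k} \<inter> configs =
   (\<lambda>\<eta>. \<Sum>n. enpoints (A \<inter> E n) \<eta>) -` {ennreal_of_enat k} \<inter> space S"
   unfolding ennreal_of_enat_npoints_suminf[OF dis, symmetric] A_eq[symmetric] sp
   by (auto simp: ennreal_of_enat_inj)
  also have "\<dots> \<in> sets S" by (rule measurable_sets[where A = borel]) auto
  finally show "npoints A -` {k} \<inter> configs \<in> sets S" .
 qed
 from sets.sigma_sets_subset[OF this] show "sets config_space \<subseteq> sigma_sets configs (count_events \<A>)"
  by (simp add: sp sets_config_space st[symmetric])
qed

abbreviation decomposed :: "nat \<Rightarrow> (nat \<Rightarrow> 'b set) \<Rightarrow> (nat \<Rightarrow> 'i set) \<Rightarrow> ('i \<Rightarrow> 'b set) \<Rightarrow> bool" where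
 "decomposed n A J B \<equiv> \<forall>i<n. \<forall>\<eta>. enpoints (A i) \<eta> = (\<Sum>j\<in>J i. enpoints (B j) \<eta>)"

text \<open>Refining a finite family of sets to the atoms of the algebra that it generates reduces
 joint laws of counts to counts of disjoint sets.\<close>

lemma atoms_exist:
 fixes A :: "nat \<Rightarrow> ('a::euclidean_space \<times> real) set"
 assumes A: "\<And>i. i < n \<Longrightarrow> A i \<in> sets borel"
 obtains B J m where "range B \<subseteq> sets borel" "disjoint_family B" "\<forall>j. B j \<subseteq> (\<Union>i<n. A i)"
  "\<forall>i<n. J i \<subseteq> {..<m::nat}"
  "decomposed n A J B"
proof -
 \<comment> \<open>Atoms are coded in binary by the set of those \<open>i < n\<close> whose
   \<open>A i\<close> contain the point. Codes with larger indices give the empty set, which makes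
   \<open>B\<close> an infinite disjoint sequence as the Poisson axioms want it; the atom outside
   all \<open>A i\<close> is left out, so that atoms of bounded sets are bounded.\<close>
 define B where "B j = {p. set_decode j \<subseteq> {..<n} \<and> p \<in> (\<Union>i<n. A i) \<and> (\<forall>i\<in>{..<n}. (p \<in> A i) = (i \<in> set_decode j))}" for j
 define J where "J i = {j. j < 2 ^ n \<and> i \<in> set_decode j}" for i
 have B1: "B j \<in> sets borel" for j
 proof (cases "set_decode j \<subseteq> {..<n}")
  case True
  then have "B j = (\<Union>i\<in>{..<n}. A i) \<inter> {p \<in> space borel. \<forall>i\<in>{..<n}. (p \<in> A i) = (i \<in> set_decode j)}"
   unfolding B_def by auto
  also have "\<dots> \<in> sets borel"
  proof (rule sets.Int)
   show "(\<Union>i\<in>{..<n}. A i) \<in> sets borel" using A by (intro sets.finite_UN) auto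
   show "{p \<in> space borel. \<forall>i\<in>{..<n}. (p \<in> A i) = (i \<in> set_decode j)} \<in> sets borel"
   proof (rule sets.sets_Collect_finite_All)
    fix i assume "i \<in> {..<n}"
    then have "A i \<in> sets borel" using A by simp
    then have "A i \<in> sets borel" "- A i \<in> sets borel" by (auto simp: Compl_eq_Diff_UNIV)
    then show "{p \<in> space borel. (p \<in> A i) = (i \<in> set_decode j)} \<in> sets borel"
     by (cases "i \<in> set_decode j") (simp_all add: Compl_eq)
   qed simp
  qed
  finally show ?thesis .
 next
  case False
  then have "B j = {}" unfolding B_def by auto
  then show ?thesis by simp
 qed
 have B2: "disjoint_family B" unfolding disjoint_family_on_def
 proof safe
  fix j j' p assume ne: "j \<noteq> j'" and p: "p \<in> B j" "p \<in> B j'"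
  have "set_decode j \<subseteq> {..<n}" "set_decode j' \<subseteq> {..<n}"
   "\<forall>i\<in>{..<n}. (i \<in> set_decode j) = (i \<in> set_decode j')" using p unfolding B_def by auto
  then have "set_decode j = set_decode j'" by blast
  then have "j = j'" by (metis set_decode_inverse)
  with ne show "p \<in> {}" by simp
 qed
 have B4: "A i = (\<Union>j\<in>J i. B j)" if "i < n" for i
 proof safe
  fix p assume p: "p \<in> A i"
  define S where "S = {i. i < n \<and> p \<in> A i}"
  have "set_encode S < 2 ^ n"
  proof -
   have "set_encode S \<le> set_encode {..<n}" unfolding set_encode_def by (rule sum_mono2) (auto simp: S_def)
   also have "\<dots> < 2 ^ n" unfolding set_encode_def using sum_power2[of n] by (simp add: lessThan_atLeast0)
   finally show ?thesis .
  qed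
  moreover have "set_decode (set_encode S) = S" by (rule set_encode_inverse) (auto simp: S_def)
  ultimately have "set_encode S \<in> J i" "p \<in> B (set_encode S)" using p that by (auto simp: J_def B_def S_def)
  then show "p \<in> (\<Union>j\<in>J i. B j)" by auto
 qed (use that in \<open>auto simp: J_def B_def\<close>)
 show thesis
 proof (rule that[of B J "2^n"])
  have "enpoints (A i) \<eta> = (\<Sum>j\<in>J i. enpoints (B j) \<eta>)" if i: "i < n" for i \<eta>
  proof -
   have "finite (J i)" by (auto simp: J_def)
   moreover have "disjoint_family_on B (J i)" using B2 by (auto simp: disjoint_family_on_def)
   ultimately show ?thesis using ennreal_of_enat_npoints_sum B4[OF i] by metis
  qed
  then show "decomposed n A J B" by blast
 qed (use B1 B2 in \<open>auto simp: J_def B_def\<close>)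
qed

text \<open>Product laws are available for counts of disjoint sets only. Since each count of
  \<open>A i\<close> is a sum of atom counts, the event becomes a measurable event of the vector of
  atom counts.\<close>

lemma count_event_vimage:
 fixes A :: "nat \<Rightarrow> ('a::euclidean_space \<times> real) set" and I :: "'i set"
 assumes J: "\<forall>i<n. J i \<subseteq> I" and eq: "decomposed n A J B"
 obtains C where "C \<in> sets (PiM I (\<lambda>_. count_space UNIV))"
  "{\<eta> \<in> configs. \<forall>i<n. npoints (A i) \<eta> = k i} = (\<lambda>\<eta>. \<lambda>j\<in>I. npoints (B j) \<eta>) -` C \<inter> configs"
proof -
 let ?N = "PiM I (\<lambda>_. count_space UNIV) :: ('i \<Rightarrow> enat) measure" and ?f = "\<lambda>\<eta>. \<lambda>j\<in>I. npoints (B j) \<eta>"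
 define C where "C = {v \<in> space ?N. \<forall>i\<in>{..<n}. (\<Sum>j\<in>J i. ennreal_of_enat (v j)) \<in> {ennreal_of_enat (k i)}}"
 show thesis
 proof (rule that)
  show "C \<in> sets ?N" unfolding C_def
  proof (rule sets_Collect_ball_vimage[where N = borel])
   fix i assume i: "i \<in> {..<n}"
   show "(\<lambda>v. \<Sum>j\<in>J i. ennreal_of_enat (v j)) \<in> borel_measurable ?N"
   proof (rule borel_measurable_sum)
    fix j assume "j \<in> J i"
    then have "j \<in> I" using J(1) i by auto
    then show "(\<lambda>v. ennreal_of_enat (v j)) \<in> borel_measurable ?N"
     by (intro measurable_compose[OF measurable_component_singleton]) auto
   qed
  qed auto
  have "(\<Sum>j\<in>J i. ennreal_of_enat (?f \<eta> j)) = enpoints (A i) \<eta>" if "i < n" for i \<eta>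
   unfolding eq[rule_format, OF that] by (rule sum.cong) (use J[rule_format, OF that] in auto)
  moreover have "?f \<eta> \<in> space ?N" for \<eta> by (auto simp: space_PiM)
  ultimately show "{\<eta> \<in> configs. \<forall>i<n. npoints (A i) \<eta> = k i} = ?f -` C \<inter> configs"
   unfolding C_def by (auto simp: ennreal_of_enat_inj)
 qed
qed

section \<open>Uniqueness of the Poisson law and independence of regions\<close>

locale poisson_law =
 fixes \<Lambda> :: "('a::euclidean_space \<times> real) measure" and P :: "('a \<times> real) set measure"
 assumes poisson: "poisson_process \<Lambda> P" and sets_intensity: "sets \<Lambda> = sets borel"
  and intensity_bounded: "A \<in> sets borel \<Longrightarrow> bounded A \<Longrightarrow> emeasure \<Lambda> A < \<infinity>"
begin

sublocale prob_space P using poisson by (simp add: poisson_process_def)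

lemma sets_P [simp, measurable_cong]: "sets P = sets config_space"
 using poisson by (simp add: poisson_process_def)

lemma space_P [simp]: "space P = configs" using sets_eq_imp_space_eq[OF sets_P] by simp

lemma prob_npoints:
 "A \<in> sets borel \<Longrightarrow> emeasure \<Lambda> A < \<infinity> \<Longrightarrow>
  prob {\<eta> \<in> space P. npoints A \<eta> = enat k} = measure \<Lambda> A ^ k / fact k * exp (- measure \<Lambda> A)"
 using poisson by (simp add: poisson_process_def)

lemma indep_npoints:
 "range A \<subseteq> sets borel \<Longrightarrow> disjoint_family A \<Longrightarrow>
  indep_vars (\<lambda>_. count_space UNIV) (\<lambda>i::nat. npoints (A i)) UNIV"
 using poisson by (simp add: poisson_process_def)

lemma measurable_npoints_P [measurable]:
 "A \<in> sets borel \<Longrightarrow> npoints A \<in> measurable P (count_space UNIV)"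
 using measurable_npoints measurable_cong_sets[OF sets_P refl] by blast

lemma measurable_ennreal_npoints_P [measurable]:
 "A \<in> sets borel \<Longrightarrow> (\<lambda>\<eta>. enpoints A \<eta>) \<in> borel_measurable P"
 using measurable_ennreal_npoints measurable_cong_sets[OF sets_P refl] by blast

lemma emeasure_count_law:
 assumes A: "A \<in> sets borel" "emeasure \<Lambda> A < \<infinity>"
 shows "emeasure (distr P (count_space UNIV) (npoints A)) {enat k}
  = ennreal (measure \<Lambda> A ^ k / fact k * exp (- measure \<Lambda> A))"
proof -
 have "emeasure (distr P (count_space UNIV) (npoints A)) {enat k}
  = emeasure P {\<eta> \<in> space P. npoints A \<eta> = enat k}"
  using A by (subst emeasure_distr) (auto simp: vimage_def Int_def intro!: arg_cong[where f="emeasure P"])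
 then show ?thesis by (simp add: emeasure_eq_measure prob_npoints[OF A, unfolded space_P])
qed

text \<open>The Poisson probabilities of the finite values already sum to 1, which leaves no mass
  for the value \<open>\<infinity>\<close>.\<close>

lemma AE_npoints_finite:
 assumes A: "A \<in> sets borel" "emeasure \<Lambda> A < \<infinity>"
 shows "AE \<eta> in P. npoints A \<eta> \<noteq> \<infinity>"
proof -
 let ?N = "distr P (count_space UNIV) (npoints A)" and ?m = "measure \<Lambda> A"
 interpret N: prob_space ?N by (intro prob_space_distr measurable_npoints_P A)
 have "(\<lambda>k. ?m ^ k / fact k * exp (- ?m)) sums (exp ?m * exp (- ?m))"
  by (intro sums_mult2) (use exp_converges[of ?m] in \<open>simp add: divide_inverse mult.commute\<close>)
 then have s: "(\<lambda>k. ?m ^ k / fact k * exp (- ?m)) sums 1" by (simp add: exp_minus)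
 have "emeasure ?N (range enat) = (\<Sum>k. emeasure ?N {enat k})"
 proof -
  have "disjoint_family (\<lambda>k. {enat k})" by (auto simp: disjoint_family_on_def)
  then have "(\<Sum>k. emeasure ?N {enat k}) = emeasure ?N (\<Union>k. {enat k})" by (intro suminf_emeasure) auto
  moreover have "(\<Union>k. {enat k}) = range enat" by auto
  ultimately show ?thesis by simp
 qed
 also have "\<dots> = (\<Sum>k. ennreal (?m ^ k / fact k * exp (- ?m)))" by (simp only: emeasure_count_law[OF A])
 also have "\<dots> = ennreal 1" using s by (subst suminf_ennreal2) (auto simp: sums_iff)
 finally have "emeasure ?N (range enat) = 1" by simp
 then have "AE k in ?N. k \<in> range enat"
  by (intro N.AE_in_set_eq_1[THEN iffD2]) (auto simp: N.emeasure_eq_measure)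
 then have "AE \<eta> in P. npoints A \<eta> \<in> range enat" using A by (subst (asm) AE_distr_iff) auto
 then show ?thesis by eventually_elim auto
qed

lemma distr_npoints_eq:
 assumes Q: "poisson_law \<Lambda> Q" and A: "A \<in> sets borel" "emeasure \<Lambda> A < \<infinity>"
 shows "distr P (count_space UNIV) (npoints A) = distr Q (count_space UNIV) (npoints A)"
proof -
 interpret Q: poisson_law \<Lambda> Q by fact
 show ?thesis
 proof (rule measure_eqI_countable[where A = UNIV])
  fix k :: enat
  show "emeasure (distr P (count_space UNIV) (npoints A)) {k} = emeasure (distr Q (count_space UNIV) (npoints A)) {k}"
  proof (cases k)
   case infinity
   have *: "emeasure (distr M (count_space UNIV) (npoints A)) {\<infinity>} = 0"
    if [measurable]: "npoints A \<in> measurable M (count_space UNIV)" and "AE \<eta> in M. npoints A \<eta> \<noteq> \<infinity>" for M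
   proof -
    have "npoints A -` {\<infinity>} \<inter> space M = {\<eta> \<in> space M. npoints A \<eta> = \<infinity>}" by auto
    moreover have "emeasure M {\<eta> \<in> space M. npoints A \<eta> = \<infinity>} = 0"
     by (rule emeasure_eq_0_AE) (use that(2) in simp)
    ultimately show ?thesis by (subst emeasure_distr) auto
   qed
   show ?thesis unfolding infinity using *[OF measurable_npoints_P[OF A(1)] AE_npoints_finite[OF A]]
     *[OF Q.measurable_npoints_P[OF A(1)] Q.AE_npoints_finite[OF A]] by simp
  qed (simp add: emeasure_count_law[OF A] Q.emeasure_count_law[OF A])
 qed auto
qed

end

text \<open>After refinement to atoms the counts of bounded sets are, under both measures,
  independent with the same Poisson laws, so the measures agree on a generating pi-system.
  Invariance under translations and reflections follows from this.\<close>

lemma poisson_law_unique: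
 assumes P: "poisson_law \<Lambda> P" and Q: "poisson_law \<Lambda> Q"
 shows "P = Q"
proof -
 interpret P: poisson_law \<Lambda> P by fact
 interpret Q: poisson_law \<Lambda> Q by fact
 let ?A = "{A :: ('a \<times> real) set. A \<in> sets borel \<and> bounded A}"
 define E :: "nat \<Rightarrow> ('a \<times> real) set" where "E n = {p. real n \<le> norm p \<and> norm p < real n + 1}" for n
 have E: "E n \<in> sets borel" for n unfolding E_def by measurable
 have bE: "bounded (E n)" for n unfolding bounded_iff E_def by (rule exI[of _ "real n + 1"]) auto
 have gen: "sigma_sets configs (count_events ?A) = sets config_space"
 proof (rule sigma_sets_count_events[where E = E])
  show "disjoint_family E" by (auto simp: disjoint_family_on_def E_def)
  show "(\<Union>n. E n) = UNIV"
  proof safe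
   fix p :: "'a \<times> real"
   have "p \<in> E (nat \<lfloor>norm p\<rfloor>)" by (simp add: E_def)
   then show "p \<in> (\<Union>n. E n)" by blast
  qed auto
  show "A \<inter> E n \<in> ?A" if "A \<in> sets borel" for n A using that E bE bounded_subset[OF bE] by auto
 qed auto
 show ?thesis
 proof (rule measure_eqI_generator_eq[of "count_events ?A" configs _ _ "\<lambda>_. configs"])
  show "Int_stable (count_events ?A)" by (rule Int_stable_count_events)
  show "count_events ?A \<subseteq> Pow configs" unfolding count_events_def by auto
  show "range (\<lambda>_. configs) \<subseteq> count_events ?A" using count_eventsI[of 0 "\<lambda>_. {}" ?A] by auto
  fix X assume "X \<in> count_events ?A"
  then obtain n :: nat and A k where A: "\<forall>i<n. A i \<in> ?A" and X: "X = {\<eta> \<in> configs. \<forall>i<n. npoints (A i) \<eta> = k i}"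
   by (rule count_eventsE)
  have "i < n \<Longrightarrow> A i \<in> sets borel" for i using A by auto
  then obtain B J m where B: "range B \<subseteq> sets borel" "disjoint_family B" "\<forall>j. B j \<subseteq> (\<Union>i<n. A i)"
   and J: "\<forall>i<n. J i \<subseteq> {..<m::nat}"
   "decomposed n A J B" by (rule atoms_exist)
  have "bounded (\<Union>i\<in>{..<n}. A i)" by (rule bounded_UN) (use A in auto)
  then have bB: "bounded (B j)" for j by (rule bounded_subset) (rule B(3)[rule_format])
  have Bs [measurable]: "B j \<in> sets borel" for j using B(1) by auto
  have fB: "emeasure \<Lambda> (B j) < \<infinity>" for j by (rule P.intensity_bounded[OF Bs bB])
  \<comment> \<open>The extra index keeps the index set nonempty, as the characterisation of
    independence by product measures demands, even for \<open>m = 0\<close>.\<close>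
  let ?I = "insert m {..<m}"
  let ?f = "\<lambda>\<eta>. \<lambda>j\<in>?I. npoints (B j) \<eta>" and ?N = "PiM ?I (\<lambda>_. count_space UNIV) :: (nat \<Rightarrow> enat) measure"
  have "\<forall>i<n. J i \<subseteq> ?I" using J(1) by blast
  then obtain C where C: "C \<in> sets ?N" "X = ?f -` C \<inter> configs"
   unfolding X by (rule count_event_vimage) (rule J(2))
  have em: "emeasure M X = emeasure (\<Pi>\<^sub>M j\<in>?I. distr M (count_space UNIV) (npoints (B j))) C"
   if "poisson_law \<Lambda> M" for M
  proof -
   interpret M: poisson_law \<Lambda> M by fact
   have iv: "M.indep_vars (\<lambda>_. count_space UNIV) (\<lambda>i. npoints (B i)) ?I"
    by (rule M.indep_vars_subset[OF M.indep_npoints[OF B(1,2)]]) auto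
   have rv: "\<And>i. i \<in> ?I \<Longrightarrow> M.random_variable (count_space UNIV) (npoints (B i))" by measurable
   have "distr M ?N ?f = (\<Pi>\<^sub>M j\<in>?I. distr M (count_space UNIV) (npoints (B j)))"
    using M.indep_vars_iff_distr_eq_PiM'[where I = ?I and M' = "\<lambda>_. count_space UNIV" and X = "\<lambda>i. npoints (B i)", OF _ rv] iv by auto
   moreover have "emeasure (distr M ?N ?f) C = emeasure M (?f -` C \<inter> space M)"
    by (rule emeasure_distr[OF _ C(1)]) (intro measurable_restrict rv)
   moreover have "?f -` C \<inter> space M = X" using C(2) by simp
   ultimately show ?thesis by simp
  qed
  show "emeasure P X = emeasure Q X" unfolding em[OF P] em[OF Q]
   by (rule arg_cong[where f="\<lambda>M. emeasure M C"], rule PiM_cong, simp, rule P.distr_npoints_eq[OF Q Bs fB])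
 next
  show "sets P = sigma_sets configs (count_events ?A)" "sets Q = sigma_sets configs (count_events ?A)"
   by (simp_all add: gen)
  show "emeasure P configs \<noteq> \<infinity>" for i :: nat by (simp add: P.emeasure_eq_measure)
 qed auto
qed

lemma measurable_config_spaceI:
 fixes f :: "'m \<Rightarrow> ('a::euclidean_space \<times> real) set"
 assumes "\<And>x. x \<in> space M \<Longrightarrow> f x \<in> configs"
  and "\<And>A. A \<in> sets borel \<Longrightarrow> (\<lambda>x. npoints A (f x)) \<in> measurable M (count_space UNIV)"
 shows "f \<in> measurable M config_space"
proof (rule measurable_sigma_sets[OF sets_config_space])
 show "f \<in> space M \<rightarrow> configs" using assms(1) by auto
 fix y :: "('a \<times> real) set set" assume "y \<in> {npoints A -` {k} \<inter> configs |A k. A \<in> sets borel}"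
 then obtain A k where A: "A \<in> sets borel" and y: "y = npoints A -` {k} \<inter> configs" by blast
 have "f -` y \<inter> space M = (\<lambda>x. npoints A (f x)) -` {k} \<inter> space M" unfolding y using assms(1) by auto
 also have "\<dots> \<in> sets M" by (rule measurable_sets[OF assms(2)[OF A]]) auto
 finally show "f -` y \<inter> space M \<in> sets M" .
qed auto

context poisson_law
begin

text \<open>The Poisson axioms speak of one disjoint sequence. The atoms of the two families are
  interleaved at even and odd indices into such a sequence, whose two blocks of counts are then
  independent.\<close>

lemma prob_count_events_disjoint:
 assumes E: "E \<in> count_events {A \<in> sets borel. A \<subseteq> D}"
  and F: "F \<in> count_events {A \<in> sets borel. A \<subseteq> D'}" and disj: "D \<inter> D' = {}"
 shows "prob (E \<inter> F) = prob E * prob F"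
proof -
 from E obtain n :: nat and A k where A: "\<forall>i<n. A i \<in> {A \<in> sets borel. A \<subseteq> D}"
  and E': "E = {\<eta> \<in> configs. \<forall>i<n. npoints (A i) \<eta> = k i}" by (rule count_eventsE)
 from F obtain n' :: nat and A' k' where A': "\<forall>i<n'. A' i \<in> {A \<in> sets borel. A \<subseteq> D'}"
  and F': "F = {\<eta> \<in> configs. \<forall>i<n'. npoints (A' i) \<eta> = k' i}" by (rule count_eventsE)
 have "i < n \<Longrightarrow> A i \<in> sets borel" for i using A by auto
 then obtain B J m where B: "range B \<subseteq> sets borel" "disjoint_family B" "\<forall>j. B j \<subseteq> (\<Union>i<n. A i)"
  and J: "\<forall>i<n. J i \<subseteq> {..<m::nat}"
  "decomposed n A J B" by (rule atoms_exist)
 have "i < n' \<Longrightarrow> A' i \<in> sets borel" for i using A' by auto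
 then obtain B' J' m' where B': "range B' \<subseteq> sets borel" "disjoint_family B'" "\<forall>j. B' j \<subseteq> (\<Union>i<n'. A' i)"
  and J': "\<forall>i<n'. J' i \<subseteq> {..<m'::nat}"
  "decomposed n' A' J' B'" by (rule atoms_exist)
 define X where "X i = (if even i then B (i div 2) else B' (i div 2))" for i :: nat
 have BD: "B j \<subseteq> D" for j using B(3) A by blast
 have BD': "B' j \<subseteq> D'" for j using B'(3) A' by blast
 have Xs: "range X \<subseteq> sets borel" using B(1) B'(1) by (auto simp: X_def)
 have "disjoint_family X" unfolding disjoint_family_on_def
 proof (intro ballI impI)
  fix i j :: nat assume "i \<noteq> j"
  then have "i div 2 \<noteq> j div 2" if "even i = even j" using that
   by (metis div_mult_mod_eq even_iff_mod_2_eq_zero odd_iff_mod_2_eq_one)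
  then show "X i \<inter> X j = {}" using B(2) B'(2) BD BD' disj unfolding X_def disjoint_family_on_def
   by (cases "even i"; cases "even j") (auto, blast+)
 qed
 from indep_npoints[OF Xs this]
 have iv: "indep_vars (\<lambda>_. count_space UNIV) (\<lambda>i. npoints (X i)) UNIV" .
 let ?I = "(\<lambda>j. 2 * j) ` {..<m}" and ?I' = "(\<lambda>j. 2 * j + 1) ` {..<m'}"
 let ?f = "\<lambda>\<eta>. \<lambda>j\<in>?I. npoints (X j) \<eta>" and ?f' = "\<lambda>\<eta>. \<lambda>j\<in>?I'. npoints (X j) \<eta>"
 have "\<forall>i<n. (\<lambda>j. 2 * j) ` J i \<subseteq> ?I" using J(1) by blast
 moreover have "\<forall>i<n. \<forall>\<eta>. enpoints (A i) \<eta> = (\<Sum>j\<in>(\<lambda>j. 2 * j) ` J i. enpoints (X j) \<eta>)"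
  using J(2) by (simp add: sum.reindex inj_on_def X_def)
 ultimately obtain C where C: "C \<in> sets (PiM ?I (\<lambda>_. count_space UNIV))" "E = ?f -` C \<inter> configs"
  unfolding E' by (rule count_event_vimage)
 have "\<forall>i<n'. (\<lambda>j. 2 * j + 1) ` J' i \<subseteq> ?I'" using J'(1) by blast
 moreover have "\<forall>i<n'. \<forall>\<eta>. enpoints (A' i) \<eta> = (\<Sum>j\<in>(\<lambda>j. 2 * j + 1) ` J' i. enpoints (X j) \<eta>)"
  using J'(2) by (simp add: sum.reindex inj_on_def X_def)
 ultimately obtain C' where C': "C' \<in> sets (PiM ?I' (\<lambda>_. count_space UNIV))" "F = ?f' -` C' \<inter> configs"
  unfolding F' by (rule count_event_vimage)
 have "?I \<inter> ?I' = {}" by (auto, presburger)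
 then have "indep_var (PiM ?I (\<lambda>_. count_space UNIV)) ?f (PiM ?I' (\<lambda>_. count_space UNIV)) ?f'"
  by (rule indep_var_restrict[OF iv]) auto
 from indep_varD[OF this C(1) C'(1)]
 have "prob ((\<lambda>x. (?f x, ?f' x)) -` (C \<times> C') \<inter> configs) = prob (?f -` C \<inter> configs) * prob (?f' -` C' \<inter> configs)"
  by simp
 moreover have "(\<lambda>x. (?f x, ?f' x)) -` (C \<times> C') \<inter> configs = (?f -` C \<inter> configs) \<inter> (?f' -` C' \<inter> configs)"
  by auto
 ultimately show ?thesis unfolding C(2) C'(2) by simp
qed

end

section \<open>Translations and reflections of the environment: invariance and mixing\<close>

text \<open>For \<open>c = 1\<close> this is the environment seen from \<open>t\<close>, for
  \<open>c = - 1\<close> its point reflection; one map serves both symmetries.\<close>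

definition move :: "real \<Rightarrow> 'a::euclidean_space \<Rightarrow> ('a \<times> real) set \<Rightarrow> ('a \<times> real) set" where
 "move c t \<eta> = (\<lambda>(y, r). (c *\<^sub>R (y - t), r)) ` \<eta>"

context
 fixes c :: real assumes c: "\<bar>c\<bar> = 1"
begin

lemma unit_mult_self: "c * c = 1" using c by (metis abs_mult_self_eq mult_1)

lemma inj_move: "inj (\<lambda>(y, r). (c *\<^sub>R (y - t), r) :: 'a::euclidean_space \<times> real)"
 using c by (auto simp: inj_def)

lemma move_vimage_eq: "(\<lambda>(y, r). (c *\<^sub>R (y - t), r)) -` K = (\<lambda>(y, r). (t + c *\<^sub>R y, r)) ` (K :: ('a::euclidean_space \<times> real) set)"
proof safe
 fix y r assume "(c *\<^sub>R (y - t), r) \<in> K"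
 then show "(y, r) \<in> (\<lambda>(y, r). (t + c *\<^sub>R y, r)) ` K"
  by (intro image_eqI[of _ _ "(c *\<^sub>R (y - t), r)"]) (auto simp: unit_mult_self)
qed (auto simp: unit_mult_self)

lemma npoints_move:
 "npoints A (move c t \<eta>) = npoints ((\<lambda>(y, r). (c *\<^sub>R (y - t), r)) -` A) \<eta>"
proof -
 let ?f = "\<lambda>(y, r::real). (c *\<^sub>R (y - t), r)"
 have "move c t \<eta> \<inter> A = ?f ` (\<eta> \<inter> ?f -` A)" unfolding move_def by auto
 moreover have "inj_on ?f X" for X using inj_move by (rule inj_on_subset) simp
 ultimately show ?thesis unfolding npoints_def by (simp only: finite_image_iff card_image)
qed

lemma move_configs:
 assumes "\<eta> \<in> configs" shows "move c t \<eta> \<in> configs"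
proof -
 have "finite (move c t \<eta> \<inter> K)" if "compact K" for K
 proof -
  have "compact ((\<lambda>(y, r). (t + c *\<^sub>R y, r)) ` K)"
   by (intro compact_continuous_image that) (auto simp: case_prod_unfold intro!: continuous_intros)
  then have "finite (\<eta> \<inter> (\<lambda>(y, r). (c *\<^sub>R (y - t), r)) -` K)"
   unfolding move_vimage_eq using assms by (rule configs_finite[rotated])
  moreover have "move c t \<eta> \<inter> K \<subseteq> (\<lambda>(y, r). (c *\<^sub>R (y - t), r)) ` (\<eta> \<inter> (\<lambda>(y, r). (c *\<^sub>R (y - t), r)) -` K)"
   unfolding move_def by auto
  ultimately show ?thesis by (meson finite_imageI finite_subset)
 qed
 then show ?thesis using assms unfolding configs_def move_def by auto
qed

lemma move_vimage_borel [measurable]: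
 "A \<in> sets borel \<Longrightarrow> (\<lambda>(y, r). (c *\<^sub>R (y - t), r)) -` A \<in> sets (borel :: ('a::euclidean_space \<times> real) measure)"
proof -
 assume A: "A \<in> sets borel"
 have "(\<lambda>p. (c *\<^sub>R (fst p - t), snd p)) \<in> measurable borel (borel :: ('a \<times> real) measure)"
  unfolding borel_prod[symmetric] by measurable
 from measurable_sets[OF this A] show ?thesis by (simp add: case_prod_unfold)
qed

lemma measurable_move [measurable]: "move c t \<in> measurable config_space config_space"
 by (rule measurable_config_spaceI) (auto simp: move_configs npoints_move intro!: measurable_npoints move_vimage_borel)

lemma lacoin_move: "lacoin \<gamma> x (move c t \<eta>) = lacoin \<gamma> (t + c *\<^sub>R x) \<eta>"
proof -
 let ?f = "\<lambda>(y, r::real). (c *\<^sub>R (y - t), r)"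
 have inj: "inj_on ?f \<eta>" using inj_move by (rule inj_on_subset) simp
 have d: "dist (c *\<^sub>R (y - t)) x = dist y (t + c *\<^sub>R x)" for y
 proof -
  have "c *\<^sub>R (y - t) - x = c *\<^sub>R (y - (t + c *\<^sub>R x))"
   by (simp add: scaleR_diff_right scaleR_add_right unit_mult_self)
  then show ?thesis using c by (simp add: dist_norm)
 qed
 have "lacoin \<gamma> x (move c t \<eta>) = (\<integral>\<^sup>+ p. (\<lambda>(y, r). ennreal (r powr (-\<gamma>)) * indicator (ball y r) x) (?f p) \<partial>count_space \<eta>)"
  unfolding lacoin_def move_def
  by (rule nn_integral_bij_count_space[symmetric]) (use inj in \<open>simp add: bij_betw_def\<close>)
 also have "\<dots> = lacoin \<gamma> (t + c *\<^sub>R x) \<eta>"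
  unfolding lacoin_def by (intro nn_integral_cong) (auto simp: d indicator_def)
 finally show ?thesis .
qed

end

lemma move_add: "move 1 a (move 1 b \<eta>) = move 1 (a + b) \<eta>"
 unfolding move_def by (force simp: image_image algebra_simps)

lemma move_0: "move 1 0 \<eta> = \<eta>" unfolding move_def by auto

lemma move_funpow: "(move 1 a ^^ n) \<eta> = move 1 (real n *\<^sub>R a) \<eta>"
 by (induction n) (auto simp: move_0 move_add algebra_simps)

lemma bounded_borel_generate:
 "sigma_sets configs (count_events {A :: ('a::euclidean_space \<times> real) set. A \<in> sets borel \<and> bounded A}) = sets config_space"
proof -
 let ?A = "{A :: ('a \<times> real) set. A \<in> sets borel \<and> bounded A}"
 define E :: "nat \<Rightarrow> ('a \<times> real) set" where "E n = {p. real n \<le> norm p \<and> norm p < real n + 1}" for n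
 have E: "E n \<in> sets borel" for n unfolding E_def by measurable
 have bE: "bounded (E n)" for n unfolding bounded_iff E_def by (rule exI[of _ "real n + 1"]) auto
 show ?thesis
 proof (rule sigma_sets_count_events[where E = E])
  show "disjoint_family E" by (auto simp: disjoint_family_on_def E_def)
  show "(\<Union>n. E n) = UNIV"
  proof safe
   fix p :: "'a \<times> real"
   have "p \<in> E (nat \<lfloor>norm p\<rfloor>)" by (simp add: E_def)
   then show "p \<in> (\<Union>n. E n)" by blast
  qed auto
  show "A \<inter> E n \<in> ?A" if "A \<in> sets borel" for n A using that E bE bounded_subset[OF bE] by auto
 qed auto
qed

locale marked_poisson =
 fixes \<nu> :: "real measure" and P :: "('a::euclidean_space \<times> real) set measure"
 assumes prob_nu: "prob_space \<nu>" and sets_nu [measurable_cong]: "sets \<nu> = sets borel"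
  and poisson_pair: "poisson_process (lborel \<Otimes>\<^sub>M \<nu>) P"
begin

sublocale nu: prob_space \<nu> by (rule prob_nu)

abbreviation intensity :: "('a \<times> real) measure" ("\<Lambda>") where
 "\<Lambda> \<equiv> lborel \<Otimes>\<^sub>M \<nu>"

lemma emeasure_intensity_Times:
 "A \<in> sets borel \<Longrightarrow> B \<in> sets borel \<Longrightarrow> emeasure \<Lambda> (A \<times> B) = emeasure lborel (A::'a set) * emeasure \<nu> B"
 by (rule nu.emeasure_pair_measure_Times) (auto simp: sets_nu)

sublocale poisson_law \<Lambda> P
proof
 show "poisson_process \<Lambda> P" by (rule poisson_pair)
 show sets: "sets \<Lambda> = sets borel"
  unfolding borel_prod[symmetric] by (rule sets_pair_measure_cong) (auto simp: sets_nu)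
 fix A :: "('a \<times> real) set" assume A: "A \<in> sets borel" "bounded A"
 then obtain R where R: "\<And>p. p \<in> A \<Longrightarrow> norm p \<le> R" unfolding bounded_iff by blast
 have "A \<subseteq> cball 0 R \<times> UNIV" using R norm_fst_le order_trans by fastforce
 then have "emeasure \<Lambda> A \<le> emeasure \<Lambda> (cball (0::'a) R \<times> UNIV)" by (rule emeasure_mono) (auto simp: sets_nu)
 also have "\<dots> = emeasure lborel (cball (0::'a) R) * emeasure \<nu> UNIV" by (rule emeasure_intensity_Times) auto
 also have "\<dots> < \<infinity>"
  using emeasure_lborel_cball_finite[of "0::'a" R] by (simp add: ennreal_mult_less_top nu.emeasure_eq_measure)
 finally show "emeasure \<Lambda> A < \<infinity>" .
qed

lemma intensity_move:
 assumes c: "\<bar>c\<bar> = 1" and A: "A \<in> sets (borel :: ('a \<times> real) measure)"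
 shows "emeasure \<Lambda> ((\<lambda>(y, r). (c *\<^sub>R (y - t), r)) -` A) = emeasure \<Lambda> A"
proof -
 let ?f = "\<lambda>y::'a. c *\<^sub>R (y - t)"
 have c0: "c \<noteq> 0" using c by auto
 have 1: "distr lborel borel ?f = (lborel :: 'a measure)"
 proof -
  have "lborel = density (distr lborel borel (\<lambda>x. (- c *\<^sub>R t) + c *\<^sub>R x)) (\<lambda>_. \<bar>c\<bar>^DIM('a))"
   by (rule lborel_affine[OF c0])
  then show ?thesis by (simp add: c density_1 scaleR_diff_right)
 qed
 have id: "distr \<nu> borel (\<lambda>r. r) = \<nu>" by (rule distr_id2) (simp add: sets_nu)
 have "lborel \<Otimes>\<^sub>M \<nu> = distr lborel borel ?f \<Otimes>\<^sub>M distr \<nu> borel (\<lambda>r. r)" by (simp add: 1 id)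
 also have "\<dots> = distr \<Lambda> (borel \<Otimes>\<^sub>M borel) (\<lambda>(y, r). (?f y, r))"
 proof (rule pair_measure_distr)
  show "sigma_finite_measure (distr \<nu> borel (\<lambda>r. r))"
   unfolding id by (rule prob_space_imp_sigma_finite) unfold_locales
 qed auto
 finally have "emeasure \<Lambda> A = emeasure (distr \<Lambda> (borel \<Otimes>\<^sub>M borel) (\<lambda>(y, r). (?f y, r))) A" by simp
 also have "\<dots> = emeasure \<Lambda> ((\<lambda>(y, r). (?f y, r)) -` A \<inter> space \<Lambda>)"
 proof (rule emeasure_distr)
  show "A \<in> sets (borel \<Otimes>\<^sub>M borel)" using A unfolding borel_prod .
 qed auto
 also have "space \<Lambda> = UNIV" using sets_eq_imp_space_eq[OF sets_intensity] by simp
 finally show ?thesis by simp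
qed

text \<open>The moved process satisfies the Poisson axioms with the same intensity, because the
  isometry preserves Lebesgue measure; uniqueness of the law does the rest.\<close>

lemma distr_move:
 assumes c: "\<bar>c\<bar> = 1"
 shows "distr P config_space (move c t) = P"
proof -
 have m [measurable]: "move c t \<in> measurable P config_space"
  using measurable_move[OF c] measurable_cong_sets[OF sets_P refl] by blast
 let ?D = "distr P config_space (move c t)"
 let ?F = "\<lambda>A. (\<lambda>(y, r). (c *\<^sub>R (y - t), r)) -` A :: ('a \<times> real) set"
 interpret D: prob_space ?D by (rule prob_space_distr[OF m])
 have "poisson_law \<Lambda> ?D"
 proof
  show "sets \<Lambda> = sets borel" by (rule sets_intensity)
  show "emeasure \<Lambda> A < \<infinity>" if "A \<in> sets borel" "bounded A" for A :: "('a \<times> real) set"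
   by (rule intensity_bounded[OF that])
  show "poisson_process \<Lambda> ?D" unfolding poisson_process_def
  proof (intro conjI ballI allI impI)
   show "prob_space ?D" by unfold_locales
   show "sets ?D = sets config_space" by simp
  next
   fix A :: "('a \<times> real) set" and k assume A: "A \<in> sets borel" and f: "emeasure \<Lambda> A < \<infinity>"
   have "{\<eta> \<in> configs. npoints A \<eta> = enat k} \<in> sets config_space"
    using measurable_sets[OF measurable_npoints[OF A], of "{enat k}"] by (simp add: vimage_def Int_def conj_commute)
   then have "measure ?D {\<eta> \<in> space ?D. npoints A \<eta> = enat k} = prob (move c t -` {\<eta> \<in> configs. npoints A \<eta> = enat k} \<inter> space P)"
    by (simp add: measure_distr)
   also have "move c t -` {\<eta> \<in> configs. npoints A \<eta> = enat k} \<inter> space P = {\<eta> \<in> space P. npoints (?F A) \<eta> = enat k}"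
    by (auto simp: npoints_move[OF c] move_configs[OF c])
   also have "prob \<dots> = measure \<Lambda> (?F A) ^ k / fact k * exp (- measure \<Lambda> (?F A))"
    by (rule prob_npoints) (use A f c in \<open>simp_all add: move_vimage_borel intensity_move\<close>)
   also have "measure \<Lambda> (?F A) = measure \<Lambda> A" unfolding measure_def intensity_move[OF c A] ..
   finally show "measure ?D {\<eta> \<in> space ?D. npoints A \<eta> = enat k} = measure \<Lambda> A ^ k / fact k * exp (- measure \<Lambda> A)" .
  next
   fix A :: "nat \<Rightarrow> ('a \<times> real) set" assume A: "range A \<subseteq> sets borel" "disjoint_family A"
   have As: "A i \<in> sets borel" for i using A by auto
   have iv: "indep_vars (\<lambda>_. count_space UNIV) (\<lambda>i. npoints (?F (A i))) UNIV"
    by (rule indep_npoints) (use A c in \<open>auto simp: disjoint_family_on_def move_vimage_borel\<close>)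
   have comp: "npoints (A i) \<circ> move c t = npoints (?F (A i))" for i by (auto simp: npoints_move[OF c])
   have comp': "(\<lambda>\<eta>. \<lambda>i\<in>UNIV. npoints (A i) \<eta>) \<circ> move c t = (\<lambda>\<eta>. \<lambda>i\<in>UNIV. npoints (?F (A i)) \<eta>)"
    by (auto simp: npoints_move[OF c])
   have rv: "npoints (?F (A i)) \<in> measurable P (count_space UNIV)" for i
    by (rule measurable_npoints_P[OF move_vimage_borel[OF c As]])
   show "D.indep_vars (\<lambda>_. count_space UNIV) (\<lambda>i. npoints (A i)) UNIV"
   proof (subst D.indep_vars_iff_distr_eq_PiM')
    show "npoints (A i) \<in> measurable ?D (count_space UNIV)" for i using measurable_npoints[OF As] by simp
    have "distr ?D (\<Pi>\<^sub>M i\<in>UNIV. count_space UNIV) (\<lambda>\<eta>. \<lambda>i\<in>UNIV. npoints (A i) \<eta>)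
     = distr P (\<Pi>\<^sub>M i\<in>UNIV. count_space UNIV) (\<lambda>\<eta>. \<lambda>i\<in>UNIV. npoints (?F (A i)) \<eta>)"
     by (subst distr_distr) (auto simp: comp' intro!: measurable_restrict measurable_npoints As m)
    also have "\<dots> = (\<Pi>\<^sub>M i\<in>UNIV. distr P (count_space UNIV) (npoints (?F (A i))))"
     using indep_vars_iff_distr_eq_PiM'[where I = UNIV and M' = "\<lambda>_. count_space UNIV" and X = "\<lambda>i. npoints (?F (A i))"] iv rv by auto
    also have "\<dots> = (\<Pi>\<^sub>M i\<in>UNIV. distr ?D (count_space UNIV) (npoints (A i)))"
     by (rule PiM_cong) (auto simp: distr_distr comp measurable_npoints[OF As] m)
    finally show "distr ?D (\<Pi>\<^sub>M i\<in>UNIV. count_space UNIV) (\<lambda>\<eta>. \<lambda>i\<in>UNIV. npoints (A i) \<eta>)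
     = (\<Pi>\<^sub>M i\<in>UNIV. distr ?D (count_space UNIV) (npoints (A i)))" .
   qed simp
  qed
 qed
 from poisson_law_unique[OF this] show ?thesis using poisson_law_axioms by blast
qed

lemma measurable_move_P [measurable]: "\<bar>c\<bar> = 1 \<Longrightarrow> move c t \<in> measurable P P"
 using measurable_move measurable_cong_sets[OF sets_P sets_P] by blast

lemma distr_move_P: "\<bar>c\<bar> = 1 \<Longrightarrow> distr P P (move c t) = P"
 using distr_move distr_cong[OF refl sets_P refl] by metis

lemma prob_move:
 "\<bar>c\<bar> = 1 \<Longrightarrow> A \<in> sets config_space \<Longrightarrow> prob (move c t -` A \<inter> configs) = prob A"
 using measure_distr[of "move c t" P P A] by (simp add: distr_move_P)

lemma move_mixing:
 assumes A: "A \<in> sets config_space" and B: "B \<in> sets config_space" and x: "x \<noteq> 0"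
 shows "(\<lambda>n. prob (A \<inter> (move 1 (real n *\<^sub>R x) -` B \<inter> configs))) \<longlonglongrightarrow> prob A * prob B"
proof -
 let ?S = "\<lambda>x n B. move 1 (real n *\<^sub>R x) -` B \<inter> configs"
 let ?bd = "{A :: ('a \<times> real) set. A \<in> sets borel \<and> bounded A}"
 have sub: "count_events ?bd \<subseteq> Pow configs" unfolding count_events_def by auto
 have T [measurable]: "?S x n B \<in> sets config_space" if "B \<in> sets config_space" for x n B
  using measurable_sets[OF measurable_move[of 1] that] by simp
 have pT: "prob (?S x n B) = prob B" if "B \<in> sets config_space" for x n B
  by (rule prob_move) (use that in auto)
 have base: "(\<lambda>n. prob (A \<inter> ?S x n B)) \<longlonglongrightarrow> prob A * prob B"
  if A: "A \<in> count_events ?bd" and B: "B \<in> count_events ?bd" and x: "x \<noteq> 0" for A B x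
 proof -
  from A obtain m :: nat and X k where X: "\<forall>i<m. X i \<in> ?bd" "A = {\<eta> \<in> configs. \<forall>i<m. npoints (X i) \<eta> = k i}"
   by (rule count_eventsE)
  from B obtain m' :: nat and Y k' where Y: "\<forall>i<m'. Y i \<in> ?bd" "B = {\<eta> \<in> configs. \<forall>i<m'. npoints (Y i) \<eta> = k' i}"
   by (rule count_eventsE)
  have "bounded ((\<Union>i\<in>{..<m}. X i) \<union> (\<Union>i\<in>{..<m'}. Y i))"
   using X Y by (intro bounded_Un[THEN iffD2] conjI bounded_UN) auto
  then obtain R where R: "\<forall>p\<in>(\<Union>i\<in>{..<m}. X i) \<union> (\<Union>i\<in>{..<m'}. Y i). norm p \<le> R" unfolding bounded_iff by blast
  \<comment> \<open>Both events look only at points of norm at most \<open>R\<close>; a shift by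
    more than \<open>2 * R\<close> makes the two regions disjoint.\<close>
  have "prob (A \<inter> ?S x n B) = prob A * prob B" if n: "real n * norm x > 2 * R" for n
  proof -
   let ?F = "\<lambda>(y, r::real). (1 *\<^sub>R (y - real n *\<^sub>R x), r)"
   have TB: "?S x n B = {\<eta> \<in> configs. \<forall>i<m'. npoints (?F -` Y i) \<eta> = k' i}"
   proof -
    have "npoints (Y i) (move 1 (real n *\<^sub>R x) \<eta>) = npoints (?F -` Y i) \<eta>" for i \<eta> by (rule npoints_move) simp
    then show ?thesis unfolding Y(2) using move_configs[of 1] by auto
   qed
   have "prob (A \<inter> ?S x n B) = prob A * prob (?S x n B)"
   proof (rule prob_count_events_disjoint)
    show "A \<in> count_events {A \<in> sets borel. A \<subseteq> cball 0 R}"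
     unfolding X(2) by (rule count_eventsI) (use X R in force)
    show "?S x n B \<in> count_events {A \<in> sets borel. A \<subseteq> ?F -` cball 0 R}" unfolding TB
    proof (rule count_eventsI)
     fix i assume i: "i < m'"
     then have "Y i \<subseteq> cball 0 R" using R by force
     then show "?F -` Y i \<in> {A \<in> sets borel. A \<subseteq> ?F -` cball 0 R}"
      using Y(1) i move_vimage_borel[of 1] by auto
    qed
    show "cball 0 R \<inter> ?F -` cball 0 R = {}"
    proof -
     have False if 1: "(y, r) \<in> cball 0 R" and 2: "?F (y, r) \<in> cball 0 R" for y r
     proof -
      have "norm y \<le> R" "norm (y - real n *\<^sub>R x) \<le> R"
       using 1 2 norm_fst_le[of y r] norm_fst_le[of "y - real n *\<^sub>R x" r] by auto
      moreover have "norm (real n *\<^sub>R x) \<le> norm y + norm (y - real n *\<^sub>R x)"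
       by (metis norm_minus_commute add.commute norm_triangle_sub)
      ultimately show False using n by simp
     qed
     then show ?thesis by force
    qed
   qed
   also have "prob (?S x n B) = prob B" by (rule pT) (use count_events_sets[of ?bd] B in auto)
   finally show ?thesis .
  qed
  moreover have "eventually (\<lambda>n. real n * norm x > 2 * R) sequentially" using x by real_asymp
  ultimately show ?thesis by (intro tendsto_eventually) (auto elim: eventually_mono)
 qed
 have ms: "A \<in> sets config_space" if "A \<in> sigma_sets configs (count_events ?bd)" for A
  using that by (simp add: bounded_borel_generate)
 \<comment> \<open>Tannery's theorem, dominated convergence for series: it exchanges the limit with
   a countable disjoint union, majorised by the probabilities of the pieces.\<close>
 have tann: "(\<lambda>n. \<Sum>i. f i n) \<longlonglongrightarrow> (\<Sum>i. b i)"
  if "\<And>i. (\<lambda>n. f i n) \<longlonglongrightarrow> b i" "\<And>i n. 0 \<le> f i n \<and> f i n \<le> c i" "summable c" for f :: "nat \<Rightarrow> nat \<Rightarrow> real" and b c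
 proof -
  have "eventually (\<lambda>(k, n). norm (f k n) \<le> c k) (at_top \<times>\<^sub>F sequentially)"
   by (rule always_eventually) (use that(2) in auto)
  from tannerys_theorem[OF that(1) this that(3)] show ?thesis by simp
 qed
 have sm: "summable (\<lambda>i. prob (A i))" "prob (\<Union>i. A i) = (\<Sum>i. prob (A i))"
  if "range A \<subseteq> sets config_space" "disjoint_family A" for A
  using finite_measure_UNION[of A] that by (auto simp: sums_iff)
 have dynkin: "(\<lambda>n. prob (A \<inter> ?S x n B)) \<longlonglongrightarrow> prob A * prob B"
  if base: "\<And>A. A \<in> count_events ?bd \<Longrightarrow> (\<lambda>n. prob (A \<inter> ?S x n B)) \<longlonglongrightarrow> prob A * prob B"
   and Bs: "B \<in> sets config_space" and A: "A \<in> sets config_space" for A B x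
 proof -
  let ?T = "?S x"
  have "A \<in> sigma_sets configs (count_events ?bd)" using A by (simp add: bounded_borel_generate)
  from Int_stable_count_events sub this show ?thesis
  proof (induction rule: sigma_sets_induct_disjoint)
   case (basic A) then show ?case by (rule base)
  next
   case empty then show ?case by simp
  next
   case (compl A)
   have [measurable]: "A \<in> sets config_space" by (rule ms[OF compl(1)])
   have "prob ((configs - A) \<inter> ?T n B) = prob B - prob (A \<inter> ?T n B)" for n
   proof -
    have "prob (?T n B - A \<inter> ?T n B) = prob (?T n B) - prob (A \<inter> ?T n B)"
     by (rule finite_measure_Diff) (use T[OF Bs] ms[OF compl(1)] in auto)
    moreover have "?T n B - A \<inter> ?T n B = (configs - A) \<inter> ?T n B" by auto
    ultimately show ?thesis using pT[OF Bs] by simp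
   qed
   moreover have "prob (configs - A) = 1 - prob A" using prob_compl[of A] ms[OF compl(1)] by simp
   ultimately show ?case using tendsto_diff[OF tendsto_const[of "prob B"] compl(2)]
    by (simp only: left_diff_distrib mult_1)
  next
   case (union A)
   have As: "range A \<subseteq> sets config_space" using ms union(2) by auto
   have "prob ((\<Union>i. A i) \<inter> ?T n B) = (\<Sum>i. prob (A i \<inter> ?T n B))" for n
   proof -
    have "range (\<lambda>i. A i \<inter> ?T n B) \<subseteq> sets config_space" using As T[OF Bs] by auto
    moreover have "disjoint_family (\<lambda>i. A i \<inter> ?T n B)" using union(1) by (auto simp: disjoint_family_on_def)
    moreover have "(\<Union>i. A i) \<inter> ?T n B = (\<Union>i. A i \<inter> ?T n B)" by auto
    ultimately show ?thesis using sm(2)[of "\<lambda>i. A i \<inter> ?T n B"] by (simp only:)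
   qed
   moreover have "(\<lambda>n. \<Sum>i. prob (A i \<inter> ?T n B)) \<longlonglongrightarrow> (\<Sum>i. prob (A i) * prob B)"
    by (rule tann[OF union(3)]) (use As sm(1)[OF As union(1)] in \<open>auto intro!: finite_measure_mono\<close>)
   moreover have "(\<Sum>i. prob (A i) * prob B) = prob (\<Union>i. A i) * prob B"
    using sm[OF As union(1)] by (simp add: suminf_mult2)
   ultimately show ?case by simp
  qed
 qed
 have basic: "B \<in> sets config_space" if "B \<in> count_events ?bd" for B using that count_events_sets[of ?bd] by auto
 have flip: "prob (A \<inter> ?S x n B) = prob (B \<inter> ?S (- x) n A)" if A: "A \<in> sets config_space" and B: "B \<in> sets config_space" for A B n
 proof -
  have "prob (A \<inter> ?S x n B) = prob (?S (- x) n (A \<inter> ?S x n B))" by (rule pT[symmetric]) (use A B in auto)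
  also have "?S (- x) n (A \<inter> ?S x n B) = B \<inter> ?S (- x) n A"
  proof -
   have mv: "move 1 (real n *\<^sub>R x) (move 1 (real n *\<^sub>R - x) \<eta>) = \<eta>" for \<eta> :: "('a \<times> real) set"
    by (simp add: move_add move_0)
   have "\<eta> \<in> ?S (- x) n (A \<inter> ?S x n B) \<longleftrightarrow> \<eta> \<in> B \<inter> ?S (- x) n A" for \<eta>
    by (simp only: Int_iff vimage_eq mv) (use sets.sets_into_space[OF B] move_configs[of 1 \<eta>] in auto)
   then show ?thesis by blast
  qed
  finally show ?thesis .
 qed
 show ?thesis
 proof (rule dynkin[OF _ B A])
  fix A assume A: "A \<in> count_events ?bd"
  have "(\<lambda>n. prob (B \<inter> ?S (- x) n A)) \<longlonglongrightarrow> prob B * prob A"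
   by (rule dynkin[OF _ basic[OF A] B]) (rule base[OF _ A], use x in auto)
  then show "(\<lambda>n. prob (A \<inter> ?S x n B)) \<longlonglongrightarrow> prob A * prob B"
   using flip[OF basic[OF A] B] by (simp add: mult.commute)
 qed
qed

end

section \<open>A one-sided subadditive ergodic theorem\<close>

text \<open>Greedy tiling of \<open>{0..<n}\<close>: from each index jump ahead by its good length
  \<open>N\<close>, paying \<open>b\<close> extra. Once a jump would overshoot \<open>n\<close>,
  fewer than \<open>M\<close> places remain, and they are crossed by unit steps at the extra price
  \<open>e\<close>.\<close>

lemma greedy_cover_bound:
 fixes x :: "nat \<Rightarrow> nat \<Rightarrow> real" and b e :: "nat \<Rightarrow> real"
 assumes sub: "\<And>i j k. i < j \<Longrightarrow> j < k \<Longrightarrow> x i k \<le> x i j + x j k"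
  and jump: "\<And>i. \<exists>N. 1 \<le> N \<and> N \<le> M \<and> x i (i + N) \<le> c * real N + b i" and unit: "\<And>i. x i (Suc i) \<le> c + e i"
  and nonneg: "\<And>i. 0 \<le> b i" "\<And>i. 0 \<le> e i" and n: "0 < n"
 shows "x 0 n \<le> c * real n + (\<Sum>i<n. b i) + (\<Sum>i\<in>{n - M..<n}. e i)"
proof -
 have units: "x i n \<le> c * real (n - i) + (\<Sum>j\<in>{i..<n}. e j)" if "i < n" for i n using that
 proof (induction "n - i" arbitrary: i)
  case (Suc m)
  show ?case
  proof (cases "Suc i = n")
   case True
   then have "{i..<n} = {i}" by auto
   then show ?thesis using unit[of i] True by auto
  next
   case False
   then have lt: "Suc i < n" using Suc.prems by simp
   have "x i n \<le> x i (Suc i) + x (Suc i) n" using sub lt by simp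
   also have "\<dots> \<le> (c + e i) + (c * real (n - Suc i) + (\<Sum>j\<in>{Suc i..<n}. e j))"
    using Suc.hyps(1)[of "Suc i"] Suc.hyps(2) lt unit[of i] by linarith
   also have "\<dots> = c * real (n - i) + (\<Sum>j\<in>{i..<n}. e j)"
    using Suc.prems by (simp add: sum.atLeast_Suc_lessThan of_nat_diff algebra_simps)
   finally show ?thesis .
  qed
 qed simp
 have main: "x i n \<le> c * real (n - i) + (\<Sum>j\<in>{i..<n}. b j) + (\<Sum>j\<in>{max i (n - M)..<n}. e j)" if "i < n" for i
  using that
 proof (induction "n - i" arbitrary: i rule: less_induct)
  case less
  obtain N where N: "1 \<le> N" "N \<le> M" "x i (i + N) \<le> c * real N + b i" using jump by blast
  consider "i + N < n" | "i + N = n" | "i + N > n" by linarith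
  then show ?case
  proof cases
   case 1
   have "x i n \<le> x i (i + N) + x (i + N) n" using sub N(1) 1 by simp
   also have "\<dots> \<le> (c * real N + b i) + (c * real (n - (i + N)) + (\<Sum>j\<in>{i + N..<n}. b j) + (\<Sum>j\<in>{max (i + N) (n - M)..<n}. e j))"
    using less.hyps[of "i + N"] N 1 by (intro add_mono) auto
   also have "(\<Sum>j\<in>{max (i + N) (n - M)..<n}. e j) \<le> (\<Sum>j\<in>{max i (n - M)..<n}. e j)"
    by (rule sum_mono2) (auto simp: nonneg)
   also have "(\<Sum>j\<in>{i + N..<n}. b j) \<le> (\<Sum>j\<in>{Suc i..<n}. b j)" by (rule sum_mono2) (use N nonneg in auto)
   also have "(c * real N + b i) + (c * real (n - (i + N)) + (\<Sum>j\<in>{Suc i..<n}. b j) + (\<Sum>j\<in>{max i (n - M)..<n}. e j))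
    = c * real (n - i) + (\<Sum>j\<in>{i..<n}. b j) + (\<Sum>j\<in>{max i (n - M)..<n}. e j)"
    using 1 by (simp add: sum.atLeast_Suc_lessThan[of i n] of_nat_diff algebra_simps)
   finally show ?thesis by simp
  next
   case 2
   have "b i \<le> (\<Sum>j\<in>{i..<n}. b j)" using less.prems by (intro member_le_sum) (auto simp: nonneg)
   moreover have "0 \<le> (\<Sum>j\<in>{max i (n - M)..<n}. e j)" by (rule sum_nonneg) (simp add: nonneg)
   moreover have "N = n - i" using 2 by simp
   ultimately show ?thesis using N(3) 2 by simp
  next
   case 3
   then have "max i (n - M) = i" using N by simp
   moreover have "0 \<le> (\<Sum>j\<in>{i..<n}. b j)" by (rule sum_nonneg) (simp add: nonneg)
   ultimately show ?thesis using units[OF less.prems] by simp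
  qed
 qed
 from main[OF n] show ?thesis by (simp add: lessThan_atLeast0)
qed

locale measure_preserving = prob_space +
 fixes T :: "'a \<Rightarrow> 'a"
 assumes T [measurable]: "T \<in> measurable M M" and distr_T: "distr M M T = M"
begin

lemma measurable_T_pow [measurable]: "(T ^^ n) \<in> measurable M M" by (induction n) auto

lemma distr_T_pow: "distr M M (T ^^ n) = M"
proof (induction n)
 case (Suc n)
 have "distr M M (T ^^ Suc n) = distr (distr M M (T ^^ n)) M T" by (subst distr_distr) auto
 then show ?case by (simp only: Suc distr_T)
qed (simp add: distr_id2 id_def)

lemma AE_T_pow: "AE \<eta> in M. Q \<eta> \<Longrightarrow> AE \<eta> in M. Q ((T ^^ n) \<eta>)"
 by (rule AE_distrD[OF measurable_T_pow[of n], of Q]) (simp only: distr_T_pow)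

lemma prob_T_pow: "A \<in> events \<Longrightarrow> prob ((T ^^ n) -` A \<inter> space M) = prob A"
 using measure_distr[OF measurable_T_pow[of n], of A] by (simp add: distr_T_pow)

lemma integral_T_pow:
 fixes f :: "'a \<Rightarrow> real"
 assumes "f \<in> borel_measurable M" shows "(\<integral>\<eta>. f ((T ^^ n) \<eta>) \<partial>M) = (\<integral>\<eta>. f \<eta> \<partial>M)"
 using integral_distr[OF measurable_T_pow[of n] assms] by (simp add: distr_T_pow)

lemma integrable_T_pow:
 fixes f :: "'a \<Rightarrow> real"
 assumes "integrable M f" shows "integrable M (\<lambda>\<eta>. f ((T ^^ n) \<eta>))"
 using integrable_distr[OF measurable_T_pow[of n], of f] assms by (simp add: distr_T_pow)

text \<open>Iterated, the one-sided inclusion puts the preimages of \<open>A\<close> inside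
  \<open>A\<close> up to null sets, so the mixing sequence is constantly \<open>prob A\<close>,
  which must then equal its square.\<close>

lemma zero_one_of_mixing:
 assumes mix: "\<And>A. A \<in> events \<Longrightarrow> (\<lambda>n. prob (A \<inter> ((T ^^ n) -` A \<inter> space M))) \<longlonglongrightarrow> prob A * prob A"
  and A: "A \<in> events" and inv: "AE \<eta> in M. T \<eta> \<in> A \<longrightarrow> \<eta> \<in> A"
 shows "prob A = 0 \<or> prob A = 1"
proof -
 have "prob (A \<inter> ((T ^^ n) -` A \<inter> space M)) = prob A" for n
 proof -
  have "AE \<eta> in M. (T ^^ n) \<eta> \<in> A \<longrightarrow> \<eta> \<in> A"
  proof (induction n)
   case (Suc n)
   from Suc AE_T_pow[OF inv, of n] show ?case by eventually_elim (auto simp: funpow_swap1)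
  qed simp
  then have "prob (A \<inter> ((T ^^ n) -` A \<inter> space M)) = prob ((T ^^ n) -` A \<inter> space M)"
   by (intro finite_measure_eq_AE) (use A in auto)
  then show ?thesis by (simp add: prob_T_pow A)
 qed
 then have "(\<lambda>n. prob A) \<longlonglongrightarrow> prob A * prob A" using mix[OF A] by simp
 then have "prob A = prob A * prob A" by (simp add: tendsto_const_iff)
 then show ?thesis by simp
qed

text \<open>The greedy tiling is run along the orbit of almost every point and then integrated.
  Points without a good time up to \<open>m\<close> form \<open>Bad m\<close>; their share vanishes
  as \<open>m\<close> grows, by dominated convergence.\<close>

lemma subadditive_mean_le:
 assumes int: "\<And>n. 1 \<le> n \<Longrightarrow> integrable M (X n)"
  and sub: "AE \<eta> in M. \<forall>m\<ge>1. \<forall>n\<ge>1. X (m + n) \<eta> \<le> X m \<eta> + X n ((T ^^ m) \<eta>)"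
  and hit: "AE \<eta> in M. \<exists>n\<ge>1. X n \<eta> \<le> c * real n" and \<beta>: "0 < \<beta>"
 shows "\<exists>n\<ge>1. (\<integral>\<eta>. X n \<eta> \<partial>M) \<le> (c + \<beta>) * real n"
proof -
 have Xm [measurable]: "X n \<in> borel_measurable M" if "1 \<le> n" for n using int[OF that] by auto
 define E where "E \<eta> = max 0 (X 1 \<eta> - c)" for \<eta>
 define Bad where "Bad m = {\<eta> \<in> space M. \<forall>n\<in>{1..m}. \<not> X n \<eta> \<le> c * real n}" for m
 define b where "b m \<eta> = E \<eta> * indicator (Bad m) \<eta>" for m \<eta>
 have E [measurable]: "integrable M E" unfolding E_def using int[of 1] by auto
 have Em [measurable]: "E \<in> borel_measurable M" using E by auto
 have E0: "0 \<le> E \<eta>" for \<eta> by (simp add: E_def)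
 have [measurable]: "Bad m \<in> events" for m
  unfolding Bad_def by (rule sets.sets_Collect_finite_All) (auto intro!: borel_measurable_le sets.sets_Collect_neg simp: Xm)
 have b0: "0 \<le> b m \<eta>" for m \<eta> by (simp add: b_def E0)
 have [measurable]: "b m \<in> borel_measurable M" for m unfolding b_def by measurable
 have bi: "integrable M (b m)" for m
  by (rule Bochner_Integration.integrable_bound[OF E]) (auto simp: b_def indicator_def E0)
 have "(\<lambda>m. \<integral>\<eta>. b m \<eta> \<partial>M) \<longlonglongrightarrow> (\<integral>\<eta>. 0 \<partial>M)"
 proof (rule integral_dominated_convergence[where w = E])
  show "AE \<eta> in M. (\<lambda>m. b m \<eta>) \<longlonglongrightarrow> 0" using hit
  proof eventually_elim
   case (elim \<eta>)
   then obtain n where n: "n \<ge> 1" "X n \<eta> \<le> c * real n" by blast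
   have "b m \<eta> = 0" if "m \<ge> n" for m using n that by (auto simp: b_def Bad_def indicator_def)
   then show ?case by (intro tendsto_eventually eventually_sequentiallyI[of n]) auto
  qed
  show "AE \<eta> in M. norm (b m \<eta>) \<le> E \<eta>" for m by (auto simp: b_def indicator_def E0)
 qed (use E bi in auto)
 then have "(\<lambda>m. \<integral>\<eta>. b m \<eta> \<partial>M) \<longlonglongrightarrow> 0" by simp
 then have "eventually (\<lambda>m. (\<integral>\<eta>. b m \<eta> \<partial>M) < \<beta> / 2) sequentially" using \<beta> by (intro order_tendstoD(2)) auto
 then obtain m where m: "(\<integral>\<eta>. b m \<eta> \<partial>M) < \<beta> / 2" "1 \<le> m" unfolding eventually_sequentially by (metis nle_le)
 \<comment> \<open>So large that the at most \<open>m\<close> unit steps at the end cost no more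
   than \<open>\<beta> / 2\<close> per unit of \<open>n\<close> in the mean.\<close>
 obtain n where n: "real n > 2 * (real m * (\<integral>\<eta>. E \<eta> \<partial>M)) / \<beta>" "1 \<le> n"
  using reals_Archimedean2[of "max 1 (2 * (real m * (\<integral>\<eta>. E \<eta> \<partial>M)) / \<beta>)"] by auto
 have "AE \<eta> in M. \<forall>i. \<forall>m\<ge>1. \<forall>n\<ge>1. X (m + n) ((T ^^ i) \<eta>) \<le> X m ((T ^^ i) \<eta>) + X n ((T ^^ m) ((T ^^ i) \<eta>))"
  by (subst AE_all_countable) (intro allI AE_T_pow[OF sub])
 then have "AE \<eta> in M. X n \<eta> \<le> c * real n + (\<Sum>i<n. b m ((T ^^ i) \<eta>)) + (\<Sum>i\<in>{n - m..<n}. E ((T ^^ i) \<eta>))"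
  using AE_space
 proof eventually_elim
  case (elim \<eta>)
  define x where "x i k = X (k - i) ((T ^^ i) \<eta>)" for i k
  have sp: "(T ^^ i) \<eta> \<in> space M" for i using measurable_space[OF measurable_T_pow elim(2)] .
  have "x 0 n \<le> c * real n + (\<Sum>i<n. b m ((T ^^ i) \<eta>)) + (\<Sum>i\<in>{n - m..<n}. E ((T ^^ i) \<eta>))"
  proof (rule greedy_cover_bound)
   fix i j k :: nat assume ij: "i < j" "j < k"
   have "X ((j - i) + (k - j)) ((T ^^ i) \<eta>) \<le> X (j - i) ((T ^^ i) \<eta>) + X (k - j) ((T ^^ (j - i)) ((T ^^ i) \<eta>))"
    using elim(1)[rule_format, of "j - i" "k - j" i] ij by simp
   moreover have "(T ^^ (j - i)) ((T ^^ i) \<eta>) = (T ^^ j) \<eta>"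
    using ij by (metis comp_apply funpow_add le_add_diff_inverse2 less_imp_le)
   moreover have "(j - i) + (k - j) = k - i" using ij by simp
   ultimately show "x i k \<le> x i j + x j k" by (simp add: x_def)
  next
   fix i
   show "\<exists>N\<ge>1. N \<le> m \<and> x i (i + N) \<le> c * real N + b m ((T ^^ i) \<eta>)"
   proof (cases "(T ^^ i) \<eta> \<in> Bad m")
    case True
    then show ?thesis using m by (intro exI[of _ 1]) (auto simp: x_def b_def E_def)
   next
    case False
    then obtain N where "N \<in> {1..m}" "X N ((T ^^ i) \<eta>) \<le> c * real N" using sp by (auto simp: Bad_def)
    then show ?thesis using b0[of m "(T ^^ i) \<eta>"] by (intro exI[of _ N]) (auto simp: x_def)
   qed
   show "x i (Suc i) \<le> c + E ((T ^^ i) \<eta>)" by (simp add: x_def E_def)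
   show "0 \<le> b m ((T ^^ i) \<eta>)" "0 \<le> E ((T ^^ i) \<eta>)" by (auto simp: b_def E0)
  qed (use n in auto)
  then show ?case by (simp add: x_def)
 qed
 then have "(\<integral>\<eta>. X n \<eta> \<partial>M) \<le> (\<integral>\<eta>. c * real n + (\<Sum>i<n. b m ((T ^^ i) \<eta>)) + (\<Sum>i\<in>{n - m..<n}. E ((T ^^ i) \<eta>)) \<partial>M)"
  using n by (intro integral_mono_AE) (auto intro!: int integrable_T_pow bi E Bochner_Integration.integrable_sum)
 also have "\<dots> = c * real n + (\<Sum>i<n. \<integral>\<eta>. b m ((T ^^ i) \<eta>) \<partial>M) + (\<Sum>i\<in>{n - m..<n}. \<integral>\<eta>. E ((T ^^ i) \<eta>) \<partial>M)"
  by (simp add: Bochner_Integration.integrable_sum integrable_T_pow bi E prob_space)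
 also have "\<dots> = c * real n + real n * (\<integral>\<eta>. b m \<eta> \<partial>M) + real (n - (n - m)) * (\<integral>\<eta>. E \<eta> \<partial>M)"
  using bi[of m] E by (simp add: integral_T_pow borel_measurable_integrable)
 also have "\<dots> \<le> c * real n + real n * (\<beta> / 2) + real m * (\<integral>\<eta>. E \<eta> \<partial>M)"
  using m by (intro add_mono mult_left_mono mult_right_mono integral_nonneg_AE) (auto simp: E0)
 also have "\<dots> \<le> c * real n + real n * (\<beta> / 2) + real n * (\<beta> / 2)" using n \<beta> by (simp add: field_simps)
 finally show ?thesis using n by (intro exI[of _ n]) (auto simp: algebra_simps)
qed

end

text \<open>The zero-one law is stated for sets that contain their preimage up to a null set:
  subadditivity makes level sets invariant in this one direction only.\<close>

locale ergodic_map = measure_preserving +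
 assumes zero_one: "A \<in> events \<Longrightarrow> (AE \<eta> in M. T \<eta> \<in> A \<longrightarrow> \<eta> \<in> A) \<Longrightarrow> prob A = 0 \<or> prob A = 1"
begin

text \<open>The lower half of Kingman's theorem. If the averages fell below a rate under \<alpha>
  infinitely often with positive probability, they would do so almost surely, and
  \<open>subadditive_mean_le\<close> would produce an \<open>n\<close> whose mean is below
  \<open>\<alpha> * real n\<close>.\<close>

lemma subadditive_eventually_ge:
 assumes int: "\<And>n. 1 \<le> n \<Longrightarrow> integrable M (X n)"
  and sub: "AE \<eta> in M. \<forall>m\<ge>1. \<forall>n\<ge>1. X (m + n) \<eta> \<le> X m \<eta> + X n ((T ^^ m) \<eta>)"
  and mean: "\<And>n. 1 \<le> n \<Longrightarrow> \<alpha> * real n \<le> (\<integral>\<eta>. X n \<eta> \<partial>M)" and c: "c < \<alpha>"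
 shows "AE \<eta> in M. eventually (\<lambda>n. c * real n \<le> X n \<eta>) sequentially"
proof -
 define c' where "c' = (c + \<alpha>) / 2"
 have c': "c < c'" "c' < \<alpha>" using c by (auto simp: c'_def)
 \<comment> \<open>Passing from \<open>T \<eta>\<close> to \<eta> adds the cost of one step. The
   margin \<open>1 / real (Suc k)\<close> with \<open>k\<close> existentially quantified leaves room
   to absorb it, so \<open>A\<close> contains its preimage. The indices \<open>Suc n\<close> reflect
   that \<open>X\<close> is controlled from 1 on.\<close>
 define A where "A = {\<eta> \<in> space M. \<exists>k::nat. \<forall>m. \<exists>n\<ge>m. X (Suc n) \<eta> \<le> (c' - 1 / real (Suc k)) * real (Suc n)}"
 have Xm [measurable]: "X (Suc n) \<in> borel_measurable M" for n using int[of "Suc n"] by auto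
 have A: "A \<in> events" unfolding A_def by measurable
 have shift: "(\<exists>n\<ge>Suc m. Q n) \<longleftrightarrow> (\<exists>n\<ge>m. Q (Suc n))" for Q m by (metis Suc_le_D Suc_le_mono)
 have A_iff: "\<eta> \<in> A \<longleftrightarrow> \<eta> \<in> space M \<and> (\<exists>k::nat. \<forall>m. \<exists>n\<ge>Suc m. X n \<eta> \<le> (c' - 1 / real (Suc k)) * real n)" for \<eta>
  unfolding A_def mem_Collect_eq shift ..
 have "AE \<eta> in M. T \<eta> \<in> A \<longrightarrow> \<eta> \<in> A" using sub AE_space
 proof eventually_elim
  case (elim \<eta>)
  show ?case
  proof
   assume "T \<eta> \<in> A"
   then obtain k where k: "\<forall>m. \<exists>n\<ge>Suc m. X n (T \<eta>) \<le> (c' - 1 / real (Suc k)) * real n" unfolding A_iff by blast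
   let ?d = "1 / real (Suc k) - 1 / real (Suc (Suc k))"
   have "1 / real (Suc (Suc k)) < 1 / real (Suc k)" by (intro divide_strict_left_mono) auto
   then have d: "?d > 0" by simp
   have "\<exists>n\<ge>Suc m. X n \<eta> \<le> (c' - 1 / real (Suc (Suc k))) * real n" for m
   proof -
    \<comment> \<open>From \<open>N\<close> on, the margin gained by replacing \<open>k\<close> with
      \<open>Suc k\<close> pays for the first step \<open>X 1 \<eta>\<close>.\<close>
    obtain N :: nat where N: "real N * ?d \<ge> X 1 \<eta> - (c' - 1 / real (Suc (Suc k)))"
     using ex_less_of_nat_mult[OF d] less_imp_le by blast
    obtain n where n: "n \<ge> Suc (max m N)" "X n (T \<eta>) \<le> (c' - 1 / real (Suc k)) * real n" using k by blast
    have "X (1 + n) \<eta> \<le> X 1 \<eta> + X n ((T ^^ 1) \<eta>)" using elim(1)[rule_format, of 1 n] n by simp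
    then have "X (Suc n) \<eta> \<le> X 1 \<eta> + (c' - 1 / real (Suc k)) * real n" using n by simp
    also have "\<dots> \<le> real N * ?d + (c' - 1 / real (Suc (Suc k))) + (c' - 1 / real (Suc k)) * real n"
     using N by simp
    also have "real N * ?d \<le> real n * ?d" using n d by (intro mult_right_mono) auto
    also have "real n * ?d + (c' - 1 / real (Suc (Suc k))) + (c' - 1 / real (Suc k)) * real n = (c' - 1 / real (Suc (Suc k))) * real (Suc n)"
     unfolding of_nat_Suc[of n] by (simp only: algebra_simps)
    finally show ?thesis using n by (intro exI[of _ "Suc n"]) auto
   qed
   then show "\<eta> \<in> A" using elim(2) unfolding A_iff by blast
  qed
 qed
 from zero_one[OF A this] consider "prob A = 0" | "prob A = 1" by blast
 then show ?thesis
 proof cases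
  case 1
  then have "AE \<eta> in M. \<eta> \<notin> A" using A by (subst AE_iff_measurable[OF A]) (auto simp: emeasure_eq_measure dest: sets.sets_into_space)
  then show ?thesis using AE_space
  proof eventually_elim
   case (elim \<eta>)
   obtain k where k: "1 / real (Suc k) < c' - c" using c' nat_approx_posE[of "c' - c"] by auto
   from elim obtain m where m: "\<forall>n\<ge>Suc m. \<not> X n \<eta> \<le> (c' - 1 / real (Suc k)) * real n" unfolding A_iff by blast
   show ?case
   proof (rule eventually_sequentiallyI[of "Suc m"])
    fix n assume "Suc m \<le> n"
    then have "(c' - 1 / real (Suc k)) * real n \<le> X n \<eta>" using m by force
    moreover have "c * real n \<le> (c' - 1 / real (Suc k)) * real n" using k by (intro mult_right_mono) auto
    ultimately show "c * real n \<le> X n \<eta>" by linarith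
   qed
  qed
 next
  case 2
  then have "AE \<eta> in M. \<eta> \<in> A" using A by (simp add: AE_in_set_eq_1)
  then have "AE \<eta> in M. \<exists>n\<ge>1. X n \<eta> \<le> c' * real n"
  proof eventually_elim
   case (elim \<eta>)
   then obtain k n where n: "n \<ge> Suc 0" "X n \<eta> \<le> (c' - 1 / real (Suc k)) * real n" unfolding A_iff by blast
   have "(c' - 1 / real (Suc k)) * real n \<le> c' * real n" by (intro mult_right_mono) auto
   with n show ?case by (intro exI[of _ n]) linarith
  qed
  from subadditive_mean_le[OF int sub this, of "(\<alpha> - c') / 2"] c'
  obtain n where n: "n \<ge> 1" "(\<integral>\<eta>. X n \<eta> \<partial>M) \<le> (c' + (\<alpha> - c') / 2) * real n" by auto
  moreover have "(c' + (\<alpha> - c') / 2) * real n < \<alpha> * real n"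
   using n c' by (intro mult_strict_right_mono) (auto simp: field_simps)
  ultimately show ?thesis using mean[of n] by linarith
 qed
qed

text \<open>Negated Birkhoff sums are additive, hence subadditive, so the lower bound for them is
  the upper half of Birkhoff's theorem.\<close>

lemma birkhoff_eventually_le:
 fixes f :: "'a \<Rightarrow> real"
 assumes f: "integrable M f" and c: "(\<integral>\<eta>. f \<eta> \<partial>M) < c"
 shows "AE \<eta> in M. eventually (\<lambda>n. (\<Sum>j<n. f ((T ^^ j) \<eta>)) \<le> c * real n) sequentially"
proof -
 define X where "X n \<eta> = - (\<Sum>j<n. f ((T ^^ j) \<eta>))" for n \<eta>
 have "AE \<eta> in M. eventually (\<lambda>n. (- c) * real n \<le> X n \<eta>) sequentially"
 proof (rule subadditive_eventually_ge[where \<alpha> = "- (\<integral>\<eta>. f \<eta> \<partial>M)"])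
  show "integrable M (X n)" for n unfolding X_def by (intro Bochner_Integration.integrable_minus Bochner_Integration.integrable_sum integrable_T_pow f)
  have eq: "X (m + n) \<eta> = X m \<eta> + X n ((T ^^ m) \<eta>)" for m n \<eta>
  proof -
   have "(\<Sum>j<m + n. f ((T ^^ j) \<eta>)) = (\<Sum>j<m. f ((T ^^ j) \<eta>)) + (\<Sum>j<n. f ((T ^^ (m + j)) \<eta>))"
    by (induction n) auto
   moreover have "(T ^^ (m + j)) \<eta> = (T ^^ j) ((T ^^ m) \<eta>)" for j by (metis add.commute comp_apply funpow_add)
   ultimately show ?thesis by (simp add: X_def)
  qed
  show "AE \<eta> in M. \<forall>m\<ge>1. \<forall>n\<ge>1. X (m + n) \<eta> \<le> X m \<eta> + X n ((T ^^ m) \<eta>)" by (simp add: eq)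
  show "- (\<integral>\<eta>. f \<eta> \<partial>M) * real n \<le> (\<integral>\<eta>. X n \<eta> \<partial>M)" for n
   unfolding X_def using f by (simp add: integrable_T_pow integral_T_pow borel_measurable_integrable mult.commute)
 qed (use c in auto)
 then show ?thesis by eventually_elim (auto simp: X_def elim: eventually_mono)
qed

end

section \<open>The path law of Brownian motion\<close>

definition gauss :: "real \<Rightarrow> 'a::euclidean_space measure" where
 "gauss t = density lborel (\<lambda>x. ennreal (\<Prod>b\<in>Basis. normal_density 0 (sqrt t) (x \<bullet> b)))"

lemma sets_gauss [simp, measurable_cong]: "sets (gauss t) = sets borel" by (simp add: gauss_def)

lemma space_gauss [simp]: "space (gauss t) = UNIV" by (simp add: gauss_def)

lemma lborel_distr_uminus_euclidean: "distr lborel borel uminus = (lborel :: 'a::euclidean_space measure)"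
proof -
 have "(lborel :: 'a measure) = density (distr lborel borel (\<lambda>x. 0 + (-1) *\<^sub>R x)) (\<lambda>_. ennreal (\<bar>-1::real\<bar>^DIM('a)))"
  by (rule lborel_affine) simp
 then show ?thesis by (simp add: density_1)
qed

lemma gauss_uminus: "distr (gauss t) borel uminus = (gauss t :: 'a::euclidean_space measure)"
proof -
 let ?f = "\<lambda>x::'a. ennreal (\<Prod>b\<in>Basis. normal_density 0 (sqrt t) (x \<bullet> b))"
 have "?f (- x) = ?f x" for x by (simp add: normal_density_def)
 then have "distr (gauss t) borel uminus = distr (density lborel (\<lambda>x. ?f (- x))) borel uminus" by (simp add: gauss_def)
 also have "\<dots> = density (distr lborel borel uminus) ?f" by (rule density_distr[symmetric]) auto
 finally show ?thesis by (simp add: lborel_distr_uminus_euclidean gauss_def)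
qed

abbreviation grid_step :: "(real \<Rightarrow> 'w \<Rightarrow> 'a::euclidean_space) \<Rightarrow> nat \<Rightarrow> nat \<Rightarrow> 'w \<Rightarrow> 'a" where
 "grid_step Z m i w \<equiv> Z (real (Suc i) / 2 ^ m) w - Z (real i / 2 ^ m) w"

text \<open>Only the laws of increments along dyadic grids matter for the law of a continuous process;
 this weaker notion is easy to verify for reflected and concatenated processes.\<close>

definition bm_grid :: "'w measure \<Rightarrow> (real \<Rightarrow> 'w \<Rightarrow> 'a::euclidean_space) \<Rightarrow> bool" where
 "bm_grid W Z \<longleftrightarrow> prob_space W \<and> (\<forall>t\<ge>0. Z t \<in> borel_measurable W) \<and>
   (\<forall>w\<in>space W. Z 0 w = 0 \<and> continuous_on {0..} (\<lambda>t. Z t w)) \<and>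
   (\<forall>m (N::nat) A. (\<forall>i<N. A i \<in> sets borel) \<longrightarrow>
    emeasure W {w \<in> space W. \<forall>i<N. grid_step Z m i w \<in> A i}
    = (\<Prod>i<N. emeasure (gauss (1 / 2 ^ m)) (A i)))"

lemma brownian_motion_grid:
 assumes "brownian_motion W Z" shows "bm_grid W Z"
proof -
 interpret prob_space W using assms by (simp add: brownian_motion_def)
 have Zm: "Z t \<in> borel_measurable W" if "0 \<le> t" for t using assms that by (simp add: brownian_motion_def)
 have law: "distr W borel (\<lambda>w. Z t w - Z s w) = gauss (t - s)" if "0 \<le> s" "s < t" for s t
  using assms that unfolding brownian_motion_def gauss_def by blast
 have iv: "indep_vars (\<lambda>_. borel) (\<lambda>i w. Z (t (Suc i)) w - Z (t i) w) {..<n}" if "0 \<le> t 0" "mono t" for t and n :: nat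
  using assms that unfolding brownian_motion_def by blast
 have "emeasure W {w \<in> space W. \<forall>i<N. grid_step Z m i w \<in> A i}
  = (\<Prod>i<N. emeasure (gauss (1 / 2 ^ m)) (A i))" if A: "\<forall>i<N. A i \<in> sets borel" for m and N :: nat and A
 proof (cases "N = 0")
  case True then show ?thesis by (simp add: emeasure_space_1)
 next
  case False
  let ?D = "\<lambda>i w. grid_step Z m i w"
  have iv': "indep_vars (\<lambda>_. borel) ?D {..<N}" by (rule iv) (auto simp: mono_def divide_right_mono)
  have "prob (\<Inter>i\<in>{..<N}. ?D i -` A i \<inter> space W) = (\<Prod>i\<in>{..<N}. prob (?D i -` A i \<inter> space W))"
   by (rule indep_varsD_finite[OF iv']) (use False A in auto)
  moreover have "(\<Inter>i\<in>{..<N}. ?D i -` A i \<inter> space W) = {w \<in> space W. \<forall>i<N. ?D i w \<in> A i}" using False by auto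
  ultimately have "emeasure W {w \<in> space W. \<forall>i<N. ?D i w \<in> A i} = (\<Prod>i<N. emeasure W (?D i -` A i \<inter> space W))"
   by (simp add: emeasure_eq_measure prod_ennreal)
  also have "\<dots> = (\<Prod>i<N. emeasure (gauss (1 / 2 ^ m)) (A i))"
  proof (rule prod.cong[OF refl])
   fix i assume i: "i \<in> {..<N}"
   have "?D i \<in> borel_measurable W" by (intro borel_measurable_diff Zm) auto
   then have "emeasure W (?D i -` A i \<inter> space W) = emeasure (distr W borel (?D i)) (A i)"
    using A i by (subst emeasure_distr) auto
   also have "distr W borel (?D i) = gauss (real (Suc i) / 2 ^ m - real i / 2 ^ m)"
    by (rule law) (auto simp: divide_strict_right_mono)
   also have "real (Suc i) / 2 ^ m - real i / 2 ^ m = 1 / 2 ^ m" by (simp add: field_simps)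
   finally show "emeasure W (?D i -` A i \<inter> space W) = emeasure (gauss (1 / 2 ^ m)) (A i)" .
  qed
  finally show ?thesis .
 qed
 then show ?thesis using assms unfolding bm_grid_def brownian_motion_def by blast
qed

lemma bm_gridD:
 "bm_grid W Z \<Longrightarrow> (\<And>i. i < N \<Longrightarrow> A i \<in> sets borel) \<Longrightarrow>
  emeasure W {w \<in> space W. \<forall>i<N. grid_step Z m i w \<in> A i}
   = (\<Prod>i<N. emeasure (gauss (1 / 2 ^ m)) (A i))" unfolding bm_grid_def by blast

lemma bm_grid_uminus:
 assumes "bm_grid W Z" shows "bm_grid W (\<lambda>t w. - Z t w)"
proof -
 have "emeasure W {w \<in> space W. \<forall>i<N. - Z (real (Suc i) / 2 ^ m) w - - Z (real i / 2 ^ m) w \<in> A i}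
  = (\<Prod>i<N. emeasure (gauss (1 / 2 ^ m)) (A i))" if A: "\<forall>i<N. A i \<in> sets borel" for m and N :: nat and A
 proof -
  have "{w \<in> space W. \<forall>i<N. - Z (real (Suc i) / 2 ^ m) w - - Z (real i / 2 ^ m) w \<in> A i}
   = {w \<in> space W. \<forall>i<N. grid_step Z m i w \<in> uminus -` A i}" by (simp add: add.commute)
  also have "emeasure W \<dots> = (\<Prod>i<N. emeasure (gauss (1 / 2 ^ m)) (uminus -` A i))"
   by (rule bm_gridD[OF assms]) (use A measurable_sets[of "uminus :: 'b \<Rightarrow> 'b" borel borel] in auto)
  also have "\<dots> = (\<Prod>i<N. emeasure (gauss (1 / 2 ^ m)) (A i))"
  proof (rule prod.cong[OF refl])
   fix i assume "i \<in> {..<N}"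
   then have "emeasure (distr (gauss (1 / 2 ^ m)) borel uminus) (A i) = emeasure (gauss (1 / 2 ^ m)) (uminus -` A i)"
    using A by (subst emeasure_distr) auto
   then show "emeasure (gauss (1 / 2 ^ m)) (uminus -` A i) = emeasure (gauss (1 / 2 ^ m)) (A i)" by (simp add: gauss_uminus)
  qed
  finally show ?thesis .
 qed
 then show ?thesis using assms unfolding bm_grid_def by (auto intro!: continuous_on_minus)
qed

text \<open>The first path up to time \<open>a\<close>, continued by the increments of an
  independent second one. The junction is an integer and hence lies on every dyadic grid, so no grid
  increment mixes the two paths.\<close>

definition concat_at :: "nat \<Rightarrow> (real \<Rightarrow> 'w \<Rightarrow> 'a::euclidean_space) \<Rightarrow> (real \<Rightarrow> 'v \<Rightarrow> 'a) \<Rightarrow> real \<Rightarrow> 'w \<times> 'v \<Rightarrow> 'a" where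
 "concat_at a Z Z' t p = Z (min t (real a)) (fst p) + Z' (max (t - real a) 0) (snd p)"

lemma bm_grid_concat:
 assumes W: "bm_grid W Z" and W': "bm_grid W' Z'"
 shows "bm_grid (W \<Otimes>\<^sub>M W') (concat_at a Z Z')"
proof -
 interpret W: prob_space W using W by (simp add: bm_grid_def)
 interpret W': prob_space W' using W' by (simp add: bm_grid_def)
 interpret pair_prob_space W W' ..
 have Zm [measurable]: "Z t \<in> borel_measurable W" if "0 \<le> t" for t using W that by (simp add: bm_grid_def)
 have Zm' [measurable]: "Z' t \<in> borel_measurable W'" if "0 \<le> t" for t using W' that by (simp add: bm_grid_def)
 have Z0: "Z' 0 w = 0" if "w \<in> space W'" for w using W' that by (simp add: bm_grid_def)
 have cont: "continuous_on {0..} (\<lambda>t. Z t w)" if "w \<in> space W" for w using W that by (simp add: bm_grid_def)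
 have cont': "continuous_on {0..} (\<lambda>t. Z' t w)" if "w \<in> space W'" for w using W' that by (simp add: bm_grid_def)
 have "emeasure (W \<Otimes>\<^sub>M W') {p \<in> space (W \<Otimes>\<^sub>M W'). \<forall>i<N. concat_at a Z Z' (real (Suc i) / 2 ^ m) p - concat_at a Z Z' (real i / 2 ^ m) p \<in> A i}
  = (\<Prod>i<N. emeasure (gauss (1 / 2 ^ m)) (A i))" if A: "\<forall>i<N. A i \<in> sets borel" for m and N :: nat and A
 proof -
  let ?K = "a * 2 ^ m"
  let ?D = "\<lambda>i w. grid_step Z m i w"
  let ?D' = "\<lambda>i w. Z' (real (Suc i) / 2 ^ m) w - Z' (real i / 2 ^ m) w"
  have lo: "concat_at a Z Z' (real (Suc i) / 2 ^ m) p - concat_at a Z Z' (real i / 2 ^ m) p = ?D i (fst p)"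
   if "i < ?K" "p \<in> space (W \<Otimes>\<^sub>M W')" for i p
  proof -
   have "real (Suc i) \<le> real (a * 2 ^ m)" "real i \<le> real (a * 2 ^ m)" using that(1) by (simp_all only: of_nat_le_iff)
   then have "real (Suc i) / 2 ^ m \<le> real a" "real i / 2 ^ m \<le> real a" by (simp_all add: field_simps)
   then show ?thesis by (simp add: concat_at_def min_absorb1 max_absorb2)
  qed
  have hi: "concat_at a Z Z' (real (Suc (?K + j)) / 2 ^ m) p - concat_at a Z Z' (real (?K + j) / 2 ^ m) p = ?D' j (snd p)"
   for j p
  proof -
   have 1: "real (Suc (?K + j)) / 2 ^ m = real a + real (Suc j) / 2 ^ m" "real (?K + j) / 2 ^ m = real a + real j / 2 ^ m"
    by (simp_all add: field_simps)
   show ?thesis unfolding 1 by (simp add: concat_at_def min_absorb2 max_absorb1)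
  qed
  have split: "(\<forall>i<N. Q i) \<longleftrightarrow> (\<forall>i<min N ?K. Q i) \<and> (\<forall>j<N - ?K. Q (?K + j))" for Q
  proof (intro iffI conjI allI impI; (elim conjE)?)
   fix i assume 1: "\<forall>i<min N ?K. Q i" and 2: "\<forall>j<N - ?K. Q (?K + j)" and i: "i < N"
   show "Q i" using 1 2[rule_format, of "i - ?K"] i by (cases "i < ?K") auto
  qed auto
  have "{p \<in> space (W \<Otimes>\<^sub>M W'). \<forall>i<N. concat_at a Z Z' (real (Suc i) / 2 ^ m) p - concat_at a Z Z' (real i / 2 ^ m) p \<in> A i}
   = {w \<in> space W. \<forall>i<min N ?K. ?D i w \<in> A i} \<times> {w \<in> space W'. \<forall>j<N - ?K. ?D' j w \<in> A (?K + j)}"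
   (is "_ = ?E \<times> ?E'")
  proof -
   have eq: "(\<forall>i<N. concat_at a Z Z' (real (Suc i) / 2 ^ m) p - concat_at a Z Z' (real i / 2 ^ m) p \<in> A i)
    \<longleftrightarrow> (\<forall>i<min N ?K. ?D i (fst p) \<in> A i) \<and> (\<forall>j<N - ?K. ?D' j (snd p) \<in> A (?K + j))"
    if "p \<in> space (W \<Otimes>\<^sub>M W')" for p unfolding split hi using lo[OF _ that] by (simp cong: conj_cong)
   show ?thesis by (intro set_eqI, unfold mem_Collect_eq mem_Times_iff)
      (use eq in \<open>simp only: space_pair_measure mem_Times_iff cong: conj_cong\<close>, blast)
  qed
  moreover have "?E \<in> sets W"
  proof -
   have "{w \<in> space W. \<forall>i\<in>{..<min N ?K}. ?D i w \<in> A i} \<in> sets W"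
    by (rule sets_Collect_ball_vimage[OF _ borel_measurable_diff[OF Zm Zm]]) (use A in auto)
   then show ?thesis by (simp only: Ball_def lessThan_iff)
  qed
  moreover have "?E' \<in> sets W'"
  proof -
   have "{w \<in> space W'. \<forall>i\<in>{..<N - ?K}. ?D' i w \<in> A (?K + i)} \<in> sets W'"
    by (rule sets_Collect_ball_vimage[OF _ borel_measurable_diff[OF Zm' Zm']]) (use A in auto)
   then show ?thesis by (simp only: Ball_def lessThan_iff)
  qed
  ultimately have "emeasure (W \<Otimes>\<^sub>M W') {p \<in> space (W \<Otimes>\<^sub>M W'). \<forall>i<N. concat_at a Z Z' (real (Suc i) / 2 ^ m) p - concat_at a Z Z' (real i / 2 ^ m) p \<in> A i}
   = emeasure W ?E * emeasure W' ?E'" by (simp only: W'.emeasure_pair_measure_Times)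
  also have "emeasure W ?E = (\<Prod>i<min N ?K. emeasure (gauss (1 / 2 ^ m)) (A i))"
   by (rule bm_gridD[OF W]) (use A in auto)
  also have "emeasure W' ?E' = (\<Prod>j<N - ?K. emeasure (gauss (1 / 2 ^ m)) (A (?K + j)))"
   by (rule bm_gridD[OF W']) (use A in auto)
  also have "(\<Prod>i<min N ?K. emeasure (gauss (1 / 2 ^ m)) (A i)) * (\<Prod>j<N - ?K. emeasure (gauss (1 / 2 ^ m)) (A (?K + j)))
   = (\<Prod>i<N. emeasure (gauss (1 / 2 ^ m)) (A i))"
  proof (cases "N \<le> ?K")
   case False
   then have "N = ?K + (N - ?K)" by simp
   then have "(\<Prod>i<N. emeasure (gauss (1 / 2 ^ m)) (A i)) = (\<Prod>i<?K + (N - ?K). emeasure (gauss (1 / 2 ^ m)) (A i))" by simp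
   also have "\<dots> = (\<Prod>i<?K. emeasure (gauss (1 / 2 ^ m)) (A i)) * (\<Prod>j<N - ?K. emeasure (gauss (1 / 2 ^ m)) (A (?K + j)))"
   proof -
    have "(\<Prod>i<k + n. f i) = (\<Prod>i<k. f i) * (\<Prod>j<n. f (k + j))" for k n :: nat and f :: "nat \<Rightarrow> ennreal"
     by (induction n) (simp_all add: ac_simps)
    then show ?thesis .
   qed
   finally show ?thesis using False by (simp add: min_absorb2)
  qed (simp add: min_absorb1)
  finally show ?thesis .
 qed
 moreover have "concat_at a Z Z' t \<in> borel_measurable (W \<Otimes>\<^sub>M W')" if "0 \<le> t" for t
  unfolding concat_at_def[abs_def]
  by (intro borel_measurable_add measurable_compose[OF measurable_fst Zm] measurable_compose[OF measurable_snd Zm'])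
    (use that in auto)
 moreover have "concat_at a Z Z' 0 p = 0" if "p \<in> space (W \<Otimes>\<^sub>M W')" for p
  using that W W' by (auto simp: concat_at_def space_pair_measure bm_grid_def)
 moreover have "continuous_on {0..} (\<lambda>t. concat_at a Z Z' t p)" if "p \<in> space (W \<Otimes>\<^sub>M W')" for p
  unfolding concat_at_def using that
  by (intro continuous_on_add continuous_on_compose2[OF cont] continuous_on_compose2[OF cont'] continuous_intros)
    (auto simp: space_pair_measure)
 ultimately show ?thesis unfolding bm_grid_def using prob_space_axioms by blast
qed

definition dyadic_times :: "real set" where "dyadic_times = {real (j::nat) / 2 ^ m | j m. True}"

text \<open>The countably many dyadic coordinates determine a continuous path, and functionals that
  involve all times stay measurable.\<close>

definition path_space :: "(real \<Rightarrow> 'a::euclidean_space) measure" where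
 "path_space = PiM dyadic_times (\<lambda>_. borel)"

definition sample_path :: "(real \<Rightarrow> 'w \<Rightarrow> 'a::euclidean_space) \<Rightarrow> 'w \<Rightarrow> real \<Rightarrow> 'a" where
 "sample_path Z w = (\<lambda>s\<in>dyadic_times. Z s w)"

lemma dyadic_times_nonneg: "s \<in> dyadic_times \<Longrightarrow> 0 \<le> s" by (auto simp: dyadic_times_def)

lemma dyadic_timesI [intro]: "real j / 2 ^ m \<in> dyadic_times" by (auto simp: dyadic_times_def)

lemma nat_in_dyadic_times: "real j \<in> dyadic_times" using dyadic_timesI[of j 0] by simp

lemma common_grid:
 assumes "finite J" "J \<subseteq> dyadic_times"
 obtains m f where "\<forall>s\<in>J. s = real (f s) / 2 ^ m" using assms
proof (induction arbitrary: thesis rule: finite_induct)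
 case empty then show ?case by simp
next
 case (insert s J)
 from insert(5) have "J \<subseteq> dyadic_times" by simp
 with insert(3) obtain m f where m: "\<forall>s\<in>J. s = real (f s) / 2 ^ m" by blast
 obtain j k where s: "s = real j / 2 ^ k" using insert(5) by (auto simp: dyadic_times_def)
 show ?case
 proof (rule insert(4)[of "\<lambda>t. if t = s then j * 2 ^ m else f t * 2 ^ k" "m + k"], intro ballI)
  fix t assume "t \<in> insert s J"
  then show "t = real (if t = s then j * 2 ^ m else f t * 2 ^ k) / 2 ^ (m + k)"
   using m s by (cases "t = s") (simp_all add: power_add)
 qed
qed

lemma sample_path_measurable [measurable]:
 assumes "bm_grid W Z" shows "sample_path Z \<in> measurable W path_space"
 unfolding sample_path_def path_space_def
 by (rule measurable_restrict) (use assms dyadic_times_nonneg in \<open>auto simp: bm_grid_def\<close>)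

text \<open>Finitely many dyadic times lie on a common grid, where the values of the process are
  partial sums of increments whose joint law \<open>bm_grid\<close> prescribes. These
  finite-dimensional laws determine the measure on \<open>path_space\<close>.\<close>

lemma bm_path_law:
 assumes W: "bm_grid W Z" and W': "bm_grid W' Z'"
 shows "distr W path_space (sample_path Z) = distr W' path_space (sample_path Z')" unfolding path_space_def
proof (rule measure_eqI_PiM_infinite[where I = dyadic_times and M = "\<lambda>_. borel"])
 have fin: "finite_measure (distr W (PiM dyadic_times (\<lambda>_. borel)) (sample_path Z))"
  if "bm_grid W Z" for W :: "'x measure" and Z :: "real \<Rightarrow> 'x \<Rightarrow> 'b" using that sample_path_measurable[OF that]
  by (intro prob_space.finite_measure prob_space.prob_space_distr) (auto simp: bm_grid_def path_space_def)
 show "finite_measure (distr W (PiM dyadic_times (\<lambda>_. borel)) (sample_path Z))" by (rule fin[OF W])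
 fix A :: "real \<Rightarrow> 'b set" and J assume J: "finite J" "J \<subseteq> dyadic_times" and A: "\<And>i. i \<in> J \<Longrightarrow> A i \<in> sets borel"
 obtain m f where f: "\<forall>s\<in>J. s = real (f s) / 2 ^ m" using common_grid[OF J] by blast
 obtain N where N: "\<forall>s\<in>J. f s \<le> N" using finite_nat_set_iff_bounded_le[of "f ` J"] J by auto
 let ?M = "PiM {..<N} (\<lambda>_. borel) :: (nat \<Rightarrow> 'b) measure"
 define C where "C = {v \<in> space ?M. \<forall>s\<in>J. (\<Sum>i<f s. v i) \<in> A s}"
 have C: "C \<in> sets ?M" unfolding C_def
  by (rule sets_Collect_ball_vimage[OF J(1) borel_measurable_sum A]) (use N in \<open>auto intro!: measurable_component_singleton\<close>)
 have em: "emeasure (distr W (PiM dyadic_times (\<lambda>_. borel)) (sample_path Z)) (prod_emb dyadic_times (\<lambda>_. borel) J (Pi\<^sub>E J A))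
  = emeasure (PiM {..<N} (\<lambda>_. gauss (1 / 2 ^ m))) C" if W: "bm_grid W Z" for W :: "'x measure" and Z :: "real \<Rightarrow> 'x \<Rightarrow> 'b"
 proof -
  let ?D = "\<lambda>w. \<lambda>i\<in>{..<N}. grid_step Z m i w"
  interpret W: prob_space W using W by (simp add: bm_grid_def)
  have Zm: "Z t \<in> borel_measurable W" if "0 \<le> t" for t using W that by (simp add: bm_grid_def)
  have D: "?D \<in> measurable W ?M" by (intro measurable_restrict borel_measurable_diff Zm) auto
  \<comment> \<open>That the Gaussian density has total mass one is read off from an increment of
    \<open>Z\<close> instead of being computed.\<close>
  interpret G: prob_space "gauss (1 / 2 ^ m) :: 'b measure"
  proof
   have "emeasure W {w \<in> space W. \<forall>i<Suc 0. grid_step Z m i w \<in> UNIV}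
    = (\<Prod>i<Suc 0. emeasure (gauss (1 / 2 ^ m)) (UNIV :: 'b set))" by (rule bm_gridD[OF W]) auto
   then show "emeasure (gauss (1 / 2 ^ m) :: 'b measure) (space (gauss (1 / 2 ^ m))) = 1" by (simp add: W.emeasure_space_1)
  qed
  interpret product_prob_space "\<lambda>_. gauss (1 / 2 ^ m) :: 'b measure" "{..<N}" ..
  have law: "distr W ?M ?D = PiM {..<N} (\<lambda>_. gauss (1 / 2 ^ m))"
  proof (rule PiM_eqI[OF finite_lessThan])
   show "sets (distr W ?M ?D) = sets (PiM {..<N} (\<lambda>_. gauss (1 / 2 ^ m) :: 'b measure))"
    by (subst sets_distr) (rule sets_PiM_cong, auto)
   fix B :: "nat \<Rightarrow> 'b set" assume B: "\<And>i. i \<in> {..<N} \<Longrightarrow> B i \<in> sets (gauss (1 / 2 ^ m))"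
   have "Pi\<^sub>E {..<N} B \<in> sets ?M" by (rule sets_PiM_I_finite) (use B in auto)
   then have "emeasure (distr W ?M ?D) (Pi\<^sub>E {..<N} B) = emeasure W (?D -` Pi\<^sub>E {..<N} B \<inter> space W)"
    by (rule emeasure_distr[OF D])
   also have "?D -` Pi\<^sub>E {..<N} B \<inter> space W = {w \<in> space W. \<forall>i<N. grid_step Z m i w \<in> B i}"
   proof -
    have "?D w \<in> Pi\<^sub>E {..<N} B \<longleftrightarrow> (\<forall>i<N. grid_step Z m i w \<in> B i)" for w
    proof -
     have "?D w \<in> Pi\<^sub>E {..<N} B \<longleftrightarrow> (\<forall>i\<in>{..<N}. ?D w i \<in> B i)"
      by (simp only: PiE_iff restrict_extensional simp_thms)
     also have "\<dots> \<longleftrightarrow> (\<forall>i\<in>{..<N}. grid_step Z m i w \<in> B i)"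
      by (rule ball_cong[OF refl]) (simp only: restrict_apply')
     finally show ?thesis by blast
    qed
    then show ?thesis by blast
   qed
   also have "emeasure W \<dots> = (\<Prod>i<N. emeasure (gauss (1 / 2 ^ m)) (B i))"
    by (rule bm_gridD[OF W]) (use B in auto)
   finally show "emeasure (distr W ?M ?D) (Pi\<^sub>E {..<N} B) = (\<Prod>i<N. emeasure (gauss (1 / 2 ^ m)) (B i))" .
  qed
  have sp: "sample_path Z -` prod_emb dyadic_times (\<lambda>_. borel) J (Pi\<^sub>E J A) \<inter> space W = ?D -` C \<inter> space W"
  proof -
   have val: "Z s w = (\<Sum>i<f s. ?D w i)" if s: "s \<in> J" and w: "w \<in> space W" for s w
   proof -
    have Z0: "Z 0 w = 0" using W w by (simp add: bm_grid_def)
    have "(\<Sum>i<k. grid_step Z m i w) = Z (real k / 2 ^ m) w" for k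
     using sum_lessThan_telescope[of "\<lambda>i. Z (real i / 2 ^ m) w" k] Z0 by simp
    moreover have "(\<Sum>i<f s. ?D w i) = (\<Sum>i<f s. grid_step Z m i w)" by (rule sum.cong) (use N s in auto)
    ultimately show ?thesis using f s by metis
   qed
   have smp: "sample_path Z w s = Z s w" if "s \<in> J" for s w using that J by (auto simp: sample_path_def)
   have sp: "w \<in> space W \<Longrightarrow> ?D w \<in> space ?M" for w by (auto simp: space_PiM)
   have ext: "sample_path Z w \<in> extensional dyadic_times" for w by (simp add: sample_path_def)
   have "sample_path Z w \<in> prod_emb dyadic_times (\<lambda>_. borel) J (Pi\<^sub>E J A) \<longleftrightarrow> ?D w \<in> C"
    if w: "w \<in> space W" for w
   proof -
    have "(\<forall>s\<in>J. (\<Sum>i<f s. ?D w i) \<in> A s) \<longleftrightarrow> (\<forall>s\<in>J. Z s w \<in> A s)"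
     by (rule ball_cong[OF refl]) (simp only: val[OF _ w])
    then have "?D w \<in> C \<longleftrightarrow> (\<forall>s\<in>J. Z s w \<in> A s)" using sp[OF w] unfolding C_def by blast
    moreover have "sample_path Z w \<in> prod_emb dyadic_times (\<lambda>_. borel) J (Pi\<^sub>E J A) \<longleftrightarrow> (\<forall>s\<in>J. Z s w \<in> A s)"
     using ext[of w] smp by (simp add: prod_emb_def PiE_iff)
    ultimately show ?thesis by blast
   qed
   then show ?thesis by blast
  qed
  have "emeasure (distr W (PiM dyadic_times (\<lambda>_. borel)) (sample_path Z)) (prod_emb dyadic_times (\<lambda>_. borel) J (Pi\<^sub>E J A))
   = emeasure W (sample_path Z -` prod_emb dyadic_times (\<lambda>_. borel) J (Pi\<^sub>E J A) \<inter> space W)"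
   by (rule emeasure_distr) (use sample_path_measurable[OF W] J A in \<open>auto simp: path_space_def intro!: sets_PiM_I\<close>)
  also have "\<dots> = emeasure (distr W ?M ?D) C" unfolding sp by (rule emeasure_distr[OF D C, symmetric])
  finally show ?thesis unfolding law .
 qed
 show "emeasure (distr W (PiM dyadic_times (\<lambda>_. borel)) (sample_path Z)) (prod_emb dyadic_times (\<lambda>_. borel) J (Pi\<^sub>E J A))
  = emeasure (distr W' (PiM dyadic_times (\<lambda>_. borel)) (sample_path Z')) (prod_emb dyadic_times (\<lambda>_. borel) J (Pi\<^sub>E J A))"
  unfolding em[OF W] em[OF W'] ..
qed auto

lemma bm_path_integral:
 assumes W: "bm_grid W Z" and W': "bm_grid W' Z'" and F: "F \<in> borel_measurable path_space"
 shows "(\<integral>\<^sup>+w. F (sample_path Z w) \<partial>W) = (\<integral>\<^sup>+w. F (sample_path Z' w) \<partial>W')"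
proof -
 have "F \<in> borel_measurable (distr M path_space f)" for M f using F by simp
 then show ?thesis
  using nn_integral_distr[OF sample_path_measurable[OF W], of F] nn_integral_distr[OF sample_path_measurable[OF W'], of F]
   bm_path_law[OF W W'] by simp
qed

text \<open>Recovers a continuous path from its dyadic values, so that functionals of Brownian paths
 become measurable functions on the path space.\<close>

definition path_at :: "(real \<Rightarrow> 'a::euclidean_space) \<Rightarrow> real \<Rightarrow> 'a" where
 "path_at \<xi> s = lim (\<lambda>m. \<xi> (real (nat \<lfloor>max 0 s * 2 ^ m\<rfloor>) / 2 ^ m))"

lemma path_at_measurable:
 "(\<lambda>(\<xi>, s). path_at \<xi> s) \<in> borel_measurable (path_space \<Otimes>\<^sub>M borel)"
proof -
 have [measurable]: "(\<lambda>z. fst z (real (nat \<lfloor>max 0 (snd z) * 2 ^ m\<rfloor>) / 2 ^ m))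
  \<in> borel_measurable (path_space \<Otimes>\<^sub>M borel :: ((real \<Rightarrow> 'a) \<times> real) measure)" for m
 proof (rule measurable_compose_countable[where f = "\<lambda>k z. fst z (real k / 2 ^ m)" and g = "\<lambda>z. nat \<lfloor>max 0 (snd z) * 2 ^ m\<rfloor>"])
  fix k :: nat
  have "(\<lambda>\<xi>. \<xi> (real k / 2 ^ m)) \<in> borel_measurable (path_space :: (real \<Rightarrow> 'a) measure)"
   unfolding path_space_def by (rule measurable_component_singleton) auto
  then show "(\<lambda>z. fst z (real k / 2 ^ m)) \<in> borel_measurable (path_space \<Otimes>\<^sub>M borel :: ((real \<Rightarrow> 'a) \<times> real) measure)"
   by (rule measurable_compose[OF measurable_fst])
 qed measurable
 show ?thesis unfolding path_at_def case_prod_beta by measurable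
qed

lemma dyadic_approx:
 assumes s: "0 \<le> s" shows "(\<lambda>m. real (nat \<lfloor>s * 2 ^ m\<rfloor>) / 2 ^ m) \<longlonglongrightarrow> s"
proof (rule tendsto_sandwich[of "\<lambda>m. s - 1 / 2 ^ m" _ _ "\<lambda>_. s"])
 have e: "real (nat \<lfloor>s * 2 ^ m\<rfloor>) = of_int \<lfloor>s * 2 ^ m\<rfloor>" for m using s by simp
 show "eventually (\<lambda>m. s - 1 / 2 ^ m \<le> real (nat \<lfloor>s * 2 ^ m\<rfloor>) / 2 ^ m) sequentially" unfolding e
 proof (rule always_eventually, rule allI)
  fix m :: nat
  have "(s * 2 ^ m - 1) / 2 ^ m \<le> of_int \<lfloor>s * 2 ^ m\<rfloor> / 2 ^ m" by (intro divide_right_mono) (linarith, simp)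
  then show "s - 1 / 2 ^ m \<le> of_int \<lfloor>s * 2 ^ m\<rfloor> / 2 ^ m" by (simp add: field_simps)
 qed
 show "eventually (\<lambda>m. real (nat \<lfloor>s * 2 ^ m\<rfloor>) / 2 ^ m \<le> s) sequentially"
  unfolding e by (rule always_eventually) (auto simp: field_simps)
 show "(\<lambda>m. s - 1 / 2 ^ m) \<longlonglongrightarrow> s" by real_asymp
qed auto

lemma dyadic_approx_unit:
 assumes s: "s \<in> {0..1}" shows "nat \<lfloor>s * 2 ^ m\<rfloor> \<le> 2 ^ m"
proof -
 have "s * 2 ^ m \<le> 1 * 2 ^ m" by (rule mult_right_mono) (use s in auto)
 then have "s * 2 ^ m < 2 ^ m + 1" by linarith
 then have "\<lfloor>s * 2 ^ m\<rfloor> \<le> 2 ^ m" by (simp add: floor_le_iff)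
 then show ?thesis by (simp add: nat_le_iff)
qed

lemma path_at_sample_path:
 assumes W: "bm_grid W Z" and w: "w \<in> space W" and s: "0 \<le> s"
 shows "path_at (sample_path Z w) s = Z s w" unfolding path_at_def
proof (rule limI)
 have cont: "continuous_on {0..} (\<lambda>t. Z t w)" using W w by (simp add: bm_grid_def)
 have "(\<lambda>m. Z (real (nat \<lfloor>s * 2 ^ m\<rfloor>) / 2 ^ m) w) \<longlonglongrightarrow> Z s w"
  by (rule continuous_on_tendsto_compose[OF cont dyadic_approx[OF s]]) (use s in auto)
 then show "(\<lambda>m. sample_path Z w (real (nat \<lfloor>max 0 s * 2 ^ m\<rfloor>) / 2 ^ m)) \<longlonglongrightarrow> Z s w"
 proof -
  have "sample_path Z w (real k / 2 ^ m) = Z (real k / 2 ^ m) w" for k m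
   by (simp only: sample_path_def restrict_apply' dyadic_timesI)
  then show "(\<lambda>m. Z (real (nat \<lfloor>s * 2 ^ m\<rfloor>) / 2 ^ m) w) \<longlonglongrightarrow> Z s w \<Longrightarrow> ?thesis" by (simp only: max_absorb2 s)
 qed
qed

section \<open>Gaussian tails and oscillations of the path\<close>

lemma normal_density_add_le:
 assumes "0 \<le> u" "0 \<le> k" "0 < \<sigma>"
 shows "normal_density 0 \<sigma> (u + k) \<le> exp (- k\<^sup>2 / (2 * \<sigma>\<^sup>2)) * normal_density 0 \<sigma> u"
proof -
 have "(u + k)\<^sup>2 \<ge> u\<^sup>2 + k\<^sup>2" using assms by (simp add: power2_sum)
 then have "- (u + k)\<^sup>2 / (2 * \<sigma>\<^sup>2) \<le> (- k\<^sup>2 - u\<^sup>2) / (2 * \<sigma>\<^sup>2)" using assms by (intro divide_right_mono) auto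
 then have "exp (- (u + k)\<^sup>2 / (2 * \<sigma>\<^sup>2)) \<le> exp (- k\<^sup>2 / (2 * \<sigma>\<^sup>2)) * exp (- u\<^sup>2 / (2 * \<sigma>\<^sup>2))"
  by (simp add: exp_add[symmetric] diff_divide_distrib)
 then show ?thesis using assms by (simp add: normal_density_def mult.left_commute divide_right_mono)
qed

text \<open>Shifting the variable by \<open>k\<close> shrinks the density on the positive axis by
  the stated factor. The comparison of two tails, and not just a tail bound, makes overshoots
  controllable uniformly in the distance to the level.\<close>

lemma normal_tail_ratio:
 assumes "0 \<le> u" "0 \<le> k" "0 < \<sigma>"
 shows "(\<integral>\<^sup>+x\<in>{u + k..}. ennreal (normal_density 0 \<sigma> x) \<partial>lborel)
  \<le> ennreal (exp (- k\<^sup>2 / (2 * \<sigma>\<^sup>2))) * (\<integral>\<^sup>+x\<in>{u..}. ennreal (normal_density 0 \<sigma> x) \<partial>lborel)"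
proof -
 have "(\<integral>\<^sup>+x\<in>{u + k..}. ennreal (normal_density 0 \<sigma> x) \<partial>lborel)
  = (\<integral>\<^sup>+x. ennreal (normal_density 0 \<sigma> (k + 1 * x)) * indicator {u + k..} (k + 1 * x) \<partial>lborel)"
  by (subst nn_integral_real_affine[where c = 1 and t = k]) auto
 also have "\<dots> \<le> (\<integral>\<^sup>+x. ennreal (exp (- k\<^sup>2 / (2 * \<sigma>\<^sup>2))) * (ennreal (normal_density 0 \<sigma> x) * indicator {u..} x) \<partial>lborel)"
 proof (rule nn_integral_mono)
  fix x :: real
  show "ennreal (normal_density 0 \<sigma> (k + 1 * x)) * indicator {u + k..} (k + 1 * x)
   \<le> ennreal (exp (- k\<^sup>2 / (2 * \<sigma>\<^sup>2))) * (ennreal (normal_density 0 \<sigma> x) * indicator {u..} x)"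
   using normal_density_add_le[of x k \<sigma>] assms
   by (auto simp: indicator_def ennreal_mult[symmetric] add.commute intro!: ennreal_leI)
 qed
 also have "\<dots> = ennreal (exp (- k\<^sup>2 / (2 * \<sigma>\<^sup>2))) * (\<integral>\<^sup>+x\<in>{u..}. ennreal (normal_density 0 \<sigma> x) \<partial>lborel)"
  by (rule nn_integral_cmult) auto
 finally show ?thesis .
qed

lemma nn_integral_normal_density:
 "0 < \<sigma> \<Longrightarrow> (\<integral>\<^sup>+x. ennreal (normal_density \<mu> \<sigma> x) \<partial>lborel) = 1" by (subst nn_integral_eq_integral) auto

lemma normal_tail:
 assumes "0 \<le> k" "0 < \<sigma>"
 shows "(\<integral>\<^sup>+x\<in>{k..}. ennreal (normal_density 0 \<sigma> x) \<partial>lborel) \<le> ennreal (exp (- k\<^sup>2 / (2 * \<sigma>\<^sup>2)))"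
proof -
 have "(\<integral>\<^sup>+x\<in>{0..}. ennreal (normal_density 0 \<sigma> x) \<partial>lborel) \<le> (\<integral>\<^sup>+x. ennreal (normal_density 0 \<sigma> x) \<partial>lborel)"
  by (rule nn_integral_mono) (auto simp: indicator_def)
 then have "(\<integral>\<^sup>+x\<in>{0..}. ennreal (normal_density 0 \<sigma> x) \<partial>lborel) \<le> 1"
  using assms by (simp add: nn_integral_normal_density)
 from mult_left_mono[OF this, of "ennreal (exp (- k\<^sup>2 / (2 * \<sigma>\<^sup>2)))"]
 show ?thesis using normal_tail_ratio[of 0 k \<sigma>] assms by simp
qed

lemma gauss_marginal:
 fixes b :: "'a::euclidean_space"
 assumes b: "b \<in> Basis" and g [measurable]: "g \<in> borel_measurable borel" and t: "0 < t"
 shows "(\<integral>\<^sup>+x. g (x \<bullet> b) \<partial>gauss t) = (\<integral>\<^sup>+u. g u * ennreal (normal_density 0 (sqrt t) u) \<partial>lborel)"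
proof -
 let ?n = "\<lambda>u. ennreal (normal_density 0 (sqrt t) u)"
 let ?f = "\<lambda>b' u. (if b' = b then g u else 1) * ?n u"
 have "(\<integral>\<^sup>+x. g (x \<bullet> b) \<partial>gauss t) = (\<integral>\<^sup>+x. (\<Prod>b'\<in>Basis. ?f b' (x \<bullet> b')) \<partial>lborel)" unfolding gauss_def
  by (subst nn_integral_density)
    (auto simp: prod.distrib prod.delta b prod_ennreal mult.commute intro!: nn_integral_cong)
 also have "\<dots> = (\<Prod>b'\<in>Basis. (\<integral>\<^sup>+u. ?f b' u \<partial>lborel))" by (rule nn_integral_lborel_prod) auto
 also have "\<dots> = (\<Prod>b'\<in>Basis. if b' = b then (\<integral>\<^sup>+u. g u * ?n u \<partial>lborel) else 1)"
  by (rule prod.cong) (auto simp: nn_integral_normal_density t)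
 also have "\<dots> = (\<integral>\<^sup>+u. g u * ?n u \<partial>lborel)" by (simp add: prod.delta b)
 finally show ?thesis .
qed

text \<open>The norm is at most the sum of the absolute coordinates, so some coordinate has absolute
  value at least \<open>a / real DIM('a)\<close>; the bound adds up the two half spaces of every
  coordinate.\<close>

lemma gauss_tail:
 assumes a: "0 \<le> a" and t: "0 < t"
 shows "emeasure (gauss t) {x :: 'a::euclidean_space. a \<le> norm x}
  \<le> ennreal (2 * real DIM('a) * exp (- a\<^sup>2 / (2 * (real DIM('a))\<^sup>2 * t)))"
proof -
 let ?d = "real DIM('a)" and ?c = "a / real DIM('a)"
 have d: "?d > 0" by simp
 have c: "0 \<le> ?c" using a by simp
 have one: "emeasure (gauss t) {x :: 'a. ?c \<le> x \<bullet> b} \<le> ennreal (exp (- ?c\<^sup>2 / (2 * t)))" if b: "b \<in> Basis" for b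
 proof -
  have [measurable]: "{x :: 'a. ?c \<le> x \<bullet> b} \<in> sets borel" by measurable
  have "emeasure (gauss t) {x :: 'a. ?c \<le> x \<bullet> b} = (\<integral>\<^sup>+x. indicator {?c..} (x \<bullet> b) \<partial>gauss t)"
  proof -
   have "(\<integral>\<^sup>+x. indicator {?c..} (x \<bullet> b) \<partial>gauss t) = (\<integral>\<^sup>+x. indicator {x :: 'a. ?c \<le> x \<bullet> b} x \<partial>gauss t)"
    by (intro nn_integral_cong) (auto simp: indicator_def)
   then show ?thesis by simp
  qed
  also have "\<dots> = (\<integral>\<^sup>+u. indicator {?c..} u * ennreal (normal_density 0 (sqrt t) u) \<partial>lborel)"
   by (rule gauss_marginal[OF b _ t]) auto
  also have "\<dots> \<le> ennreal (exp (- ?c\<^sup>2 / (2 * (sqrt t)\<^sup>2)))"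
   using normal_tail[OF c, of "sqrt t"] t by (simp add: mult.commute)
  finally show ?thesis using t by simp
 qed
 have one': "emeasure (gauss t) {x :: 'a. x \<bullet> b \<le> - ?c} \<le> ennreal (exp (- ?c\<^sup>2 / (2 * t)))" if b: "b \<in> Basis" for b
 proof -
  have [measurable]: "{x :: 'a. ?c \<le> x \<bullet> b} \<in> sets borel" "{x :: 'a. x \<bullet> b \<le> - ?c} \<in> sets borel" by measurable
  have "emeasure (gauss t) {x :: 'a. x \<bullet> b \<le> - ?c} = emeasure (distr (gauss t) borel uminus) {x :: 'a. x \<bullet> b \<le> - ?c}"
   by (simp add: gauss_uminus)
  also have "\<dots> = emeasure (gauss t) {x :: 'a. ?c \<le> x \<bullet> b}" by (subst emeasure_distr) (auto simp: vimage_def)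
  finally show ?thesis using one[OF b] by simp
 qed
 have "{x :: 'a. a \<le> norm x} \<subseteq> (\<Union>b\<in>Basis. {x. ?c \<le> x \<bullet> b} \<union> {x. x \<bullet> b \<le> - ?c})"
 proof
  fix x :: 'a assume x: "x \<in> {x. a \<le> norm x}"
  show "x \<in> (\<Union>b\<in>Basis. {x. ?c \<le> x \<bullet> b} \<union> {x. x \<bullet> b \<le> - ?c})"
  proof (rule ccontr)
   assume "x \<notin> (\<Union>b\<in>Basis. {x. ?c \<le> x \<bullet> b} \<union> {x. x \<bullet> b \<le> - ?c})"
   then have "\<forall>b\<in>Basis. \<bar>x \<bullet> b\<bar> < ?c" by (auto simp: abs_less_iff not_le minus_less_iff)
   then have "(\<Sum>b\<in>Basis. \<bar>x \<bullet> b\<bar>) < (\<Sum>b\<in>(Basis::'a set). ?c)" by (intro sum_strict_mono) auto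
   then have "norm x < a" using norm_le_l1[of x] by simp
   with x show False by simp
  qed
 qed
 then have "emeasure (gauss t) {x :: 'a. a \<le> norm x} \<le> emeasure (gauss t) (\<Union>b\<in>Basis. {x :: 'a. ?c \<le> x \<bullet> b} \<union> {x. x \<bullet> b \<le> - ?c})"
  by (rule emeasure_mono) (auto intro!: sets.finite_UN)
 also have "\<dots> \<le> (\<Sum>b\<in>Basis. emeasure (gauss t) ({x :: 'a. ?c \<le> x \<bullet> b} \<union> {x. x \<bullet> b \<le> - ?c}))"
  by (rule emeasure_subadditive_finite) auto
 also have "\<dots> \<le> (\<Sum>b\<in>(Basis::'a set). ennreal (exp (- ?c\<^sup>2 / (2 * t))) + ennreal (exp (- ?c\<^sup>2 / (2 * t))))"
  by (intro sum_mono order_trans[OF emeasure_subadditive] add_mono one one') auto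
 also have "\<dots> = ennreal (2 * ?d * exp (- ?c\<^sup>2 / (2 * t)))"
  by (simp add: ennreal_plus[symmetric] ennreal_of_nat_eq_real_of_nat ennreal_mult[symmetric] del: ennreal_plus)
 also have "- ?c\<^sup>2 / (2 * t) = - a\<^sup>2 / (2 * ?d\<^sup>2 * t)" using t by (simp add: power_divide field_simps)
 finally show ?thesis .
qed

text \<open>A grid point of level \<open>Suc m\<close> with odd index is one step away from a point
  of level \<open>m\<close>, so reaching it from 0 uses at most one increment per level.\<close>

lemma dyadic_chain:
 fixes f :: "real \<Rightarrow> 'a::real_normed_vector"
 assumes step: "\<And>k j. j < 2 ^ k \<Longrightarrow> norm (f (real (Suc j) / 2 ^ k) - f (real j / 2 ^ k)) \<le> c k"
  and j: "j \<le> 2 ^ m"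
 shows "norm (f (real j / 2 ^ m) - f 0) \<le> (\<Sum>k\<le>m. c k)"
proof -
 have c0: "0 \<le> c k" for k by (rule order_trans[OF norm_ge_zero step[of 0 k]]) simp
 show ?thesis using j
 proof (induction m arbitrary: j)
  case 0
  then consider "j = 0" | "j = 1" by force
  then show ?case using step[of 0 0] c0[of 0] by cases auto
 next
  case (Suc m)
  have half: "real (2 * i) / 2 ^ Suc m = real i / 2 ^ m" for i by simp
  show ?case
  proof (cases "even j")
   case True
   then obtain i where i: "j = 2 * i" by blast
   have il: "i \<le> 2 ^ m" using Suc.prems i by simp
   have "norm (f (real j / 2 ^ Suc m) - f 0) \<le> (\<Sum>k\<le>m. c k)" unfolding i half by (rule Suc.IH[OF il])
   then show ?thesis using c0[of "Suc m"] by simp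
  next
   case False
   then obtain i where i: "j = Suc (2 * i)" by (metis oddE Suc_eq_plus1)
   have "norm (f (real j / 2 ^ Suc m) - f 0) \<le> norm (f (real j / 2 ^ Suc m) - f (real (2 * i) / 2 ^ Suc m)) + norm (f (real i / 2 ^ m) - f 0)"
    unfolding half
    using dist_triangle[of "f (real j / 2 ^ Suc m)" "f 0" "f (real i / 2 ^ m)"] by (simp only: dist_norm)
   also have "norm (f (real j / 2 ^ Suc m) - f (real (2 * i) / 2 ^ Suc m)) \<le> c (Suc m)"
    unfolding i by (rule step) (use Suc.prems i in auto)
   also have "norm (f (real i / 2 ^ m) - f 0) \<le> (\<Sum>k\<le>m. c k)" by (rule Suc.IH) (use Suc.prems i in auto)
   finally show ?thesis by simp
  qed
 qed
qed

lemma dyadic_chain_continuous: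
 fixes f :: "real \<Rightarrow> 'a::real_normed_vector"
 assumes cont: "continuous_on {0..1} f"
  and step: "\<And>k j. j < 2 ^ k \<Longrightarrow> norm (f (real (Suc j) / 2 ^ k) - f (real j / 2 ^ k)) \<le> c k"
  and bound: "\<And>m. (\<Sum>k\<le>m. c k) \<le> M" and s: "s \<in> {0..1}"
 shows "norm (f s - f 0) \<le> M"
proof -
 let ?q = "\<lambda>m. real (nat \<lfloor>s * 2 ^ m\<rfloor>) / 2 ^ m"
 have s0: "0 \<le> s" "s \<le> 1" using s by auto
 have q01: "?q m \<in> {0..1}" for m using dyadic_approx_unit[OF s, of m] by (simp add: field_simps)
 have "(\<lambda>m. f (?q m)) \<longlonglongrightarrow> f s"
  by (rule continuous_on_tendsto_compose[OF cont dyadic_approx[OF s0(1)] s]) (use q01 in auto)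
 then have "(\<lambda>m. norm (f (?q m) - f 0)) \<longlonglongrightarrow> norm (f s - f 0)" by (intro tendsto_intros)
 moreover have "norm (f (?q m) - f 0) \<le> M" for m
  using dyadic_chain[of f c, OF step dyadic_approx_unit[OF s]] bound[of m] by (rule order_trans)
 ultimately show ?thesis by (intro LIMSEQ_le_const2) auto
qed

text \<open>The constant is so large that the bound is trivial where the chaining argument fails.\<close>

definition osc_tail :: "nat \<Rightarrow> real \<Rightarrow> real" where
 "osc_tail d M = 65536 * real d * exp (- M\<^sup>2 / (32 * (real d)\<^sup>2))"

locale brownian =
 fixes W :: "'w measure" and Z :: "real \<Rightarrow> 'w \<Rightarrow> 'a::euclidean_space"
 assumes bm: "brownian_motion W Z"
begin

sublocale prob_space W using bm by (simp add: brownian_motion_def)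

lemma grid: "bm_grid W Z" by (rule brownian_motion_grid[OF bm])

lemma Z_measurable [measurable]: "0 \<le> t \<Longrightarrow> Z t \<in> borel_measurable W"
 using bm by (simp add: brownian_motion_def)

lemma Z_0: "w \<in> space W \<Longrightarrow> Z 0 w = 0" using bm by (simp add: brownian_motion_def)

lemma Z_continuous: "w \<in> space W \<Longrightarrow> continuous_on {0..} (\<lambda>t. Z t w)"
 using bm by (simp add: brownian_motion_def)

lemma increment_law: "0 \<le> s \<Longrightarrow> s < t \<Longrightarrow> distr W borel (\<lambda>w. Z t w - Z s w) = gauss (t - s)"
 using bm unfolding brownian_motion_def gauss_def by blast

lemma value_law: "0 < t \<Longrightarrow> distr W borel (Z t) = gauss t"
 using increment_law[of 0 t] Z_0 by (simp cong: distr_cong)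

lemma increment_tail:
 assumes "0 \<le> s" "s < t" "0 \<le> a"
 shows "prob {w \<in> space W. a \<le> norm (Z t w - Z s w)} \<le> 2 * real DIM('a) * exp (- a\<^sup>2 / (2 * (real DIM('a))\<^sup>2 * (t - s)))"
proof -
 have [measurable]: "(\<lambda>w. Z t w - Z s w) \<in> borel_measurable W" using assms by (intro borel_measurable_diff Z_measurable) auto
 have "emeasure W {w \<in> space W. a \<le> norm (Z t w - Z s w)} = emeasure (distr W borel (\<lambda>w. Z t w - Z s w)) {x. a \<le> norm x}"
  by (subst emeasure_distr) (auto intro!: arg_cong[where f = "emeasure W"])
 also have "\<dots> \<le> ennreal (2 * real DIM('a) * exp (- a\<^sup>2 / (2 * (real DIM('a))\<^sup>2 * (t - s))))"
  unfolding increment_law[OF assms(1,2)] by (rule gauss_tail) (use assms in auto)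
 finally show ?thesis by (subst (asm) emeasure_eq_measure) (simp add: ennreal_le_iff)
qed

text \<open>Chaining over dyadic levels with allowances \<open>M (3/4)^k / 4\<close> needs only the marginal Gaussian tails.\<close>

lemma oscillation_tail:
 assumes a: "0 \<le> a" and M: "0 \<le> M"
 obtains B where "B \<in> events" "prob B \<le> osc_tail DIM('a) M"
  "\<And>w s. w \<in> space W - B \<Longrightarrow> s \<in> {0..1} \<Longrightarrow> norm (Z (a + s) w - Z a w) \<le> M"
proof -
 define d where "d = real DIM('a)"
 have d: "d \<ge> 1" unfolding d_def using DIM_positive[where 'a='a] by linarith
 define \<kappa> where "\<kappa> = 1 / (32 * d\<^sup>2)"
 have \<kappa>: "\<kappa> > 0" using d by (simp add: \<kappa>_def)
 have tail: "osc_tail DIM('a) M = 65536 * d * exp (- \<kappa> * M\<^sup>2)" by (simp add: osc_tail_def d_def \<kappa>_def)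
 show thesis
 proof (cases "16 * ln 2 \<le> \<kappa> * M\<^sup>2")
  case False
  then have "ln (1 / 65536) \<le> - \<kappa> * M\<^sup>2" using ln_realpow[of 2 16] by (simp add: ln_div)
  then have "exp (ln (1 / 65536)) \<le> exp (- \<kappa> * M\<^sup>2)" by (rule exp_le_cancel_iff[THEN iffD2])
  then have "1 / 65536 \<le> exp (- \<kappa> * M\<^sup>2)" by (simp only: exp_ln zero_less_divide_1_iff zero_less_numeral)
  then have "1 \<le> d * (65536 * exp (- \<kappa> * M\<^sup>2))" using d mult_mono[of 1 d 1 "65536 * exp (- \<kappa> * M\<^sup>2)"] by simp
  then have "prob (space W) \<le> osc_tail DIM('a) M" unfolding tail using prob_space by (simp add: mult_ac)
  then show thesis by (intro that[of "space W"]) auto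
 next
  case True
  then have M2: "2 * ln 2 \<le> \<kappa> * M\<^sup>2 / 8" by simp
  \<comment> \<open>The factor \<open>1 / 4\<close> makes the allowances of all levels sum to
    exactly \<open>M\<close>.\<close>
  define c where "c k = M * (3 / 4) ^ k / 4" for k :: nat
  have c0: "0 \<le> c k" for k using M by (simp add: c_def)
  define E where "E k j = {w \<in> space W. c k \<le> norm (Z (a + real (Suc j) / 2 ^ k) w - Z (a + real j / 2 ^ k) w)}" for k j :: nat
  have E [measurable]: "E k j \<in> events" for k j
  proof -
   have [measurable]: "Z (a + real j / 2 ^ k) \<in> borel_measurable W" for j :: nat using a by (intro Z_measurable) auto
   show ?thesis unfolding E_def by measurable
  qed
  define B where "B = (\<Union>k. \<Union>j\<in>{..<2 ^ k}. E k j)"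
  have pE: "prob (E k j) \<le> 2 * d * exp (- \<kappa> * M\<^sup>2) * (1 / 4) ^ k" for k j
  proof -
   have "prob (E k j) \<le> 2 * d * exp (- (c k)\<^sup>2 / (2 * d\<^sup>2 * ((a + real (Suc j) / 2 ^ k) - (a + real j / 2 ^ k))))"
    unfolding E_def d_def by (rule increment_tail) (use a c0 in \<open>auto simp: divide_strict_right_mono\<close>)
   also have "(a + real (Suc j) / 2 ^ k) - (a + real j / 2 ^ k) = 1 / 2 ^ k" by (simp add: field_simps)
   also have "- (c k)\<^sup>2 / (2 * d\<^sup>2 * (1 / 2 ^ k)) = - \<kappa> * M\<^sup>2 * (9 / 8) ^ k"
   proof -
    have "(c k)\<^sup>2 * 2 ^ k = M\<^sup>2 / 16 * (9 / 8) ^ k"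
    proof -
     have "((3 / 4) ^ k)\<^sup>2 * (2::real) ^ k = (9 / 8) ^ k"
      by (simp add: power2_eq_square power_mult_distrib[symmetric])
     then show ?thesis unfolding c_def by (simp add: power_divide power_mult_distrib field_simps)
    qed
    then show ?thesis using d by (simp add: \<kappa>_def field_simps)
   qed
   \<comment> \<open>Bernoulli bounds \<open>(9 / 8) ^ k\<close> below by \<open>1 + k / 8\<close>,
     and in the present case every eighth is worth a factor \<open>1 / 4\<close>. The
     \<open>2 ^ k\<close> grid steps of a level turn this into the ratio \<open>1 / 2\<close> of a
     geometric series.\<close>
   also have "exp (- \<kappa> * M\<^sup>2 * (9 / 8) ^ k) \<le> exp (- \<kappa> * M\<^sup>2) * (1 / 4) ^ k"
   proof -
    have "1 + real k * (1/8) \<le> (1 + 1/8) ^ k" by (rule Bernoulli_inequality) simp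
    then have "\<kappa> * M\<^sup>2 * (1 + real k / 8) \<le> \<kappa> * M\<^sup>2 * (9 / 8) ^ k" using \<kappa> by (intro mult_left_mono) auto
    moreover have "real k * (2 * ln 2) \<le> real k * (\<kappa> * M\<^sup>2 / 8)" using M2 by (intro mult_left_mono) auto
    ultimately have "- \<kappa> * M\<^sup>2 * (9 / 8) ^ k \<le> - \<kappa> * M\<^sup>2 + real k * - (2 * ln 2)" by (simp add: algebra_simps)
    then have "exp (- \<kappa> * M\<^sup>2 * (9 / 8) ^ k) \<le> exp (- \<kappa> * M\<^sup>2) * exp (- (2 * ln 2)) ^ k"
     by (simp add: exp_add[symmetric] exp_of_nat_mult[symmetric])
    also have "exp (- (2 * ln 2)) = (1 / 4 :: real)"
    proof -
     have "exp (2 * ln (2::real)) = 4" using exp_of_nat_mult[of 2 "ln (2::real)"] by simp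
     then show ?thesis by (simp add: exp_minus)
    qed
    finally show ?thesis .
   qed
   finally show ?thesis using d by (simp add: mult_left_mono mult.assoc)
  qed
  have "emeasure W B \<le> (\<Sum>k. emeasure W (\<Union>j\<in>{..<2 ^ k}. E k j))"
   unfolding B_def by (rule emeasure_subadditive_countably) auto
  also have "\<dots> \<le> (\<Sum>k. ennreal (2 * d * exp (- \<kappa> * M\<^sup>2) * (1 / 2) ^ k))"
  proof (rule suminf_le)
   fix k :: nat
   have "prob (\<Union>j\<in>{..<2 ^ k}. E k j) \<le> (\<Sum>j\<in>{..<2 ^ k}. prob (E k j))"
    by (rule finite_measure_subadditive_finite) auto
   also have "\<dots> \<le> (\<Sum>j\<in>{..<(2::nat) ^ k}. 2 * d * exp (- \<kappa> * M\<^sup>2) * (1 / 4) ^ k)" by (intro sum_mono pE)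
   also have "\<dots> = 2 * d * exp (- \<kappa> * M\<^sup>2) * (2 ^ k * (1 / 4) ^ k)" by simp
   also have "2 ^ k * (1 / 4) ^ k = ((1 / 2) ^ k :: real)" by (simp add: power_mult_distrib[symmetric])
   finally show "emeasure W (\<Union>j\<in>{..<2 ^ k}. E k j) \<le> ennreal (2 * d * exp (- \<kappa> * M\<^sup>2) * (1 / 2) ^ k)"
    by (simp add: emeasure_eq_measure ennreal_leI)
  qed auto
  also have "\<dots> = ennreal (\<Sum>k. 2 * d * exp (- \<kappa> * M\<^sup>2) * (1 / 2) ^ k)"
   by (rule suminf_ennreal2) (use d in \<open>auto intro!: summable_mult summable_geometric\<close>)
  also have "(\<Sum>k. 2 * d * exp (- \<kappa> * M\<^sup>2) * (1 / 2) ^ k) = 4 * d * exp (- \<kappa> * M\<^sup>2)"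
   by (subst suminf_mult) (auto simp: suminf_geometric)
  finally have "prob B \<le> 4 * d * exp (- \<kappa> * M\<^sup>2)"
   using d by (subst (asm) emeasure_eq_measure) (simp add: ennreal_le_iff)
  moreover have "B \<in> events" unfolding B_def by auto
  moreover have "norm (Z (a + s) w - Z a w) \<le> M" if w: "w \<in> space W - B" and s: "s \<in> {0..1}" for w s
  proof -
   have "norm ((\<lambda>s. Z (a + s) w) s - (\<lambda>s. Z (a + s) w) 0) \<le> M"
   proof (rule dyadic_chain_continuous[where c = c])
    show "continuous_on {0..1} (\<lambda>s. Z (a + s) w)"
     by (rule continuous_on_compose2[OF Z_continuous]) (use w a in \<open>auto intro!: continuous_intros\<close>)
    show "norm (Z (a + real (Suc j) / 2 ^ k) w - Z (a + real j / 2 ^ k) w) \<le> c k" if "j < 2 ^ k" for k j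
     using w that unfolding B_def E_def by (auto simp del: of_nat_Suc simp: not_le intro: less_imp_le)
    show "(\<Sum>k\<le>m. c k) \<le> M" for m
    proof -
     have "(\<Sum>k\<le>m. c k) \<le> (\<Sum>k. c k)"
      using c0 by (intro sum_le_suminf) (auto simp: c_def intro!: summable_mult summable_divide summable_geometric)
     also have "\<dots> = M" unfolding c_def
      by (subst suminf_divide, simp add: summable_mult, subst suminf_mult) (auto simp: suminf_geometric)
     finally show ?thesis .
    qed
   qed (use s in auto)
   then show ?thesis by simp
  qed
  moreover have "4 * d * exp (- \<kappa> * M\<^sup>2) \<le> osc_tail DIM('a) M" unfolding tail using d by (intro mult_right_mono) auto
  ultimately show thesis by (intro that[of B]) auto
 qed
qed

end

section \<open>Feynman-Kac weights at integer times\<close>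

lemma exp_neg_nonneg: "0 \<le> exp_neg a" by (simp add: exp_neg_def)

lemma exp_neg_le_1: "exp_neg a \<le> 1" by (simp add: exp_neg_def)

lemma exp_neg_0 [simp]: "exp_neg 0 = 1" by (simp add: exp_neg_def)

lemma exp_neg_ennreal: "0 \<le> a \<Longrightarrow> exp_neg (ennreal a) = exp (- a)" by (simp add: exp_neg_def)

lemma exp_neg_add: "exp_neg (a + b) = exp_neg a * exp_neg b"
 by (cases a; cases b) (auto simp: exp_neg_def exp_add[symmetric] ennreal_plus[symmetric] simp del: ennreal_plus)

lemma exp_neg_antimono: "a \<le> b \<Longrightarrow> exp_neg b \<le> exp_neg a"
 by (cases a; cases b) (auto simp: exp_neg_def top_unique)

lemma exp_neg_measurable [measurable]: "exp_neg \<in> borel_measurable borel" unfolding exp_neg_def by measurable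

text \<open>Every \<open>c < a\<close> is eventually exceeded by \<open>A k\<close>, and
  \<open>exp_neg c\<close> approaches \<open>exp_neg a\<close> as \<open>c\<close> increases to
  \<open>a\<close>, also when \<open>a\<close> is infinite. For \<open>a = 0\<close> there is no
  such \<open>c\<close>, but then the bound is 1.\<close>

lemma exp_neg_limsup:
 assumes "a \<le> liminf A" shows "limsup (\<lambda>k. ennreal (exp_neg (A k))) \<le> ennreal (exp_neg a)"
proof -
 have "limsup (\<lambda>k. ennreal (exp_neg (A k))) \<le> ennreal (exp_neg c)" if "c < liminf A" for c
 proof (rule Limsup_bounded)
  have "eventually (\<lambda>k. c < A k) sequentially" using less_LiminfD[OF that] .
  then show "eventually (\<lambda>k. ennreal (exp_neg (A k)) \<le> ennreal (exp_neg c)) sequentially"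
   by eventually_elim (auto intro!: ennreal_leI exp_neg_antimono)
 qed
 then have *: "limsup (\<lambda>k. ennreal (exp_neg (A k))) \<le> ennreal (exp_neg c)" if "c < a" for c
  using assms that less_le_trans by blast
 show ?thesis
 proof (cases "a = 0")
  case True
  have "limsup (\<lambda>k. ennreal (exp_neg (A k))) \<le> 1"
   by (rule Limsup_bounded) (auto simp: exp_neg_le_1 intro: always_eventually)
  then show ?thesis using True by simp
 next
  case False
  show ?thesis
  proof (cases a)
   case (real r)
   then have r: "0 < r" using False by (auto simp: less_le)
   have lim: "(\<lambda>n. ennreal (exp (- (r - r / real (Suc n))))) \<longlonglongrightarrow> ennreal (exp (- (r - 0)))"
    by (intro tendsto_ennrealI tendsto_exp tendsto_minus tendsto_diff tendsto_const LIMSEQ_Suc[OF lim_const_over_n])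
   have "limsup (\<lambda>k. ennreal (exp_neg (A k))) \<le> ennreal (exp (- (r - r / real (Suc n))))" for n
   proof -
    have "r / real (Suc n) \<le> r" "r / real (Suc n) > 0" using r by (simp_all add: pos_divide_le_eq algebra_simps)
    then show ?thesis using *[of "ennreal (r - r / real (Suc n))"] r real
     by (simp add: exp_neg_ennreal ennreal_less_iff)
   qed
   then have "limsup (\<lambda>k. ennreal (exp_neg (A k))) \<le> ennreal (exp (- (r - 0)))"
    using LIMSEQ_le_const[OF lim] by blast
   then show ?thesis using real by (simp add: exp_neg_ennreal)
  next
   case top
   have lim: "(\<lambda>n. ennreal (exp (- real n))) \<longlonglongrightarrow> ennreal 0" by (intro tendsto_ennrealI) real_asymp
   have "limsup (\<lambda>k. ennreal (exp_neg (A k))) \<le> ennreal (exp (- real n))" for n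
    using *[of "ennreal (real n)"] top by (simp add: exp_neg_ennreal)
   then have "limsup (\<lambda>k. ennreal (exp_neg (A k))) \<le> ennreal 0" using LIMSEQ_le_const[OF lim] by blast
   then show ?thesis by simp
  qed
 qed
qed

text \<open>The Feynman-Kac semigroup applied to \<open>f\<close> at the point \<open>z\<close>.
  Times are integers because these are the junction times of \<open>concat_at\<close>.\<close>

definition fk :: "'w measure \<Rightarrow> (real \<Rightarrow> 'w \<Rightarrow> 'a::euclidean_space) \<Rightarrow> ('a \<Rightarrow> ennreal) \<Rightarrow> nat \<Rightarrow> 'a \<Rightarrow> ('a \<Rightarrow> ennreal) \<Rightarrow> ennreal" where
 "fk W Z v n z f = (\<integral>\<^sup>+w. ennreal (exp_neg (\<integral>\<^sup>+s\<in>{0..real n}. v (z + Z s w) \<partial>lborel)) * f (z + Z (real n) w) \<partial>W)"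

text \<open>The integrand of \<open>fk\<close> as a functional on \<open>path_space\<close>, so that
  equality of path laws transfers to weights.\<close>

definition fk_path :: "('a::euclidean_space \<Rightarrow> ennreal) \<Rightarrow> nat \<Rightarrow> 'a \<Rightarrow> ('a \<Rightarrow> ennreal) \<Rightarrow> (real \<Rightarrow> 'a) \<Rightarrow> ennreal" where
 "fk_path v n z f \<xi> = ennreal (exp_neg (\<integral>\<^sup>+s\<in>{0..real n}. v (z + path_at \<xi> s) \<partial>lborel)) * f (z + path_at \<xi> (real n))"

text \<open>The parameter will be the environment: joint measurability in environment and path is
  what Tonelli's theorem needs when the environment is averaged first.\<close>

lemma fk_path_measurable_param:
 fixes V :: "'p \<Rightarrow> 'a::euclidean_space \<Rightarrow> ennreal"
 assumes V: "(\<lambda>(p, x). V p x) \<in> borel_measurable (N \<Otimes>\<^sub>M borel)"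
  and z [measurable]: "z \<in> borel_measurable N" and f [measurable]: "f \<in> borel_measurable borel"
 shows "(\<lambda>(p, \<xi>). fk_path (V p) n (z p) f \<xi>) \<in> borel_measurable (N \<Otimes>\<^sub>M path_space)"
proof -
 have pm [measurable]: "(\<lambda>q. path_at (snd (fst q)) (snd q)) \<in> borel_measurable ((N \<Otimes>\<^sub>M path_space) \<Otimes>\<^sub>M borel)"
 proof -
  have "(\<lambda>q. (snd (fst q), snd q)) \<in> measurable ((N \<Otimes>\<^sub>M path_space) \<Otimes>\<^sub>M borel) (path_space \<Otimes>\<^sub>M borel)" by measurable
  from measurable_compose[OF this path_at_measurable] show ?thesis by simp
 qed
 have pn [measurable]: "(\<lambda>q. path_at (snd q) (real n)) \<in> borel_measurable (N \<Otimes>\<^sub>M path_space)"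
 proof -
  have "(\<lambda>q. (snd q, real n)) \<in> measurable (N \<Otimes>\<^sub>M path_space) (path_space \<Otimes>\<^sub>M borel)" by measurable
  from measurable_compose[OF this path_at_measurable] show ?thesis by simp
 qed
 have "(\<lambda>q. (fst (fst q), z (fst (fst q)) + path_at (snd (fst q)) (snd q))) \<in> measurable ((N \<Otimes>\<^sub>M path_space) \<Otimes>\<^sub>M borel) (N \<Otimes>\<^sub>M borel)"
  by measurable
 from measurable_compose[OF this V]
 have [measurable]: "(\<lambda>q. V (fst (fst q)) (z (fst (fst q)) + path_at (snd (fst q)) (snd q))) \<in> borel_measurable ((N \<Otimes>\<^sub>M path_space) \<Otimes>\<^sub>M borel)"
  by simp
 have "(\<lambda>q. \<integral>\<^sup>+s. V (fst q) (z (fst q) + path_at (snd q) s) * indicator {0..real n} s \<partial>lborel) \<in> borel_measurable (N \<Otimes>\<^sub>M path_space)"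
  by (rule lborel.borel_measurable_nn_integral) (simp add: case_prod_beta)
 then show ?thesis unfolding fk_path_def case_prod_beta by measurable
qed

lemma fk_path_measurable [measurable]:
 assumes [measurable]: "v \<in> borel_measurable borel" "f \<in> borel_measurable borel"
 shows "fk_path v n z f \<in> borel_measurable (path_space :: (real \<Rightarrow> 'a::euclidean_space) measure)"
proof -
 have "(\<lambda>(p, \<xi>). fk_path v n z f \<xi>) \<in> borel_measurable (borel \<Otimes>\<^sub>M path_space :: (real \<times> (real \<Rightarrow> 'a)) measure)"
  by (rule fk_path_measurable_param[where V = "\<lambda>_. v" and z = "\<lambda>_. z"]) auto
 from measurable_compose[OF measurable_Pair1'[of 0] this] show ?thesis by simp
qed

lemma fk_path_sample_path:
 assumes "bm_grid W Z" "w \<in> space W"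
 shows "fk_path v n z f (sample_path Z w)
  = ennreal (exp_neg (\<integral>\<^sup>+s\<in>{0..real n}. v (z + Z s w) \<partial>lborel)) * f (z + Z (real n) w)"
proof -
 have "(\<integral>\<^sup>+s\<in>{0..real n}. v (z + path_at (sample_path Z w) s) \<partial>lborel) = (\<integral>\<^sup>+s\<in>{0..real n}. v (z + Z s w) \<partial>lborel)"
  by (intro nn_integral_cong) (auto simp: indicator_def path_at_sample_path[OF assms])
 then show ?thesis by (simp add: fk_path_def path_at_sample_path[OF assms])
qed

lemma fk_eq_path_integral:
 assumes "bm_grid W Z" shows "fk W Z v n z f = (\<integral>\<^sup>+w. fk_path v n z f (sample_path Z w) \<partial>W)"
 unfolding fk_def by (intro nn_integral_cong) (simp add: fk_path_sample_path[OF assms])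

lemma fk_law:
 assumes "bm_grid W Z" "bm_grid W' Z'" "v \<in> borel_measurable borel" "f \<in> borel_measurable borel"
 shows "fk W Z v n z f = fk W' Z' v n z f"
 unfolding fk_eq_path_integral[OF assms(1)] fk_eq_path_integral[OF assms(2)]
 by (rule bm_path_integral[OF assms(1,2)]) (use assms(3,4) in measurable)

lemma fk_measurable_param:
 fixes V :: "'p \<Rightarrow> 'a::euclidean_space \<Rightarrow> ennreal"
 assumes W: "bm_grid W Z" and V: "(\<lambda>(p, x). V p x) \<in> borel_measurable (N \<Otimes>\<^sub>M borel)"
  and z: "z \<in> borel_measurable N" and f: "f \<in> borel_measurable borel"
 shows "(\<lambda>p. fk W Z (V p) n (z p) f) \<in> borel_measurable N"
proof -
 interpret prob_space W using W by (simp add: bm_grid_def)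
 have "(\<lambda>(p, w). (p, sample_path Z w)) \<in> measurable (N \<Otimes>\<^sub>M W) (N \<Otimes>\<^sub>M path_space)"
  using sample_path_measurable[OF W] by measurable
 from measurable_compose[OF this fk_path_measurable_param[OF V z f]]
 have "(\<lambda>(p, w). fk_path (V p) n (z p) f (sample_path Z w)) \<in> borel_measurable (N \<Otimes>\<^sub>M W)" by (simp add: case_prod_beta)
 then show ?thesis unfolding fk_eq_path_integral[OF W] by (rule borel_measurable_nn_integral)
qed

lemma fk_measurable:
 assumes "bm_grid W Z" and [measurable]: "v \<in> borel_measurable borel" "f \<in> borel_measurable borel"
 shows "(\<lambda>z. fk W Z v n z f) \<in> borel_measurable borel"
 by (rule fk_measurable_param[OF assms(1), where V = "\<lambda>_. v" and z = "\<lambda>x. x"]) auto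

lemma nn_integral_interval_split:
 assumes [measurable]: "h \<in> borel_measurable borel" and ab: "0 \<le> a" "0 \<le> (b::real)"
 shows "(\<integral>\<^sup>+s\<in>{0..a + b}. h s \<partial>lborel) = (\<integral>\<^sup>+s\<in>{0..a}. h s \<partial>lborel) + (\<integral>\<^sup>+s\<in>{0..b}. h (a + s) \<partial>lborel)"
proof -
 have "(\<integral>\<^sup>+s\<in>{0..a + b}. h s \<partial>lborel) = (\<integral>\<^sup>+s. h s * indicator {0..a} s + h s * indicator {a<..a + b} s \<partial>lborel)"
  by (intro nn_integral_cong) (use ab in \<open>auto simp: indicator_def\<close>)
 also have "\<dots> = (\<integral>\<^sup>+s\<in>{0..a}. h s \<partial>lborel) + (\<integral>\<^sup>+s\<in>{a<..a + b}. h s \<partial>lborel)" by (rule nn_integral_add) auto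
 also have "(\<integral>\<^sup>+s\<in>{a<..a + b}. h s \<partial>lborel) = (\<integral>\<^sup>+s. h (a + 1 * s) * indicator {a<..a + b} (a + 1 * s) \<partial>lborel)"
  by (subst nn_integral_real_affine[where c = 1 and t = a]) auto
 also have "\<dots> = (\<integral>\<^sup>+s\<in>{0..b}. h (a + s) \<partial>lborel)"
  by (rule nn_integral_cong_AE, rule AE_mp[OF AE_lborel_singleton[of 0]], rule AE_I2) (auto simp: indicator_def)
 finally show ?thesis .
qed

text \<open>The path may be replaced by one glued at time \<open>m\<close> from two independent
  copies, since both have the same law. For each pair of pieces the weight factors, and Tonelli
  integrates the second piece out.\<close>

lemma fk_markov:
 assumes W: "bm_grid W Z" and v [measurable]: "v \<in> borel_measurable borel" and f [measurable]: "f \<in> borel_measurable borel"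
 shows "fk W Z v (m + n) z f = fk W Z v m z (\<lambda>x. fk W Z v n x f)"
proof -
 interpret W: prob_space W using W by (simp add: bm_grid_def)
 let ?C = "concat_at m Z Z"
 have C: "bm_grid (W \<Otimes>\<^sub>M W) ?C" by (rule bm_grid_concat[OF W W])
 have Zm: "0 \<le> t \<Longrightarrow> Z t \<in> borel_measurable W" for t using W by (simp add: bm_grid_def)
 have vpm: "(\<lambda>s. v (z + path_at \<xi> s)) \<in> borel_measurable borel" if "\<xi> \<in> space path_space" for z \<xi>
  using measurable_compose[OF measurable_Pair1'[OF that] path_at_measurable] by simp
 have pt: "fk_path v (m + n) z f (sample_path ?C (w, w')) = fk_path v m z (\<lambda>_. 1) (sample_path Z w) * fk_path v n (z + Z (real m) w) f (sample_path Z w')"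
  if w: "w \<in> space W" and w': "w' \<in> space W" for w w'
 proof -
  have ww: "(w, w') \<in> space (W \<Otimes>\<^sub>M W)" using w w' by (simp add: space_pair_measure)
  let ?\<xi> = "sample_path ?C (w, w')"
  have sp: "?\<xi> \<in> space path_space" by (rule measurable_space[OF sample_path_measurable[OF C] ww])
  have at: "0 \<le> s \<Longrightarrow> path_at ?\<xi> s = Z (min s m) w + Z (max (s - m) 0) w'" for s
   using path_at_sample_path[OF C ww] by (simp add: concat_at_def)
  have Z0: "Z 0 w' = 0" using W w' by (simp add: bm_grid_def)
  have "(\<integral>\<^sup>+s\<in>{0..real (m + n)}. v (z + path_at ?\<xi> s) \<partial>lborel)
   = (\<integral>\<^sup>+s\<in>{0..real m}. v (z + path_at ?\<xi> s) \<partial>lborel) + (\<integral>\<^sup>+s\<in>{0..real n}. v (z + path_at ?\<xi> (real m + s)) \<partial>lborel)"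
   unfolding of_nat_add by (rule nn_integral_interval_split[OF vpm[OF sp]]) auto
  also have "(\<integral>\<^sup>+s\<in>{0..real m}. v (z + path_at ?\<xi> s) \<partial>lborel) = (\<integral>\<^sup>+s\<in>{0..real m}. v (z + Z s w) \<partial>lborel)"
   by (intro nn_integral_cong) (auto simp: indicator_def at min_absorb1 max_absorb2 Z0)
  also have "(\<integral>\<^sup>+s\<in>{0..real n}. v (z + path_at ?\<xi> (real m + s)) \<partial>lborel) = (\<integral>\<^sup>+s\<in>{0..real n}. v (z + Z (real m) w + Z s w') \<partial>lborel)"
   by (intro nn_integral_cong) (auto simp: indicator_def at min_absorb2 max_absorb1 add.assoc)
  finally have e: "(\<integral>\<^sup>+s\<in>{0..real (m + n)}. v (z + path_at ?\<xi> s) \<partial>lborel)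
   = (\<integral>\<^sup>+s\<in>{0..real m}. v (z + Z s w) \<partial>lborel) + (\<integral>\<^sup>+s\<in>{0..real n}. v (z + Z (real m) w + Z s w') \<partial>lborel)" .
  have "path_at ?\<xi> (real (m + n)) = Z (real m) w + Z (real n) w'" by (simp add: at min_absorb2 max_absorb1)
  then show ?thesis unfolding fk_path_sample_path[OF W w] fk_path_sample_path[OF W w']
   unfolding fk_path_def e by (simp add: exp_neg_add ennreal_mult exp_neg_nonneg ac_simps)
 qed
 have meas: "(\<lambda>p. fk_path v (m + n) z f (sample_path ?C p)) \<in> borel_measurable (W \<Otimes>\<^sub>M W)"
  by (rule measurable_compose[OF sample_path_measurable[OF C] fk_path_measurable]) auto
 have "fk W Z v (m + n) z f = fk (W \<Otimes>\<^sub>M W) ?C v (m + n) z f" by (rule fk_law[OF W C v f])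
 also have "\<dots> = (\<integral>\<^sup>+p. fk_path v (m + n) z f (sample_path ?C p) \<partial>(W \<Otimes>\<^sub>M W))" by (rule fk_eq_path_integral[OF C])
 also have "\<dots> = (\<integral>\<^sup>+w. \<integral>\<^sup>+w'. fk_path v (m + n) z f (sample_path ?C (w, w')) \<partial>W \<partial>W)"
  by (rule W.nn_integral_fst[OF meas, symmetric])
 also have "\<dots> = (\<integral>\<^sup>+w. fk_path v m z (\<lambda>_. 1) (sample_path Z w) * fk W Z v n (z + Z (real m) w) f \<partial>W)"
 proof (rule nn_integral_cong)
  fix w assume w: "w \<in> space W"
  have "(\<integral>\<^sup>+w'. fk_path v (m + n) z f (sample_path ?C (w, w')) \<partial>W)
   = (\<integral>\<^sup>+w'. fk_path v m z (\<lambda>_. 1) (sample_path Z w) * fk_path v n (z + Z (real m) w) f (sample_path Z w') \<partial>W)"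
   by (intro nn_integral_cong pt w)
  also have "\<dots> = fk_path v m z (\<lambda>_. 1) (sample_path Z w) * fk W Z v n (z + Z (real m) w) f"
   unfolding fk_eq_path_integral[OF W]
   by (rule nn_integral_cmult) (rule measurable_compose[OF sample_path_measurable[OF W] fk_path_measurable], auto)
  finally show "(\<integral>\<^sup>+w'. fk_path v (m + n) z f (sample_path ?C (w, w')) \<partial>W)
   = fk_path v m z (\<lambda>_. 1) (sample_path Z w) * fk W Z v n (z + Z (real m) w) f" .
 qed
 also have "\<dots> = fk W Z v m z (\<lambda>x. fk W Z v n x f)"
  unfolding fk_def[of W Z v m z] by (intro nn_integral_cong) (simp add: fk_path_sample_path[OF W])
 finally show ?thesis .
qed

lemma fk_mono: "(\<And>x. f x \<le> g x) \<Longrightarrow> fk W Z v n z f \<le> fk W Z v n z g"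
 unfolding fk_def by (intro nn_integral_mono mult_left_mono) auto

lemma fk_cmult:
 assumes "bm_grid W Z" and [measurable]: "v \<in> borel_measurable borel" "f \<in> borel_measurable borel"
 shows "fk W Z v n z (\<lambda>x. c * f x) = c * fk W Z v n z f"
proof -
 have "fk_path v n z (\<lambda>x. c * f x) \<xi> = c * fk_path v n z f \<xi>" for \<xi>
  by (simp add: fk_path_def mult.left_commute)
 then show ?thesis unfolding fk_eq_path_integral[OF assms(1)]
  by (simp, intro nn_integral_cmult measurable_compose[OF sample_path_measurable[OF assms(1)] fk_path_measurable]) auto
qed

lemma fk_le:
 assumes W: "bm_grid W Z" and f: "\<And>x. f x \<le> c"
 shows "fk W Z v n z f \<le> c"
proof -
 interpret W: prob_space W using W by (simp add: bm_grid_def)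
 have "fk W Z v n z f \<le> (\<integral>\<^sup>+w. 1 * c \<partial>W)"
  unfolding fk_def by (intro nn_integral_mono mult_mono f) (auto simp: exp_neg_le_1)
 then show ?thesis by (simp add: W.emeasure_space_1)
qed

lemma fk_translate: "fk W Z v n (a + z) f = fk W Z (\<lambda>x. v (a + x)) n z (\<lambda>x. f (a + x))"
 unfolding fk_def by (simp add: add.assoc)

lemma fk_reflect:
 assumes W: "bm_grid W Z" and v: "v \<in> borel_measurable borel" and f: "f \<in> borel_measurable borel"
 shows "fk W Z (\<lambda>x. v (- x)) n (- z) (\<lambda>x. f (- x)) = fk W Z v n z f"
proof -
 have "fk W Z (\<lambda>x. v (- x)) n (- z) (\<lambda>x. f (- x)) = fk W (\<lambda>t w. - Z t w) v n z f" unfolding fk_def by simp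
 also have "\<dots> = fk W Z v n z f" by (rule fk_law[OF bm_grid_uminus[OF W] W v f])
 finally show ?thesis .
qed

text \<open>Sequential lower semicontinuity. The potential has it because its balls are open, and it
  allows infima of weights and suprema of the potential over balls to be taken over countable dense
  sets.\<close>

definition lsc :: "('a::topological_space \<Rightarrow> ennreal) \<Rightarrow> bool" where
 "lsc v \<longleftrightarrow> (\<forall>X x. X \<longlonglongrightarrow> x \<longrightarrow> v x \<le> liminf (\<lambda>k. v (X k)))"

lemma lsc_lacoin: "lsc (\<lambda>x :: 'a::euclidean_space. lacoin \<gamma> x \<eta>)" unfolding lsc_def
proof (intro allI impI)
 fix X and x :: 'a assume X: "X \<longlonglongrightarrow> x"
 let ?f = "\<lambda>x (y, r). ennreal (r powr (-\<gamma>)) * indicator (ball y r) x"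
 have "?f x p \<le> liminf (\<lambda>k. ?f (X k) p)" for p
 proof (cases "x \<in> ball (fst p) (snd p)")
  case True
  have "eventually (\<lambda>k. X k \<in> ball (fst p) (snd p)) sequentially"
   using topological_tendstoD[OF X open_ball True] .
  then have "eventually (\<lambda>k. ?f x p \<le> ?f (X k) p) sequentially"
   by eventually_elim (use True in \<open>auto split: prod.split simp: indicator_def\<close>)
  then show ?thesis by (rule Liminf_bounded)
 qed (auto split: prod.split simp: indicator_def)
 then have "lacoin \<gamma> x \<eta> \<le> (\<integral>\<^sup>+p. liminf (\<lambda>k. ?f (X k) p) \<partial>count_space \<eta>)"
  unfolding lacoin_def by (intro nn_integral_mono)
 also have "\<dots> \<le> liminf (\<lambda>k. \<integral>\<^sup>+p. ?f (X k) p \<partial>count_space \<eta>)" by (rule nn_integral_liminf) auto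
 finally show "lacoin \<gamma> x \<eta> \<le> liminf (\<lambda>k. lacoin \<gamma> (X k) \<eta>)" by (simp add: lacoin_def)
qed

text \<open>By Fatou the accumulated potential is lower semicontinuous in the starting point, and
  the indicator of a closed set is upper semicontinuous; weights are at most 1, so the reverse Fatou
  lemma passes to the expectation.\<close>

lemma fk_usc:
 assumes W: "bm_grid W Z" and v [measurable]: "v \<in> borel_measurable borel" and l: "lsc v"
  and A: "closed A" and X: "X \<longlonglongrightarrow> z"
 shows "limsup (\<lambda>k. fk W Z v n (X k) (indicator A)) \<le> fk W Z v n z (indicator A)"
proof -
 interpret W: prob_space W using W by (simp add: bm_grid_def)
 have [measurable]: "A \<in> sets borel" using A by (rule borel_closed)
 have "limsup (\<lambda>k. \<integral>\<^sup>+w. fk_path v n (X k) (indicator A) (sample_path Z w) \<partial>W)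
  \<le> (\<integral>\<^sup>+w. limsup (\<lambda>k. fk_path v n (X k) (indicator A) (sample_path Z w)) \<partial>W)"
 proof (rule nn_integral_limsup[where w = "\<lambda>_. 1"])
  show "(\<lambda>w. fk_path v n (X i) (indicator A) (sample_path Z w)) \<in> borel_measurable W" for i
   by (rule measurable_compose[OF sample_path_measurable[OF W] fk_path_measurable]) auto
  have "ennreal (exp_neg a) * indicator A x \<le> 1 * 1" for a x
   by (intro mult_mono) (auto simp: exp_neg_le_1 indicator_def)
  then show "AE w in W. fk_path v n (X i) (indicator A) (sample_path Z w) \<le> 1" for i
   by (simp add: fk_path_def)
 qed (auto simp: W.emeasure_space_1)
 also have "\<dots> \<le> (\<integral>\<^sup>+w. fk_path v n z (indicator A) (sample_path Z w) \<partial>W)"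
 proof (rule nn_integral_mono)
  fix w assume w: "w \<in> space W"
  let ?\<xi> = "sample_path Z w"
  have sp: "?\<xi> \<in> space path_space" by (rule measurable_space[OF sample_path_measurable[OF W] w])
  have [measurable]: "(\<lambda>s. v (z + path_at ?\<xi> s)) \<in> borel_measurable borel" for z
   using measurable_compose[OF measurable_Pair1'[OF sp] path_at_measurable] by simp
  have "(\<integral>\<^sup>+s\<in>{0..real n}. v (z + path_at ?\<xi> s) \<partial>lborel)
   \<le> (\<integral>\<^sup>+s. liminf (\<lambda>k. v (X k + path_at ?\<xi> s) * indicator {0..real n} s) \<partial>lborel)"
  proof (rule nn_integral_mono)
   fix s
   have "(\<lambda>k. X k + path_at ?\<xi> s) \<longlonglongrightarrow> z + path_at ?\<xi> s" using X by (intro tendsto_intros)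
   then show "v (z + path_at ?\<xi> s) * indicator {0..real n} s \<le> liminf (\<lambda>k. v (X k + path_at ?\<xi> s) * indicator {0..real n} s)"
    using l unfolding lsc_def by (auto simp: indicator_def)
  qed
  also have "\<dots> \<le> liminf (\<lambda>k. \<integral>\<^sup>+s\<in>{0..real n}. v (X k + path_at ?\<xi> s) \<partial>lborel)"
   by (rule nn_integral_liminf) auto
  finally have L: "limsup (\<lambda>k. ennreal (exp_neg (\<integral>\<^sup>+s\<in>{0..real n}. v (X k + path_at ?\<xi> s) \<partial>lborel)))
   \<le> ennreal (exp_neg (\<integral>\<^sup>+s\<in>{0..real n}. v (z + path_at ?\<xi> s) \<partial>lborel))" by (rule exp_neg_limsup)
  show "limsup (\<lambda>k. fk_path v n (X k) (indicator A) ?\<xi>) \<le> fk_path v n z (indicator A) ?\<xi>"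
  proof (cases "z + path_at ?\<xi> (real n) \<in> A")
   case True
   have "limsup (\<lambda>k. fk_path v n (X k) (indicator A) ?\<xi>)
    \<le> limsup (\<lambda>k. ennreal (exp_neg (\<integral>\<^sup>+s\<in>{0..real n}. v (X k + path_at ?\<xi> s) \<partial>lborel)))"
    by (intro Limsup_mono always_eventually) (auto simp: fk_path_def indicator_def)
   with L show ?thesis using True by (simp add: fk_path_def)
  next
   case False
   have "(\<lambda>k. X k + path_at ?\<xi> (real n)) \<longlonglongrightarrow> z + path_at ?\<xi> (real n)" using X by (intro tendsto_intros)
   from topological_tendstoD[OF this, of "- A"] A False
   have "eventually (\<lambda>k. X k + path_at ?\<xi> (real n) \<in> - A) sequentially" by auto
   then have "eventually (\<lambda>k. fk_path v n (X k) (indicator A) ?\<xi> \<le> 0) sequentially"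
    by eventually_elim (simp add: fk_path_def)
   then have "limsup (\<lambda>k. fk_path v n (X k) (indicator A) ?\<xi>) \<le> 0" by (rule Limsup_bounded)
   then show ?thesis by simp
  qed
 qed
 finally show ?thesis by (simp add: fk_eq_path_integral[OF W])
qed

lemma indicator_cball_measurable [measurable, simp]:
 "(indicator (cball y r) :: 'a::euclidean_space \<Rightarrow> ennreal) \<in> borel_measurable borel"
 by (rule borel_measurable_indicator) auto

lemma countable_dense_limits:
 obtains D :: "'a::euclidean_space set"
 where "countable D" "\<And>x r z. z \<in> ball x r \<Longrightarrow> \<exists>X. (\<forall>k. X k \<in> ball x r \<inter> D) \<and> X \<longlonglongrightarrow> z"
proof -
 obtain D :: "'a set" where D: "countable D" "UNIV \<subseteq> closure D" using separable by metis
 show thesis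
 proof (rule that[OF D(1)])
  fix x z :: 'a and r assume "z \<in> ball x r"
  then have "z \<in> closure (ball x r \<inter> D)" using open_Int_closure_subset[OF open_ball, of x r D] D(2) by blast
  then show "\<exists>X. (\<forall>k. X k \<in> ball x r \<inter> D) \<and> X \<longlonglongrightarrow> z" unfolding closure_sequential .
 qed
qed

section \<open>Hops and connection weights\<close>

context brownian
begin

text \<open>The closed target ball of radius \<open>1 / 2\<close> lies inside the open starting ball
  of the next hop, which makes hops composable. A closed target is also what \<open>fk_usc\<close>
  requires, and with it the infimum is measurable in the environment.\<close>

definition hop :: "('a \<Rightarrow> ennreal) \<Rightarrow> nat \<Rightarrow> 'a \<Rightarrow> 'a \<Rightarrow> ennreal" where
 "hop v n x y = (INF z\<in>ball x 1. fk W Z v n z (indicator (cball y (1/2))))"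

definition conn :: "('a \<Rightarrow> ennreal) \<Rightarrow> 'a \<Rightarrow> 'a \<Rightarrow> ennreal" where
 "conn v x y = (SUP n. hop v n x y)"

lemma fk_indicator_le_1: "fk W Z v n z (indicator A) \<le> 1" by (rule fk_le[OF grid]) (auto simp: indicator_def)

lemma hop_le_fk: "z \<in> ball x 1 \<Longrightarrow> hop v n x y \<le> fk W Z v n z (indicator (cball y (1/2)))"
 unfolding hop_def by (rule INF_lower)

lemma hop_le_1: "hop v n x y \<le> 1" using hop_le_fk[of x x v n y] fk_indicator_le_1 order_trans by fastforce

lemma conn_le_1: "conn v x y \<le> 1" unfolding conn_def by (rule SUP_least) (rule hop_le_1)

lemma hop_mult:
 assumes v [measurable]: "v \<in> borel_measurable borel"
 shows "hop v m x y * hop v n y u \<le> hop v (m + n) x u" unfolding hop_def[of v "m + n"]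
proof (rule INF_greatest)
 fix z assume z: "z \<in> ball x 1"
 have "hop v m x y * hop v n y u \<le> fk W Z v m z (indicator (cball y (1/2))) * hop v n y u"
  by (intro mult_right_mono hop_le_fk z) simp
 also have "\<dots> = fk W Z v m z (\<lambda>x. hop v n y u * indicator (cball y (1/2)) x)"
  by (subst fk_cmult[OF grid]) (auto simp: mult.commute)
 also have "\<dots> \<le> fk W Z v m z (\<lambda>x. fk W Z v n x (indicator (cball u (1/2))))"
 proof (rule fk_mono)
  fix x' show "hop v n y u * indicator (cball y (1/2)) x' \<le> fk W Z v n x' (indicator (cball u (1/2)))"
   by (cases "x' \<in> cball y (1/2)") (auto intro!: hop_le_fk)
 qed
 also have "\<dots> = fk W Z v (m + n) z (indicator (cball u (1/2)))" by (rule fk_markov[OF grid, symmetric]) auto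
 finally show "hop v m x y * hop v n y u \<le> fk W Z v (m + n) z (indicator (cball u (1/2)))" .
qed

lemma hop_le_conn: "hop v n x y \<le> conn v x y" unfolding conn_def by (rule SUP_upper) simp

lemma conn_mult:
 assumes v: "v \<in> borel_measurable borel"
 shows "conn v x y * conn v y u \<le> conn v x u"
 unfolding conn_def[of v x y] conn_def[of v y u] SUP_mult_right_ennreal SUP_mult_left_ennreal
 by (intro SUP_least order_trans[OF hop_mult[OF v]] hop_le_conn)

lemma hop_eq_countable:
 assumes v: "v \<in> borel_measurable borel" "lsc v"
  and D: "\<And>x r z :: 'a. z \<in> ball x r \<Longrightarrow> \<exists>X. (\<forall>k. X k \<in> ball x r \<inter> D) \<and> X \<longlonglongrightarrow> z"
 shows "hop v n x y = (INF z\<in>ball x 1 \<inter> D. fk W Z v n z (indicator (cball y (1/2))))" (is "_ = (INF z\<in>_. ?f z)")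
proof (rule antisym)
 show "hop v n x y \<le> (INF z\<in>ball x 1 \<inter> D. ?f z)" unfolding hop_def by (rule INF_superset_mono) auto
 show "(INF z\<in>ball x 1 \<inter> D. ?f z) \<le> hop v n x y" unfolding hop_def
 proof (rule INF_greatest)
  fix z assume "z \<in> ball x 1"
  from D[OF this] obtain X where X: "\<And>k. X k \<in> ball x 1 \<inter> D" "X \<longlonglongrightarrow> z" by blast
  have "(INF z\<in>ball x 1 \<inter> D. ?f z) \<le> limsup (\<lambda>k. ?f (X k))"
   by (rule le_Limsup) (use X in \<open>auto intro!: always_eventually INF_lower\<close>)
  also have "\<dots> \<le> ?f z" by (intro fk_usc[OF grid] v X(2)) auto
  finally show "(INF z\<in>ball x 1 \<inter> D. ?f z) \<le> ?f z" .
 qed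
qed

lemma hop_measurable_param:
 assumes V: "(\<lambda>(p, x). V p x) \<in> borel_measurable (N \<Otimes>\<^sub>M borel)" and l: "\<And>p. p \<in> space N \<Longrightarrow> lsc (V p)"
 shows "(\<lambda>p. hop (V p) n x y) \<in> borel_measurable N"
proof -
 obtain D :: "'a set" where D: "countable D" "\<And>x r z. z \<in> ball x r \<Longrightarrow> \<exists>X. (\<forall>k. X k \<in> ball x r \<inter> D) \<and> X \<longlonglongrightarrow> z"
  using countable_dense_limits by blast
 have Vp: "V p \<in> borel_measurable borel" if "p \<in> space N" for p
  using measurable_compose[OF measurable_Pair1'[OF that] V] by simp
 have "(\<lambda>p. INF z\<in>ball x 1 \<inter> D. fk W Z (V p) n z (indicator (cball y (1/2)))) \<in> borel_measurable N"
  by (intro borel_measurable_INF fk_measurable_param[OF grid V]) (use D in auto)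
 then show ?thesis
  by (rule measurable_cong[THEN iffD1, rotated]) (rule hop_eq_countable[OF Vp l D(2), symmetric])
qed

lemma conn_measurable_param:
 assumes V: "(\<lambda>(p, x). V p x) \<in> borel_measurable (N \<Otimes>\<^sub>M borel)" and l: "\<And>p. p \<in> space N \<Longrightarrow> lsc (V p)"
 shows "(\<lambda>p. conn (V p) x y) \<in> borel_measurable N"
 unfolding conn_def by (intro borel_measurable_SUP hop_measurable_param[OF V l]) auto

lemma ball_translate: "ball (a + x :: 'a) r = (\<lambda>z. a + z) ` ball x r"
proof -
 have "(\<lambda>z. a + z) ` ball x r = ball (x + a) r" by (simp only: image_add_ball)
 then show ?thesis by (simp only: add.commute[of a x])
qed

lemma hop_translate: "hop (\<lambda>u. v (a + u)) n x y = hop v n (a + x) (a + y)"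
proof -
 have i: "(\<lambda>u. indicator (cball (a + y) (1/2)) (a + u) :: ennreal) = indicator (cball y (1/2))"
  by (auto simp: indicator_def fun_eq_iff dist_norm)
 show ?thesis unfolding hop_def ball_translate image_image fk_translate i ..
qed

lemma conn_translate: "conn (\<lambda>u. v (a + u)) x y = conn v (a + x) (a + y)" unfolding conn_def hop_translate ..

lemma hop_reflect:
 assumes [measurable]: "v \<in> borel_measurable borel"
 shows "hop (\<lambda>u. v (- u)) n (- x) (- y) = hop v n x y"
proof -
 have mem: "u \<in> uminus ` A \<longleftrightarrow> - u \<in> A" for u and A :: "'a set" by force
 have d: "dist (- x) u = dist x (- u)" for x u :: 'a by (metis dist_minus minus_minus)
 have b: "ball (- x) 1 = uminus ` ball x 1" by (rule set_eqI) (simp add: mem d)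
 have i: "indicator (cball (- y) (1/2)) = (\<lambda>u. indicator (cball y (1/2)) (- u) :: ennreal)"
  by (auto simp: indicator_def fun_eq_iff d)
 show ?thesis unfolding hop_def b image_image i
  by (rule INF_cong[OF refl], rule fk_reflect[OF grid assms]) simp
qed

lemma conn_reflect:
 "v \<in> borel_measurable borel \<Longrightarrow> conn (\<lambda>u. v (- u)) (- x) (- y) = conn v x y"
 unfolding conn_def by (simp add: hop_reflect)

text \<open>Compares the free expectation over one unit of time with the Feynman-Kac weight: a path
  that stays within \<open>M\<close> of its start collects at most \<open>S\<close>, and the other
  paths have total probability at most \<open>osc_tail\<close>.\<close>

lemma fk_one_lower:
 assumes v [measurable]: "v \<in> borel_measurable borel" and F [measurable]: "F \<in> borel_measurable borel" and F1: "\<And>x. F x \<le> 1"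
  and S: "0 \<le> S" and M: "0 \<le> M" and bd: "\<And>u. u \<in> cball z M \<Longrightarrow> v u \<le> ennreal S"
 shows "(\<integral>\<^sup>+w. F (z + Z 1 w) \<partial>W) \<le> ennreal (exp S) * fk W Z v 1 z F + ennreal (osc_tail DIM('a) M)"
proof -
 obtain B where B: "B \<in> events" "prob B \<le> osc_tail DIM('a) M"
  "\<And>w s. w \<in> space W - B \<Longrightarrow> s \<in> {0..1} \<Longrightarrow> norm (Z (0 + s) w - Z 0 w) \<le> M"
  using oscillation_tail[of 0 M] M by auto
 let ?e = "\<lambda>w. exp_neg (\<integral>\<^sup>+s\<in>{0..real 1}. v (z + Z s w) \<partial>lborel)"
 have "(\<integral>\<^sup>+w. F (z + Z 1 w) \<partial>W) \<le> (\<integral>\<^sup>+w. ennreal (exp S) * (ennreal (?e w) * F (z + Z (real 1) w)) + indicator B w \<partial>W)"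
 proof (rule nn_integral_mono)
  fix w assume w: "w \<in> space W"
  show "F (z + Z 1 w) \<le> ennreal (exp S) * (ennreal (?e w) * F (z + Z (real 1) w)) + indicator B w"
  proof (cases "w \<in> B")
   case True
   then show ?thesis using F1[of "z + Z 1 w"] by (auto intro: add_increasing)
  next
   case False
   have "v (z + Z s w) \<le> ennreal S" if "s \<in> {0..1}" for s
    using B(3)[of w s] False w that Z_0[OF w] by (intro bd) (simp add: dist_norm)
   then have "v (z + Z s w) * indicator {0..real 1} s \<le> ennreal S * indicator {0..1::real} s" for s
    by (cases "s \<in> {0..1}") auto
   then have "(\<integral>\<^sup>+s\<in>{0..real 1}. v (z + Z s w) \<partial>lborel) \<le> (\<integral>\<^sup>+s. ennreal S * indicator {0..1::real} s \<partial>lborel)"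
    by (rule nn_integral_mono)
   also have "\<dots> = ennreal S" by (subst nn_integral_cmult_indicator) auto
   finally have "exp (- S) \<le> ?e w" using exp_neg_antimono S by (metis exp_neg_ennreal)
   then have "exp S * exp (- S) \<le> exp S * ?e w" by (intro mult_left_mono) auto
   then have "1 \<le> exp S * ?e w" by (simp add: exp_add[symmetric])
   then have "1 * F (z + Z 1 w) \<le> (ennreal (exp S) * ennreal (?e w)) * F (z + Z 1 w)"
    by (intro mult_right_mono) (auto simp: ennreal_mult[symmetric] exp_neg_nonneg ennreal_ge_1)
   then show ?thesis using False by (simp add: mult.assoc)
  qed
 qed
 also have "\<dots> = ennreal (exp S) * fk W Z v 1 z F + emeasure W B"
 proof -
  have m: "(\<lambda>w. ennreal (?e w) * F (z + Z (real 1) w)) \<in> borel_measurable W"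
  proof -
   have "(\<lambda>w. fk_path v 1 z F (sample_path Z w)) \<in> borel_measurable W"
    by (rule measurable_compose[OF sample_path_measurable[OF grid] fk_path_measurable]) auto
   then show ?thesis by (rule measurable_cong[THEN iffD1, rotated]) (rule fk_path_sample_path[OF grid])
  qed
  have "(\<integral>\<^sup>+w. ennreal (exp S) * (ennreal (?e w) * F (z + Z (real 1) w)) + indicator B w \<partial>W)
   = (\<integral>\<^sup>+w. ennreal (exp S) * (ennreal (?e w) * F (z + Z (real 1) w)) \<partial>W) + (\<integral>\<^sup>+w. indicator B w \<partial>W)"
   using B(1) by (intro nn_integral_add borel_measurable_times_ennreal m) auto
  then show ?thesis unfolding nn_integral_cmult[OF m] fk_def using B(1) by (simp only: nn_integral_indicator)
 qed
 also have "emeasure W B \<le> ennreal (osc_tail DIM('a) M)" using B(2) by (simp add: emeasure_eq_measure ennreal_leI)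
 finally show ?thesis by (auto intro: add_left_mono)
qed

lemma hop_one_lower:
 "\<exists>c>0. \<forall>v x y S. v \<in> borel_measurable borel \<longrightarrow> dist x y \<le> 1 \<longrightarrow> 0 \<le> S \<longrightarrow>
  (\<forall>u\<in>cball x c. v u \<le> ennreal S) \<longrightarrow> ennreal (exp (- (c + S))) \<le> hop v 1 x y"
proof -
 \<comment> \<open>A lower bound for hitting, at time 1, a ball of radius \<open>1 / 2\<close> whose
   centre is within 2 of the start: on it all coordinates of the displacement are at most 3 in
   absolute value.\<close>
 define q where "q = (normal_density 0 1 3) ^ DIM('a) * measure lborel (ball (0::'a) (1/2))"
 have q: "q > 0" unfolding q_def using content_ball_pos[of "1/2" "0::'a"] by (simp add: normal_density_pos)
 have hit: "ennreal q \<le> (\<integral>\<^sup>+w. indicator (cball u (1/2)) (Z 1 w) \<partial>W)" if u: "norm u \<le> 2" for u :: 'a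
 proof -
  have "ennreal q = (\<integral>\<^sup>+x. ennreal ((normal_density 0 1 3) ^ DIM('a)) * indicator (ball u (1/2)) x \<partial>lborel)"
  proof -
   have "measure lborel (ball u (1/2)) = measure lborel (ball (0::'a) (1/2))"
    using content_ball[of "1/2" u] content_ball[of "1/2" "0::'a"] by simp
   moreover have "emeasure lborel (ball u (1/2)) = ennreal (measure lborel (ball u (1/2)))"
    using emeasure_lborel_ball_finite[of u "1/2"] by (intro emeasure_eq_ennreal_measure) auto
   ultimately show ?thesis unfolding q_def by (subst nn_integral_cmult_indicator) (auto simp: ennreal_mult)
  qed
  also have "\<dots> \<le> (\<integral>\<^sup>+x. ennreal (\<Prod>b\<in>Basis. normal_density 0 (sqrt 1) (x \<bullet> b)) * indicator (cball u (1/2)) x \<partial>lborel)"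
  proof (rule nn_integral_mono)
   fix x :: 'a
   show "ennreal ((normal_density 0 1 3) ^ DIM('a)) * indicator (ball u (1/2)) x
    \<le> ennreal (\<Prod>b\<in>Basis. normal_density 0 (sqrt 1) (x \<bullet> b)) * indicator (cball u (1/2)) x"
   proof (cases "x \<in> ball u (1/2)")
    case True
    then have "norm x \<le> 3" using u norm_triangle_sub[of x u] by (simp add: dist_norm norm_minus_commute)
    then have "normal_density 0 1 3 \<le> normal_density 0 1 (x \<bullet> b)" if "b \<in> Basis" for b
    proof -
     have "\<bar>x \<bullet> b\<bar> \<le> 3" using Basis_le_norm[OF that, of x] \<open>norm x \<le> 3\<close> by simp
     then have "(x \<bullet> b)\<^sup>2 \<le> 3\<^sup>2" by (intro abs_le_square_iff[THEN iffD1]) simp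
     then show ?thesis unfolding normal_density_def by (intro mult_left_mono) auto
    qed
    then have "(\<Prod>b\<in>(Basis::'a set). normal_density 0 1 3) \<le> (\<Prod>b\<in>Basis. normal_density 0 1 (x \<bullet> b))"
     by (intro prod_mono) auto
    then show ?thesis using True by (auto intro!: ennreal_leI)
   qed simp
  qed
  also have "\<dots> = emeasure (gauss 1) (cball u (1/2))" unfolding gauss_def by (subst emeasure_density) auto
  also have "\<dots> = (\<integral>\<^sup>+x. indicator (cball u (1/2)) x \<partial>distr W borel (Z 1))" by (simp add: value_law gauss_def)
  also have "\<dots> = (\<integral>\<^sup>+w. indicator (cball u (1/2)) (Z 1 w) \<partial>W)" by (rule nn_integral_distr) auto
  finally show ?thesis .
 qed
 have "(osc_tail DIM('a) \<longlongrightarrow> 0) at_top" unfolding osc_tail_def[abs_def] by real_asymp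
 \<comment> \<open>One number \<open>M\<close> has two roles: the radius in which the potential is
   controlled and, by \<open>exp (- M) \<le> q / 2\<close>, the cost of the hop. The final constant
   \<open>M + 1\<close> accounts for starting points within 1 of \<open>x\<close>.\<close>
 then have "eventually (\<lambda>M. osc_tail DIM('a) M < q / 2 \<and> max 0 (- ln (q / 2)) \<le> M) at_top"
  using q by (intro eventually_conj order_tendstoD(2) eventually_ge_at_top) auto
 then obtain M where M: "osc_tail DIM('a) M < q / 2" "0 \<le> M" "- ln (q / 2) \<le> M" by (auto simp: eventually_at_top_linorder)
 have "ennreal (exp (- ((M + 1) + S))) \<le> hop v 1 x y"
  if v: "v \<in> borel_measurable borel" and xy: "dist x y \<le> 1" and S: "0 \<le> S" and bd: "\<forall>u\<in>cball x (M + 1). v u \<le> ennreal S" for v x y S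
  unfolding hop_def
 proof (rule INF_greatest)
  fix z assume z: "z \<in> ball x 1"
  let ?X = "fk W Z v 1 z (indicator (cball y (1/2)))"
  have "norm (y - z) \<le> 2" using dist_triangle[of y z x] xy z by (simp add: dist_norm[symmetric] dist_commute)
  from hit[OF this] have "ennreal q \<le> (\<integral>\<^sup>+w. indicator (cball y (1/2)) (z + Z 1 w) \<partial>W)"
   by (simp add: indicator_def dist_norm algebra_simps)
  also have "\<dots> \<le> ennreal (exp S) * ?X + ennreal (osc_tail DIM('a) M)"
  proof (rule fk_one_lower[OF v])
   fix u assume "u \<in> cball z M"
   then show "v u \<le> ennreal S" using z dist_triangle[of x u z] by (intro bspec[OF bd]) simp
  qed (use S M in \<open>auto simp: indicator_def\<close>)
  finally have *: "ennreal q \<le> ennreal (exp S) * ?X + ennreal (osc_tail DIM('a) M)" .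
  obtain X where X: "?X = ennreal X" "0 \<le> X" using fk_indicator_le_1[of v 1 z "cball y (1/2)"] by (cases ?X) (auto simp: top_unique)
  have "0 \<le> osc_tail DIM('a) M" by (simp add: osc_tail_def)
  then have "q \<le> exp S * X + osc_tail DIM('a) M" using * X by (simp add: ennreal_mult[symmetric] ennreal_plus[symmetric] del: ennreal_plus)
  then have "q / 2 \<le> exp S * X" using M(1) by linarith
  moreover have "exp (- M) \<le> q / 2" using M(3) q exp_le_cancel_iff[of "- M" "ln (q / 2)"] by simp
  ultimately have "exp (- S) * exp (- M) \<le> exp (- S) * (exp S * X)" by (intro mult_left_mono) auto
  moreover have "exp (- S) * exp (- M) = exp (- (M + S))" "exp (- S) * (exp S * X) = X"
   by (simp_all add: mult_exp_exp mult.assoc[symmetric] add.commute)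
  ultimately have "exp (- (M + S)) \<le> X" by simp
  then have "exp (- ((M + 1) + S)) \<le> X" by (rule order_trans[rotated]) simp
  then show "ennreal (exp (- ((M + 1) + S))) \<le> ?X" unfolding X(1) by (rule ennreal_leI)
 qed
 then show ?thesis using M(2) by (intro exI[of _ "M + 1"]) auto
qed

text \<open>The constant \<open>c\<close> is at once the cost of a unit hop beyond the potential and
  the width of the margin in which \<open>S\<close> has to bound the potential.\<close>

definition hop_const :: "real \<Rightarrow> bool" where
 "hop_const c \<longleftrightarrow> 0 < c \<and> (\<forall>v x y S m. v \<in> borel_measurable borel \<longrightarrow> 1 \<le> m \<longrightarrow> dist x y \<le> real m \<longrightarrow> 0 \<le> S \<longrightarrow>
  (\<forall>u\<in>cball x (real m + c). v u \<le> ennreal S) \<longrightarrow> ennreal (exp (- (real m * (c + S)))) \<le> hop v m x y)"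

lemma hop_constD:
 "hop_const c \<Longrightarrow> v \<in> borel_measurable borel \<Longrightarrow> 1 \<le> m \<Longrightarrow> dist x y \<le> real m \<Longrightarrow> 0 \<le> S \<Longrightarrow>
  (\<And>u. u \<in> cball x (real m + c) \<Longrightarrow> v u \<le> ennreal S) \<Longrightarrow> ennreal (exp (- (real m * (c + S)))) \<le> hop v m x y"
 unfolding hop_const_def by blast

text \<open>The segment from \<open>x\<close> to \<open>y\<close> is divided into \<open>m\<close>
  pieces of length at most 1, and the unit hops along it multiply.\<close>

lemma hop_const_exists: "\<exists>c. hop_const c"
proof -
 obtain c where c: "0 < c" "\<forall>v x y S. v \<in> borel_measurable borel \<longrightarrow> dist x y \<le> 1 \<longrightarrow> 0 \<le> S \<longrightarrow>
  (\<forall>u\<in>cball x c. v u \<le> ennreal S) \<longrightarrow> ennreal (exp (- (c + S))) \<le> hop v 1 x y" using hop_one_lower by blast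
 have "ennreal (exp (- (real m * (c + S)))) \<le> hop v m x y"
  if v: "v \<in> borel_measurable borel" and m: "1 \<le> m" and xy: "dist x y \<le> real m" and S: "0 \<le> S"
   and bd: "\<forall>u\<in>cball x (real m + c). v u \<le> ennreal S" for v x y S m
 proof -
  define p where "p i = x + (real i / real m) *\<^sub>R (y - x)" for i
  have step: "dist (p i) (p (Suc i)) \<le> 1" for i
  proof -
   have "p (Suc i) - p i = (1 / real m) *\<^sub>R (y - x)"
    by (simp add: p_def scaleR_diff_left[symmetric] diff_divide_distrib[symmetric])
   moreover have "dist (p i) (p (Suc i)) = norm (p (Suc i) - p i)" by (metis dist_commute dist_norm)
   ultimately have "dist (p i) (p (Suc i)) = (1 / real m) * dist x y" by (simp add: dist_norm norm_minus_commute)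
   also have "\<dots> \<le> (1 / real m) * real m" using xy by (intro mult_left_mono) auto
   finally show ?thesis using m by simp
  qed
  have near: "cball (p i) c \<subseteq> cball x (real m + c)" if "i \<le> m" for i
  proof
   fix u assume u: "u \<in> cball (p i) c"
   have "dist x (p i) = real i / real m * dist x y" by (simp add: p_def dist_norm norm_minus_commute)
   also have "\<dots> \<le> 1 * real m" using that m xy by (intro mult_mono) auto
   finally show "u \<in> cball x (real m + c)" using u dist_triangle[of x u "p i"] by simp
  qed
  have one: "ennreal (exp (- (c + S))) \<le> hop v 1 (p i) (p (Suc i))" if "i \<le> m" for i
   by (rule c(2)[rule_format, OF v step S]) (use near[OF that] bd in blast)
  have "ennreal (exp (- (real (Suc k) * (c + S)))) \<le> hop v (Suc k) x (p (Suc k))" if "Suc k \<le> m" for k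
   using that
  proof (induction k)
   case 0
   then show ?case using one[of 0] by (simp add: p_def)
  next
   case (Suc k)
   have "ennreal (exp (- (real (Suc (Suc k)) * (c + S)))) = ennreal (exp (- (real (Suc k) * (c + S)))) * ennreal (exp (- (c + S)))"
    by (simp add: ennreal_mult[symmetric] exp_add[symmetric] algebra_simps)
   also have "\<dots> \<le> hop v (Suc k) x (p (Suc k)) * hop v 1 (p (Suc k)) (p (Suc (Suc k)))"
    using Suc by (intro mult_mono one) auto
   also have "\<dots> \<le> hop v (Suc k + 1) x (p (Suc (Suc k)))" by (rule hop_mult[OF v])
   finally show ?case by simp
  qed
  from this[of "m - 1"] m show ?thesis by (simp add: p_def)
 qed
 then show ?thesis using c(1) unfolding hop_const_def by blast
qed

text \<open>Completing the square, the two densities have the ratio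
  \<open>exp ((norm z)\<^sup>2 / 2 - x \<bullet> z)\<close>, which Cauchy-Schwarz bounds on the ball
  of radius \<open>M\<close>.\<close>

lemma gauss_shift_le:
 fixes x z :: 'a
 assumes z: "norm z \<le> 1" and x: "norm x \<le> M"
 shows "(\<Prod>b\<in>Basis. normal_density 0 1 (x \<bullet> b)) \<le> exp (M + 1) * (\<Prod>b\<in>Basis. normal_density 0 1 ((x - z) \<bullet> b))"
proof -
 have "normal_density 0 1 (x \<bullet> b) = exp ((z \<bullet> b) * (z \<bullet> b) / 2 - (x \<bullet> b) * (z \<bullet> b)) * normal_density 0 1 ((x - z) \<bullet> b)" for b
  by (simp add: normal_density_def inner_diff_left exp_add[symmetric] power2_eq_square field_simps)
 then have "(\<Prod>b\<in>Basis. normal_density 0 1 (x \<bullet> b))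
  = exp (\<Sum>b\<in>Basis. (z \<bullet> b) * (z \<bullet> b) / 2 - (x \<bullet> b) * (z \<bullet> b)) * (\<Prod>b\<in>Basis. normal_density 0 1 ((x - z) \<bullet> b))"
  by (simp only: prod.distrib[symmetric] exp_sum[OF finite_Basis])
 also have "(\<Sum>b\<in>Basis. (z \<bullet> b) * (z \<bullet> b) / 2 - (x \<bullet> b) * (z \<bullet> b)) = (norm z)\<^sup>2 / 2 - x \<bullet> z"
  by (simp add: sum_subtractf sum_divide_distrib[symmetric] euclidean_inner[symmetric] power2_norm_eq_inner)
 also have "\<dots> \<le> M + 1"
 proof -
  have "(norm z)\<^sup>2 \<le> 1" using z by (simp add: power_le_one)
  moreover have "\<bar>x \<bullet> z\<bar> \<le> M * 1" by (rule order_trans[OF Cauchy_Schwarz_ineq2 mult_mono]) (use x z in \<open>auto intro: order_trans[OF norm_ge_zero]\<close>)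
  ultimately show ?thesis by linarith
 qed
 finally show ?thesis by (simp add: mult_right_mono prod_nonneg)
qed

text \<open>A substitute for a Harnack inequality. The positions at time 1 from the starts 0 and
  \<open>z\<close> have comparable densities on the ball of radius \<open>M\<close>; the potential
  of the first unit of time is dropped for the start 0 and paid with \<open>exp S\<close> for the
  start \<open>z\<close>. Each side contributes one exceptional oscillation event, whence the factor
  2.\<close>

lemma fk_change_start:
 assumes v [measurable]: "v \<in> borel_measurable borel" and f [measurable]: "f \<in> borel_measurable borel" and f1: "\<And>x. f x \<le> 1"
  and S: "0 \<le> S" and M: "0 \<le> M" and z: "norm z \<le> 1" and bd: "\<And>u. u \<in> cball 0 (M + 1) \<Longrightarrow> v u \<le> ennreal S"
 shows "fk W Z v (Suc n) 0 f \<le> ennreal (exp (M + 1 + S)) * fk W Z v (Suc n) z f + ennreal (2 * exp (M + 1) * osc_tail DIM('a) M)"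
proof -
 define F where "F x = fk W Z v n x f" for x
 have F [measurable]: "F \<in> borel_measurable borel" unfolding F_def by (rule fk_measurable[OF grid]) auto
 have F1: "F x \<le> 1" for x unfolding F_def by (rule fk_le[OF grid]) (use f1 in auto)
 have markov: "fk W Z v (Suc n) x f = fk W Z v 1 x F" for x
  unfolding F_def using fk_markov[OF grid v f, of 1 n x] by simp
 let ?t = "osc_tail DIM('a) M" and ?p = "\<lambda>x. \<Prod>b\<in>Basis. normal_density 0 1 (x \<bullet> b)"
 have t0: "0 \<le> ?t" by (simp add: osc_tail_def)
 obtain B where B: "B \<in> events" "prob B \<le> ?t"
  "\<And>w s. w \<in> space W - B \<Longrightarrow> s \<in> {0..1} \<Longrightarrow> norm (Z (0 + s) w - Z 0 w) \<le> M"
  using oscillation_tail[of 0 M] M by auto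
 have law: "(\<integral>\<^sup>+w. g (Z 1 w) \<partial>W) = (\<integral>\<^sup>+x. ennreal (?p x) * g x \<partial>lborel)" if [measurable]: "g \<in> borel_measurable borel" for g
 proof -
  have "(\<integral>\<^sup>+w. g (Z 1 w) \<partial>W) = (\<integral>\<^sup>+x. g x \<partial>distr W borel (Z 1))" by (rule nn_integral_distr[symmetric]) auto
  then show ?thesis unfolding value_law[OF zero_less_one] gauss_def by (simp add: nn_integral_density)
 qed
 have "fk W Z v 1 0 F \<le> (\<integral>\<^sup>+w. F (Z 1 w) * indicator (cball 0 M) (Z 1 w) + indicator B w \<partial>W)" unfolding fk_def
 proof (rule nn_integral_mono)
  fix w assume w: "w \<in> space W"
  have "ennreal (exp_neg (\<integral>\<^sup>+s\<in>{0..real 1}. v (0 + Z s w) \<partial>lborel)) * F (0 + Z (real 1) w) \<le> 1 * F (0 + Z (real 1) w)"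
   by (rule mult_right_mono) (auto simp: exp_neg_le_1)
  also have "\<dots> = F (Z 1 w)" by simp
  also have "F (Z 1 w) \<le> F (Z 1 w) * indicator (cball 0 M) (Z 1 w) + indicator B w"
   using B(3)[of w 1] w Z_0[OF w] F1[of "Z 1 w"] by (cases "w \<in> B") (auto intro: add_increasing)
  finally show "ennreal (exp_neg (\<integral>\<^sup>+s\<in>{0..real 1}. v (0 + Z s w) \<partial>lborel)) * F (0 + Z (real 1) w)
    \<le> F (Z 1 w) * indicator (cball 0 M) (Z 1 w) + indicator B w" .
 qed
 also have "\<dots> = (\<integral>\<^sup>+w. F (Z 1 w) * indicator (cball 0 M) (Z 1 w) \<partial>W) + emeasure W B"
  using B(1) by (subst nn_integral_add) auto
 also have "(\<integral>\<^sup>+w. F (Z 1 w) * indicator (cball 0 M) (Z 1 w) \<partial>W) = (\<integral>\<^sup>+x. ennreal (?p x) * (F x * indicator (cball 0 M) x) \<partial>lborel)"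
  by (rule law) measurable
 also have "\<dots> \<le> (\<integral>\<^sup>+x. ennreal (exp (M + 1)) * (ennreal (?p (x - z)) * F x) \<partial>lborel)"
 proof (rule nn_integral_mono)
  fix x :: 'a
  show "ennreal (?p x) * (F x * indicator (cball 0 M) x) \<le> ennreal (exp (M + 1)) * (ennreal (?p (x - z)) * F x)"
  proof (cases "x \<in> cball 0 M")
   case True
   then have "ennreal (?p x) \<le> ennreal (exp (M + 1)) * ennreal (?p (x - z))"
    using gauss_shift_le[OF z, of x M] by (simp add: ennreal_mult[symmetric] prod_nonneg ennreal_leI)
   then show ?thesis using True by (simp add: mult.assoc[symmetric] mult_right_mono)
  qed simp
 qed
 also have "\<dots> = ennreal (exp (M + 1)) * (\<integral>\<^sup>+x. ennreal (?p (x - z)) * F x \<partial>lborel)"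
  by (rule nn_integral_cmult) auto
 also have "(\<integral>\<^sup>+x. ennreal (?p (x - z)) * F x \<partial>lborel) = (\<integral>\<^sup>+x. ennreal (?p (x - z)) * F x \<partial>distr lborel borel ((+) z))"
  by (simp only: lborel_distr_plus)
 also have "\<dots> = (\<integral>\<^sup>+x. ennreal (?p x) * F (z + x) \<partial>lborel)" by (subst nn_integral_distr) auto
 also have "\<dots> = (\<integral>\<^sup>+w. F (z + Z 1 w) \<partial>W)" by (rule law[symmetric]) measurable
 finally have 1: "fk W Z v 1 0 F \<le> ennreal (exp (M + 1)) * (\<integral>\<^sup>+w. F (z + Z 1 w) \<partial>W) + emeasure W B" by (simp add: add_right_mono)
 have 2: "(\<integral>\<^sup>+w. F (z + Z 1 w) \<partial>W) \<le> ennreal (exp S) * fk W Z v 1 z F + ennreal ?t"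
 proof (rule fk_one_lower[OF v F F1 S M])
  fix u assume "u \<in> cball z M"
  then show "v u \<le> ennreal S" using z dist_triangle[of 0 u z] by (intro bd) simp
 qed
 have "emeasure W B \<le> ennreal (exp (M + 1) * ?t)"
  using B(2) t0 M mult_right_mono[of 1 "exp (M + 1)" ?t] by (auto simp: emeasure_eq_measure intro!: ennreal_leI)
 from order_trans[OF 1 add_mono[OF mult_left_mono[OF 2] this]]
 have "fk W Z v 1 0 F \<le> (ennreal (exp (M + 1)) * ennreal (exp S)) * fk W Z v 1 z F + (ennreal (exp (M + 1)) * ennreal ?t + ennreal (exp (M + 1) * ?t))"
  by (simp only: zero_le distrib_left mult.assoc add.assoc)
 also have "ennreal (exp (M + 1)) * ennreal (exp S) = ennreal (exp (M + 1 + S))"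
  by (simp add: ennreal_mult[symmetric] mult_exp_exp)
 also have "ennreal (exp (M + 1)) * ennreal ?t + ennreal (exp (M + 1) * ?t) = ennreal (2 * exp (M + 1) * ?t)"
  using t0 by (simp add: ennreal_mult[symmetric] ennreal_plus[symmetric] del: ennreal_plus)
 finally show ?thesis unfolding markov .
qed

end

section \<open>The annealed price of visiting distinct cells\<close>

locale lacoin_env = marked_poisson \<nu> P for \<nu> :: "real measure" and P :: "('a::euclidean_space \<times> real) set measure" +
 fixes \<delta> \<gamma> :: real
 assumes \<delta>_pos: "\<delta> > 0" and \<gamma>_pos: "\<gamma> > 0" and exponents: "\<gamma> + \<delta> - real DIM('a) > 0"
  and radius_tail: "\<And>r. 1 \<le> r \<Longrightarrow> measure \<nu> {r..} = r powr (- \<delta>)"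
begin

lemma radius_interval:
 assumes "1 \<le> a" "a \<le> b" shows "emeasure \<nu> {a..<b} = ennreal (a powr (- \<delta>) - b powr (- \<delta>))"
proof -
 have "{a..<b} = {a..} - {b..}" using assms by auto
 then have "measure \<nu> {a..<b} = measure \<nu> {a..} - measure \<nu> {b..}"
  using assms by (simp only:) (rule nu.finite_measure_Diff, auto simp: sets_nu)
 then show ?thesis using assms by (simp add: nu.emeasure_eq_measure radius_tail)
qed

text \<open>The half-open unit cube of the integer lattice around \<open>x\<close>; points whose
  coordinates differ in one integer part have disjoint cells.\<close>

definition cell :: "'a \<Rightarrow> 'a set" where
 "cell x = {y. \<forall>b\<in>Basis. \<lfloor>y \<bullet> b\<rfloor> = \<lfloor>x \<bullet> b\<rfloor>}"

lemma cell_measurable [measurable]: "cell x \<in> sets borel"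
proof -
 have "cell x = {y \<in> space borel. \<forall>b\<in>Basis. \<lfloor>y \<bullet> b\<rfloor> = \<lfloor>x \<bullet> b\<rfloor>}" by (auto simp: cell_def)
 also have "\<dots> \<in> sets borel" by measurable
 finally show ?thesis .
qed

lemma cell_volume: "emeasure lborel (cell x) = 1"
proof -
 define l where "l = (\<Sum>b\<in>Basis. of_int \<lfloor>x \<bullet> b\<rfloor> *\<^sub>R b)"
 define u where "u = l + (\<Sum>b\<in>Basis. b)"
 have l: "l \<bullet> b = of_int \<lfloor>x \<bullet> b\<rfloor>" if "b \<in> Basis" for b using that by (simp add: l_def inner_sum_left_Basis)
 have u: "u \<bullet> b = of_int \<lfloor>x \<bullet> b\<rfloor> + 1" if "b \<in> Basis" for b
 proof -
  have "(\<Sum>b\<in>Basis. b) \<bullet> b = (\<Sum>b'\<in>Basis. 1 *\<^sub>R b') \<bullet> b" by simp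
  also have "\<dots> = 1" using that by (simp only: inner_sum_left_Basis)
  finally show ?thesis using l[OF that] by (simp add: u_def inner_add_left)
 qed
 have p: "(\<Prod>b\<in>Basis. (u - l) \<bullet> b) = 1" by (rule prod.neutral) (auto simp: inner_diff_left l u)
 have "emeasure lborel (box l u) = 1" "emeasure lborel (cbox l u) = 1"
  by (simp_all add: emeasure_lborel_box_eq emeasure_lborel_cbox_eq l u p)
 moreover have "box l u \<subseteq> cell x" unfolding box_def cell_def by (auto simp: l u floor_eq_iff less_imp_le)
 moreover have "cell x \<subseteq> cbox l u" unfolding cbox_def cell_def by (auto simp: l u floor_eq_iff less_imp_le)
 ultimately show ?thesis
  using emeasure_mono[of "box l u" "cell x" lborel] emeasure_mono[of "cell x" "cbox l u" lborel] by (simp add: antisym)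
qed

lemma cell_near: "y \<in> cell x \<Longrightarrow> norm (x - y) \<le> real DIM('a)"
proof -
 assume y: "y \<in> cell x"
 have "\<bar>(x - y) \<bullet> b\<bar> \<le> 1" if "b \<in> Basis" for b
 proof -
  have "\<lfloor>y \<bullet> b\<rfloor> = \<lfloor>x \<bullet> b\<rfloor>" using y that by (auto simp: cell_def)
  then show ?thesis unfolding inner_diff_left by linarith
 qed
 then have "(\<Sum>b\<in>Basis. \<bar>(x - y) \<bullet> b\<bar>) \<le> (\<Sum>b\<in>(Basis::'a set). 1)" by (rule sum_mono)
 then show ?thesis using norm_le_l1[of "x - y"] by simp
qed

lemma lacoin_ge_point:
 assumes "(y, r) \<in> \<eta>" "dist y x < r"
 shows "ennreal (r powr (- \<gamma>)) \<le> lacoin \<gamma> x \<eta>"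
proof -
 have "(case (y, r) of (y, r) \<Rightarrow> ennreal (r powr (-\<gamma>)) * indicator (ball y r) x) \<le> lacoin \<gamma> x \<eta>"
  unfolding lacoin_def by (rule nn_integral_ge_point) (rule assms(1))
 then show ?thesis using assms(2) by simp
qed

lemma npoints_pos: "npoints A \<eta> \<noteq> 0 \<Longrightarrow> \<exists>p\<in>\<eta>. p \<in> A"
proof (rule ccontr)
 assume 0: "npoints A \<eta> \<noteq> 0" and "\<not> (\<exists>p\<in>\<eta>. p \<in> A)"
 then have "\<eta> \<inter> A = {}" by blast
 with 0 show False by (simp add: npoints_def zero_enat_def)
qed

text \<open>A point in the cell of \<open>f (real j)\<close> with radius at least \<rho>0 covers the
  path throughout the next unit of time, since \<rho>0 exceeds the oscillation plus the width of a
  cell. The upper end \<rho>1 of the radius window bounds its height from below.\<close>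

lemma quenched_path_bound:
 assumes J: "J \<subseteq> {..<n}" and f [measurable]: "f \<in> borel_measurable borel"
  and good: "\<And>j s. j \<in> J \<Longrightarrow> s \<in> {0..1} \<Longrightarrow> norm (f (real j + s) - f (real j)) \<le> \<rho>"
  and \<rho>: "0 \<le> \<rho>" "\<rho> + real DIM('a) < \<rho>0" "\<rho>0 \<le> \<rho>1" and w: "\<eta> \<in> configs"
 shows "(\<Sum>j\<in>J. if npoints (cell (f (real j)) \<times> {\<rho>0..<\<rho>1}) \<eta> = 0 then 0 else ennreal (\<rho>1 powr (- \<gamma>)))
  \<le> (\<integral>\<^sup>+s\<in>{0..real n}. lacoin \<gamma> (f s) \<eta> \<partial>lborel)"
proof -
 have fJ: "finite J" using J finite_subset by auto
 have wm: "(\<lambda>s. lacoin \<gamma> (f s) \<eta>) \<in> borel_measurable borel" by (rule borel_measurable_lacoin) (use w in auto)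
 have "(\<Sum>j\<in>J. if npoints (cell (f (real j)) \<times> {\<rho>0..<\<rho>1}) \<eta> = 0 then 0 else ennreal (\<rho>1 powr (- \<gamma>)))
  \<le> (\<Sum>j\<in>J. \<integral>\<^sup>+s. lacoin \<gamma> (f s) \<eta> * indicator {real j..<real j + 1} s \<partial>lborel)"
 proof (rule sum_mono)
  fix j assume j: "j \<in> J"
  show "(if npoints (cell (f (real j)) \<times> {\<rho>0..<\<rho>1}) \<eta> = 0 then 0 else ennreal (\<rho>1 powr (- \<gamma>)))
   \<le> (\<integral>\<^sup>+s. lacoin \<gamma> (f s) \<eta> * indicator {real j..<real j + 1} s \<partial>lborel)"
  proof (cases "npoints (cell (f (real j)) \<times> {\<rho>0..<\<rho>1}) \<eta> = 0")
   case False
   then obtain y r where p: "(y, r) \<in> \<eta>" "y \<in> cell (f (real j))" "\<rho>0 \<le> r" "r < \<rho>1"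
    using npoints_pos by fastforce
   have r0: "0 < r" using p \<rho> by (simp add: add_nonneg_nonneg le_less_trans less_le_trans)
   have "ennreal (\<rho>1 powr (- \<gamma>)) \<le> lacoin \<gamma> (f s) \<eta>" if s: "s \<in> {real j..<real j + 1}" for s
   proof -
    have "norm (f s - f (real j)) \<le> \<rho>" using good[OF j, of "s - real j"] s by auto
    then have "dist y (f s) < r"
     using cell_near[OF p(2)] norm_triangle_ineq[of "f s - f (real j)" "f (real j) - y"] p \<rho>
     by (simp add: dist_norm norm_minus_commute)
    then have "ennreal (r powr (- \<gamma>)) \<le> lacoin \<gamma> (f s) \<eta>" by (rule lacoin_ge_point[OF p(1)])
    moreover have "\<rho>1 powr (- \<gamma>) \<le> r powr (- \<gamma>)" using p r0 \<gamma>_pos by (intro powr_mono2') auto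
    ultimately show ?thesis by (meson ennreal_leI order_trans)
   qed
   then have "(\<integral>\<^sup>+s. ennreal (\<rho>1 powr (- \<gamma>)) * indicator {real j..<real j + 1} s \<partial>lborel)
    \<le> (\<integral>\<^sup>+s. lacoin \<gamma> (f s) \<eta> * indicator {real j..<real j + 1} s \<partial>lborel)"
    by (intro nn_integral_mono) (auto simp: indicator_def)
   then show ?thesis using False by (subst (asm) nn_integral_cmult_indicator) auto
  qed simp
 qed
 also have "\<dots> = (\<integral>\<^sup>+s. (\<Sum>j\<in>J. lacoin \<gamma> (f s) \<eta> * indicator {real j..<real j + 1} s) \<partial>lborel)"
  using wm by (intro nn_integral_sum[symmetric]) auto
 also have "\<dots> \<le> (\<integral>\<^sup>+s\<in>{0..real n}. lacoin \<gamma> (f s) \<eta> \<partial>lborel)"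
 proof (rule nn_integral_mono)
  fix s :: real
  have "(\<Sum>j\<in>J. indicator {real j..<real j + 1} s) = (indicator (\<Union>j\<in>J. {real j..<real j + 1}) s :: ennreal)"
  proof (rule indicator_UN_disjoint[symmetric, OF fJ])
   show "disjoint_family_on (\<lambda>j. {real j..<real j + 1}) J" by (auto simp: disjoint_family_on_def)
  qed
  also have "\<dots> \<le> indicator {0..real n} s"
  proof -
   have "real j + 1 \<le> real n" if "j \<in> J" for j using J that by (metis Suc_leI add.commute lessThan_iff of_nat_Suc of_nat_le_iff subsetD)
   then show ?thesis by (fastforce simp: indicator_def)
  qed
  finally show "(\<Sum>j\<in>J. lacoin \<gamma> (f s) \<eta> * indicator {real j..<real j + 1} s) \<le> lacoin \<gamma> (f s) \<eta> * indicator {0..real n} s"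
   by (simp add: sum_distrib_left[symmetric] mult_left_mono)
 qed
 finally show ?thesis .
qed

text \<open>Disjoint cells have independent counts. A cell has volume 1, so its mean count is the
  mass of the radius window, and each factor is 1 when the cell is empty and
  \<open>exp (- \<epsilon>)\<close> otherwise.\<close>

lemma annealed_cells:
 assumes J: "finite J" and x: "\<And>i j. i \<in> J \<Longrightarrow> j \<in> J \<Longrightarrow> i \<noteq> j \<Longrightarrow> cell (x i) \<inter> cell (x j) = {}"
  and \<rho>: "1 \<le> \<rho>0" "\<rho>0 \<le> \<rho>1" and \<epsilon>: "0 \<le> \<epsilon>"
 shows "(\<integral>\<^sup>+\<eta>. ennreal (exp_neg (\<Sum>j\<in>J. if npoints (cell (x j) \<times> {\<rho>0..<\<rho>1}) \<eta> = 0 then 0 else ennreal \<epsilon>)) \<partial>P)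
  = ennreal ((exp (- \<epsilon>) + (1 - exp (- \<epsilon>)) * exp (- (\<rho>0 powr (- \<delta>) - \<rho>1 powr (- \<delta>)))) ^ card (J :: nat set))"
proof -
 let ?A = "\<lambda>j. if j \<in> J then cell (x j) \<times> {\<rho>0..<\<rho>1} else {}"
 let ?g = "\<lambda>k::enat. if k = 0 then 1 else ennreal (exp (- \<epsilon>))"
 let ?\<theta> = "\<rho>0 powr (- \<delta>) - \<rho>1 powr (- \<delta>)"
 have \<theta>: "0 \<le> ?\<theta>" using \<rho> \<delta>_pos by (simp add: powr_mono2')
 have As: "range ?A \<subseteq> sets borel" by (auto simp: borel_prod[symmetric])
 have dis: "disjoint_family ?A" using x by (auto simp: disjoint_family_on_def)
 have "indep_vars (\<lambda>_. count_space UNIV) (\<lambda>i. npoints (?A i)) J"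
  by (rule indep_vars_subset[OF indep_npoints[OF As dis]]) auto
 then have "indep_vars (\<lambda>_. borel) (\<lambda>j \<eta>. ?g (npoints (?A j) \<eta>)) J" by (rule indep_vars_compose2) auto
 from indep_vars_nn_integral[OF J this]
 have expec: "(\<integral>\<^sup>+\<eta>. (\<Prod>j\<in>J. ?g (npoints (?A j) \<eta>)) \<partial>P) = (\<Prod>j\<in>J. \<integral>\<^sup>+\<eta>. ?g (npoints (?A j) \<eta>) \<partial>P)" by simp
 have weights: "ennreal (exp_neg (\<Sum>j\<in>J. if npoints (cell (x j) \<times> {\<rho>0..<\<rho>1}) \<eta> = 0 then 0 else ennreal \<epsilon>)) = (\<Prod>j\<in>J. ?g (npoints (?A j) \<eta>))" for \<eta>
 proof -
  have "ennreal (exp_neg (\<Sum>j\<in>K. if npoints (cell (x j) \<times> {\<rho>0..<\<rho>1}) \<eta> = 0 then 0 else ennreal \<epsilon>)) = (\<Prod>j\<in>K. ?g (npoints (cell (x j) \<times> {\<rho>0..<\<rho>1}) \<eta>))" if "finite K" for K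
   using that by (induction K) (auto simp: exp_neg_add ennreal_mult exp_neg_nonneg exp_neg_ennreal \<epsilon>)
  then show ?thesis using J by (simp cong: prod.cong)
 qed
 have single: "(\<integral>\<^sup>+\<eta>. ?g (npoints (?A j) \<eta>) \<partial>P) = ennreal (exp (- \<epsilon>) + (1 - exp (- \<epsilon>)) * exp (- ?\<theta>))" if j: "j \<in> J" for j
 proof -
  let ?B = "cell (x j) \<times> {\<rho>0..<\<rho>1}"
  have B: "?B \<in> sets borel" by (auto simp: borel_prod[symmetric])
  have lam: "emeasure \<Lambda> ?B = ennreal ?\<theta>"
   by (subst emeasure_intensity_Times) (auto simp: cell_volume radius_interval \<rho>)
  have p0: "prob {\<eta> \<in> space P. npoints ?B \<eta> = 0} = exp (- ?\<theta>)"
   using prob_npoints[OF B, of 0] lam \<theta> by (simp add: zero_enat_def measure_def)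
  have e0 [measurable]: "{\<eta> \<in> space P. npoints ?B \<eta> = 0} \<in> events"
  proof -
   have "npoints ?B -` {0} \<inter> space P \<in> events" by (rule measurable_sets[OF measurable_npoints_P[OF B]]) auto
   moreover have "npoints ?B -` {0} \<inter> space P = {\<eta> \<in> space P. npoints ?B \<eta> = 0}" by auto
   ultimately show ?thesis by simp
  qed
  note e0' [measurable] = e0[unfolded space_P]
  have "(\<integral>\<^sup>+\<eta>. ?g (npoints (?A j) \<eta>) \<partial>P) = (\<integral>\<^sup>+\<eta>. ennreal (exp (- \<epsilon>)) + ennreal (1 - exp (- \<epsilon>)) * indicator {\<eta> \<in> space P. npoints ?B \<eta> = 0} \<eta> \<partial>P)"
   using \<epsilon> by (intro nn_integral_cong) (auto simp: j indicator_def ennreal_plus[symmetric] simp del: ennreal_plus)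
  also have "\<dots> = ennreal (exp (- \<epsilon>)) + ennreal (1 - exp (- \<epsilon>)) * emeasure P {\<eta> \<in> space P. npoints ?B \<eta> = 0}"
   by (subst nn_integral_add) (use emeasure_space_1[unfolded space_P] e0' in \<open>auto simp: nn_integral_cmult_indicator\<close>)
  also have "\<dots> = ennreal (exp (- \<epsilon>) + (1 - exp (- \<epsilon>)) * exp (- ?\<theta>))"
   using \<epsilon> p0 by (simp add: emeasure_eq_measure ennreal_mult[symmetric] ennreal_plus[symmetric] del: ennreal_plus)
  finally show ?thesis .
 qed
 define c where "c = exp (- \<epsilon>) + (1 - exp (- \<epsilon>)) * exp (- ?\<theta>)"
 have "(\<integral>\<^sup>+\<eta>. ennreal (exp_neg (\<Sum>j\<in>J. if npoints (cell (x j) \<times> {\<rho>0..<\<rho>1}) \<eta> = 0 then 0 else ennreal \<epsilon>)) \<partial>P) = (\<Prod>j\<in>J. ennreal c)"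
  unfolding weights expec by (rule prod.cong[OF refl]) (unfold c_def, rule single)
 moreover have "0 \<le> c" unfolding c_def using \<epsilon> by (intro add_nonneg_nonneg mult_nonneg_nonneg) auto
 ultimately show ?thesis unfolding c_def[symmetric] by (simp add: ennreal_power)
qed

end

section \<open>Overshoots and records of a coordinate\<close>

text \<open>Convexity of the exponential between 0 and \<open>x\<close>. It trades a small exponent
  \<theta> for the full exponential moment with the small factor \<theta>.\<close>

lemma exp_interpolate:
 fixes x :: real
 assumes "0 \<le> \<theta>" "\<theta> \<le> 1" shows "exp (\<theta> * x) \<le> (1 - \<theta>) + \<theta> * exp x"
proof -
 have "exp ((1 - \<theta>) *\<^sub>R 0 + \<theta> *\<^sub>R x) \<le> (1 - \<theta>) * exp 0 + \<theta> * exp x"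
  by (rule convex_onD[OF exp_convex]) (use assms in auto)
 then show ?thesis by simp
qed

lemma overshoot_summable: "summable (\<lambda>k. exp (real k + 1 - (real k)\<^sup>2 / 2))"
proof (rule summable_comparison_test')
 show "summable (\<lambda>k. exp 3 * exp (- 1) ^ k :: real)" by (intro summable_mult summable_geometric) simp
 fix k :: nat
 have "real k + 1 - (real k)\<^sup>2 / 2 \<le> 3 + real k * (- 1)"
  using zero_le_power2[of "real k - 2"] by (simp add: power2_diff)
 then have "exp (real k + 1 - (real k)\<^sup>2 / 2) \<le> exp 3 * exp (real k * (- 1))" by (simp only: exp_add[symmetric] exp_le_cancel_iff)
 then show "norm (exp (real k + 1 - (real k)\<^sup>2 / 2)) \<le> exp 3 * exp (- 1) ^ k"
  by (simp only: exp_of_nat_mult) simp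
qed

text \<open>An integer overshoot of \<open>k + 1\<close> has weight \<open>exp (k + 1)\<close>, and
  by \<open>normal_tail_ratio\<close> the chance to get that far, given that the level is passed, is
  at most \<open>exp (- k\<^sup>2 / 2)\<close>.\<close>

definition overshoot_const :: real where
 "overshoot_const = (\<Sum>k. exp (real k + 1 - (real k)\<^sup>2 / 2))"

text \<open>A Gaussian step that exceeds a level does so by an amount with uniformly bounded exponential
 moment, whatever the distance to the level was.\<close>

lemma gaussian_overshoot:
 fixes l :: int
 assumes u: "u < of_int l + 1" and \<theta>: "0 \<le> \<theta>" "\<theta> \<le> 1" and \<beta>: "0 \<le> \<beta>" "\<beta> * (1 + \<theta> * overshoot_const) \<le> 1"
 shows "(\<integral>\<^sup>+x. ennreal (if l < \<lfloor>u + x\<rfloor> then \<beta> * exp (\<theta> * of_int (\<lfloor>u + x\<rfloor> - l)) else 1) * ennreal (normal_density 0 1 x) \<partial>lborel) \<le> 1"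
proof -
 define v where "v = of_int l + 1 - u"
 have v: "0 \<le> v" using u by (simp add: v_def)
 let ?n = "\<lambda>x. ennreal (normal_density 0 1 x)"
 define T where "T = (\<integral>\<^sup>+x\<in>{v..}. ?n x \<partial>lborel)"
 let ?c = "\<lambda>k. ennreal (\<beta> * \<theta> * exp (real k + 1))"
 have C: "(\<Sum>k. ennreal (exp (real k + 1 - (real k)\<^sup>2 / 2))) = ennreal overshoot_const"
  unfolding overshoot_const_def by (rule suminf_ennreal2) (auto intro: overshoot_summable)
 have C0: "0 \<le> overshoot_const" unfolding overshoot_const_def by (intro suminf_nonneg overshoot_summable) simp
 \<comment> \<open>Steps below \<open>v\<close>, the distance to the next level, count 1. Beyond
   \<open>v\<close>, \<open>exp_interpolate\<close> leaves a constant part and a multiple of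
   \<theta>, and the latter is summed over the possible integer overshoots.\<close>
 have pt: "ennreal (if l < \<lfloor>u + x\<rfloor> then \<beta> * exp (\<theta> * of_int (\<lfloor>u + x\<rfloor> - l)) else 1) * ?n x
  \<le> ?n x * indicator {..<v} x + (ennreal (\<beta> * (1 - \<theta>)) * (?n x * indicator {v..} x) + (\<Sum>k. ?c k * (?n x * indicator {v + real k..} x)))" for x
 proof (cases "l < \<lfloor>u + x\<rfloor>")
  case False
  then have "x < v" unfolding v_def by linarith
  then show ?thesis using False by (auto simp: add_increasing2)
 next
  case True
  define J where "J = \<lfloor>u + x\<rfloor> - l"
  define k where "k = nat (J - 1)"
  have J: "1 \<le> J" "J = int k + 1" using True by (auto simp: J_def k_def)
  have xk: "v + real k \<le> x" using J unfolding J_def v_def by linarith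
  then have xv: "v \<le> x" by simp
  have "exp (\<theta> * of_int J) \<le> (1 - \<theta>) + \<theta> * exp (of_int J)" by (rule exp_interpolate[OF \<theta>])
  then have "\<beta> * exp (\<theta> * of_int J) \<le> \<beta> * (1 - \<theta>) + \<beta> * \<theta> * exp (real k + 1)"
   using \<beta>(1) mult_left_mono[OF _ \<beta>(1)] J(2) by (fastforce simp: algebra_simps)
  then have "ennreal (\<beta> * exp (\<theta> * of_int J)) * ?n x \<le> (ennreal (\<beta> * (1 - \<theta>)) + ?c k) * ?n x"
   using \<beta>(1) \<theta> by (intro mult_right_mono) (auto simp: ennreal_plus[symmetric] simp del: ennreal_plus intro!: ennreal_leI)
  also have "\<dots> = ennreal (\<beta> * (1 - \<theta>)) * ?n x + ?c k * (?n x * indicator {v + real k..} x)"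
   using xk by (simp add: distrib_right)
  also have "\<dots> \<le> ennreal (\<beta> * (1 - \<theta>)) * ?n x + (\<Sum>k. ?c k * (?n x * indicator {v + real k..} x))"
  proof (rule add_left_mono)
   have "(\<Sum>i\<in>{k}. ?c i * (?n x * indicator {v + real i..} x)) \<le> (\<Sum>k. ?c k * (?n x * indicator {v + real k..} x))"
    by (rule sum_le_suminf) auto
   then show "?c k * (?n x * indicator {v + real k..} x) \<le> (\<Sum>k. ?c k * (?n x * indicator {v + real k..} x))" by simp
  qed
  finally show ?thesis using True xv by (simp add: J_def)
 qed
 have "(\<integral>\<^sup>+x. ennreal (if l < \<lfloor>u + x\<rfloor> then \<beta> * exp (\<theta> * of_int (\<lfloor>u + x\<rfloor> - l)) else 1) * ?n x \<partial>lborel)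
  \<le> (\<integral>\<^sup>+x. ?n x * indicator {..<v} x + (ennreal (\<beta> * (1 - \<theta>)) * (?n x * indicator {v..} x) + (\<Sum>k. ?c k * (?n x * indicator {v + real k..} x))) \<partial>lborel)"
  by (rule nn_integral_mono) (rule pt)
 also have "\<dots> = (\<integral>\<^sup>+x\<in>{..<v}. ?n x \<partial>lborel) + (ennreal (\<beta> * (1 - \<theta>)) * T + (\<Sum>k. ?c k * (\<integral>\<^sup>+x\<in>{v + real k..}. ?n x \<partial>lborel)))"
  unfolding T_def by (simp add: nn_integral_add nn_integral_cmult nn_integral_suminf)
 also have "\<dots> \<le> (\<integral>\<^sup>+x\<in>{..<v}. ?n x \<partial>lborel) + (ennreal (\<beta> * (1 - \<theta>)) * T + ennreal (\<beta> * \<theta> * overshoot_const) * T)"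
 proof (intro add_left_mono)
  have "(\<Sum>k. ?c k * (\<integral>\<^sup>+x\<in>{v + real k..}. ?n x \<partial>lborel)) \<le> (\<Sum>k. (ennreal (\<beta> * \<theta>) * T) * ennreal (exp (real k + 1 - (real k)\<^sup>2 / 2)))"
  proof (rule suminf_le)
   fix k :: nat
   have "?c k * (\<integral>\<^sup>+x\<in>{v + real k..}. ?n x \<partial>lborel) \<le> ?c k * (ennreal (exp (- (real k)\<^sup>2 / 2)) * T)"
    using normal_tail_ratio[OF v, of "real k" 1] by (intro mult_left_mono) (auto simp: T_def)
   also have "\<dots> = (ennreal (\<beta> * \<theta>) * T) * ennreal (exp (real k + 1) * exp (- (real k)\<^sup>2 / 2))"
    using \<beta> \<theta> by (simp add: ennreal_mult ac_simps)
   also have "exp (real k + 1) * exp (- (real k)\<^sup>2 / 2) = exp (real k + 1 - (real k)\<^sup>2 / 2)"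
    by (simp add: exp_add[symmetric])
   finally show "?c k * (\<integral>\<^sup>+x\<in>{v + real k..}. ?n x \<partial>lborel) \<le> (ennreal (\<beta> * \<theta>) * T) * ennreal (exp (real k + 1 - (real k)\<^sup>2 / 2))" .
  qed auto
  also have "\<dots> = ennreal (\<beta> * \<theta>) * T * ennreal overshoot_const" by (simp add: C)
  also have "\<dots> = ennreal (\<beta> * \<theta> * overshoot_const) * T" using \<beta> \<theta> C0 by (simp add: ennreal_mult ac_simps)
  finally show "(\<Sum>k. ?c k * (\<integral>\<^sup>+x\<in>{v + real k..}. ?n x \<partial>lborel)) \<le> ennreal (\<beta> * \<theta> * overshoot_const) * T" .
 qed
 also have "\<dots> = (\<integral>\<^sup>+x\<in>{..<v}. ?n x \<partial>lborel) + ennreal (\<beta> * (1 - \<theta>) + \<beta> * \<theta> * overshoot_const) * T"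
  using \<beta> \<theta> C0 by (simp add: distrib_right)
 also have "\<dots> \<le> (\<integral>\<^sup>+x\<in>{..<v}. ?n x \<partial>lborel) + 1 * T"
 proof (intro add_left_mono mult_right_mono)
  have "\<beta> * (1 - \<theta>) + \<beta> * \<theta> * overshoot_const \<le> \<beta> * (1 + \<theta> * overshoot_const)"
   using \<beta>(1) \<theta> by (simp add: algebra_simps)
  then show "ennreal (\<beta> * (1 - \<theta>) + \<beta> * \<theta> * overshoot_const) \<le> 1" using \<beta>(2) by simp
 qed simp
 also have "\<dots> = (\<integral>\<^sup>+x. ?n x * indicator {..<v} x + ?n x * indicator {v..} x \<partial>lborel)"
  unfolding T_def by (simp add: nn_integral_add)
 also have "\<dots> = (\<integral>\<^sup>+x. ?n x \<partial>lborel)" by (intro nn_integral_cong) (auto simp: indicator_def)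
 also have "\<dots> = 1" by (rule nn_integral_normal_density) simp
 finally show ?thesis .
qed

primrec lev :: "'a::euclidean_space \<Rightarrow> (real \<Rightarrow> 'a) \<Rightarrow> nat \<Rightarrow> int" where
 "lev e f 0 = \<lfloor>f 0 \<bullet> e\<rfloor>"
| "lev e f (Suc n) = max (lev e f n) \<lfloor>f (real (Suc n)) \<bullet> e\<rfloor>"

definition record_at :: "'a::euclidean_space \<Rightarrow> (real \<Rightarrow> 'a) \<Rightarrow> nat \<Rightarrow> bool" where
 "record_at e f n \<longleftrightarrow> (case n of 0 \<Rightarrow> False | Suc m \<Rightarrow> lev e f m < \<lfloor>f (real n) \<bullet> e\<rfloor>)"

text \<open>Testing dyadic times only keeps the event measurable on \<open>path_space\<close>; by
  continuity it controls the whole unit of time after \<open>n\<close>.\<close>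

definition calm :: "real \<Rightarrow> (real \<Rightarrow> 'a::euclidean_space) \<Rightarrow> nat \<Rightarrow> bool" where
 "calm \<rho> f n \<longleftrightarrow> (\<forall>s\<in>dyadic_times \<inter> {0..1}. norm (f (real n + s) - f (real n)) \<le> \<rho>)"

text \<open>A factor \<kappa> for every calm record before time \<open>n\<close>. A record at time
  \<open>n\<close> itself is not charged yet, because its calmness depends on the path after
  \<open>n\<close>.\<close>

primrec record_weight :: "real \<Rightarrow> real \<Rightarrow> 'a::euclidean_space \<Rightarrow> (real \<Rightarrow> 'a) \<Rightarrow> nat \<Rightarrow> real" where
 "record_weight \<kappa> \<rho> e f 0 = 1"
| "record_weight \<kappa> \<rho> e f (Suc n) = record_weight \<kappa> \<rho> e f n * (if record_at e f n \<and> calm \<rho> f n then \<kappa> else 1)"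

lemma lev_ge: "j \<le> n \<Longrightarrow> \<lfloor>f (real j) \<bullet> e\<rfloor> \<le> lev e f n" by (induction n) (auto simp: le_Suc_eq max.coboundedI1)

lemma record_weight_eq: "record_weight \<kappa> \<rho> e f n = \<kappa> ^ card {j \<in> {..<n}. record_at e f j \<and> calm \<rho> f j}"
proof (induction n)
 case (Suc n)
 have "{j \<in> {..<Suc n}. record_at e f j \<and> calm \<rho> f j}
  = (if record_at e f n \<and> calm \<rho> f n then insert n {j \<in> {..<n}. record_at e f j \<and> calm \<rho> f j} else {j \<in> {..<n}. record_at e f j \<and> calm \<rho> f j})"
  by (auto simp: less_Suc_eq)
 then show ?case using Suc by simp
qed simp

lemma record_weight_nonneg: "0 \<le> \<kappa> \<Longrightarrow> 0 \<le> record_weight \<kappa> \<rho> e f n" by (simp add: record_weight_eq)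

text \<open>The later record exceeds the running maximum and hence the level of the earlier one.
  Different levels mean disjoint cells, whatever the other coordinates do.\<close>

lemma records_distinct:
 assumes "record_at e f i" "record_at e f j" "i \<noteq> j"
 shows "\<lfloor>f (real i) \<bullet> e\<rfloor> \<noteq> \<lfloor>f (real j) \<bullet> e\<rfloor>"
proof -
 have *: "\<lfloor>f (real i) \<bullet> e\<rfloor> < \<lfloor>f (real j) \<bullet> e\<rfloor>" if r: "record_at e f j" "i < j" for i j
 proof -
  obtain m where m: "j = Suc m" "lev e f m < \<lfloor>f (real j) \<bullet> e\<rfloor>"
   using r(1) by (cases j) (auto simp: record_at_def)
  have "\<lfloor>f (real i) \<bullet> e\<rfloor> \<le> lev e f m" by (rule lev_ge) (use r m in auto)
  then show ?thesis using m by simp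
 qed
 show ?thesis using *[of j i] *[of i j] assms by (cases i j rule: linorder_cases) auto
qed

lemma nat_add_dyadic: "s \<in> dyadic_times \<Longrightarrow> real n + s \<in> dyadic_times"
proof -
 assume "s \<in> dyadic_times"
 then obtain j m where "s = real j / 2 ^ m" by (auto simp: dyadic_times_def)
 then have "real n + s = real (n * 2 ^ m + j) / 2 ^ m" by (simp add: field_simps)
 then show ?thesis by (metis dyadic_timesI)
qed

lemma countable_dyadic_times: "countable dyadic_times"
proof -
 have "dyadic_times = (\<lambda>(j, m). real j / 2 ^ m) ` (UNIV :: (nat \<times> nat) set)" by (auto simp: dyadic_times_def)
 then show ?thesis by (metis countable_image countableI_type)
qed

lemma path_component_measurable:
 "t \<in> dyadic_times \<Longrightarrow> (\<lambda>\<xi>. \<xi> t) \<in> borel_measurable path_space"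
 unfolding path_space_def by (rule measurable_component_singleton)

lemma lev_measurable: "(\<lambda>\<xi>. real_of_int (lev e \<xi> n)) \<in> borel_measurable path_space"
proof (induction n)
 case 0
 have [measurable]: "(\<lambda>\<xi>. \<xi> 0) \<in> borel_measurable path_space" using path_component_measurable[OF nat_in_dyadic_times[of 0]] by simp
 then have "(\<lambda>\<xi>. \<xi> 0 \<bullet> e) \<in> borel_measurable path_space" by simp
 from measurable_compose[OF this borel_measurable_real_floor] show ?case by simp
next
 case (Suc n)
 have "(\<lambda>\<xi>. \<xi> (real (Suc n))) \<in> borel_measurable path_space" by (rule path_component_measurable[OF nat_in_dyadic_times])
 then have "(\<lambda>\<xi>. \<xi> (real (Suc n)) \<bullet> e) \<in> borel_measurable path_space" by (rule borel_measurable_inner) simp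
 from borel_measurable_max[OF Suc measurable_compose[OF this borel_measurable_real_floor]]
 show ?case by (simp add: of_int_max max.commute del: of_nat_Suc)
qed

lemma record_at_measurable [measurable]: "Measurable.pred path_space (\<lambda>\<xi>. record_at e \<xi> n)"
proof (cases n)
 case (Suc m)
 have "(\<lambda>\<xi>. \<xi> (real (Suc m))) \<in> borel_measurable path_space" by (rule path_component_measurable[OF nat_in_dyadic_times])
 then have "(\<lambda>\<xi>. \<xi> (real (Suc m)) \<bullet> e) \<in> borel_measurable path_space" by (rule borel_measurable_inner) simp
 from borel_measurable_pred_less[OF lev_measurable[of e m] measurable_compose[OF this borel_measurable_real_floor]]
 have "Measurable.pred path_space (\<lambda>\<xi>. real_of_int (lev e \<xi> m) < real_of_int \<lfloor>\<xi> (real (Suc m)) \<bullet> e\<rfloor>)" .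
 then show ?thesis by (simp add: record_at_def Suc)
qed (simp add: record_at_def)

lemma calm_measurable [measurable]: "Measurable.pred path_space (\<lambda>\<xi>. calm \<rho> \<xi> n)" unfolding calm_def pred_def
proof (rule sets.sets_Collect_countable_All')
 show "countable (dyadic_times \<inter> {0..1})" using countable_dyadic_times by auto
 fix s assume s: "s \<in> dyadic_times \<inter> {0..1}"
 have [measurable]: "(\<lambda>\<xi>. \<xi> (real n)) \<in> borel_measurable path_space" "(\<lambda>\<xi>. \<xi> (real n + s)) \<in> borel_measurable path_space"
  using s by (auto intro: path_component_measurable nat_in_dyadic_times nat_add_dyadic)
 show "{\<xi> \<in> space path_space. norm (\<xi> (real n + s) - \<xi> (real n)) \<le> \<rho>} \<in> sets path_space" by measurable
qed

lemma record_weight_measurable [measurable]: "(\<lambda>\<xi>. record_weight \<kappa> \<rho> e \<xi> n) \<in> borel_measurable path_space"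
 by (induction n) auto

text \<open>All functionals depend on the path up to time \<open>n\<close> only; for
  \<open>calm\<close> the index is strictly smaller because it looks one unit ahead.\<close>

lemma path_functionals_cong:
 assumes "\<And>t. t \<in> dyadic_times \<Longrightarrow> t \<le> real n \<Longrightarrow> f t = g t"
 shows "j \<le> n \<Longrightarrow> lev e f j = lev e g j" "j \<le> n \<Longrightarrow> record_at e f j = record_at e g j"
  "j < n \<Longrightarrow> calm \<rho> f j = calm \<rho> g j" "j \<le> n \<Longrightarrow> record_weight \<kappa> \<rho> e f j = record_weight \<kappa> \<rho> e g j"
proof -
 have v: "f (real j) = g (real j)" if "j \<le> n" for j using assms nat_in_dyadic_times that by simp
 show l: "j \<le> n \<Longrightarrow> lev e f j = lev e g j" for j by (induction j) (use v[of 0] v in \<open>auto simp del: of_nat_Suc\<close>)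
 show r: "j \<le> n \<Longrightarrow> record_at e f j = record_at e g j" for j
  using l v by (auto simp: record_at_def split: nat.splits simp del: of_nat_Suc)
 show c: "j < n \<Longrightarrow> calm \<rho> f j = calm \<rho> g j" for j
 proof -
  assume j: "j < n"
  have "f (real j + s) = g (real j + s)" if "s \<in> dyadic_times \<inter> {0..1}" for s
   by (rule assms[OF nat_add_dyadic]) (use that j in auto)
  then show ?thesis unfolding calm_def using v[of j] j by simp
 qed
 show "j \<le> n \<Longrightarrow> record_weight \<kappa> \<rho> e f j = record_weight \<kappa> \<rho> e g j" by (induction j) (auto simp: r c)
qed

text \<open>A supermartingale-type functional: its expectation does not increase with
  \<open>n\<close>. The factor \<beta> is an advance on a record at time \<open>n\<close> whose
  calmness is decided only in the next unit of time.\<close>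

definition record_potential :: "real \<Rightarrow> real \<Rightarrow> real \<Rightarrow> real \<Rightarrow> 'a::euclidean_space \<Rightarrow> (real \<Rightarrow> 'a) \<Rightarrow> nat \<Rightarrow> real" where
 "record_potential \<theta> \<beta> \<kappa> \<rho> e f n = exp (\<theta> * of_int (lev e f n)) * record_weight \<kappa> \<rho> e f n * (if record_at e f n then \<beta> else 1)"

lemma record_potential_measurable [measurable]:
 "(\<lambda>\<xi>. record_potential \<theta> \<beta> \<kappa> \<rho> e \<xi> n) \<in> borel_measurable path_space"
proof -
 note lev_measurable[measurable]
 show ?thesis unfolding record_potential_def by measurable
qed

context brownian
begin

lemma calm_prob:
 obtains \<rho> where "0 < \<rho>" "1 / 2 \<le> prob {w \<in> space W. calm \<rho> (sample_path Z w) 0}"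
proof -
 have "(osc_tail DIM('a) \<longlongrightarrow> 0) at_top" unfolding osc_tail_def[abs_def] by real_asymp
 then have "eventually (\<lambda>M. osc_tail DIM('a) M < 1 / 2 \<and> 0 < M) at_top"
  by (intro eventually_conj order_tendstoD(2) eventually_gt_at_top) auto
 then obtain M where M: "osc_tail DIM('a) M < 1 / 2" "0 < M" by (auto simp: eventually_at_top_linorder)
 obtain B where B: "B \<in> events" "prob B \<le> osc_tail DIM('a) M"
  "\<And>w s. w \<in> space W - B \<Longrightarrow> s \<in> {0..1} \<Longrightarrow> norm (Z (0 + s) w - Z 0 w) \<le> M"
  using oscillation_tail[of 0 M] M by auto
 have [measurable]: "{w \<in> space W. calm M (sample_path Z w) 0} \<in> events"
  using sample_path_measurable[OF grid] by measurable
 have "calm M (sample_path Z w) 0" if w: "w \<in> space W - B" for w unfolding calm_def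
 proof
  fix s assume s: "s \<in> dyadic_times \<inter> {0..1}"
  have "norm (Z (0 + s) w - Z 0 w) \<le> M" by (rule B(3)) (use w s in auto)
  then show "norm (sample_path Z w (real 0 + s) - sample_path Z w (real 0)) \<le> M"
   using s nat_in_dyadic_times[of 0] by (simp add: sample_path_def)
 qed
 then have "prob (space W - B) \<le> prob {w \<in> space W. calm M (sample_path Z w) 0}"
  by (intro finite_measure_mono) auto
 then have "1 / 2 \<le> prob {w \<in> space W. calm M (sample_path Z w) 0}" using B M prob_compl[OF B(1)] by simp
 then show thesis using M by (intro that[of M]) auto
qed

lemma nn_integral_coordinate:
 assumes e: "e \<in> Basis" and g [measurable]: "g \<in> borel_measurable borel"
 shows "(\<integral>\<^sup>+w. g (Z 1 w \<bullet> e) \<partial>W) = (\<integral>\<^sup>+x. g x * ennreal (normal_density 0 1 x) \<partial>lborel)"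
proof -
 have "(\<integral>\<^sup>+w. g (Z 1 w \<bullet> e) \<partial>W) = (\<integral>\<^sup>+x. g (x \<bullet> e) \<partial>gauss 1)"
  using nn_integral_distr[of "Z 1" W borel "\<lambda>x. g (x \<bullet> e)"] value_law[of 1] by simp
 then show ?thesis using gauss_marginal[OF e g, of 1] by simp
qed

text \<open>Condition on the path up to \<open>n\<close>. A new record raises the exponential of the
  level but brings the factor \<beta>, and by \<open>gaussian_overshoot\<close> the mean of this
  change is at most 1. If a record is pending, its advance \<beta> must be earned: calmness has
  probability at least \<open>1 / 2\<close> and then multiplies by \<kappa>, which saves at least
  \<open>(1 - \<kappa>) * \<beta> / 2\<close>.\<close>

lemma record_potential_step:
 assumes e: "e \<in> Basis" and calm: "1 / 2 \<le> prob {w \<in> space W. calm \<rho> (sample_path Z w) 0}"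
  and \<theta>: "0 \<le> \<theta>" "\<theta> \<le> 1" and \<kappa>: "0 \<le> \<kappa>" "\<kappa> \<le> 1" and \<beta>: "0 \<le> \<beta>" "\<beta> \<le> 1" "\<beta> * (1 + \<theta> * overshoot_const) \<le> 1"
   "1 \<le> \<beta> + (1 - \<kappa>) * \<beta> / 2"
 shows "(\<integral>\<^sup>+w. ennreal (record_potential \<theta> \<beta> \<kappa> \<rho> e (sample_path Z w) (Suc n)) \<partial>W)
  \<le> (\<integral>\<^sup>+w. ennreal (record_potential \<theta> \<beta> \<kappa> \<rho> e (sample_path Z w) n) \<partial>W)"
proof -
 let ?C = "concat_at n Z Z" and ?Y = "record_potential \<theta> \<beta> \<kappa> \<rho> e"
 have C: "bm_grid (W \<Otimes>\<^sub>M W) ?C" by (rule bm_grid_concat[OF grid grid])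
 let ?g = "\<lambda>w. calm \<rho> (sample_path Z w) 0"
 have gm [measurable]: "Measurable.pred W ?g" using sample_path_measurable[OF grid] by measurable
 have Z1 [measurable]: "Z 1 \<in> borel_measurable W" by simp
 have one_step: "(\<integral>\<^sup>+w'. ennreal (?Y (sample_path ?C (w, w')) (Suc n)) \<partial>W) \<le> ennreal (?Y (sample_path Z w) n)"
  if w: "w \<in> space W" for w
 proof -
  let ?f = "sample_path Z w"
  define l where "l = lev e ?f n"
  define u where "u = Z (real n) w \<bullet> e"
  define p where "p = record_at e ?f n"
  define K where "K = exp (\<theta> * of_int l) * record_weight \<kappa> \<rho> e ?f n"
  have K0: "0 \<le> K" unfolding K_def using \<kappa> by (simp add: record_weight_nonneg)
  have fn: "?f (real n) = Z (real n) w" using nat_in_dyadic_times[of n] by (simp add: sample_path_def)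
  have ul: "u < of_int l + 1" using lev_ge[of n n ?f e] unfolding fn l_def u_def by linarith
  let ?h = "\<lambda>x. if l < \<lfloor>u + x\<rfloor> then \<beta> * exp (\<theta> * of_int (\<lfloor>u + x\<rfloor> - l)) else 1"
  have h0: "0 \<le> ?h x" for x using \<beta> by simp
  \<comment> \<open>Calmness and the size of the step come from the same unit of time and are
    dependent; the pointwise bound from below makes the saving on the calm event independent of the
    step.\<close>
  have h\<beta>: "\<beta> \<le> ?h x" for x
  proof (cases "l < \<lfloor>u + x\<rfloor>")
   case True
   then have "1 \<le> exp (\<theta> * of_int (\<lfloor>u + x\<rfloor> - l))" using \<theta> by simp
   from mult_left_mono[OF this \<beta>(1)] True show ?thesis by simp
  qed (use \<beta> in simp)
  have pt: "?Y (sample_path ?C (w, w')) (Suc n) = K * ((if p \<and> ?g w' then \<kappa> else 1) * ?h (Z 1 w' \<bullet> e))"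
   if w': "w' \<in> space W" for w'
  proof -
   let ?F = "sample_path ?C (w, w')"
   have Z0: "Z 0 w' = 0" by (rule Z_0[OF w'])
   have eq: "?F t = ?f t" if "t \<in> dyadic_times" "t \<le> real n" for t
    using that Z0 by (simp add: sample_path_def concat_at_def min_absorb1 max_absorb2)
   have later: "?F (real n + s) = Z (real n) w + Z s w'" if "s \<in> dyadic_times" for s
    using nat_add_dyadic[OF that, of n] dyadic_times_nonneg[OF that] by (simp add: sample_path_def concat_at_def min_absorb2 max_absorb1)
   have one: "(1::real) \<in> dyadic_times" using nat_in_dyadic_times[of 1] by simp
   have zero: "(0::real) \<in> dyadic_times" using nat_in_dyadic_times[of 0] by simp
   have F1: "?F (real (Suc n)) \<bullet> e = u + Z 1 w' \<bullet> e"
    using later[OF one] by (simp add: u_def inner_add_left add.commute)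
   note cong = path_functionals_cong[of n ?F ?f, OF eq]
   have lv: "lev e ?F n = l" by (simp add: cong(1) l_def)
   have lS: "lev e ?F (Suc n) = max l \<lfloor>u + Z 1 w' \<bullet> e\<rfloor>" using F1 lv by simp
   have rS: "record_at e ?F (Suc n) \<longleftrightarrow> l < \<lfloor>u + Z 1 w' \<bullet> e\<rfloor>" using F1 lv by (simp add: record_at_def)
   have cl: "calm \<rho> ?F n \<longleftrightarrow> ?g w'" unfolding calm_def using later later[OF zero] zero Z0
    by (intro ball_cong refl) (auto simp: sample_path_def)
   have wS: "record_weight \<kappa> \<rho> e ?F (Suc n) = record_weight \<kappa> \<rho> e ?f n * (if p \<and> ?g w' then \<kappa> else 1)"
    by (simp add: cong(2,4) cl p_def)
   show ?thesis
   proof (cases "l < \<lfloor>u + Z 1 w' \<bullet> e\<rfloor>")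
    case True
    have "exp (\<theta> * of_int \<lfloor>u + Z 1 w' \<bullet> e\<rfloor>) = exp (\<theta> * of_int l) * exp (\<theta> * of_int (\<lfloor>u + Z 1 w' \<bullet> e\<rfloor> - l))"
     by (simp add: exp_add[symmetric] algebra_simps)
    then show ?thesis unfolding record_potential_def lS rS wS K_def using True by (simp add: max_def)
   next
    case False
    then show ?thesis unfolding record_potential_def lS rS wS K_def by (simp add: max_def)
   qed
  qed
  have [measurable]: "?h \<in> borel_measurable borel" by measurable
  have A: "(\<integral>\<^sup>+w'. ennreal (?h (Z 1 w' \<bullet> e)) \<partial>W) \<le> 1"
   using nn_integral_coordinate[OF e, of "\<lambda>x. ennreal (?h x)"] gaussian_overshoot[OF ul \<theta> \<beta>(1,3)] by simp
  have B: "(\<integral>\<^sup>+w'. ennreal ((if p \<and> ?g w' then \<kappa> else 1) * ?h (Z 1 w' \<bullet> e)) \<partial>W) \<le> ennreal (if p then \<beta> else 1)"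
  proof (cases p)
   case False then show ?thesis using A by simp
  next
   case True
   \<comment> \<open>The saving is added on both sides and cancelled at the end, which avoids
     truncated subtraction in \<open>ennreal\<close>.\<close>
   have "(\<integral>\<^sup>+w'. ennreal ((if ?g w' then \<kappa> else 1) * ?h (Z 1 w' \<bullet> e)) \<partial>W) + ennreal ((1 - \<kappa>) * \<beta> / 2)
    \<le> (\<integral>\<^sup>+w'. ennreal ((if ?g w' then \<kappa> else 1) * ?h (Z 1 w' \<bullet> e)) \<partial>W) + (\<integral>\<^sup>+w'. ennreal ((1 - \<kappa>) * \<beta>) * indicator {w \<in> space W. ?g w} w' \<partial>W)"
   proof (rule add_left_mono)
    have "(1 - \<kappa>) * \<beta> / 2 \<le> (1 - \<kappa>) * \<beta> * prob {w \<in> space W. ?g w}"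
     using mult_left_mono[OF calm, of "(1 - \<kappa>) * \<beta>"] \<kappa> \<beta> by simp
    then show "ennreal ((1 - \<kappa>) * \<beta> / 2) \<le> (\<integral>\<^sup>+w'. ennreal ((1 - \<kappa>) * \<beta>) * indicator {w \<in> space W. ?g w} w' \<partial>W)"
     using \<kappa> \<beta> by (subst nn_integral_cmult_indicator) (auto simp: emeasure_eq_measure ennreal_mult[symmetric] ennreal_leI)
   qed
   also have "\<dots> = (\<integral>\<^sup>+w'. ennreal ((if ?g w' then \<kappa> else 1) * ?h (Z 1 w' \<bullet> e)) + ennreal ((1 - \<kappa>) * \<beta>) * indicator {w \<in> space W. ?g w} w' \<partial>W)"
    by (rule nn_integral_add[symmetric]) measurable
   also have "\<dots> \<le> (\<integral>\<^sup>+w'. ennreal (?h (Z 1 w' \<bullet> e)) \<partial>W)"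
   proof (rule nn_integral_mono)
    fix w' assume w': "w' \<in> space W"
    let ?x = "Z 1 w' \<bullet> e"
    have "\<kappa> * ?h ?x + (1 - \<kappa>) * \<beta> \<le> \<kappa> * ?h ?x + (1 - \<kappa>) * ?h ?x"
     using h\<beta>[of ?x] \<kappa> by (intro add_left_mono mult_left_mono) auto
    also have "\<dots> = ?h ?x" by (simp only: distrib_right[symmetric]) simp
    finally have "ennreal (\<kappa> * ?h ?x + (1 - \<kappa>) * \<beta>) \<le> ennreal (?h ?x)" by (rule ennreal_leI)
    moreover have "ennreal (\<kappa> * ?h ?x + (1 - \<kappa>) * \<beta>) = ennreal (\<kappa> * ?h ?x) + ennreal ((1 - \<kappa>) * \<beta>)"
     using \<kappa> \<beta> h0[of ?x] by (intro ennreal_plus mult_nonneg_nonneg) auto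
    ultimately show "ennreal ((if ?g w' then \<kappa> else 1) * ?h ?x) + ennreal ((1 - \<kappa>) * \<beta>) * indicator {w \<in> space W. ?g w} w' \<le> ennreal (?h ?x)"
     using w' by (cases "?g w'") simp_all
   qed
   also have "\<dots> \<le> ennreal (\<beta> + (1 - \<kappa>) * \<beta> / 2)" using A \<beta>(4) by (meson ennreal_ge_1 order_trans)
   also have "\<dots> = ennreal \<beta> + ennreal ((1 - \<kappa>) * \<beta> / 2)" using \<kappa> \<beta> by (intro ennreal_plus) auto
   finally show ?thesis using True by (simp add: add_right_mono ennreal_add_left_cancel_le add.commute)
  qed
  have "(\<integral>\<^sup>+w'. ennreal (?Y (sample_path ?C (w, w')) (Suc n)) \<partial>W) = (\<integral>\<^sup>+w'. ennreal K * ennreal ((if p \<and> ?g w' then \<kappa> else 1) * ?h (Z 1 w' \<bullet> e)) \<partial>W)"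
   using K0 \<kappa> h0 by (intro nn_integral_cong) (simp only: pt, intro ennreal_mult, auto)
  also have "\<dots> = ennreal K * (\<integral>\<^sup>+w'. ennreal ((if p \<and> ?g w' then \<kappa> else 1) * ?h (Z 1 w' \<bullet> e)) \<partial>W)"
   by (rule nn_integral_cmult) measurable
  also have "\<dots> \<le> ennreal K * ennreal (if p then \<beta> else 1)" by (intro mult_left_mono B) simp
  also have "\<dots> = ennreal (?Y ?f n)"
   using K0 \<beta> by (simp add: ennreal_mult[symmetric] record_potential_def K_def l_def p_def)
  finally show ?thesis .
 qed
 have Ym: "(\<lambda>\<xi>. ennreal (?Y \<xi> (Suc n))) \<in> borel_measurable path_space" by measurable
 have "(\<integral>\<^sup>+w. ennreal (?Y (sample_path Z w) (Suc n)) \<partial>W) = (\<integral>\<^sup>+p. ennreal (?Y (sample_path ?C p) (Suc n)) \<partial>(W \<Otimes>\<^sub>M W))"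
  by (rule bm_path_integral[OF grid C Ym])
 also have "\<dots> = (\<integral>\<^sup>+w. \<integral>\<^sup>+w'. ennreal (?Y (sample_path ?C (w, w')) (Suc n)) \<partial>W \<partial>W)"
  by (rule nn_integral_fst[symmetric]) (rule measurable_compose[OF sample_path_measurable[OF C] Ym])
 also have "\<dots> \<le> (\<integral>\<^sup>+w. ennreal (?Y (sample_path Z w) n) \<partial>W)" by (intro nn_integral_mono one_step)
 finally show ?thesis .
qed

lemma record_decay:
 assumes e: "e \<in> Basis" and calm: "1 / 2 \<le> prob {w \<in> space W. calm \<rho> (sample_path Z w) 0}" and \<kappa>: "0 \<le> \<kappa>" "\<kappa> < 1"
 obtains \<theta> C where "0 < \<theta>" "0 < C"
  "\<forall>n R. (\<integral>\<^sup>+w. ennreal (record_weight \<kappa> \<rho> e (sample_path Z w) n) * indicator {w. int R \<le> lev e (sample_path Z w) n} w \<partial>W) \<le> ennreal (C * exp (- \<theta> * real R))"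
proof -
 \<comment> \<open>The solution of \<open>\<beta> + (1 - \<kappa>) * \<beta> / 2 = 1\<close>, the
   balance for a pending record. The exponent \<theta> below is the largest one up to 1 for which
   the advance \<beta> still pays for the overshoot.\<close>
 define \<beta> where "\<beta> = 1 / (1 + (1 - \<kappa>) / 2)"
 have "0 < 1 + (1 - \<kappa>) / 2" using \<kappa> by (simp add: add_pos_nonneg)
 then have "\<beta> * (1 + (1 - \<kappa>) / 2) = 1" by (simp add: \<beta>_def)
 then have "\<beta> + (1 - \<kappa>) * \<beta> / 2 = 1" by (simp add: algebra_simps)
 moreover have "0 < \<beta>" "\<beta> < 1" using \<kappa> by (auto simp: \<beta>_def field_simps)
 ultimately have \<beta>: "0 < \<beta>" "\<beta> < 1" "\<beta> + (1 - \<kappa>) * \<beta> / 2 = 1" by auto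
 have C0: "0 < overshoot_const" unfolding overshoot_const_def by (intro suminf_pos overshoot_summable) simp
 define \<theta> where "\<theta> = min 1 ((1 / \<beta> - 1) / overshoot_const)"
 have \<theta>: "0 < \<theta>" "\<theta> \<le> 1" using \<beta> C0 by (auto simp: \<theta>_def)
 have "\<theta> * overshoot_const \<le> 1 / \<beta> - 1" using C0 by (simp add: \<theta>_def min_def field_simps)
 then have \<theta>2: "\<beta> * (1 + \<theta> * overshoot_const) \<le> 1" using \<beta> by (simp add: field_simps)
 let ?Y = "record_potential \<theta> \<beta> \<kappa> \<rho> e"
 have Y: "(\<integral>\<^sup>+w. ennreal (?Y (sample_path Z w) n) \<partial>W) \<le> 1" for n
 proof (induction n)
  case 0
  have "(\<integral>\<^sup>+w. ennreal (?Y (sample_path Z w) 0) \<partial>W) = (\<integral>\<^sup>+w. 1 \<partial>W)"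
  proof (rule nn_integral_cong)
   fix w assume "w \<in> space W"
   then have "sample_path Z w 0 = 0" using nat_in_dyadic_times[of 0] by (simp add: sample_path_def Z_0)
   then show "ennreal (?Y (sample_path Z w) 0) = 1" by (simp add: record_potential_def record_at_def)
  qed
  then show ?case by (simp add: emeasure_space_1)
 next
  case (Suc n)
  show ?case by (rule order_trans[OF record_potential_step[OF e calm] Suc]) (use \<theta> \<theta>2 \<beta> \<kappa> in auto)
 qed
 have "(\<integral>\<^sup>+w. ennreal (record_weight \<kappa> \<rho> e (sample_path Z w) n) * indicator {w. int R \<le> lev e (sample_path Z w) n} w \<partial>W) \<le> ennreal ((1 / \<beta>) * exp (- \<theta> * real R))" for n R
 proof -
  have "(\<integral>\<^sup>+w. ennreal (record_weight \<kappa> \<rho> e (sample_path Z w) n) * indicator {w. int R \<le> lev e (sample_path Z w) n} w \<partial>W)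
   \<le> (\<integral>\<^sup>+w. ennreal ((1 / \<beta>) * exp (- \<theta> * real R)) * ennreal (?Y (sample_path Z w) n) \<partial>W)"
  proof (rule nn_integral_mono)
   fix w
   let ?f = "sample_path Z w"
   show "ennreal (record_weight \<kappa> \<rho> e ?f n) * indicator {w. int R \<le> lev e (sample_path Z w) n} w \<le> ennreal ((1 / \<beta>) * exp (- \<theta> * real R)) * ennreal (?Y ?f n)"
   proof (cases "int R \<le> lev e ?f n")
    case True
    have w0: "0 \<le> record_weight \<kappa> \<rho> e ?f n" using \<kappa> by (intro record_weight_nonneg) simp
    have "real R \<le> of_int (lev e ?f n)" using True by linarith
    then have "1 \<le> exp (- \<theta> * real R) * exp (\<theta> * of_int (lev e ?f n))"
     using \<theta> by (simp add: exp_add[symmetric] algebra_simps)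
    moreover have "1 \<le> (1 / \<beta>) * (if record_at e ?f n then \<beta> else 1)" using \<beta> by simp
    ultimately have "1 * 1 \<le> (exp (- \<theta> * real R) * exp (\<theta> * of_int (lev e ?f n))) * ((1 / \<beta>) * (if record_at e ?f n then \<beta> else 1))"
     by (intro mult_mono) auto
    then have "record_weight \<kappa> \<rho> e ?f n * 1 \<le> record_weight \<kappa> \<rho> e ?f n * ((exp (- \<theta> * real R) * exp (\<theta> * of_int (lev e ?f n))) * ((1 / \<beta>) * (if record_at e ?f n then \<beta> else 1)))"
     using w0 by (intro mult_left_mono) simp_all
    also have "\<dots> = (1 / \<beta>) * exp (- \<theta> * real R) * ?Y ?f n"
     unfolding record_potential_def by (simp only: ac_simps)
    finally show ?thesis using True \<beta> w0 by (simp add: ennreal_mult'[symmetric] ennreal_leI)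
   qed simp
  qed
  also have "\<dots> = ennreal ((1 / \<beta>) * exp (- \<theta> * real R)) * (\<integral>\<^sup>+w. ennreal (?Y (sample_path Z w) n) \<partial>W)"
   by (rule nn_integral_cmult, rule measurable_compose[OF sample_path_measurable[OF grid]]) measurable
  also have "\<dots> \<le> ennreal ((1 / \<beta>) * exp (- \<theta> * real R)) * 1" by (intro mult_left_mono Y) simp
  finally show ?thesis by simp
 qed
 then show thesis using \<theta> \<beta> by (intro that[of \<theta> "1 / \<beta>"]) auto
qed

end

section \<open>Annealed decay in the level reached\<close>

lemma level_indicator_measurable:
 "(\<lambda>\<xi>. indicator {\<xi>. int R \<le> lev e \<xi> n} \<xi> :: ennreal) \<in> borel_measurable path_space"
proof -
 have "Measurable.pred path_space (\<lambda>\<xi>. real R \<le> real_of_int (lev e \<xi> n))"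
  using lev_measurable[of e n] by measurable
 moreover have "real R \<le> real_of_int (lev e \<xi> n) \<longleftrightarrow> int R \<le> lev e \<xi> n" for \<xi> :: "real \<Rightarrow> 'a" by linarith
 ultimately have "Measurable.pred path_space (\<lambda>\<xi>. int R \<le> lev e \<xi> n)" by simp
 then have "(\<lambda>\<xi>. if int R \<le> lev e \<xi> n then 1 else 0 :: ennreal) \<in> borel_measurable path_space" by measurable
 moreover have "(\<lambda>\<xi>. indicator {\<xi>. int R \<le> lev e \<xi> n} \<xi> :: ennreal) = (\<lambda>\<xi>. if int R \<le> lev e \<xi> n then 1 else 0)"
  by (auto simp: indicator_def)
 ultimately show ?thesis by simp
qed

text \<open>Markov's inequality and the Borel-Cantelli lemma; this turns annealed bounds into
  quenched ones.\<close>

lemma (in prob_space) AE_eventually_le_1: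
 assumes X [measurable]: "\<And>k. X k \<in> borel_measurable M" and b: "\<And>k. (\<integral>\<^sup>+x. X k x \<partial>M) \<le> ennreal (a k)"
  and a: "\<And>k. 0 \<le> a k" "summable a"
 shows "AE x in M. eventually (\<lambda>k. X k x \<le> (1::ennreal)) sequentially"
proof -
 have m: "prob {x \<in> space M. 1 \<le> X k x} \<le> a k" for k
 proof -
  have "emeasure M {x \<in> space M. 1 \<le> 1 * X k x} \<le> 1 * (\<integral>\<^sup>+x. X k x * indicator (space M) x \<partial>M)"
   using nn_integral_Markov_inequality[of "X k" "space M" M 1] by simp
  also have "(\<integral>\<^sup>+x. X k x * indicator (space M) x \<partial>M) = (\<integral>\<^sup>+x. X k x \<partial>M)" by (intro nn_integral_cong) auto
  finally have "emeasure M {x \<in> space M. 1 \<le> X k x} \<le> ennreal (a k)" using b[of k] by simp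
  then show ?thesis using a by (simp add: emeasure_eq_measure)
 qed
 have "AE x in M. eventually (\<lambda>k. x \<in> space M - {x \<in> space M. 1 \<le> X k x}) sequentially"
 proof (rule borel_cantelli_AE1)
  show "summable (\<lambda>k. prob {x \<in> space M. 1 \<le> X k x})"
   by (rule summable_comparison_test'[OF a(2)]) (use m in auto)
 qed (auto simp: emeasure_eq_measure)
 then show ?thesis by eventually_elim (auto elim: eventually_mono)
qed

locale lacoin_bm = env: lacoin_env \<nu> P \<delta> \<gamma> + bm: brownian W Z
 for \<nu> :: "real measure" and P :: "('a::euclidean_space \<times> real) set measure" and \<delta> \<gamma> :: real
  and W :: "'w measure" and Z :: "real \<Rightarrow> 'w \<Rightarrow> 'a"
begin

abbreviation V :: "('a \<times> real) set \<Rightarrow> 'a \<Rightarrow> ennreal" where "V \<eta> \<equiv> \<lambda>x. lacoin \<gamma> x \<eta>"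

lemma V_pair_measurable: "(\<lambda>(\<eta>, x). V \<eta> x) \<in> borel_measurable (P \<Otimes>\<^sub>M borel)"
proof -
 have "(\<lambda>q. lacoin \<gamma> (snd q) (fst q)) \<in> borel_measurable (P \<Otimes>\<^sub>M borel)"
  by (rule borel_measurable_lacoin) (auto simp: measurable_cong_sets[OF refl env.sets_P[symmetric]])
 then show ?thesis by (simp add: case_prod_beta)
qed

lemma V_measurable: "\<eta> \<in> configs \<Longrightarrow> V \<eta> \<in> borel_measurable borel" by (rule borel_measurable_lacoin) auto

abbreviation survival :: "nat \<Rightarrow> (real \<Rightarrow> 'w \<Rightarrow> 'a) \<Rightarrow> ('a \<times> real) set \<Rightarrow> 'w \<Rightarrow> ennreal" where
 "survival n Y \<eta> w \<equiv> fk_path (V \<eta>) n 0 (\<lambda>_. 1) (sample_path Y w)"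

definition weighted :: "nat \<Rightarrow> (real \<Rightarrow> 'w \<Rightarrow> 'a) \<Rightarrow> ((real \<Rightarrow> 'a) \<Rightarrow> ennreal) \<Rightarrow> ('a \<times> real) set \<Rightarrow> ennreal" where
 "weighted n Y F \<eta> = (\<integral>\<^sup>+w. survival n Y \<eta> w * F (sample_path Y w) \<partial>W)"

lemma weighted_pair_measurable:
 assumes F [measurable]: "F \<in> borel_measurable path_space" and Y: "bm_grid W Y"
 shows "(\<lambda>(\<eta>, w). survival n Y \<eta> w * F (sample_path Y w)) \<in> borel_measurable (P \<Otimes>\<^sub>M W)"
proof -
 have "(\<lambda>(\<eta>, \<xi>). fk_path (V \<eta>) n 0 (\<lambda>_. 1) \<xi>) \<in> borel_measurable (P \<Otimes>\<^sub>M path_space)"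
  by (rule fk_path_measurable_param[OF V_pair_measurable, where z = "\<lambda>_. 0"]) auto
 then have "(\<lambda>q. fk_path (V (fst q)) n 0 (\<lambda>_. 1) (snd q) * F (snd q)) \<in> borel_measurable (P \<Otimes>\<^sub>M path_space)"
  by (intro borel_measurable_times_ennreal) (auto simp: case_prod_beta)
 moreover have "(\<lambda>q. (fst q, sample_path Y (snd q))) \<in> measurable (P \<Otimes>\<^sub>M W) (P \<Otimes>\<^sub>M path_space)"
  using sample_path_measurable[OF Y] by measurable
 ultimately have "(\<lambda>q. fk_path (V (fst (fst q, sample_path Y (snd q)))) n 0 (\<lambda>_. 1) (snd (fst q, sample_path Y (snd q)))
   * F (snd (fst q, sample_path Y (snd q)))) \<in> borel_measurable (P \<Otimes>\<^sub>M W)"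
  by (rule measurable_compose[rotated])
 then show ?thesis by (simp only: fst_conv snd_conv split_beta')
qed

lemma weighted_measurable:
 "F \<in> borel_measurable path_space \<Longrightarrow> bm_grid W Y \<Longrightarrow> weighted n Y F \<in> borel_measurable P"
 unfolding weighted_def[abs_def] by (rule bm.borel_measurable_nn_integral) (rule weighted_pair_measurable)

lemma weighted_swap:
 assumes F: "F \<in> borel_measurable path_space" and Y: "bm_grid W Y"
 shows "(\<integral>\<^sup>+\<eta>. weighted n Y F \<eta> \<partial>P) = (\<integral>\<^sup>+w. (\<integral>\<^sup>+\<eta>. survival n Y \<eta> w \<partial>P) * F (sample_path Y w) \<partial>W)"
proof -
 interpret pair_sigma_finite P W ..
 have "(\<integral>\<^sup>+\<eta>. weighted n Y F \<eta> \<partial>P) = (\<integral>\<^sup>+w. \<integral>\<^sup>+\<eta>. survival n Y \<eta> w * F (sample_path Y w) \<partial>P \<partial>W)"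
  unfolding weighted_def using Fubini'[OF weighted_pair_measurable[OF F Y]] by simp
 also have "\<dots> = (\<integral>\<^sup>+w. (\<integral>\<^sup>+\<eta>. survival n Y \<eta> w \<partial>P) * F (sample_path Y w) \<partial>W)"
 proof (rule nn_integral_cong)
  fix w assume w: "w \<in> space W"
  have "(\<lambda>\<eta>. survival n Y \<eta> w) \<in> borel_measurable P"
   using measurable_compose[OF measurable_Pair2'[OF w] weighted_pair_measurable[OF _ Y, of "\<lambda>_. 1"]] by simp
  then show "(\<integral>\<^sup>+\<eta>. survival n Y \<eta> w * F (sample_path Y w) \<partial>P) = (\<integral>\<^sup>+\<eta>. survival n Y \<eta> w \<partial>P) * F (sample_path Y w)"
   by (rule nn_integral_multc)
 qed
 finally show ?thesis .
qed

text \<open>For a fixed path the calm records lie in disjoint cells, and a point of such a cell with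
  radius between \<rho>0 and \<open>2 * \<rho>0\<close> covers the path during the following unit of
  time. Averaging over the environment then yields one factor per calm record.\<close>

lemma annealed_given_path:
 assumes e: "e \<in> Basis" and w: "w \<in> space W" and \<rho>: "0 < \<rho>"
 defines "\<rho>0 \<equiv> \<rho> + real DIM('a) + 1" and "\<epsilon> \<equiv> (2 * (\<rho> + real DIM('a) + 1)) powr (- \<gamma>)"
 shows "(\<integral>\<^sup>+\<eta>. survival n Z \<eta> w \<partial>P)
  \<le> ennreal (record_weight (exp (- \<epsilon>) + (1 - exp (- \<epsilon>)) * exp (- (\<rho>0 powr (- \<delta>) - (2 * \<rho>0) powr (- \<delta>)))) \<rho> e (sample_path Z w) n)"
proof -
 define J where "J = {j \<in> {..<n}. record_at e (sample_path Z w) j \<and> calm \<rho> (sample_path Z w) j}"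
 define f where "f s = Z (max 0 s) w" for s
 have cont: "continuous_on {0..} (\<lambda>t. Z t w)" by (rule bm.Z_continuous[OF w])
 have "continuous_on UNIV f" unfolding f_def
  by (rule continuous_on_compose2[OF cont]) (auto intro!: continuous_intros)
 then have fm: "f \<in> borel_measurable borel" by (rule borel_measurable_continuous_onI)
 have fs: "sample_path Z w t = f t" if "t \<in> dyadic_times" for t
  using that dyadic_times_nonneg[OF that] by (simp add: sample_path_def f_def)
 have fn: "sample_path Z w (real j) = f (real j)" for j by (rule fs[OF nat_in_dyadic_times])
 have good: "norm (f (real j + s) - f (real j)) \<le> \<rho>" if j: "j \<in> J" and s: "s \<in> {0..1}" for j s
 proof -
  let ?q = "\<lambda>m. real (nat \<lfloor>s * 2 ^ m\<rfloor>) / 2 ^ m"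
  have q: "?q m \<in> dyadic_times \<inter> {0..1}" for m
  proof -
   have "?q m \<in> dyadic_times" unfolding dyadic_times_def by blast
   then show ?thesis using dyadic_approx_unit[OF s, of m] by (simp add: field_simps)
  qed
  have "(\<lambda>m. f (real j + ?q m)) \<longlonglongrightarrow> f (real j + s)"
   by (rule continuous_on_tendsto_compose[OF \<open>continuous_on UNIV f\<close> tendsto_add[OF tendsto_const dyadic_approx]])
     (use s in auto)
  then have "(\<lambda>m. norm (f (real j + ?q m) - f (real j))) \<longlonglongrightarrow> norm (f (real j + s) - f (real j))"
   by (intro tendsto_intros)
  moreover have "norm (f (real j + ?q m) - f (real j)) \<le> \<rho>" for m
  proof -
   have "norm (sample_path Z w (real j + ?q m) - sample_path Z w (real j)) \<le> \<rho>"
    using j q[of m] unfolding J_def calm_def by blast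
   then show ?thesis using fs[OF nat_add_dyadic, of "?q m" j] q[of m] fn[of j] by (simp only: Int_iff)
  qed
  ultimately show ?thesis by (intro LIMSEQ_le_const2) auto
 qed
 have distinct: "env.cell (f (real i)) \<inter> env.cell (f (real j)) = {}" if "i \<in> J" "j \<in> J" "i \<noteq> j" for i j
 proof -
  have "\<lfloor>f (real i) \<bullet> e\<rfloor> \<noteq> \<lfloor>f (real j) \<bullet> e\<rfloor>"
   using records_distinct[of e "sample_path Z w" i j] that by (simp add: J_def fn)
  then show ?thesis using e by (auto simp: env.cell_def)
 qed
 have \<rho>0: "1 \<le> \<rho>0" "\<rho>0 \<le> 2 * \<rho>0" using \<rho> by (auto simp: \<rho>0_def)
 let ?S = "\<lambda>\<eta>. \<Sum>j\<in>J. if npoints (env.cell (f (real j)) \<times> {\<rho>0..<2 * \<rho>0}) \<eta> = 0 then 0 else ennreal \<epsilon>"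
 have "(\<integral>\<^sup>+\<eta>. survival n Z \<eta> w \<partial>P) \<le> (\<integral>\<^sup>+\<eta>. ennreal (exp_neg (?S \<eta>)) \<partial>P)"
 proof (rule nn_integral_mono)
  fix \<eta> assume \<eta>: "\<eta> \<in> space P"
  have "?S \<eta> \<le> (\<integral>\<^sup>+s\<in>{0..real n}. lacoin \<gamma> (f s) \<eta> \<partial>lborel)" unfolding \<epsilon>_def \<rho>0_def
   by (rule env.quenched_path_bound[where \<rho> = \<rho>]) (use fm good \<rho> \<eta> in \<open>auto simp: J_def\<close>)
  also have "\<dots> = (\<integral>\<^sup>+s\<in>{0..real n}. V \<eta> (0 + Z s w) \<partial>lborel)"
   by (intro nn_integral_cong) (auto simp: f_def indicator_def)
  finally show "survival n Z \<eta> w \<le> ennreal (exp_neg (?S \<eta>))"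
   unfolding fk_path_sample_path[OF bm.grid w] by (auto intro!: ennreal_leI exp_neg_antimono)
 qed
 also have "\<dots> = ennreal ((exp (- \<epsilon>) + (1 - exp (- \<epsilon>)) * exp (- (\<rho>0 powr (- \<delta>) - (2 * \<rho>0) powr (- \<delta>)))) ^ card J)"
  by (rule env.annealed_cells) (use distinct \<rho>0 in \<open>auto simp: J_def \<epsilon>_def\<close>)
 finally show ?thesis unfolding record_weight_eq J_def .
qed

text \<open>By Tonelli the environment is averaged first, for a fixed path; what remains is the
  decay of the record weight. The factor per record is below 1 because the window of radii has
  positive mass.\<close>

lemma annealed_level:
 assumes e: "e \<in> Basis"
 obtains \<theta> C where "0 < \<theta>" "0 < C"
  "\<forall>n R. (\<integral>\<^sup>+\<eta>. weighted n Z (\<lambda>\<xi>. indicator {\<xi>. int R \<le> lev e \<xi> n} \<xi>) \<eta> \<partial>P) \<le> ennreal (C * exp (- \<theta> * real R))"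
proof -
 obtain \<rho> where \<rho>: "0 < \<rho>" "1 / 2 \<le> bm.prob {w \<in> space W. calm \<rho> (sample_path Z w) 0}" using bm.calm_prob by blast
 define \<rho>0 where "\<rho>0 = \<rho> + real DIM('a) + 1"
 define \<epsilon> where "\<epsilon> = (2 * (\<rho> + real DIM('a) + 1)) powr (- \<gamma>)"
 define \<kappa> where "\<kappa> = exp (- \<epsilon>) + (1 - exp (- \<epsilon>)) * exp (- (\<rho>0 powr (- \<delta>) - (2 * \<rho>0) powr (- \<delta>)))"
 have \<epsilon>: "0 < \<epsilon>" unfolding \<epsilon>_def using \<rho> by (simp add: add_pos_nonneg)
 have "1 \<le> \<rho>0" using \<rho> by (simp add: \<rho>0_def)
 then have "(2 * \<rho>0) powr (- \<delta>) < \<rho>0 powr (- \<delta>)" using env.\<delta>_pos by (intro powr_less_mono2_neg) auto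
 then have "(1 - exp (- \<epsilon>)) * exp (- (\<rho>0 powr (- \<delta>) - (2 * \<rho>0) powr (- \<delta>))) < (1 - exp (- \<epsilon>)) * 1"
  using \<epsilon> by (intro mult_strict_left_mono) auto
 then have "\<kappa> < exp (- \<epsilon>) + (1 - exp (- \<epsilon>)) * 1" unfolding \<kappa>_def by (rule add_strict_left_mono)
 then have "\<kappa> < 1" by simp
 moreover have "0 \<le> (1 - exp (- \<epsilon>)) * exp (- (\<rho>0 powr (- \<delta>) - (2 * \<rho>0) powr (- \<delta>)))" using \<epsilon> by (intro mult_nonneg_nonneg) auto
 then have "0 \<le> \<kappa>" unfolding \<kappa>_def by (intro add_nonneg_nonneg) auto
 ultimately have \<kappa>: "0 \<le> \<kappa>" "\<kappa> < 1" by auto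
 obtain \<theta> C where C: "0 < \<theta>" "0 < C"
  "\<forall>n R. (\<integral>\<^sup>+w. ennreal (record_weight \<kappa> \<rho> e (sample_path Z w) n) * indicator {w. int R \<le> lev e (sample_path Z w) n} w \<partial>W) \<le> ennreal (C * exp (- \<theta> * real R))"
  using bm.record_decay[OF e \<rho>(2) \<kappa>] by blast
 have "(\<integral>\<^sup>+\<eta>. weighted n Z (\<lambda>\<xi>. indicator {\<xi>. int R \<le> lev e \<xi> n} \<xi>) \<eta> \<partial>P) \<le> ennreal (C * exp (- \<theta> * real R))" for n R
 proof -
  have m: "(\<lambda>\<xi>. indicator {\<xi>. int R \<le> lev e \<xi> n} \<xi> :: ennreal) \<in> borel_measurable path_space"
   by (rule level_indicator_measurable)
  have "(\<integral>\<^sup>+\<eta>. weighted n Z (\<lambda>\<xi>. indicator {\<xi>. int R \<le> lev e \<xi> n} \<xi>) \<eta> \<partial>P)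
   = (\<integral>\<^sup>+w. (\<integral>\<^sup>+\<eta>. survival n Z \<eta> w \<partial>P) * indicator {\<xi>. int R \<le> lev e \<xi> n} (sample_path Z w) \<partial>W)"
   by (rule weighted_swap[OF m bm.grid])
  also have "\<dots> \<le> (\<integral>\<^sup>+w. ennreal (record_weight \<kappa> \<rho> e (sample_path Z w) n) * indicator {w. int R \<le> lev e (sample_path Z w) n} w \<partial>W)"
  proof (rule nn_integral_mono)
   fix w assume w: "w \<in> space W"
   show "(\<integral>\<^sup>+\<eta>. survival n Z \<eta> w \<partial>P) * indicator {\<xi>. int R \<le> lev e \<xi> n} (sample_path Z w)
    \<le> ennreal (record_weight \<kappa> \<rho> e (sample_path Z w) n) * indicator {w. int R \<le> lev e (sample_path Z w) n} w"
    using annealed_given_path[OF e w \<rho>(1), of n] unfolding \<kappa>_def \<epsilon>_def \<rho>0_def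
    by (cases "int R \<le> lev e (sample_path Z w) n") auto
  qed
  also have "\<dots> \<le> ennreal (C * exp (- \<theta> * real R))" using C(3) by blast
  finally show ?thesis .
 qed
 then show thesis by (intro that[OF C(1,2)]) blast
qed

text \<open>The reflected process sees the reflected environment, which has the same law.\<close>

lemma annealed_level_reflected:
 assumes F [measurable]: "F \<in> borel_measurable path_space"
 shows "(\<integral>\<^sup>+\<eta>. (\<integral>\<^sup>+w. survival n Z \<eta> w * F (sample_path (\<lambda>t w. - Z t w) w) \<partial>W) \<partial>P) = (\<integral>\<^sup>+\<eta>. weighted n Z F \<eta> \<partial>P)"
proof -
 let ?Y = "\<lambda>t w. - Z t w"
 have Y: "bm_grid W ?Y" by (rule bm_grid_uminus[OF bm.grid])
 have "(\<integral>\<^sup>+\<eta>. weighted n Z F \<eta> \<partial>P) = (\<integral>\<^sup>+\<eta>. weighted n ?Y F \<eta> \<partial>P)"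
 proof (rule nn_integral_cong)
  fix \<eta> assume "\<eta> \<in> space P"
  then have [measurable]: "V \<eta> \<in> borel_measurable borel" by (intro V_measurable) simp
  show "weighted n Z F \<eta> = weighted n ?Y F \<eta>"
   unfolding weighted_def by (rule bm_path_integral[OF bm.grid Y]) measurable
 qed
 also have "\<dots> = (\<integral>\<^sup>+\<eta>. weighted n ?Y F \<eta> \<partial>distr P P (move (-1) 0))" by (simp add: env.distr_move_P)
 also have "\<dots> = (\<integral>\<^sup>+\<eta>. weighted n ?Y F (move (-1) 0 \<eta>) \<partial>P)"
  by (rule nn_integral_distr) (auto intro: env.measurable_move_P weighted_measurable[OF F Y])
 also have "\<dots> = (\<integral>\<^sup>+\<eta>. (\<integral>\<^sup>+w. survival n Z \<eta> w * F (sample_path ?Y w) \<partial>W) \<partial>P)" unfolding weighted_def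
  by (intro nn_integral_cong arg_cong2[where f = "(*)"] refl)
    (simp add: fk_path_sample_path[OF bm.grid] fk_path_sample_path[OF Y] lacoin_move)
 finally show ?thesis by simp
qed

end

section \<open>Mean weight of long survival\<close>

context brownian
begin

text \<open>Over a time \<open>16 * k\<^sup>2\<close> the coordinate has standard deviation
  \<open>4 * k\<close>, so its density is at most \<open>1 / (8 * k)\<close>, while the slab has
  width \<open>4 * k\<close>.\<close>

lemma increment_slab:
 assumes e: "e \<in> Basis" and k: "1 \<le> k" and s: "0 \<le> s"
 shows "emeasure W {w \<in> space W. \<bar>(Z (s + 16 * (real k)\<^sup>2) w - Z s w) \<bullet> e\<bar> < 2 * real k} \<le> ennreal (1 / 2)"
proof -
 let ?q = "16 * (real k)\<^sup>2"
 have q: "0 < ?q" using k by simp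
 have sq: "sqrt ?q = 4 * real k" by (simp add: real_sqrt_mult)
 let ?S = "{x::'a. \<bar>x \<bullet> e\<bar> < 2 * real k}"
 have [measurable]: "(\<lambda>w. Z (s + ?q) w - Z s w) \<in> borel_measurable W" using s by (intro borel_measurable_diff Z_measurable) auto
 have "emeasure W {w \<in> space W. \<bar>(Z (s + ?q) w - Z s w) \<bullet> e\<bar> < 2 * real k} = emeasure (distr W borel (\<lambda>w. Z (s + ?q) w - Z s w)) ?S"
  by (subst emeasure_distr) (auto intro!: arg_cong[where f = "emeasure W"])
 also have "distr W borel (\<lambda>w. Z (s + ?q) w - Z s w) = gauss ?q" using increment_law[of s "s + ?q"] s q by simp
 also have "emeasure (gauss ?q) ?S = (\<integral>\<^sup>+x. indicator {u. \<bar>u\<bar> < 2 * real k} (x \<bullet> e) \<partial>gauss ?q)"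
 proof -
  have "emeasure (gauss ?q) ?S = (\<integral>\<^sup>+x. indicator ?S x \<partial>gauss ?q)"
   by (rule nn_integral_indicator[symmetric]) (simp add: gauss_def)
  also have "\<dots> = (\<integral>\<^sup>+x. indicator {u. \<bar>u\<bar> < 2 * real k} (x \<bullet> e) \<partial>gauss ?q)"
   by (intro nn_integral_cong) (simp add: indicator_def)
  finally show ?thesis .
 qed
 also have "\<dots> = (\<integral>\<^sup>+u. indicator {u. \<bar>u\<bar> < 2 * real k} u * ennreal (normal_density 0 (4 * real k) u) \<partial>lborel)"
  using gauss_marginal[OF e _ q, of "indicator {u. \<bar>u\<bar> < 2 * real k}"] unfolding sq by simp
 also have "\<dots> \<le> (\<integral>\<^sup>+u. ennreal (1 / (8 * real k)) * indicator {- (2 * real k)..2 * real k} u \<partial>lborel)"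
 proof (rule nn_integral_mono)
  fix u :: real
  have "2 \<le> sqrt (2 * pi)" by (rule real_le_rsqrt) (use pi_ge_two in simp)
  then have "2 * (4 * real k) \<le> sqrt (2 * pi) * (4 * real k)" by (rule mult_right_mono) simp
  also have "sqrt (2 * pi) * (4 * real k) = sqrt (2 * pi * (4 * real k)\<^sup>2)"
   unfolding real_sqrt_mult[of "2 * pi"] real_sqrt_abs by simp
  finally have "8 * real k \<le> sqrt (2 * pi * (4 * real k)\<^sup>2)" by simp
  then have "1 / sqrt (2 * pi * (4 * real k)\<^sup>2) * exp (- (u - 0)\<^sup>2 / (2 * (4 * real k)\<^sup>2)) \<le> 1 / (8 * real k) * 1"
   using k by (intro mult_mono frac_le) auto
  then show "indicator {u. \<bar>u\<bar> < 2 * real k} u * ennreal (normal_density 0 (4 * real k) u)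
   \<le> ennreal (1 / (8 * real k)) * indicator {- (2 * real k)..2 * real k} u"
   unfolding normal_density_def by (auto simp: indicator_def intro!: ennreal_leI)
 qed
 also have "\<dots> = ennreal (1 / (8 * real k)) * ennreal (4 * real k)" by (simp add: nn_integral_cmult)
 also have "\<dots> = ennreal (1 / 2)" using k by (simp add: ennreal_mult[symmetric])
 finally show ?thesis .
qed

text \<open>The time \<open>16 * k ^ 4\<close> splits into \<open>k\<^sup>2\<close> blocks of length
  \<open>16 * k\<^sup>2\<close>. Staying in the slab forces the independent increments of all blocks
  to be smaller than \<open>2 * k\<close>, each with probability at most
  \<open>1 / 2\<close>.\<close>

lemma slab_escape:
 assumes e: "e \<in> Basis" and k: "1 \<le> k"
 shows "emeasure W {w \<in> space W. \<forall>j\<le>16 * k ^ 4. \<bar>Z (real j) w \<bullet> e\<bar> < real k} \<le> ennreal ((1 / 2) ^ k)"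
proof -
 let ?t = "\<lambda>i. real (16 * k\<^sup>2 * i)"
 let ?I = "\<lambda>i w. Z (?t (Suc i)) w - Z (?t i) w"
 let ?A = "{x::'a. \<bar>x \<bullet> e\<bar> < 2 * real k}"
 have iv: "indep_vars (\<lambda>_. borel) ?I {..<k\<^sup>2}"
 proof -
  have m: "mono ?t" by (intro monoI) (simp add: mult_left_mono)
  have "\<And>t (n::nat). 0 \<le> t 0 \<Longrightarrow> mono t \<Longrightarrow> indep_vars (\<lambda>_. borel) (\<lambda>i w. Z (t (Suc i)) w - Z (t i) w) {..<n}"
   using bm unfolding brownian_motion_def by blast
  from this[of ?t, OF of_nat_0_le_iff m] show ?thesis .
 qed
 have Im [measurable]: "?I i \<in> borel_measurable W" for i by (intro borel_measurable_diff Z_measurable) auto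
 have one: "prob (?I i -` ?A \<inter> space W) \<le> 1 / 2" for i
 proof -
  have "?I i -` ?A \<inter> space W = {w \<in> space W. \<bar>(Z (?t i + 16 * (real k)\<^sup>2) w - Z (?t i) w) \<bullet> e\<bar> < 2 * real k}"
   by (auto simp: algebra_simps)
  then have "emeasure W (?I i -` ?A \<inter> space W) \<le> ennreal (1 / 2)" using increment_slab[OF e k, of "?t i"] by simp
  then show ?thesis by (simp only: emeasure_eq_measure) (subst (asm) ennreal_le_iff, auto)
 qed
 have k2: "{..<k\<^sup>2} \<noteq> {}" using k by (auto simp: lessThan_empty_iff)
 have "{w \<in> space W. \<forall>j\<le>16 * k ^ 4. \<bar>Z (real j) w \<bullet> e\<bar> < real k} \<subseteq> (\<Inter>i\<in>{..<k\<^sup>2}. ?I i -` ?A \<inter> space W)"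
 proof (intro subsetI INT_I)
  fix w i assume w: "w \<in> {w \<in> space W. \<forall>j\<le>16 * k ^ 4. \<bar>Z (real j) w \<bullet> e\<bar> < real k}" and i: "i \<in> {..<k\<^sup>2}"
  have "16 * k\<^sup>2 * Suc i \<le> 16 * k\<^sup>2 * k\<^sup>2" by (rule mult_le_mono2) (use i in auto)
  also have "\<dots> = 16 * k ^ 4" by (simp add: power_add[symmetric])
  finally have le: "16 * k\<^sup>2 * Suc i \<le> 16 * k ^ 4" .
  moreover have "16 * k\<^sup>2 * i \<le> 16 * k\<^sup>2 * Suc i" by simp
  ultimately have "16 * k\<^sup>2 * i \<le> 16 * k ^ 4" by (rule order_trans[rotated])
  with le w have "\<bar>Z (?t (Suc i)) w \<bullet> e\<bar> < real k" "\<bar>Z (?t i) w \<bullet> e\<bar> < real k" by blast+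
  then have "\<bar>?I i w \<bullet> e\<bar> < 2 * real k" unfolding inner_diff_left by linarith
  then show "w \<in> ?I i -` ?A \<inter> space W" using w by simp
 qed
 then have "emeasure W {w \<in> space W. \<forall>j\<le>16 * k ^ 4. \<bar>Z (real j) w \<bullet> e\<bar> < real k} \<le> emeasure W (\<Inter>i\<in>{..<k\<^sup>2}. ?I i -` ?A \<inter> space W)"
  by (rule emeasure_mono) (use k2 in measurable)
 also have "\<dots> = ennreal (\<Prod>i\<in>{..<k\<^sup>2}. prob (?I i -` ?A \<inter> space W))"
  unfolding emeasure_eq_measure by (subst indep_varsD[OF iv k2]) auto
 also have "\<dots> \<le> ennreal (\<Prod>i\<in>{..<k\<^sup>2}. 1 / 2)" by (intro ennreal_leI prod_mono) (use one in auto)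
 also have "\<dots> \<le> ennreal ((1 / 2) ^ k)"
  unfolding prod_constant card_lessThan by (intro ennreal_leI power_decreasing) (use k in \<open>auto simp: power2_eq_square\<close>)
 finally show ?thesis .
qed

end

context lacoin_bm
begin

lemma fk_param_measurable: "f \<in> borel_measurable borel \<Longrightarrow> (\<lambda>\<eta>. fk W Z (V \<eta>) n z f) \<in> borel_measurable P"
 by (rule fk_measurable_param[OF bm.grid V_pair_measurable]) auto

lemma half_space_mean:
 assumes e: "e \<in> Basis"
 obtains \<theta> C where "0 < \<theta>" "0 < C"
  "\<forall>n R. (\<integral>\<^sup>+\<eta>. fk W Z (V \<eta>) n 0 (indicator {x. real R \<le> x \<bullet> e}) \<partial>P) \<le> ennreal (C * exp (- \<theta> * real R))"
proof -
 obtain \<theta> C where *: "0 < \<theta>" "0 < C"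
  "\<forall>n R. (\<integral>\<^sup>+\<eta>. weighted n Z (\<lambda>\<xi>. indicator {\<xi>. int R \<le> lev e \<xi> n} \<xi>) \<eta> \<partial>P) \<le> ennreal (C * exp (- \<theta> * real R))"
  by (rule annealed_level[OF e])
 have "fk W Z (V \<eta>) n 0 (indicator {x. real R \<le> x \<bullet> e}) \<le> weighted n Z (\<lambda>\<xi>. indicator {\<xi>. int R \<le> lev e \<xi> n} \<xi>) \<eta>" for \<eta> n R
  unfolding fk_def weighted_def
 proof (rule nn_integral_mono)
  fix w assume w: "w \<in> space W"
  have "int R \<le> lev e (sample_path Z w) n" if "real R \<le> Z (real n) w \<bullet> e"
  proof -
   have "int R \<le> \<lfloor>sample_path Z w (real n) \<bullet> e\<rfloor>" using that nat_in_dyadic_times[of n] by (simp add: sample_path_def le_floor_iff)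
   also have "\<dots> \<le> lev e (sample_path Z w) n" by (rule lev_ge) simp
   finally show ?thesis .
  qed
  then show "ennreal (exp_neg (\<integral>\<^sup>+s\<in>{0..real n}. V \<eta> (0 + Z s w) \<partial>lborel)) * indicator {x. real R \<le> x \<bullet> e} (0 + Z (real n) w)
   \<le> survival n Z \<eta> w * indicator {\<xi>. int R \<le> lev e \<xi> n} (sample_path Z w)"
   unfolding fk_path_sample_path[OF bm.grid w] by (auto simp: indicator_def)
 qed
 then have "(\<integral>\<^sup>+\<eta>. fk W Z (V \<eta>) n 0 (indicator {x. real R \<le> x \<bullet> e}) \<partial>P) \<le> ennreal (C * exp (- \<theta> * real R))" for n R
  by (intro order_trans[OF nn_integral_mono *(3)[rule_format]])
 then show thesis using that[OF *(1,2)] by blast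
qed

text \<open>By time \<open>16 * k ^ 4\<close> either a coordinate has stayed in the slab of
  half-width \<open>k\<close>, which is unlikely, or the path or its reflection has reached level
  \<open>k\<close>, which is expensive in the annealed mean. The smaller of the two rates
  survives.\<close>

lemma survival_mean:
 obtains \<theta> C where "0 < \<theta>" "0 < C"
  "\<forall>k\<ge>1. (\<integral>\<^sup>+\<eta>. fk W Z (V \<eta>) (16 * k ^ 4) 0 (\<lambda>_. 1) \<partial>P) \<le> ennreal (C * exp (- \<theta> * real k))"
proof -
 obtain e :: 'a where e: "e \<in> Basis" using nonempty_Basis by blast
 obtain \<theta> C where *: "0 < \<theta>" "0 < C"
  "\<forall>n R. (\<integral>\<^sup>+\<eta>. weighted n Z (\<lambda>\<xi>. indicator {\<xi>. int R \<le> lev e \<xi> n} \<xi>) \<eta> \<partial>P) \<le> ennreal (C * exp (- \<theta> * real R))"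
  by (rule annealed_level[OF e])
 define \<beta> where "\<beta> = min \<theta> (ln 2)"
 have \<beta>: "0 < \<beta>" "\<beta> \<le> \<theta>" "\<beta> \<le> ln 2" using * by (auto simp: \<beta>_def)
 have "(\<integral>\<^sup>+\<eta>. fk W Z (V \<eta>) (16 * k ^ 4) 0 (\<lambda>_. 1) \<partial>P) \<le> ennreal ((2 * C + 1) * exp (- \<beta> * real k))" if k: "1 \<le> k" for k
 proof -
  define n where "n = 16 * k ^ 4"
  let ?F = "\<lambda>\<xi>. indicator {\<xi>. int k \<le> lev e \<xi> n} \<xi> :: ennreal"
  let ?N = "{w \<in> space W. \<forall>j\<le>n. \<bar>Z (real j) w \<bullet> e\<bar> < real k}"
  let ?W' = "\<lambda>\<eta>. \<integral>\<^sup>+w. survival n Z \<eta> w * ?F (sample_path (\<lambda>t w. - Z t w) w) \<partial>W"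
  have Y: "bm_grid W (\<lambda>t w. - Z t w)" by (rule bm_grid_uminus[OF bm.grid])
  have Fm [measurable]: "?F \<in> borel_measurable path_space" by (rule level_indicator_measurable)
  have N [measurable]: "?N \<in> sets W" by measurable
  have pm: "(\<lambda>(\<eta>, w). survival n Z \<eta> w * ?F (sample_path (\<lambda>t w. - Z t w) w)) \<in> borel_measurable (P \<Otimes>\<^sub>M W)"
  proof -
   have "(\<lambda>q. fk_path (V (fst q)) n 0 (\<lambda>_. 1) (sample_path Z (snd q)) * 1) \<in> borel_measurable (P \<Otimes>\<^sub>M W)"
    using weighted_pair_measurable[OF _ bm.grid, of "\<lambda>_. 1" n] by (simp add: split_beta')
   moreover have "(\<lambda>q. ?F (sample_path (\<lambda>t w. - Z t w) (snd q))) \<in> borel_measurable (P \<Otimes>\<^sub>M W)"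
    by (rule measurable_compose[OF _ Fm]) (use sample_path_measurable[OF Y] in measurable)
   ultimately show ?thesis unfolding split_beta' by simp
  qed
  have "fk W Z (V \<eta>) n 0 (\<lambda>_. 1) \<le> weighted n Z ?F \<eta> + ?W' \<eta> + emeasure W ?N" if "\<eta> \<in> space P" for \<eta>
  proof -
   have m1: "(\<lambda>w. survival n Z \<eta> w * ?F (sample_path Z w)) \<in> borel_measurable W"
    using measurable_compose[OF measurable_Pair1'[OF that] weighted_pair_measurable[OF Fm bm.grid]] by simp
   have m2: "(\<lambda>w. survival n Z \<eta> w * ?F (sample_path (\<lambda>t w. - Z t w) w)) \<in> borel_measurable W"
    using measurable_compose[OF measurable_Pair1'[OF that] pm] by simp
   have "fk W Z (V \<eta>) n 0 (\<lambda>_. 1) \<le> (\<integral>\<^sup>+w. survival n Z \<eta> w * ?F (sample_path Z w)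
     + survival n Z \<eta> w * ?F (sample_path (\<lambda>t w. - Z t w) w) + indicator ?N w \<partial>W)"
    unfolding fk_eq_path_integral[OF bm.grid]
   proof (rule nn_integral_mono)
    fix w assume w: "w \<in> space W"
    have le1: "survival n Z \<eta> w \<le> 1" unfolding fk_path_sample_path[OF bm.grid w] by (simp add: exp_neg_le_1)
    show "survival n Z \<eta> w \<le> survival n Z \<eta> w * ?F (sample_path Z w)
     + survival n Z \<eta> w * ?F (sample_path (\<lambda>t w. - Z t w) w) + indicator ?N w"
    proof (cases "w \<in> ?N")
     case True
     then show ?thesis using le1 by (simp add: add_increasing)
    next
     case False
     then obtain j where j: "j \<le> n" "real k \<le> \<bar>Z (real j) w \<bullet> e\<bar>" using w by fastforce
     then consider "int k \<le> \<lfloor>sample_path Z w (real j) \<bullet> e\<rfloor>" | "int k \<le> \<lfloor>sample_path (\<lambda>t w. - Z t w) w (real j) \<bullet> e\<rfloor>"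
      using nat_in_dyadic_times[of j] by (auto simp: sample_path_def le_floor_iff abs_real_def split: if_splits)
     then show ?thesis
     proof cases
      case 1
      then have "int k \<le> lev e (sample_path Z w) n" using lev_ge[OF j(1), of "sample_path Z w" e] by linarith
      then show ?thesis by (simp add: add.assoc)
     next
      case 2
      then have "int k \<le> lev e (sample_path (\<lambda>t w. - Z t w) w) n" using lev_ge[OF j(1), of "sample_path (\<lambda>t w. - Z t w) w" e] by linarith
      then show ?thesis by (simp add: add_increasing add_increasing2)
     qed
    qed
   qed
   also have "\<dots> = weighted n Z ?F \<eta> + ?W' \<eta> + emeasure W ?N"
    unfolding weighted_def using m1 m2 by (simp add: nn_integral_add)
   finally show ?thesis .
  qed
  then have "(\<integral>\<^sup>+\<eta>. fk W Z (V \<eta>) n 0 (\<lambda>_. 1) \<partial>P) \<le> (\<integral>\<^sup>+\<eta>. weighted n Z ?F \<eta> + ?W' \<eta> + emeasure W ?N \<partial>P)"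
   by (rule nn_integral_mono)
  also have "\<dots> = (\<integral>\<^sup>+\<eta>. weighted n Z ?F \<eta> \<partial>P) + (\<integral>\<^sup>+\<eta>. ?W' \<eta> \<partial>P) + emeasure W ?N"
  proof -
   have "?W' \<in> borel_measurable P" by (rule bm.borel_measurable_nn_integral) (rule pm)
   then show ?thesis using weighted_measurable[OF Fm bm.grid] env.emeasure_space_1
    by (subst nn_integral_add, simp, simp)+ simp
  qed
  also have "(\<integral>\<^sup>+\<eta>. ?W' \<eta> \<partial>P) = (\<integral>\<^sup>+\<eta>. weighted n Z ?F \<eta> \<partial>P)" by (rule annealed_level_reflected[OF Fm])
  also have "(\<integral>\<^sup>+\<eta>. weighted n Z ?F \<eta> \<partial>P) + (\<integral>\<^sup>+\<eta>. weighted n Z ?F \<eta> \<partial>P) + emeasure W ?N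
   \<le> ennreal (C * exp (- \<beta> * real k)) + ennreal (C * exp (- \<beta> * real k)) + ennreal (exp (- \<beta> * real k))"
  proof (intro add_mono)
   have "C * exp (- \<theta> * real k) \<le> C * exp (- \<beta> * real k)" using \<beta> *(2) by (intro mult_left_mono) (auto intro: mult_right_mono)
   then show "(\<integral>\<^sup>+\<eta>. weighted n Z ?F \<eta> \<partial>P) \<le> ennreal (C * exp (- \<beta> * real k))"
    using *(3)[rule_format, where n = n and R = k] by (meson ennreal_leI order_trans)
   then show "(\<integral>\<^sup>+\<eta>. weighted n Z ?F \<eta> \<partial>P) \<le> ennreal (C * exp (- \<beta> * real k))" .
   have "exp (- ln 2 * real k) = exp (- ln 2) ^ k" by (rule exp_of_nat2_mult)
   then have "(1 / 2 :: real) ^ k = exp (- ln 2 * real k)" by (simp add: exp_minus)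
   also have "\<dots> \<le> exp (- \<beta> * real k)" using \<beta>(3) by (auto intro: mult_right_mono)
   finally show "emeasure W ?N \<le> ennreal (exp (- \<beta> * real k))"
    using bm.slab_escape[OF e k] unfolding n_def by (meson ennreal_leI order_trans)
  qed
  also have "\<dots> = ennreal ((2 * C + 1) * exp (- \<beta> * real k))" using *(2) by (simp add: ennreal_plus[symmetric] algebra_simps del: ennreal_plus)
  finally show ?thesis unfolding n_def .
 qed
 then show thesis using that[of \<beta> "2 * C + 1"] \<beta>(1) *(2) by simp
qed

end

section \<open>Exponential moments of the far field\<close>

text \<open>The exponential on \<open>[0, \<infinity>]\<close>, infinite at
  \<open>\<infinity>\<close>; as a reciprocal it inherits the functional equation of
  \<open>exp_neg\<close>.\<close>

definition exp_pos :: "ennreal \<Rightarrow> ennreal" where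
 "exp_pos s = inverse (ennreal (exp_neg s))"

lemma exp_pos_add: "exp_pos (a + b) = exp_pos a * exp_pos b"
proof -
 have "inverse (x * y) = inverse x * inverse (y::ennreal)" if "x \<noteq> \<infinity>" "y \<noteq> \<infinity>" for x y
  using that by (cases "x = 0"; cases "y = 0") (auto simp: ennreal_inverse_mult less_top ennreal_mult_eq_top_iff)
 then show ?thesis by (simp add: exp_pos_def exp_neg_add ennreal_mult exp_neg_nonneg)
qed

lemma exp_pos_0 [simp]: "exp_pos 0 = 1" by (simp add: exp_pos_def)

lemma exp_pos_sum: "finite I \<Longrightarrow> exp_pos (\<Sum>i\<in>I. f i) = (\<Prod>i\<in>I. exp_pos (f i))"
 by (induction I rule: finite_induct) (auto simp: exp_pos_add)

lemma ennreal_inverse_antimono: "x \<le> y \<Longrightarrow> inverse y \<le> inverse (x::ennreal)"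
 by (cases "x = 0"; cases x; cases y) (auto simp: inverse_ennreal le_imp_inverse_le ennreal_leI top_unique)

lemma exp_pos_mono: "a \<le> b \<Longrightarrow> exp_pos a \<le> exp_pos b"
 unfolding exp_pos_def by (intro ennreal_inverse_antimono ennreal_leI exp_neg_antimono)

lemma exp_pos_ennreal: "0 \<le> a \<Longrightarrow> exp_pos (ennreal a) = ennreal (exp a)"
 by (simp add: exp_pos_def exp_neg_ennreal inverse_ennreal exp_minus)

lemma le_exp_pos: "a \<le> exp_pos a"
proof (cases a)
 case (real r)
 have "r \<le> exp r" using exp_ge_add_one_self[of r] by linarith
 then show ?thesis using real by (simp add: exp_pos_ennreal ennreal_leI)
qed (simp add: exp_pos_def exp_neg_def)

lemma exp_pos_measurable [measurable]: "exp_pos \<in> borel_measurable borel"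
 unfolding exp_pos_def[abs_def] by measurable

text \<open>The moment generating function of the Poisson law. Infinite counts form a null set and
  are discarded before summing over the values.\<close>

lemma (in poisson_law) npoints_exp_moment:
 assumes A: "A \<in> sets borel" "emeasure \<Lambda> A < \<infinity>" and c: "0 \<le> c"
 shows "(\<integral>\<^sup>+\<eta>. exp_pos (ennreal c * enpoints A \<eta>) \<partial>P) = ennreal (exp (measure \<Lambda> A * (exp c - 1)))"
proof -
 let ?m = "measure \<Lambda> A" and ?E = "\<lambda>k. {\<eta> \<in> space P. npoints A \<eta> = enat k}"
 have E: "?E k \<in> events" for k
 proof -
  have "npoints A -` {enat k} \<inter> space P \<in> events" by (rule measurable_sets[OF measurable_npoints_P[OF A(1)]]) auto
  moreover have "npoints A -` {enat k} \<inter> space P = ?E k" by auto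
  ultimately show ?thesis by simp
 qed
 have "(\<integral>\<^sup>+\<eta>. exp_pos (ennreal c * enpoints A \<eta>) \<partial>P) = (\<integral>\<^sup>+\<eta>. (\<Sum>k. ennreal (exp (c * real k)) * indicator (?E k) \<eta>) \<partial>P)"
 proof (rule nn_integral_cong_AE)
  show "AE \<eta> in P. exp_pos (ennreal c * enpoints A \<eta>) = (\<Sum>k. ennreal (exp (c * real k)) * indicator (?E k) \<eta>)"
   using AE_npoints_finite[OF A] AE_space
  proof eventually_elim
   case (elim \<eta>)
   then obtain j where j: "npoints A \<eta> = enat j" by auto
   have "(\<Sum>k. ennreal (exp (c * real k)) * indicator (?E k) \<eta>) = (\<Sum>k\<in>{j}. ennreal (exp (c * real k)) * indicator (?E k) \<eta>)"
    by (rule suminf_finite) (auto simp: j)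
   also have "\<dots> = ennreal (exp (c * real j))" using elim(2) j by (simp add: indicator_def)
   also have "\<dots> = exp_pos (ennreal c * enpoints A \<eta>)"
   proof -
    have "ennreal c * enpoints A \<eta> = ennreal (c * real j)"
     unfolding j ennreal_of_enat_enat ennreal_of_nat_eq_real_of_nat by (rule ennreal_mult[symmetric]) (use c in auto)
    then show ?thesis using c by (simp only: exp_pos_ennreal mult_nonneg_nonneg of_nat_0_le_iff)
   qed
   finally show ?case by simp
  qed
 qed
 also have "\<dots> = (\<Sum>k. ennreal (exp (c * real k)) * emeasure P (?E k))"
 proof (subst nn_integral_suminf)
  show "(\<lambda>\<eta>. ennreal (exp (c * real k)) * indicator (?E k) \<eta>) \<in> borel_measurable P" for k
   using E[of k] by (intro borel_measurable_times_ennreal borel_measurable_indicator) auto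
  show "(\<Sum>k. \<integral>\<^sup>+\<eta>. ennreal (exp (c * real k)) * indicator (?E k) \<eta> \<partial>P) = (\<Sum>k. ennreal (exp (c * real k)) * emeasure P (?E k))"
   by (intro suminf_cong nn_integral_cmult_indicator E)
 qed
 also have "\<dots> = (\<Sum>k. ennreal (exp (- ?m) * ((?m * exp c) ^ k /\<^sub>R fact k)))" by (rule suminf_cong)
    (simp add: emeasure_eq_measure prob_npoints[OF A, unfolded space_P] ennreal_mult[symmetric] power_mult_distrib exp_of_nat2_mult divide_inverse mult_ac)
 also have "\<dots> = ennreal (\<Sum>k. exp (- ?m) * ((?m * exp c) ^ k /\<^sub>R fact k))"
  by (rule suminf_ennreal2[OF _ summable_mult[OF summable_exp_generic]]) simp
 also have "(\<Sum>k. exp (- ?m) * ((?m * exp c) ^ k /\<^sub>R fact k)) = exp (- ?m) * exp (?m * exp c)"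
  unfolding suminf_mult[OF summable_exp_generic] by (simp only: exp_def)
 also have "\<dots> = exp (?m * (exp c - 1))" by (simp add: exp_add[symmetric] algebra_simps)
 finally show ?thesis .
qed

context lacoin_env
begin

text \<open>A ball of the \<open>n\<close>-th shell has radius at least \<open>2 ^ n\<close>, which
  bounds its height. Weight 0 below \<open>K\<close> is meant for environments whose first
  \<open>K\<close> shells are empty.\<close>

definition weight :: "nat \<Rightarrow> nat \<Rightarrow> real" where
 "weight K n = (if n < K then 0 else (2 ^ n) powr (- \<gamma>))"

text \<open>A ball of radius below \<open>2 ^ Suc n\<close> that meets the ball of radius \<rho>
  around 0 has its centre within \<open>\<rho> + 2 ^ Suc n\<close> of 0; different radius windows
  keep the shells disjoint.\<close>

definition shell :: "real \<Rightarrow> nat \<Rightarrow> ('a \<times> real) set" where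
 "shell \<rho> n = ball 0 (\<rho> + 2 ^ Suc n) \<times> {2 ^ n..<2 ^ Suc n}"

definition far_field :: "real \<Rightarrow> nat \<Rightarrow> ('a \<times> real) set \<Rightarrow> ennreal" where
 "far_field \<rho> K \<eta> = (\<Sum>n. ennreal (weight K n) * enpoints (shell \<rho> n) \<eta>)"

text \<open>The factor 2 comes from \<open>exp w - 1 \<le> 2 * w\<close> for \<open>w\<close> in the
  unit interval, so this is a bound for the logarithm of an exponential moment.\<close>

definition far_mean :: "real \<Rightarrow> nat \<Rightarrow> real" where
 "far_mean \<rho> K = (\<Sum>n. 2 * weight K n * measure \<Lambda> (shell \<rho> n))"

lemma shell_measurable [measurable]: "shell \<rho> n \<in> sets borel" by (auto simp: shell_def borel_prod[symmetric])

lemma weight_bounds: "0 \<le> weight K n" "weight K n \<le> 1"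
 using \<gamma>_pos by (auto simp: weight_def powr_minus_divide divide_le_eq_1 ge_one_powr_ge_zero)

lemma lacoin_le_far_field:
 assumes w: "\<eta> \<in> configs" and K: "\<And>n. n < K \<Longrightarrow> npoints (shell \<rho> n) \<eta> = 0" and x: "norm x \<le> \<rho>"
 shows "lacoin \<gamma> x \<eta> \<le> far_field \<rho> K \<eta>"
proof -
 have "lacoin \<gamma> x \<eta> \<le> (\<integral>\<^sup>+p. (\<Sum>n. ennreal (weight K n) * indicator (shell \<rho> n) p) \<partial>count_space \<eta>)"
  unfolding lacoin_def
 proof (rule nn_integral_mono, clarify)
  fix y r assume p: "(y, r) \<in> space (count_space \<eta>)"
  then have "1 \<le> r" using w by (auto simp: configs_def)
  obtain n where n: "2 ^ n \<le> r" "r < 2 ^ Suc n"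
  proof -
   define m where "m = (LEAST m. r < 2 ^ m)"
   have m: "r < 2 ^ m" unfolding m_def using real_arch_pow[of 2 r] by (auto intro: LeastI_ex)
   then obtain n where n: "m = Suc n" using \<open>1 \<le> r\<close> by (cases m) auto
   then have "\<not> r < 2 ^ n" using not_less_Least[of n "\<lambda>m. r < 2 ^ m"] by (simp add: m_def)
   then show thesis using m n by (intro that[of n]) auto
  qed
  let ?f = "\<lambda>n. ennreal (weight K n) * indicator (shell \<rho> n) (y, r)"
  show "ennreal (r powr - \<gamma>) * indicator (ball y r) x \<le> (\<Sum>n. ennreal (weight K n) * indicator (shell \<rho> n) (y, r))"
  proof (cases "x \<in> ball y r")
   case True
   have "norm y \<le> norm x + dist y x" by (metis dist_norm dist_commute norm_triangle_sub)
   then have "norm y < \<rho> + 2 ^ Suc n" using True x n by simp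
   then have s: "(y, r) \<in> shell \<rho> n" using n by (simp add: shell_def)
   have "K \<le> n"
   proof (rule ccontr)
    assume "\<not> K \<le> n"
    then have "npoints (shell \<rho> n) \<eta> = 0" using K by simp
    then show False using s p by (auto simp: npoints_def zero_enat_def split: if_splits)
   qed
   then have "r powr - \<gamma> \<le> weight K n" using n(1) \<gamma>_pos by (auto simp: weight_def intro: powr_mono2')
   then have "ennreal (r powr - \<gamma>) * indicator (ball y r) x \<le> ennreal (weight K n) * indicator (shell \<rho> n) (y, r)"
    using s True by (simp add: ennreal_leI)
   also have "\<dots> \<le> (\<Sum>n. ennreal (weight K n) * indicator (shell \<rho> n) (y, r))"
   proof -
    have "sum ?f {n} \<le> suminf ?f" by (rule sum_le_suminf) auto
    then show ?thesis by (simp only: sum.insert[OF finite.emptyI] sum.empty empty_iff not_False_eq_True add_0_right)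
   qed
   finally show ?thesis .
  qed simp
 qed
 also have "\<dots> = far_field \<rho> K \<eta>" unfolding far_field_def
  by (subst nn_integral_suminf) (auto simp: nn_integral_cmult nn_integral_count_space_indicator_npoints)
 finally show ?thesis .
qed

lemma shell_intensity:
 assumes \<rho>: "0 \<le> \<rho>"
 shows "emeasure \<Lambda> (shell \<rho> n)
  \<le> ennreal (unit_ball_vol (real DIM('a)) * (\<rho> + 2) ^ DIM('a) * ((2 ^ n) ^ DIM('a) * (2 ^ n) powr (- \<delta>)))"
proof -
 have "emeasure \<Lambda> (shell \<rho> n) = emeasure lborel (ball (0::'a) (\<rho> + 2 ^ Suc n)) * emeasure \<nu> {2 ^ n..<2 ^ Suc n}"
  unfolding shell_def by (rule emeasure_intensity_Times) auto
 also have "emeasure \<nu> {2 ^ n..<2 ^ Suc n} = ennreal ((2 ^ n) powr (- \<delta>) - (2 ^ Suc n) powr (- \<delta>))" by (rule radius_interval) auto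
 also have "\<dots> \<le> ennreal ((2 ^ n) powr (- \<delta>))" by (intro ennreal_leI) simp
 also have "emeasure lborel (ball (0::'a) (\<rho> + 2 ^ Suc n)) \<le> ennreal (unit_ball_vol (real DIM('a)) * ((\<rho> + 2) * 2 ^ n) ^ DIM('a))"
 proof -
  have "\<rho> * 1 \<le> \<rho> * 2 ^ n" by (rule mult_left_mono) (use \<rho> in auto)
  then have "\<rho> + 2 ^ Suc n \<le> (\<rho> + 2) * 2 ^ n" by (simp add: algebra_simps)
  moreover have "0 \<le> \<rho> + 2 ^ Suc n" using \<rho> by (intro add_nonneg_nonneg) auto
  ultimately show ?thesis
   unfolding emeasure_ball[OF \<open>0 \<le> \<rho> + 2 ^ Suc n\<close>] by (intro ennreal_leI mult_left_mono power_mono) auto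
 qed
 finally have "emeasure \<Lambda> (shell \<rho> n)
  \<le> ennreal (unit_ball_vol (real DIM('a)) * ((\<rho> + 2) * 2 ^ n) ^ DIM('a)) * ennreal ((2 ^ n) powr (- \<delta>))"
  by (meson mult_mono order_refl order_trans zero_le)
 also have "\<dots> = ennreal (unit_ball_vol (real DIM('a)) * (\<rho> + 2) ^ DIM('a) * ((2 ^ n) ^ DIM('a) * (2 ^ n) powr (- \<delta>)))"
  using \<rho> by (subst ennreal_mult[symmetric]) (auto simp: power_mult_distrib mult_ac)
 finally show ?thesis .
qed

lemma shell_finite: "0 \<le> \<rho> \<Longrightarrow> emeasure \<Lambda> (shell \<rho> n) < \<infinity>" by (rule le_less_trans[OF shell_intensity]) auto

text \<open>Here the assumption on the exponents enters. With \<open>d\<close> for the dimension,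
  the \<open>n\<close>-th term has weight \<open>2 ^ n\<close> to the power
  \<open>- \<gamma>\<close>, volume of order \<open>2 ^ n\<close> to the power \<open>d\<close> and
  radius mass at most \<open>2 ^ n\<close> to the power \<open>- \<delta>\<close>; together this is
  a geometric series of ratio \<open>2 powr (d - \<gamma> - \<delta>)\<close>.\<close>

lemma far_mean_summable:
 assumes \<rho>: "0 \<le> \<rho>"
 shows "summable (\<lambda>n. 2 * weight K n * measure \<Lambda> (shell \<rho> n))"
proof (rule summable_comparison_test')
 let ?B = "unit_ball_vol (real DIM('a)) * (\<rho> + 2) ^ DIM('a)"
 let ?q = "2 powr (real DIM('a) - \<gamma> - \<delta>)"
 have "?q < 2 powr 0" using exponents by (intro powr_less_mono) auto
 then show "summable (\<lambda>n. 2 * ?B * ?q ^ n)" by (intro summable_mult summable_geometric) auto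
 fix n :: nat
 have B: "0 \<le> ?B" using \<rho> by auto
 have "measure \<Lambda> (shell \<rho> n) \<le> ?B * ((2 ^ n) ^ DIM('a) * (2 ^ n) powr (- \<delta>))"
  unfolding measure_def using shell_intensity[OF \<rho>, of n] B by (intro enn2real_leI) auto
 moreover have "weight K n \<le> (2 ^ n) powr (- \<gamma>)" by (simp add: weight_def)
 ultimately have "weight K n * measure \<Lambda> (shell \<rho> n) \<le> (2 ^ n) powr (- \<gamma>) * (?B * ((2 ^ n) ^ DIM('a) * (2 ^ n) powr (- \<delta>)))"
  by (intro mult_mono) auto
 also have "\<dots> = ?B * (2 powr real n) powr (real DIM('a) - \<gamma> - \<delta>)"
 proof -
  have "(2 powr real n) powr (real DIM('a) - \<gamma> - \<delta>) = (2 ^ n) powr (- \<gamma> + (real DIM('a) + - \<delta>))"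
   by (simp add: powr_realpow algebra_simps)
  also have "\<dots> = (2 ^ n) powr (- \<gamma>) * ((2 ^ n) ^ DIM('a) * (2 ^ n) powr (- \<delta>))"
   unfolding powr_add by (simp add: powr_realpow)
  finally show ?thesis by simp
 qed
 also have "(2 powr real n) powr (real DIM('a) - \<gamma> - \<delta>) = ?q ^ n" by (simp add: powr_powr powr_power mult.commute)
 finally show "norm (2 * weight K n * measure \<Lambda> (shell \<rho> n)) \<le> 2 * ?B * ?q ^ n"
  using weight_bounds(1)[of K n] by simp
qed

lemma far_mean_nonneg: "0 \<le> \<rho> \<Longrightarrow> 0 \<le> far_mean \<rho> K"
 unfolding far_mean_def by (intro suminf_nonneg far_mean_summable) (auto simp: weight_bounds)

lemma far_mean_small:
 assumes \<rho>: "0 \<le> \<rho>" and e: "0 < e"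
 obtains K where "far_mean \<rho> K < e"
proof -
 let ?f = "\<lambda>n. 2 * weight 0 n * measure \<Lambda> (shell \<rho> n)"
 obtain K where K: "norm (\<Sum>n. ?f (n + K)) < e"
  using suminf_exist_split[OF e far_mean_summable[OF \<rho>, of 0]] by blast
 have "far_mean \<rho> K = (\<Sum>n. ?f (n + K))" unfolding far_mean_def
  by (subst suminf_split_initial_segment[OF far_mean_summable[OF \<rho>], of K K]) (simp add: weight_def)
 then show thesis using K by (intro that[of K]) auto
qed

lemma far_field_measurable [measurable]: "far_field \<rho> K \<in> borel_measurable P"
 unfolding far_field_def[abs_def] by measurable

lemma shells_disjoint: "disjoint_family (shell \<rho>)"
proof -
 have "shell \<rho> m \<inter> shell \<rho> n = {}" if "m < n" for m n
 proof -
  have "(2::real) ^ Suc m \<le> 2 ^ n" using that by (intro power_increasing) auto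
  then show ?thesis by (auto simp: shell_def)
 qed
 then show ?thesis unfolding disjoint_family_on_def by (metis Int_commute linorder_neqE_nat)
qed

text \<open>Disjoint shells have independent counts, so exponential moments of finite partial sums
  multiply; the resulting bound does not depend on the number of shells.\<close>

lemma far_field_partial:
 assumes \<rho>: "0 \<le> \<rho>"
 shows "(\<integral>\<^sup>+\<eta>. exp_pos (\<Sum>n<m. ennreal (weight K n) * enpoints (shell \<rho> n) \<eta>) \<partial>P) \<le> ennreal (exp (far_mean \<rho> K))"
proof -
 have s: "range (shell \<rho>) \<subseteq> sets borel" by auto
 let ?X = "\<lambda>n \<eta>. exp_pos (ennreal (weight K n) * enpoints (shell \<rho> n) \<eta>)"
 let ?a = "\<lambda>n. 2 * weight K n * measure \<Lambda> (shell \<rho> n)"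
 have "indep_vars (\<lambda>_. count_space UNIV) (\<lambda>n. npoints (shell \<rho> n)) {..<m}"
  by (rule indep_vars_subset[OF indep_npoints[OF s shells_disjoint]]) auto
 then have "indep_vars (\<lambda>_. borel) ?X {..<m}" by (rule indep_vars_compose2) auto
 then have "(\<integral>\<^sup>+\<eta>. (\<Prod>n<m. ?X n \<eta>) \<partial>P) = (\<Prod>n<m. \<integral>\<^sup>+\<eta>. ?X n \<eta> \<partial>P)" by (intro indep_vars_nn_integral) auto
 also have "\<dots> \<le> (\<Prod>n<m. ennreal (exp (?a n)))"
 proof (rule prod_mono_ennreal)
  fix n
  have "exp (weight K n) \<le> 1 + 2 * weight K n"
   using exp_bound[OF weight_bounds(1,2)[of K n]] mult_left_le[OF weight_bounds(2,1)[of K n]]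
   by (simp add: power2_eq_square)
  then have "measure \<Lambda> (shell \<rho> n) * (exp (weight K n) - 1) \<le> measure \<Lambda> (shell \<rho> n) * (2 * weight K n)"
   by (intro mult_left_mono) auto
  then show "(\<integral>\<^sup>+\<eta>. ?X n \<eta> \<partial>P) \<le> ennreal (exp (?a n))"
   using npoints_exp_moment[OF shell_measurable shell_finite[OF \<rho>] weight_bounds(1)] by (simp add: ennreal_leI mult_ac)
 qed
 also have "\<dots> = ennreal (exp (\<Sum>n<m. ?a n))" by (simp add: exp_sum prod_ennreal)
 also have "\<dots> \<le> ennreal (exp (far_mean \<rho> K))" unfolding far_mean_def
  by (auto intro!: ennreal_leI sum_le_suminf far_mean_summable \<rho> simp: weight_bounds)
 finally show ?thesis by (simp add: exp_pos_sum)
qed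

lemma far_field_mean:
 assumes \<rho>: "0 \<le> \<rho>" shows "(\<integral>\<^sup>+\<eta>. far_field \<rho> K \<eta> \<partial>P) \<le> ennreal (exp (far_mean \<rho> K))"
proof -
 let ?f = "\<lambda>n \<eta>. ennreal (weight K n) * enpoints (shell \<rho> n) \<eta>"
 have "(\<integral>\<^sup>+\<eta>. far_field \<rho> K \<eta> \<partial>P) = (SUP m. \<Sum>n<m. \<integral>\<^sup>+\<eta>. ?f n \<eta> \<partial>P)"
  unfolding far_field_def by (subst nn_integral_suminf) (auto simp: suminf_eq_SUP)
 also have "\<dots> \<le> ennreal (exp (far_mean \<rho> K))"
 proof (rule SUP_least)
  fix m
  have "(\<Sum>n<m. \<integral>\<^sup>+\<eta>. ?f n \<eta> \<partial>P) = (\<integral>\<^sup>+\<eta>. (\<Sum>n<m. ?f n \<eta>) \<partial>P)" by (rule nn_integral_sum[symmetric]) measurable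
  also have "\<dots> \<le> (\<integral>\<^sup>+\<eta>. exp_pos (\<Sum>n<m. ?f n \<eta>) \<partial>P)" by (intro nn_integral_mono le_exp_pos)
  also have "\<dots> \<le> ennreal (exp (far_mean \<rho> K))" by (rule far_field_partial[OF \<rho>])
  finally show "(\<Sum>n<m. \<integral>\<^sup>+\<eta>. ?f n \<eta> \<partial>P) \<le> ennreal (exp (far_mean \<rho> K))" .
 qed
 finally show ?thesis .
qed

text \<open>The tail event is the increasing union of the tail events of the partial sums, and each
  of these obeys the exponential Markov inequality with the uniform bound.\<close>

lemma far_field_tail:
 assumes \<rho>: "0 \<le> \<rho>" and t: "0 \<le> t"
 shows "emeasure P {\<eta> \<in> space P. ennreal t < far_field \<rho> K \<eta>} \<le> ennreal (exp (far_mean \<rho> K - t))"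
proof -
 let ?S = "\<lambda>m \<eta>. \<Sum>n<m. ennreal (weight K n) * enpoints (shell \<rho> n) \<eta>"
 let ?E = "\<lambda>m. {\<eta> \<in> space P. ennreal t < ?S m \<eta>}"
 have Em: "?E m \<in> events" for m by measurable
 have "{\<eta> \<in> space P. ennreal t < far_field \<rho> K \<eta>} = (\<Union>m. ?E m)"
  by (auto simp: far_field_def suminf_eq_SUP less_SUP_iff)
 also have "emeasure P (\<Union>m. ?E m) = (SUP m. emeasure P (?E m))"
 proof (rule SUP_emeasure_incseq[symmetric])
  show "incseq ?E" by (rule incseq_SucI) (auto intro: less_le_trans)
 qed (use Em in auto)
 also have "\<dots> \<le> ennreal (exp (far_mean \<rho> K - t))"
 proof (rule SUP_least)
  fix m
  have "emeasure P (?E m) \<le> (\<integral>\<^sup>+\<eta>. ennreal (exp (- t)) * exp_pos (?S m \<eta>) \<partial>P)"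
  proof (subst nn_integral_indicator[OF Em, symmetric], rule nn_integral_mono)
   fix \<eta>
   have "1 \<le> ennreal (exp (- t)) * exp_pos (?S m \<eta>)" if "ennreal t < ?S m \<eta>"
   proof -
    have "ennreal (exp (- t)) * exp_pos (ennreal t) \<le> ennreal (exp (- t)) * exp_pos (?S m \<eta>)"
     by (intro mult_left_mono exp_pos_mono) (use that in auto)
    then show ?thesis using t by (simp add: exp_pos_ennreal ennreal_mult[symmetric] exp_minus)
   qed
   then show "indicator (?E m) \<eta> \<le> ennreal (exp (- t)) * exp_pos (?S m \<eta>)" by (auto simp: indicator_def)
  qed
  also have "\<dots> = ennreal (exp (- t)) * (\<integral>\<^sup>+\<eta>. exp_pos (?S m \<eta>) \<partial>P)" by (rule nn_integral_cmult) measurable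
  also have "\<dots> \<le> ennreal (exp (- t)) * ennreal (exp (far_mean \<rho> K))" by (intro mult_left_mono far_field_partial \<rho>) simp
  also have "\<dots> = ennreal (exp (far_mean \<rho> K - t))" by (simp add: ennreal_mult[symmetric] exp_add[symmetric])
  finally show "emeasure P (?E m) \<le> ennreal (exp (far_mean \<rho> K - t))" .
 qed
 finally show ?thesis .
qed

end

section \<open>Ergodicity of translations and growth of the potential\<close>

context marked_poisson
begin

lemma move_preserving: "measure_preserving P (move 1 x)" by unfold_locales (auto simp: distr_move_P)

lemma move_ergodic:
 assumes x: "x \<noteq> 0" shows "ergodic_map P (move 1 x)"
proof -
 interpret M: measure_preserving P "move 1 x" by (rule move_preserving)
 show ?thesis
 proof
  fix A assume A: "A \<in> events" "AE \<eta> in P. move 1 x \<eta> \<in> A \<longrightarrow> \<eta> \<in> A"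
  show "prob A = 0 \<or> prob A = 1"
  proof (rule M.zero_one_of_mixing[OF _ A])
   fix A assume "A \<in> events"
   then have "(\<lambda>n. prob (A \<inter> (move 1 (real n *\<^sub>R x) -` A \<inter> configs))) \<longlonglongrightarrow> prob A * prob A"
    by (intro move_mixing x) auto
   moreover have "(move 1 x ^^ n) = move 1 (real n *\<^sub>R x)" for n by (rule ext) (rule move_funpow)
   ultimately show "(\<lambda>n. prob (A \<inter> ((move 1 x ^^ n) -` A \<inter> space P))) \<longlonglongrightarrow> prob A * prob A" by simp
  qed
 qed
qed

end

context lacoin_env
begin

text \<open>Polynomially many lattice cells cover the ball of radius \<open>L * real k\<close>. By
  stationarity each exceeds the height \<open>k powr (1/8)\<close> with probability of order
  \<open>exp (- k powr (1/8))\<close>, which beats every polynomial, and Borel-Cantelli applies. Any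
  positive power would do here; \<open>1/8\<close> leaves room in the later comparison of
  rates.\<close>

lemma potential_growth:
 assumes L: "0 < L"
 shows "AE \<eta> in P. eventually (\<lambda>k. \<forall>u\<in>cball 0 (L * real k). lacoin \<gamma> u \<eta> \<le> ennreal (real k powr (1/8))) sequentially"
proof -
 let ?d = "DIM('a)"
 define m where "m k = \<lceil>L * real k\<rceil>" for k
 define F where "F k = PiE (Basis :: 'a set) (\<lambda>_. {- m k..m k})" for k
 define z :: "('a \<Rightarrow> int) \<Rightarrow> 'a" where "z f = (\<Sum>b\<in>Basis. of_int (f b) *\<^sub>R b)" for f
 \<comment> \<open>The radius \<open>real ?d\<close> of the far field around a lattice point covers
   the whole cell of that point.\<close>
 define E where "E k f = {\<eta> \<in> space P. ennreal (real k powr (1/8)) < far_field (real ?d) 0 (move 1 (z f) \<eta>)}" for k f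
 have E [measurable]: "E k f \<in> events" for k f unfolding E_def by measurable
 have finF: "finite (F k)" for k unfolding F_def by (intro finite_PiE) auto
 have pE: "prob (E k f) \<le> exp (far_mean (real ?d) 0 - real k powr (1/8))" for k f
 proof -
  let ?A = "{\<eta> \<in> space P. ennreal (real k powr (1/8)) < far_field (real ?d) 0 \<eta>}"
  have A: "?A \<in> sets config_space" unfolding sets_P[symmetric] by measurable
  have "E k f = move 1 (z f) -` ?A \<inter> configs" using move_configs[of 1] by (auto simp: E_def)
  then have "prob (E k f) = prob ?A" by (simp only: prob_move[OF _ A] abs_one)
  also have "\<dots> \<le> exp (far_mean (real ?d) 0 - real k powr (1/8))"
   using far_field_tail[of "real ?d" "real k powr (1/8)" 0] by (simp add: emeasure_eq_measure)
  finally show ?thesis .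
 qed
 let ?a = "\<lambda>k. (2 * (L * real k + 2) + 1) powr real ?d * exp (far_mean (real ?d) 0 - real k powr (1/8))"
 have pU: "prob (\<Union>f\<in>F k. E k f) \<le> ?a k" for k
 proof -
  have L0: "0 \<le> L * real k" using L by simp
  then have m0: "0 \<le> m k" by (simp add: m_def)
  have "prob (\<Union>f\<in>F k. E k f) \<le> (\<Sum>f\<in>F k. prob (E k f))"
   by (rule finite_measure_subadditive_finite) (use finF E in auto)
  also have "\<dots> \<le> real (card (F k)) * exp (far_mean (real ?d) 0 - real k powr (1/8))"
   using sum_bounded_above[of "F k" "\<lambda>f. prob (E k f)"] pE by auto
  also have "real (card (F k)) = (2 * real_of_int (m k) + 1) ^ ?d" using m0 by (simp add: F_def card_PiE)
  also have "\<dots> \<le> (2 * (L * real k + 2) + 1) ^ ?d" using m0 by (intro power_mono) (auto simp: m_def, linarith)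
  also have "\<dots> = (2 * (L * real k + 2) + 1) powr real ?d"
   using L0 by (intro powr_realpow[symmetric]) (simp add: add_nonneg_pos)
  finally show ?thesis by (simp add: mult_right_mono)
 qed
 have "summable ?a"
 proof (rule summable_comparison_test_bigo)
  show "summable (\<lambda>k. norm (real k powr (-2)))" by (simp add: summable_real_powr_iff)
  show "?a \<in> O(\<lambda>k. real k powr (-2))" using L by real_asymp
 qed
 then have "summable (\<lambda>k. prob (\<Union>f\<in>F k. E k f))" by (rule summable_comparison_test') (use pU in auto)
 then have "AE \<eta> in P. eventually (\<lambda>k. \<eta> \<in> space P - (\<Union>f\<in>F k. E k f)) sequentially"
 proof (intro borel_cantelli_AE1)
  show "(\<Union>f\<in>F k. E k f) \<in> events" for k by (rule sets.finite_UN[OF finF E])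
 qed (auto simp: emeasure_eq_measure)
 then show ?thesis
 proof eventually_elim
  case (elim \<eta>)
  then show ?case
  proof (rule eventually_mono, intro ballI)
   fix k u assume w: "\<eta> \<in> space P - (\<Union>f\<in>F k. E k f)" and u: "u \<in> cball (0::'a) (L * real k)"
   define f where "f = (\<lambda>b\<in>Basis. \<lfloor>u \<bullet> b\<rfloor>)"
   have "f \<in> F k" unfolding F_def
   proof (rule PiE_I)
    fix b :: 'a assume b: "b \<in> Basis"
    have "\<bar>u \<bullet> b\<bar> \<le> L * real k" using Basis_le_norm[OF b, of u] u by simp
    then show "f b \<in> {- m k..m k}" using b unfolding f_def m_def by simp linarith
   qed (simp add: f_def)
   then have "\<eta> \<notin> E k f" using w by blast
   then have "far_field (real ?d) 0 (move 1 (z f) \<eta>) \<le> ennreal (real k powr (1/8))" using w by (simp add: E_def not_less)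
   moreover have "lacoin \<gamma> (u - z f) (move 1 (z f) \<eta>) \<le> far_field (real ?d) 0 (move 1 (z f) \<eta>)"
   proof (rule lacoin_le_far_field)
    have "z f \<in> cell u" by (auto simp: cell_def z_def f_def)
    then show "norm (u - z f) \<le> real ?d" by (rule cell_near)
   qed (use w in \<open>auto intro: move_configs\<close>)
   ultimately show "lacoin \<gamma> u \<eta> \<le> ennreal (real k powr (1/8))" by (simp add: lacoin_move)
  qed
 qed
qed

end

section \<open>Passage costs\<close>

context lacoin_bm
begin

text \<open>Some locally finite configurations have an infinite potential. In a tame one all
  connection weights are positive, so \<open>passage\<close> is the true logarithmic cost.\<close>

definition tame :: "('a \<times> real) set \<Rightarrow> bool" where
 "tame \<eta> \<longleftrightarrow> \<eta> \<in> configs \<and> (\<forall>R. \<exists>S\<ge>0. \<forall>u\<in>cball 0 R. V \<eta> u \<le> ennreal S)"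

definition passage :: "('a \<times> real) set \<Rightarrow> 'a \<Rightarrow> real" where
 "passage \<eta> x = - ln (enn2real (bm.conn (V \<eta>) 0 x))"

lemma AE_tame: "AE \<eta> in P. tame \<eta>" using env.potential_growth[OF zero_less_one] AE_space
proof eventually_elim
 case (elim \<eta>)
 have "\<exists>S\<ge>0. \<forall>u\<in>cball 0 R. V \<eta> u \<le> ennreal S" for R
 proof -
  obtain k0 where k0: "\<And>k. k0 \<le> k \<Longrightarrow> \<forall>u\<in>cball 0 (real k). V \<eta> u \<le> ennreal (real k powr (1/8))"
   using elim(1) by (auto simp: eventually_sequentially)
  obtain k1 :: nat where "R \<le> real k1" using real_arch_simple by blast
  then have "cball 0 R \<subseteq> cball (0::'a) (real (max k0 k1))" by (intro subset_cball) simp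
  then show ?thesis using k0[of "max k0 k1"] by (intro exI[of _ "real (max k0 k1) powr (1/8)"]) auto
 qed
 then show ?case using elim(2) by (simp add: tame_def)
qed

lemma tame_measurable: "tame \<eta> \<Longrightarrow> V \<eta> \<in> borel_measurable borel" by (auto simp: tame_def intro: V_measurable)

lemma tame_cball: "tame \<eta> \<Longrightarrow> \<exists>S\<ge>0. \<forall>u\<in>cball x R. V \<eta> u \<le> ennreal S"
proof -
 assume t: "tame \<eta>"
 have "cball x R \<subseteq> cball 0 (norm x + R)" by (auto simp: dist_norm) (metis add.commute norm_triangle_sub add_left_mono order_trans norm_minus_commute)
 then show ?thesis using t unfolding tame_def by (meson subsetD)
qed

lemma V_move: "V (move 1 a \<eta>) = (\<lambda>u. V \<eta> (a + u))" by (rule ext) (simp add: lacoin_move)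

lemma conn_move: "bm.conn (V (move 1 a \<eta>)) x y = bm.conn (V \<eta>) (a + x) (a + y)"
 unfolding V_move by (rule bm.conn_translate)

lemma conn_pos:
 assumes t: "tame \<eta>" shows "0 < bm.conn (V \<eta>) x y"
proof -
 obtain c where c: "bm.hop_const c" using bm.hop_const_exists by blast
 obtain m where m: "dist x y \<le> real m" "1 \<le> m"
 proof -
  obtain n where "dist x y \<le> real n" using real_arch_simple by blast
  then show thesis by (intro that[of "Suc n"]) auto
 qed
 obtain S where "0 \<le> S" "\<forall>u\<in>cball x (real m + c). V \<eta> u \<le> ennreal S" using tame_cball[OF t] by blast
 then have "ennreal (exp (- (real m * (c + S)))) \<le> bm.hop (V \<eta>) m x y"
  by (intro bm.hop_constD[OF c tame_measurable[OF t]] m) auto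
 also have "\<dots> \<le> bm.conn (V \<eta>) x y" by (rule bm.hop_le_conn)
 finally show ?thesis by (simp add: less_le_trans[rotated])
qed

lemma conn_eq: "tame \<eta> \<Longrightarrow> bm.conn (V \<eta>) 0 x = ennreal (exp (- passage \<eta> x))"
proof -
 assume t: "tame \<eta>"
 obtain c where c: "bm.conn (V \<eta>) 0 x = ennreal c" "0 < c"
  using conn_pos[OF t, of 0 x] bm.conn_le_1[of "V \<eta>" 0 x]
  by (cases "bm.conn (V \<eta>) 0 x") (auto simp: top_unique)
 then show ?thesis by (simp add: passage_def)
qed

lemma passage_nonneg:
 assumes t: "tame \<eta>" shows "0 \<le> passage \<eta> x" using bm.conn_le_1[of "V \<eta>" 0 x] unfolding conn_eq[OF t] by simp

lemma passage_le:
 "tame \<eta> \<Longrightarrow> ennreal (exp (- c)) \<le> bm.conn (V \<eta>) 0 x \<Longrightarrow> passage \<eta> x \<le> c" by (simp add: conn_eq)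

lemma passage_measurable [measurable]: "(\<lambda>\<eta>. passage \<eta> x) \<in> borel_measurable P"
proof -
 have "(\<lambda>\<eta>. bm.conn (V \<eta>) 0 x) \<in> borel_measurable P"
  by (rule bm.conn_measurable_param[OF V_pair_measurable lsc_lacoin])
 then show ?thesis unfolding passage_def[abs_def] by measurable
qed

lemma passage_subadditive:
 assumes t: "tame \<eta>" and t': "tame (move 1 x \<eta>)"
 shows "passage \<eta> (x + y) \<le> passage \<eta> x + passage (move 1 x \<eta>) y"
proof (rule passage_le[OF t])
 have "bm.conn (V \<eta>) 0 x * bm.conn (V \<eta>) x (x + y) \<le> bm.conn (V \<eta>) 0 (x + y)"
  by (rule bm.conn_mult[OF tame_measurable[OF t]])
 also have "bm.conn (V \<eta>) x (x + y) = bm.conn (V (move 1 x \<eta>)) 0 y" by (simp add: conn_move)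
 finally show "ennreal (exp (- (passage \<eta> x + passage (move 1 x \<eta>) y))) \<le> bm.conn (V \<eta>) 0 (x + y)"
  unfolding conn_eq[OF t] conn_eq[OF t'] by (simp add: ennreal_mult[symmetric] exp_add[symmetric])
qed

lemma passage_bound:
 assumes c: "bm.hop_const c" and t: "tame \<eta>" and S: "0 \<le> S" and bd: "\<And>u. u \<in> cball 0 (norm x + 2 + c) \<Longrightarrow> V \<eta> u \<le> ennreal S"
 shows "passage \<eta> x \<le> (norm x + 2) * (c + S)"
proof -
 define m where "m = nat \<lceil>norm x\<rceil> + 1"
 have m: "1 \<le> m" "norm x \<le> real m" "real m \<le> norm x + 2" using norm_ge_zero[of x] unfolding m_def by linarith+
 have "ennreal (exp (- (real m * (c + S)))) \<le> bm.hop (V \<eta>) m 0 x"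
  by (rule bm.hop_constD[OF c tame_measurable[OF t] m(1) _ S]) (use m bd in auto)
 also have "\<dots> \<le> bm.conn (V \<eta>) 0 x" by (rule bm.hop_le_conn)
 finally have "passage \<eta> x \<le> real m * (c + S)" by (rule passage_le[OF t])
 also have "\<dots> \<le> (norm x + 2) * (c + S)" using m(3) S c by (intro mult_right_mono) (auto simp: bm.hop_const_def)
 finally show ?thesis .
qed

text \<open>Straight hops bound the cost by an affine function of the supremum of the potential near
  the origin; the far field dominates this supremum and has finite mean.\<close>

lemma passage_integrable: "integrable P (\<lambda>\<eta>. passage \<eta> x)"
proof -
 obtain c where c: "bm.hop_const c" using bm.hop_const_exists by blast
 then have c0: "0 < c" by (simp add: bm.hop_const_def)
 define \<rho> where "\<rho> = norm x + 2 + c"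
 have \<rho>: "0 \<le> \<rho>" using c0 by (simp add: \<rho>_def add_nonneg_nonneg)
 let ?X = "\<lambda>\<eta>. ennreal (norm x + 2) * (ennreal c + env.far_field \<rho> 0 \<eta>)"
 have fin: "(\<integral>\<^sup>+\<eta>. env.far_field \<rho> 0 \<eta> \<partial>P) < \<infinity>"
  using env.far_field_mean[OF \<rho>, of 0] by (auto intro: le_less_trans)
 have "AE \<eta> in P. ennreal (norm (passage \<eta> x)) \<le> ?X \<eta>"
  using AE_tame nn_integral_PInf_AE[OF env.far_field_measurable fin[THEN less_imp_neq, unfolded infinity_ennreal_def[symmetric]]]
 proof eventually_elim
  case (elim \<eta>)
  then obtain S where S: "env.far_field \<rho> 0 \<eta> = ennreal S" "0 \<le> S" by (cases "env.far_field \<rho> 0 \<eta>") auto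
  have "V \<eta> u \<le> ennreal S" if "u \<in> cball 0 \<rho>" for u
   using env.lacoin_le_far_field[of \<eta> 0 \<rho> u] that elim(1) by (simp add: S tame_def)
  then have "passage \<eta> x \<le> (norm x + 2) * (c + S)" unfolding \<rho>_def by (intro passage_bound[OF c elim(1) S(2)])
  then show ?case using passage_nonneg[OF elim(1)] c0 S(2)
   by (simp add: S ennreal_mult[symmetric] ennreal_plus[symmetric] ennreal_leI del: ennreal_plus)
 qed
 then have "(\<integral>\<^sup>+\<eta>. ennreal (norm (passage \<eta> x)) \<partial>P) \<le> (\<integral>\<^sup>+\<eta>. ?X \<eta> \<partial>P)" by (rule nn_integral_mono_AE)
 also have "\<dots> = ennreal (norm x + 2) * (ennreal c * emeasure P (space P) + (\<integral>\<^sup>+\<eta>. env.far_field \<rho> 0 \<eta> \<partial>P))"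
  by (subst nn_integral_cmult, measurable, subst nn_integral_add) (auto simp: nn_integral_const)
 also have "\<dots> < \<infinity>" unfolding env.emeasure_space_1 using fin by (auto simp: ennreal_mult_less_top)
 finally show ?thesis by (intro integrableI_bounded) auto
qed

definition mean_passage :: "'a \<Rightarrow> real" where
 "mean_passage x = (\<integral>\<eta>. passage \<eta> x \<partial>P)"

lemma AE_tame_move: "AE \<eta> in P. \<forall>n::nat. tame (move 1 (real n *\<^sub>R x) \<eta>)"
proof -
 interpret M: measure_preserving P "move 1 x" by (rule env.move_preserving)
 show ?thesis using M.AE_T_pow[OF AE_tame] by (simp add: AE_all_countable move_funpow)
qed

lemma mean_passage_nonneg: "0 \<le> mean_passage x"
 unfolding mean_passage_def by (rule integral_nonneg_AE) (use AE_tame in \<open>auto elim: AE_mp simp: passage_nonneg\<close>)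

lemma mean_passage_move: "(\<integral>\<eta>. passage (move 1 a \<eta>) x \<partial>P) = mean_passage x"
 using integral_distr[OF env.measurable_move_P[of 1 a] passage_measurable[of x]]
 by (simp add: env.distr_move_P mean_passage_def)

lemma passage_move_integrable: "integrable P (\<lambda>\<eta>. passage (move 1 a \<eta>) x)"
 using integrable_distr[OF env.measurable_move_P[of 1 a], of "\<lambda>\<eta>. passage \<eta> x"] passage_integrable
 by (simp add: env.distr_move_P)

lemma mean_passage_subadditive: "mean_passage (x + y) \<le> mean_passage x + mean_passage y"
proof -
 have "mean_passage (x + y) \<le> (\<integral>\<eta>. passage \<eta> x + passage (move 1 x \<eta>) y \<partial>P)" unfolding mean_passage_def
 proof (rule integral_mono_AE)
  show "AE \<eta> in P. passage \<eta> (x + y) \<le> passage \<eta> x + passage (move 1 x \<eta>) y" using AE_tame AE_tame_move[of x]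
  proof eventually_elim
   case (elim \<eta>)
   from elim(2)[rule_format, of 1] elim(1) show ?case by (intro passage_subadditive) auto
  qed
 qed (auto intro: passage_integrable passage_move_integrable)
 also have "\<dots> = mean_passage x + mean_passage y" by (subst Bochner_Integration.integral_add)
    (auto intro: passage_integrable passage_move_integrable simp: mean_passage_move, simp add: mean_passage_def)
 finally show ?thesis .
qed

text \<open>Environment and path are reflected together; both laws are invariant.\<close>

lemma mean_passage_uminus: "mean_passage (- x) = mean_passage x"
proof -
 have "mean_passage x = (\<integral>\<eta>. passage (move (-1) 0 \<eta>) x \<partial>P)"
  using integral_distr[OF env.measurable_move_P[of "-1" 0] passage_measurable[of x]]
  by (simp add: env.distr_move_P mean_passage_def)
 also have "\<dots> = mean_passage (- x)" unfolding mean_passage_def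
 proof (rule Bochner_Integration.integral_cong[OF refl])
  fix \<eta> assume "\<eta> \<in> space P"
  then have m: "V \<eta> \<in> borel_measurable borel" by (intro V_measurable) simp
  have "V (move (-1) 0 \<eta>) = (\<lambda>u. V \<eta> (- u))" by (rule ext) (simp add: lacoin_move)
  then show "passage (move (-1) 0 \<eta>) x = passage \<eta> (- x)"
   using bm.conn_reflect[OF m, of 0 "- x"] by (simp add: passage_def)
 qed
 finally show ?thesis ..
qed

end

section \<open>Hitting times and the travel weight\<close>

context brownian
begin

text \<open>The closed unit ball is hit by time \<open>s\<close>, expressed through rational
  fractions of \<open>s\<close> and slightly larger balls, so that the event is measurable jointly
  in path and time.\<close>

definition reached :: "'a \<Rightarrow> 'w \<Rightarrow> real \<Rightarrow> bool" where
 "reached y w s \<longleftrightarrow> (\<forall>n::nat. \<exists>q\<in>\<rat> \<inter> {0..1}. dist (path_at (sample_path Z w) (q * s)) y < 1 + 1 / real (Suc n))"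

definition hit_weight :: "('a \<Rightarrow> ennreal) \<Rightarrow> 'a \<Rightarrow> 'w \<Rightarrow> real" where
 "hit_weight v y w = exp_neg (\<integral>\<^sup>+ s\<in>{s. 0 \<le> s \<and> ereal s \<le> hitting_time Z y w}. v (Z s w) \<partial>lborel)
   * indicator {w. hitting_time Z y w < \<infinity>} w"

lemma path_pair_measurable: "(\<lambda>(w, s). path_at (sample_path Z w) s) \<in> borel_measurable (W \<Otimes>\<^sub>M borel)"
proof -
 have "(\<lambda>q. (sample_path Z (fst q), snd q)) \<in> measurable (W \<Otimes>\<^sub>M borel) (path_space \<Otimes>\<^sub>M borel)"
  using sample_path_measurable[OF grid] by measurable
 from measurable_compose[OF this path_at_measurable] show ?thesis by (simp add: split_beta')
qed

lemma reached_measurable: "Measurable.pred (W \<Otimes>\<^sub>M borel) (\<lambda>(w, s). reached y w s)"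
proof -
 have [measurable]: "(\<lambda>p. path_at (sample_path Z (fst p)) (q * snd p)) \<in> borel_measurable (W \<Otimes>\<^sub>M borel)" for q :: real
 proof -
  have "(\<lambda>p. (fst p, q * snd p)) \<in> measurable (W \<Otimes>\<^sub>M borel) (W \<Otimes>\<^sub>M borel)" by measurable
  from measurable_compose[OF this path_pair_measurable] show ?thesis by simp
 qed
 have [simp]: "countable (\<rat> \<inter> {0..1::real})" using countable_rat by blast
 show ?thesis unfolding reached_def split_beta' by measurable
qed

text \<open>The distance to \<open>y\<close> attains its minimum on the time interval, and
  approximate hits force this minimum to be at most 1. Conversely, a true hit is approximated along
  the dense set of rational fractions.\<close>

lemma reached_iff:
 assumes w: "w \<in> space W" and s: "0 \<le> s"
 shows "reached y w s \<longleftrightarrow> (\<exists>t\<in>{0..s}. Z t w \<in> cball y 1)"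
proof
 let ?g = "\<lambda>u. dist (Z (u * s) w) y"
 have cl: "closure (\<rat> \<inter> {0..1}) = {0..1::real}"
  using closure_convex_Int_superset[of "{0..1::real}" \<rat>] Rats_closure_real by (simp add: Int_commute)
 have us: "u * s \<in> {0..s}" if "u \<in> {0..1}" for u using that s by (auto intro: mult_left_le_one_le)
 have c: "continuous_on {0..1} ?g"
  by (intro continuous_on_dist continuous_on_const continuous_on_compose2[OF Z_continuous[OF w]] continuous_intros) (use us in auto)
 have X: "path_at (sample_path Z w) (u * s) = Z (u * s) w" if "0 \<le> u" for u
  using path_at_sample_path[OF grid w, of "u * s"] that s by simp
 {
  assume r: "reached y w s"
  obtain u where u: "u \<in> {0..1}" "\<And>v. v \<in> {0..1} \<Longrightarrow> ?g u \<le> ?g v"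
   using continuous_attains_inf[OF compact_Icc _ c] by auto
  have "?g u \<le> 1 + 1 / real (Suc n)" for n
  proof -
   obtain q where "q \<in> \<rat> \<inter> {0..1}" "dist (path_at (sample_path Z w) (q * s)) y < 1 + 1 / real (Suc n)"
    using r unfolding reached_def by blast
   then show ?thesis using u(2)[of q] X[of q] by auto
  qed
  then have "?g u \<le> 1" by (intro LIMSEQ_le_const[of "\<lambda>n. 1 + 1 / real (Suc n)" 1]) (real_asymp, auto)
  then show "\<exists>t\<in>{0..s}. Z t w \<in> cball y 1" using us[OF u(1)] by (auto simp: dist_commute)
 next
  assume "\<exists>t\<in>{0..s}. Z t w \<in> cball y 1"
  then obtain t where t: "0 \<le> t" "t \<le> s" "dist (Z t w) y \<le> 1" by (auto simp: dist_commute)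
  define u where "u = t / s"
  have u: "u \<in> {0..1}" "u * s = t" using t by (auto simp: u_def divide_le_eq)
  show "reached y w s"
  proof (rule ccontr)
   assume "\<not> reached y w s"
   then obtain n where "1 + 1 / real (Suc n) \<le> ?g q" if "q \<in> \<rat> \<inter> {0..1}" for q
    unfolding reached_def using X by (force simp: not_less)
   then have "1 + 1 / real (Suc n) \<le> ?g u" using continuous_ge_on_closure[of "\<rat> \<inter> {0..1}" ?g u] c u(1) unfolding cl by blast
   moreover have "0 < 1 / real (Suc n)" by simp
   ultimately show False using t(3) unfolding u(2) by linarith
  qed
 }
qed

lemma hitting_time_le: "0 \<le> t \<Longrightarrow> Z t w \<in> cball y 1 \<Longrightarrow> hitting_time Z y w \<le> ereal t"
 unfolding hitting_time_def by (rule INF_lower) simp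

lemma hitting_time_finite:
 assumes w: "w \<in> space W" shows "hitting_time Z y w < \<infinity> \<longleftrightarrow> (\<exists>n::nat. reached y w (real n))"
proof
 assume "hitting_time Z y w < \<infinity>"
 then obtain t where t: "0 \<le> t" "Z t w \<in> cball y 1" unfolding hitting_time_def INF_less_iff by auto
 obtain n :: nat where "t \<le> real n" using real_arch_simple by blast
 then show "\<exists>n::nat. reached y w (real n)" using t w by (auto simp: reached_iff intro!: exI[of _ n])
next
 assume "\<exists>n::nat. reached y w (real n)"
 then obtain t where "0 \<le> t" "Z t w \<in> cball y 1" using reached_iff[OF w] by force
 from hitting_time_le[OF this] show "hitting_time Z y w < \<infinity>" by (auto intro: le_less_trans)
qed

text \<open>Times up to the hitting time and times at which the ball is not yet
  \<open>reached\<close> differ at most in the hitting time itself, a null set; the right-hand side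
  is visibly measurable.\<close>

lemma hit_weight_eq:
 assumes w: "w \<in> space W"
 shows "hit_weight v y w = exp_neg (\<integral>\<^sup>+ s. (if 0 \<le> s \<and> \<not> reached y w s then v (path_at (sample_path Z w) s) else 0) \<partial>lborel)
   * (if \<exists>n::nat. reached y w (real n) then 1 else 0)"
proof -
 have "AE s in lborel. s \<noteq> real_of_ereal (hitting_time Z y w)" by (rule AE_lborel_singleton)
 then have "(\<integral>\<^sup>+ s\<in>{s. 0 \<le> s \<and> ereal s \<le> hitting_time Z y w}. v (Z s w) \<partial>lborel)
  = (\<integral>\<^sup>+ s. (if 0 \<le> s \<and> \<not> reached y w s then v (path_at (sample_path Z w) s) else 0) \<partial>lborel)"
 proof (intro nn_integral_cong_AE, eventually_elim)
  case (elim s)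
  show ?case
  proof (cases "0 \<le> s")
   case True
   have "ereal s \<le> hitting_time Z y w \<longleftrightarrow> \<not> reached y w s"
   proof
    assume l: "ereal s \<le> hitting_time Z y w"
    show "\<not> reached y w s"
    proof
     assume "reached y w s"
     then obtain t where t: "0 \<le> t" "t \<le> s" "Z t w \<in> cball y 1" using reached_iff[OF w True] by auto
     have "hitting_time Z y w \<le> ereal t" by (rule hitting_time_le[OF t(1,3)])
     then have "hitting_time Z y w = ereal s" using l t(2) by (metis antisym ereal_less_eq(3) order_trans)
     then show False using elim by simp
    qed
   next
    assume n: "\<not> reached y w s"
    show "ereal s \<le> hitting_time Z y w" unfolding hitting_time_def
    proof (rule INF_greatest, clarify)
     fix t assume t: "0 \<le> t" "Z t w \<in> cball y 1"
     show "ereal s \<le> ereal t"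
     proof (rule ccontr)
      assume "\<not> ereal s \<le> ereal t"
      then have "t \<in> {0..s}" using t by simp
      then show False using n t(2) reached_iff[OF w True] by blast
     qed
    qed
   qed
   then show ?thesis using True path_at_sample_path[OF grid w True] by (simp add: indicator_def)
  qed simp
 qed
 then show ?thesis unfolding hit_weight_def using hitting_time_finite[OF w, of y] by (simp add: indicator_def)
qed

lemma hit_weight_measurable:
 assumes v: "v \<in> borel_measurable borel" shows "hit_weight v y \<in> borel_measurable W"
proof -
 have [measurable]: "(\<lambda>p. v (path_at (sample_path Z (fst p)) (snd p))) \<in> borel_measurable (W \<Otimes>\<^sub>M borel)"
  using measurable_compose[OF path_pair_measurable v] by (simp add: split_beta')
 have [measurable]: "Measurable.pred (W \<Otimes>\<^sub>M borel) (\<lambda>p. reached y (fst p) (snd p))"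
  using reached_measurable by (simp add: split_beta')
 have [measurable]: "Measurable.pred W (\<lambda>w. reached y w s)" for s
  using measurable_compose[OF measurable_Pair2'[of s borel W] reached_measurable[of y]] by simp
 have "(\<lambda>w. \<integral>\<^sup>+ s. (if 0 \<le> s \<and> \<not> reached y w s then v (path_at (sample_path Z w) s) else 0) \<partial>lborel) \<in> borel_measurable W"
  by (rule lborel.borel_measurable_nn_integral) (simp add: split_beta')
 then have "(\<lambda>w. exp_neg (\<integral>\<^sup>+ s. (if 0 \<le> s \<and> \<not> reached y w s then v (path_at (sample_path Z w) s) else 0) \<partial>lborel)
   * (if \<exists>n::nat. reached y w (real n) then 1 else 0)) \<in> borel_measurable W" by measurable
 then show ?thesis by (simp cong: measurable_cong add: hit_weight_eq)
qed

lemma hit_weight_bounds: "0 \<le> hit_weight v y w" "hit_weight v y w \<le> 1"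
 by (auto simp: hit_weight_def exp_neg_nonneg exp_neg_le_1 indicator_def)

lemma travel_weight_eq:
 assumes v: "v \<in> borel_measurable borel"
 shows "ennreal (travel_weight W Z v y) = (\<integral>\<^sup>+w. ennreal (hit_weight v y w) \<partial>W)"
proof -
 have "integrable W (hit_weight v y)"
  by (rule integrable_const_bound[where B = 1]) (use hit_weight_bounds hit_weight_measurable[OF v] in auto)
 then show ?thesis unfolding travel_weight_def hit_weight_def[symmetric]
  by (intro nn_integral_eq_integral[symmetric]) (auto simp: hit_weight_bounds)
qed

text \<open>A path in the target of a hop at time \<open>n\<close> has hit the closed unit ball by
  then, and stopping the accumulation of potential at the hit only increases the weight.\<close>

lemma conn_le_travel_weight:
 assumes v: "v \<in> borel_measurable borel" shows "conn v 0 y \<le> ennreal (travel_weight W Z v y)"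
 unfolding conn_def travel_weight_eq[OF v]
proof (rule SUP_least)
 fix n
 have "hop v n 0 y \<le> fk W Z v n 0 (indicator (cball y (1/2)))" by (rule hop_le_fk) simp
 also have "\<dots> \<le> (\<integral>\<^sup>+w. ennreal (hit_weight v y w) \<partial>W)" unfolding fk_def
 proof (rule nn_integral_mono)
  fix w assume w: "w \<in> space W"
  show "ennreal (exp_neg (\<integral>\<^sup>+ s\<in>{0..real n}. v (0 + Z s w) \<partial>lborel)) * indicator (cball y (1/2)) (0 + Z (real n) w) \<le> ennreal (hit_weight v y w)"
  proof (cases "Z (real n) w \<in> cball y (1/2)")
   case True
   then have h: "hitting_time Z y w \<le> ereal (real n)" by (intro hitting_time_le) auto
   have "(\<integral>\<^sup>+ s\<in>{s. 0 \<le> s \<and> ereal s \<le> hitting_time Z y w}. v (Z s w) \<partial>lborel) \<le> (\<integral>\<^sup>+ s\<in>{0..real n}. v (0 + Z s w) \<partial>lborel)"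
   proof (rule nn_integral_mono)
    fix s
    have "s \<le> real n" if "ereal s \<le> hitting_time Z y w" using order_trans[OF that h] by simp
    then show "v (Z s w) * indicator {s. 0 \<le> s \<and> ereal s \<le> hitting_time Z y w} s \<le> v (0 + Z s w) * indicator {0..real n} s"
     by (auto simp: indicator_def)
   qed
   moreover have "hitting_time Z y w \<noteq> \<infinity>" using h by auto
   ultimately show ?thesis using True by (auto simp: hit_weight_def intro!: ennreal_leI exp_neg_antimono)
  qed simp
 qed
 finally show "hop v n 0 y \<le> (\<integral>\<^sup>+w. ennreal (hit_weight v y w) \<partial>W)" .
qed

text \<open>Either the hit comes no earlier than \<open>N\<close>, and the path has survived that
  long; or it comes in the unit interval after some \<open>j < N\<close>. In the second case the
  path is within \<open>M + 1\<close> of \<open>y\<close> at the integer time \<open>j\<close>,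
  unless it oscillates by more than \<open>M\<close> in that interval.\<close>

lemma travel_weight_le:
 assumes v [measurable]: "v \<in> borel_measurable borel" and M: "0 \<le> M"
 shows "ennreal (travel_weight W Z v y) \<le> (\<Sum>j<N. fk W Z v j 0 (indicator (cball y (M + 1)))) + fk W Z v N 0 (\<lambda>_. 1)
  + ennreal (real N * osc_tail DIM('a) M)"
proof -
 have "\<exists>B. B \<in> events \<and> prob B \<le> osc_tail DIM('a) M \<and>
   (\<forall>w\<in>space W - B. \<forall>s\<in>{0..1}. norm (Z (real j + s) w - Z (real j) w) \<le> M)" for j :: nat
  using oscillation_tail[of "real j" M] M by (metis of_nat_0_le_iff)
 then obtain B where B [measurable]: "\<And>j. B j \<in> events" and pB: "\<And>j. prob (B j) \<le> osc_tail DIM('a) M"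
  and oB: "\<And>j w s. w \<in> space W - B j \<Longrightarrow> s \<in> {0..1} \<Longrightarrow> norm (Z (real j + s) w - Z (real j) w) \<le> M" by metis
 let ?e = "\<lambda>j w. ennreal (exp_neg (\<integral>\<^sup>+ s\<in>{0..real j}. v (0 + Z s w) \<partial>lborel))"
 let ?f = "\<lambda>j w. ?e j w * indicator (cball y (M + 1)) (0 + Z (real j) w)"
 have fm: "(\<lambda>w. ?e j w * g (0 + Z (real j) w)) \<in> borel_measurable W" if [measurable]: "g \<in> borel_measurable borel" for j g
 proof -
  have "(\<lambda>w. fk_path v j 0 g (sample_path Z w)) \<in> borel_measurable W"
   by (rule measurable_compose[OF sample_path_measurable[OF grid] fk_path_measurable]) auto
  then show ?thesis by (simp cong: measurable_cong add: fk_path_sample_path[OF grid])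
 qed
 have "ennreal (hit_weight v y w) \<le> (\<Sum>j<N. ?f j w) + ?e N w * 1 + (\<Sum>j<N. indicator (B j) w)" if w: "w \<in> space W" for w
 proof (cases "ereal (real N) \<le> hitting_time Z y w")
  case True
  have "(\<integral>\<^sup>+ s\<in>{0..real N}. v (0 + Z s w) \<partial>lborel) \<le> (\<integral>\<^sup>+ s\<in>{s. 0 \<le> s \<and> ereal s \<le> hitting_time Z y w}. v (Z s w) \<partial>lborel)"
   using order_trans[OF _ True] by (intro nn_integral_mono) (auto simp: indicator_def)
  then have "ennreal (hit_weight v y w) \<le> ?e N w"
   using exp_neg_nonneg by (auto simp: hit_weight_def indicator_def intro!: ennreal_leI exp_neg_antimono)
  then show ?thesis by (simp add: add_increasing add_increasing2)
 next
  case False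
  define h where "h = real_of_ereal (hitting_time Z y w)"
  have "0 \<le> hitting_time Z y w" unfolding hitting_time_def by (rule INF_greatest) simp
  then have h: "hitting_time Z y w = ereal h" "0 \<le> h" "h < real N"
   using False unfolding h_def by (cases "hitting_time Z y w"; simp)+
  define j where "j = nat \<lfloor>h\<rfloor>"
  have j: "real j \<le> h" "h < real j + 1" "j < N" using h unfolding j_def by linarith+
  obtain t where t: "0 \<le> t" "Z t w \<in> cball y 1" "t < real j + 1"
  proof -
   have "hitting_time Z y w < ereal (real j + 1)" using h j by simp
   then show thesis using that unfolding hitting_time_def INF_less_iff by auto
  qed
  have "ereal h \<le> ereal t" using hitting_time_le[OF t(1,2)] h by simp
  then have ts: "t - real j \<in> {0..1}" using t(3) j(1) by simp
  show ?thesis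
  proof (cases "w \<in> B j")
   case True
   have "ennreal (hit_weight v y w) \<le> indicator (B j) w" using True hit_weight_bounds(2)[of v y w] by simp
   also have "\<dots> \<le> (\<Sum>j<N. indicator (B j) w)" using j(3) by (intro member_le_sum) auto
   finally show ?thesis by (simp add: add_increasing)
  next
   case False
   have "norm (Z (real j + (t - real j)) w - Z (real j) w) \<le> M" by (rule oB) (use False w ts in auto)
   then have "dist y (Z (real j) w) \<le> M + 1"
    using t(2) dist_triangle[of y "Z (real j) w" "Z t w"] by (simp add: dist_norm)
   moreover have "(\<integral>\<^sup>+ s\<in>{0..real j}. v (0 + Z s w) \<partial>lborel) \<le> (\<integral>\<^sup>+ s\<in>{s. 0 \<le> s \<and> ereal s \<le> hitting_time Z y w}. v (Z s w) \<partial>lborel)"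
    using j(1) h(1) by (intro nn_integral_mono) (auto simp: indicator_def)
   ultimately have "ennreal (hit_weight v y w) \<le> ?f j w"
    using exp_neg_nonneg by (auto simp: hit_weight_def indicator_def intro!: ennreal_leI exp_neg_antimono)
   also have "\<dots> \<le> (\<Sum>j<N. ?f j w)" using j(3) by (intro member_le_sum) auto
   finally show ?thesis by (simp add: add_increasing2 add.assoc)
  qed
 qed
 then have "ennreal (travel_weight W Z v y) \<le> (\<integral>\<^sup>+w. (\<Sum>j<N. ?f j w) + ?e N w * 1 + (\<Sum>j<N. indicator (B j) w) \<partial>W)"
  unfolding travel_weight_eq[OF v] by (rule nn_integral_mono)
 also have "\<dots> = (\<integral>\<^sup>+w. (\<Sum>j<N. ?f j w) \<partial>W) + (\<integral>\<^sup>+w. ?e N w * 1 \<partial>W) + (\<integral>\<^sup>+w. (\<Sum>j<N. indicator (B j) w) \<partial>W)"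
 proof -
  have 1: "(\<lambda>w. \<Sum>j<N. ?f j w) \<in> borel_measurable W" by (intro borel_measurable_sum fm) simp
  have 2: "(\<lambda>w. ?e N w * 1) \<in> borel_measurable W" using fm[of "\<lambda>_. 1"] by simp
  show ?thesis by (subst nn_integral_add, intro borel_measurable_add 1 2, measurable, subst nn_integral_add[OF 1 2], rule refl)
 qed
 also have "(\<integral>\<^sup>+w. (\<Sum>j<N. ?f j w) \<partial>W) = (\<Sum>j<N. fk W Z v j 0 (indicator (cball y (M + 1))))"
  unfolding fk_def by (rule nn_integral_sum) (rule fm, simp)
 also have "(\<integral>\<^sup>+w. ?e N w * 1 \<partial>W) = fk W Z v N 0 (\<lambda>_. 1)" unfolding fk_def by simp
 also have "(\<integral>\<^sup>+w. (\<Sum>j<N. indicator (B j) w) \<partial>W) = (\<Sum>j<N. ennreal (prob (B j)))"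
  by (subst nn_integral_sum) (auto simp: emeasure_eq_measure)
 also have "\<dots> \<le> ennreal (real N * osc_tail DIM('a) M)"
  using sum_bounded_above[of "{..<N}" "\<lambda>j. prob (B j)"] pB by (subst sum_ennreal) (auto intro!: ennreal_leI)
 finally show ?thesis by (simp add: add_left_mono)
qed

end

section \<open>The exponent and the almost sure growth of passage costs\<close>

lemma filterlim_nat_ceiling: "filterlim (\<lambda>r::real. nat \<lceil>r\<rceil>) sequentially at_top"
 by (rule filterlim_at_top_mono[OF filterlim_compose[OF filterlim_nat_sequentially filterlim_floor_sequentially]])
   (intro always_eventually allI nat_mono floor_le_ceiling)

lemma linear_dominates:
 fixes b c c' l :: real
 assumes "c' < c" "0 \<le> l" "0 \<le> b"
 shows "eventually (\<lambda>r. c' * r + l * (b + (r + 1) powr (1/8)) \<le> c * r) at_top" using assms by real_asymp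

context lacoin_bm
begin

text \<open>The time constant of the subadditive mean costs. As an infimum over integer multiples it
  yields evenness and the triangle inequality directly.\<close>

definition lyap :: "'a \<Rightarrow> real" where
 "lyap x = (INF n\<in>{1::nat..}. mean_passage (real n *\<^sub>R x) / real n)"

lemma lyap_bdd: "bdd_below ((\<lambda>n. mean_passage (real n *\<^sub>R x) / real n) ` {1::nat..})"
 by (rule bdd_belowI2[of _ 0]) (simp add: mean_passage_nonneg)

lemma lyap_le: "1 \<le> n \<Longrightarrow> lyap x * real n \<le> mean_passage (real n *\<^sub>R x)"
 using cINF_lower[OF lyap_bdd, of n x] by (simp add: lyap_def field_simps)

lemma lyap_greatest: "(\<And>n::nat. 1 \<le> n \<Longrightarrow> c \<le> mean_passage (real n *\<^sub>R x) / real n) \<Longrightarrow> c \<le> lyap x"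
 unfolding lyap_def by (rule cINF_greatest) auto

lemma lyap_nonneg: "0 \<le> lyap x" by (rule lyap_greatest) (simp add: mean_passage_nonneg)

lemma lyap_less: "lyap x < c \<Longrightarrow> \<exists>n\<ge>1. mean_passage (real n *\<^sub>R x) < c * real n"
 using lyap_greatest[of c x] by (auto simp: not_le[symmetric] field_simps)

lemma mean_passage_mult: "1 \<le> n \<Longrightarrow> mean_passage (real n *\<^sub>R x) \<le> real n * mean_passage x"
proof (induction n rule: dec_induct)
 case (step n)
 have "real (Suc n) *\<^sub>R x = real n *\<^sub>R x + x" by (simp add: algebra_simps)
 then show ?case using mean_passage_subadditive[of "real n *\<^sub>R x" x] step by (simp add: algebra_simps)
qed simp

lemma lyap_uminus: "lyap (- x) = lyap x" by (simp add: lyap_def mean_passage_uminus)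

lemma lyap_0: "lyap 0 = 0"
proof (rule antisym[OF _ lyap_nonneg])
 have "lyap 0 \<le> mean_passage 0 / real (Suc n)" for n using lyap_le[of "Suc n" 0] by (simp add: field_simps)
 moreover have "(\<lambda>n. mean_passage 0 / real (Suc n)) \<longlonglongrightarrow> 0" by (rule LIMSEQ_Suc[OF lim_const_over_n])
 ultimately show "lyap 0 \<le> 0" by (intro LIMSEQ_le_const) auto
qed

text \<open>The two infima are nearly attained at unrelated scales, \<open>n\<close> for
  \<open>x\<close> and \<open>m\<close> for \<open>y\<close>; both are compared at the common
  multiple \<open>n * m\<close>.\<close>

lemma lyap_triangle: "lyap (x + y) \<le> lyap x + lyap y"
proof -
 have "lyap (x + y) \<le> mean_passage (real n *\<^sub>R x) / real n + mean_passage (real m *\<^sub>R y) / real m"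
  if n: "1 \<le> n" and m: "1 \<le> m" for n m :: nat
 proof -
  have "mean_passage (real (n * m) *\<^sub>R (x + y)) \<le> mean_passage (real m *\<^sub>R real n *\<^sub>R x) + mean_passage (real n *\<^sub>R real m *\<^sub>R y)"
   using mean_passage_subadditive[of "real (n * m) *\<^sub>R x" "real (n * m) *\<^sub>R y"] by (simp add: scaleR_add_right mult.commute)
  also have "\<dots> \<le> real m * mean_passage (real n *\<^sub>R x) + real n * mean_passage (real m *\<^sub>R y)"
   by (intro add_mono mean_passage_mult n m)
  finally have "lyap (x + y) * real (n * m) \<le> real m * mean_passage (real n *\<^sub>R x) + real n * mean_passage (real m *\<^sub>R y)"
   using lyap_le[of "n * m" "x + y"] n m by simp
  then show ?thesis using n m by (simp add: field_simps)
 qed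
 then have "lyap (x + y) - mean_passage (real m *\<^sub>R y) / real m \<le> lyap x" if "1 \<le> m" for m :: nat
  by (intro lyap_greatest) (use that in \<open>simp add: algebra_simps\<close>)
 then have "lyap (x + y) - lyap x \<le> lyap y" by (intro lyap_greatest) (simp add: algebra_simps)
 then show ?thesis by simp
qed

lemma passage_chain:
 assumes t: "\<And>j::nat. tame (move 1 (real j *\<^sub>R x) \<eta>)"
 shows "passage \<eta> (real n *\<^sub>R x) \<le> passage \<eta> 0 + (\<Sum>j<n. passage (move 1 (real j *\<^sub>R x) \<eta>) x)"
proof (induction n)
 case (Suc n)
 have "real (Suc n) *\<^sub>R x = real n *\<^sub>R x + x" by (simp add: algebra_simps)
 moreover have "tame \<eta>" using t[of 0] by (simp add: move_0)
 ultimately show ?case using passage_subadditive[OF _ t[of n], of x] Suc by fastforce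
qed simp

text \<open>Choose \<open>p\<close> with mean cost of \<open>p\<close> steps below
  \<open>c' * p\<close> and chain along multiples of \<open>a = p *\<^sub>R x\<close>: Birkhoff
  bounds the sum of the costs of the blocks, and the last incomplete block costs a constant times a
  constant plus \<open>(r + 1) powr (1/8)\<close> by \<open>potential_growth\<close>.\<close>

lemma passage_eventually_le:
 assumes x: "x \<noteq> 0" and c: "lyap x < c"
 shows "AE \<eta> in P. eventually (\<lambda>r. passage \<eta> (r *\<^sub>R x) \<le> c * r) at_top"
proof -
 define c' where "c' = (lyap x + c) / 2"
 have c': "lyap x < c'" "c' < c" "0 \<le> c'" using c lyap_nonneg[of x] by (auto simp: c'_def)
 obtain p where p: "1 \<le> p" "mean_passage (real p *\<^sub>R x) < c' * real p" using lyap_less[OF c'(1)] by blast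
 define a where "a = real p *\<^sub>R x"
 have a: "a \<noteq> 0" using p x by (simp add: a_def)
 interpret T: ergodic_map P "move 1 a" by (rule env.move_ergodic[OF a])
 obtain c0 where c0: "bm.hop_const c0" using bm.hop_const_exists by blast
 then have R: "0 < c0" by (simp add: bm.hop_const_def)
 \<comment> \<open>The region that matters at scale \<open>r\<close> has radius
   \<open>r * norm x\<close>, plus the radius that \<open>passage_bound\<close> demands around the
   start of the last block.\<close>
 define L where "L = norm x + norm a + 2 + c0"
 have L: "0 < L" using R by (simp add: L_def add_nonneg_pos)
 have B: "AE \<eta> in P. eventually (\<lambda>n. (\<Sum>j<n. passage ((move 1 a ^^ j) \<eta>) a) \<le> (c' * real p) * real n) sequentially"
  by (rule T.birkhoff_eventually_le[OF passage_integrable]) (use p in \<open>simp add: a_def mean_passage_def\<close>)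
 show ?thesis using B AE_tame_move[of a] env.potential_growth[OF L]
 proof eventually_elim
  case (elim \<eta>)
  let ?n = "\<lambda>r. nat \<lfloor>r / real p\<rfloor>" and ?k = "\<lambda>r::real. nat \<lceil>r\<rceil>"
  have tame: "tame (move 1 (real j *\<^sub>R a) \<eta>)" for j using elim(2) by blast
  have t0: "tame \<eta>" using tame[of 0] by (simp add: move_0)
  have "filterlim ?n sequentially at_top" using p by real_asymp
  from eventually_compose_filterlim[OF elim(1) this]
  have e1: "eventually (\<lambda>r. (\<Sum>j<?n r. passage ((move 1 a ^^ j) \<eta>) a) \<le> (c' * real p) * real (?n r)) at_top" .
  have "filterlim ?k sequentially at_top" by (rule filterlim_nat_ceiling)
  from eventually_compose_filterlim[OF elim(3) this]
  have e2: "eventually (\<lambda>r. \<forall>u\<in>cball 0 (L * real (?k r)). V \<eta> u \<le> ennreal (real (?k r) powr (1/8))) at_top" .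
  have e3: "eventually (\<lambda>r. c' * r + (norm a + 2) * ((passage \<eta> 0 + c0) + (r + 1) powr (1/8)) \<le> c * r) at_top"
   by (rule linear_dominates) (use c' R passage_nonneg[OF t0, of 0] in auto)
  show ?case using e1 e2 e3 eventually_ge_at_top[of 1]
  proof eventually_elim
   case (elim r)
   define n where "n = ?n r"
   define y where "y = (r - real n * real p) *\<^sub>R x"
   have "0 \<le> r / real p" using elim(4) by simp
   then have "real n \<le> r / real p" "r / real p < real n + 1" unfolding n_def by linarith+
   then have n: "real n * real p \<le> r" "r < real n * real p + real p" using p by (auto simp: field_simps)
   have y: "norm y \<le> norm a" using n by (auto simp: y_def a_def intro: mult_right_mono)
   define S where "S = real (?k r) powr (1/8)"
   have S: "0 \<le> S" "S \<le> (r + 1) powr (1/8)" using elim(4) by (auto simp: S_def intro!: powr_mono2)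
   have "V (move 1 (real n *\<^sub>R a) \<eta>) u \<le> ennreal S" if u: "u \<in> cball 0 (norm y + 2 + c0)" for u
   proof -
    have "norm (real n *\<^sub>R a) \<le> r * norm x" using n(1) by (auto simp: a_def mult.assoc[symmetric] intro: mult_right_mono)
    then have "norm (real n *\<^sub>R a + u) \<le> r * norm x + (norm a + 2 + c0)"
     using u y norm_triangle_ineq[of "real n *\<^sub>R a" u] by simp
    also have "\<dots> \<le> r * norm x + (norm a + 2 + c0) * r"
     using elim(4) R mult_left_mono[of 1 r "norm a + 2 + c0"] by simp
    also have "\<dots> = L * r" by (simp add: L_def algebra_simps)
    also have "\<dots> \<le> L * real (?k r)" using L by (intro mult_left_mono) (linarith, simp)
    finally show ?thesis using elim(2) by (simp add: S_def lacoin_move)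
   qed
   then have "passage (move 1 (real n *\<^sub>R a) \<eta>) y \<le> (norm y + 2) * (c0 + S)" by (rule passage_bound[OF c0 tame S(1)])
   also have "\<dots> \<le> (norm a + 2) * (c0 + (r + 1) powr (1/8))" using y S R by (intro mult_mono) auto
   finally have 1: "passage (move 1 (real n *\<^sub>R a) \<eta>) y \<le> (norm a + 2) * (c0 + (r + 1) powr (1/8))" .
   have "r *\<^sub>R x = real n *\<^sub>R a + y" by (simp add: y_def a_def algebra_simps)
   then have "passage \<eta> (r *\<^sub>R x) \<le> passage \<eta> (real n *\<^sub>R a) + passage (move 1 (real n *\<^sub>R a) \<eta>) y"
    using passage_subadditive[OF t0 tame] by simp
   also have "passage \<eta> (real n *\<^sub>R a) \<le> passage \<eta> 0 + (\<Sum>j<n. passage (move 1 (real j *\<^sub>R a) \<eta>) a)"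
    by (rule passage_chain[OF tame])
   also have "(\<Sum>j<n. passage (move 1 (real j *\<^sub>R a) \<eta>) a) \<le> c' * (real n * real p)"
    using elim(1) by (simp add: move_funpow n_def mult_ac)
   also have "\<dots> \<le> c' * r" using n(1) c' by (intro mult_left_mono) auto
   finally have "passage \<eta> (r *\<^sub>R x) \<le> passage \<eta> 0 + c' * r + passage (move 1 (real n *\<^sub>R a) \<eta>) y" by simp
   moreover have "1 * passage \<eta> 0 \<le> (norm a + 2) * passage \<eta> 0"
    by (rule mult_right_mono) (use passage_nonneg[OF t0, of 0] in auto)
   ultimately show ?case using 1 elim(3) by (simp add: distrib_left)
  qed
 qed
qed

lemma passage_eventually_ge:
 assumes x: "x \<noteq> 0" and c: "c < lyap x"
 shows "AE \<eta> in P. eventually (\<lambda>n. c * real n \<le> passage \<eta> (real n *\<^sub>R x)) sequentially"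
proof -
 interpret T: ergodic_map P "move 1 x" by (rule env.move_ergodic[OF x])
 show ?thesis
 proof (rule T.subadditive_eventually_ge[OF _ _ _ c])
  show "AE \<eta> in P. \<forall>m\<ge>1. \<forall>n\<ge>1. passage \<eta> (real (m + n) *\<^sub>R x) \<le> passage \<eta> (real m *\<^sub>R x) + passage ((move 1 x ^^ m) \<eta>) (real n *\<^sub>R x)"
   using AE_tame AE_tame_move[of x]
  proof eventually_elim
   case (elim \<eta>)
   then show ?case by (auto simp: move_funpow scaleR_add_left intro!: passage_subadditive)
  qed
  show "lyap x * real n \<le> (\<integral>\<eta>. passage \<eta> (real n *\<^sub>R x) \<partial>P)" if "1 \<le> n" for n
   using lyap_le[OF that] by (simp add: mean_passage_def)
 qed (rule passage_integrable)
qed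

text \<open>Half of the annealed rate is given up, which makes the expectations summable.\<close>

lemma survival_eventually:
 obtains \<theta> where "0 < \<theta>" "AE \<eta> in P. eventually (\<lambda>k. fk W Z (V \<eta>) (16 * k ^ 4) 0 (\<lambda>_. 1) \<le> ennreal (exp (- \<theta> * real k))) sequentially"
proof -
 obtain \<theta> C where *: "0 < \<theta>" "0 < C"
  "\<forall>k\<ge>1. (\<integral>\<^sup>+\<eta>. fk W Z (V \<eta>) (16 * k ^ 4) 0 (\<lambda>_. 1) \<partial>P) \<le> ennreal (C * exp (- \<theta> * real k))"
  by (rule survival_mean)
 let ?X = "\<lambda>k \<eta>. ennreal (exp (\<theta> / 2 * real (Suc k))) * fk W Z (V \<eta>) (16 * Suc k ^ 4) 0 (\<lambda>_. 1)"
 have m: "(\<lambda>\<eta>. fk W Z (V \<eta>) n 0 (\<lambda>_. 1)) \<in> borel_measurable P" for n by (rule fk_param_measurable) simp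
 have "AE \<eta> in P. eventually (\<lambda>k. ?X k \<eta> \<le> 1) sequentially"
 proof (rule env.AE_eventually_le_1)
  show "?X k \<in> borel_measurable P" for k by (intro borel_measurable_times_ennreal m) simp
  show "(\<integral>\<^sup>+\<eta>. ?X k \<eta> \<partial>P) \<le> ennreal (C * exp (- (\<theta> / 2) * real (Suc k)))" for k
  proof -
   have "(\<integral>\<^sup>+\<eta>. ?X k \<eta> \<partial>P) = ennreal (exp (\<theta> / 2 * real (Suc k))) * (\<integral>\<^sup>+\<eta>. fk W Z (V \<eta>) (16 * Suc k ^ 4) 0 (\<lambda>_. 1) \<partial>P)"
    by (rule nn_integral_cmult[OF m])
   also have "\<dots> \<le> ennreal (exp (\<theta> / 2 * real (Suc k))) * ennreal (C * exp (- \<theta> * real (Suc k)))"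
    by (rule mult_left_mono[OF *(3)[rule_format]]) auto
   also have "\<dots> = ennreal (C * exp (- (\<theta> / 2) * real (Suc k)))"
    using *(2) by (simp add: ennreal_mult[symmetric] mult.left_commute[of _ C] exp_add[symmetric] field_simps del: of_nat_Suc)
   finally show ?thesis .
  qed
  have "(\<lambda>k. C * exp (- (\<theta> / 2) * real (Suc k))) = (\<lambda>k. C * exp (- (\<theta> / 2)) * exp (- (\<theta> / 2)) ^ k)"
   by (auto simp: exp_of_nat_mult[symmetric] exp_add[symmetric] algebra_simps)
  then show "summable (\<lambda>k. C * exp (- (\<theta> / 2) * real (Suc k)))" using *(1) by (simp add: summable_mult summable_geometric)
 qed (use * in auto)
 then have "AE \<eta> in P. eventually (\<lambda>k. fk W Z (V \<eta>) (16 * k ^ 4) 0 (\<lambda>_. 1) \<le> ennreal (exp (- (\<theta> / 2) * real k))) sequentially"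
 proof eventually_elim
  case (elim \<eta>)
  then have "eventually (\<lambda>k. fk W Z (V \<eta>) (16 * Suc k ^ 4) 0 (\<lambda>_. 1) \<le> ennreal (exp (- (\<theta> / 2) * real (Suc k)))) sequentially"
  proof (rule eventually_mono)
   fix k assume "?X k \<eta> \<le> 1"
   then have "ennreal (exp (- (\<theta> / 2) * real (Suc k))) * ?X k \<eta> \<le> ennreal (exp (- (\<theta> / 2) * real (Suc k))) * 1"
    by (intro mult_left_mono) auto
   then show "fk W Z (V \<eta>) (16 * Suc k ^ 4) 0 (\<lambda>_. 1) \<le> ennreal (exp (- (\<theta> / 2) * real (Suc k)))"
    by (simp add: mult.assoc[symmetric] ennreal_mult[symmetric] exp_add[symmetric] del: of_nat_Suc power_Suc)
  qed
  then show ?case by (subst eventually_sequentially_Suc[symmetric])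
 qed
 then show thesis by (rule that[of "\<theta> / 2", rotated]) (use *(1) in simp)
qed

end

section \<open>Positivity of the exponent\<close>

context lacoin_bm
begin

text \<open>The weight of being near \<open>real n *\<^sub>R x\<close> at time \<open>j\<close> is
  exponentially small in \<open>n\<close> for all \<open>j\<close> at once: up to time
  \<open>16 * n ^ 4\<close> because a far half space must be reached, afterwards because of long
  survival. Passage costs thus grow at least linearly, which contradicts
  \<open>passage_eventually_le\<close> if the exponent is too small.\<close>

lemma lyap_pos_halfspace:
 assumes e: "e \<in> Basis" and a: "0 < x \<bullet> e"
 shows "0 < lyap x"
proof -
 define a where "a = x \<bullet> e"
 have a: "0 < a" using assms by (simp add: a_def)
 have x: "x \<noteq> 0" using assms by auto
 obtain \<theta> C where *: "0 < \<theta>" "0 < C"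
  "\<forall>n R. (\<integral>\<^sup>+\<eta>. fk W Z (V \<eta>) n 0 (indicator {x. real R \<le> x \<bullet> e}) \<partial>P) \<le> ennreal (C * exp (- \<theta> * real R))"
  by (rule half_space_mean[OF e])
 obtain \<theta>' where s: "0 < \<theta>'" "AE \<eta> in P. eventually (\<lambda>k. fk W Z (V \<eta>) (16 * k ^ 4) 0 (\<lambda>_. 1) \<le> ennreal (exp (- \<theta>' * real k))) sequentially"
  by (rule survival_eventually)
 \<comment> \<open>The halved rate leaves room for the \<open>16 * n ^ 4\<close> times in the union
   bound and for summability.\<close>
 define \<beta> where "\<beta> = min (\<theta> * a / 2) (\<theta>' / 2)"
 have \<beta>: "0 < \<beta>" "\<beta> \<le> \<theta> * a / 2" "\<beta> \<le> \<theta>' / 2" using *(1) s(1) a by (auto simp: \<beta>_def)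
 \<comment> \<open>The target ball has radius \<open>1 / 2\<close> and thus lies beyond level
   \<open>real n * a - 1 / 2\<close>; rounding \<open>real n * a - 1\<close> down gives an integer
   level below it, as soon as this number is nonnegative.\<close>
 define R where "R n = nat \<lfloor>real n * a - 1\<rfloor>" for n
 let ?f = "\<lambda>n \<eta> j. fk W Z (V \<eta>) j 0 (indicator {x. real (R n) \<le> x \<bullet> e})"
 have fm: "(\<lambda>\<eta>. ?f n \<eta> j) \<in> borel_measurable P" for n j by (rule fk_param_measurable) measurable
 let ?X = "\<lambda>n \<eta>. ennreal (exp (\<beta> * real n)) * (\<Sum>j<16 * n ^ 4. ?f n \<eta> j)"
 let ?a = "\<lambda>n. exp (\<beta> * real n) * (16 * real n ^ 4 * (C * exp (- \<theta> * (real n * a - 2))))"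
 have "AE \<eta> in P. eventually (\<lambda>n. ?X n \<eta> \<le> 1) sequentially"
 proof (rule env.AE_eventually_le_1)
  show "?X n \<in> borel_measurable P" for n by (intro borel_measurable_times_ennreal borel_measurable_sum fm) simp
  show "(\<integral>\<^sup>+\<eta>. ?X n \<eta> \<partial>P) \<le> ennreal (?a n)" for n
  proof -
   have "(\<integral>\<^sup>+\<eta>. ?X n \<eta> \<partial>P) = ennreal (exp (\<beta> * real n)) * (\<Sum>j<16 * n ^ 4. \<integral>\<^sup>+\<eta>. ?f n \<eta> j \<partial>P)"
    by (subst nn_integral_cmult) (intro borel_measurable_sum fm, subst nn_integral_sum, rule fm, rule refl)
   also have "\<dots> \<le> ennreal (exp (\<beta> * real n)) * (\<Sum>j<16 * n ^ 4. ennreal (C * exp (- \<theta> * (real n * a - 2))))"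
   proof (intro mult_left_mono sum_mono)
    fix j
    have "real n * a - 2 \<le> real (R n)" unfolding R_def by linarith
    then have "C * exp (- \<theta> * real (R n)) \<le> C * exp (- \<theta> * (real n * a - 2))" using *(1,2) by simp
    then show "(\<integral>\<^sup>+\<eta>. ?f n \<eta> j \<partial>P) \<le> ennreal (C * exp (- \<theta> * (real n * a - 2)))"
     using *(3) by (meson ennreal_leI order_trans)
   qed simp
   also have "\<dots> = ennreal (?a n)"
    using *(2) by (simp add: ennreal_of_nat_eq_real_of_nat ennreal_mult[symmetric])
   finally show ?thesis .
  qed
  show "summable ?a"
  proof (rule summable_comparison_test_bigo)
   show "summable (\<lambda>n. norm (exp (- (\<theta> * a / 4)) ^ n))" using *(1) a by (simp add: summable_geometric)
   have "\<beta> < \<theta> * a * 3 / 4" using \<beta>(2) mult_pos_pos[OF *(1) a] by simp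
   then have "?a \<in> O(\<lambda>n. exp (- (\<theta> * a / 4) * real n))" using *(1,2) a \<beta>(1) by real_asymp
   then show "?a \<in> O(\<lambda>n. exp (- (\<theta> * a / 4)) ^ n)" by (simp only: exp_of_nat2_mult[symmetric])
  qed
 qed (use * in auto)
 then have lower: "AE \<eta> in P. eventually (\<lambda>n. \<beta> / 2 * real n \<le> passage \<eta> (real n *\<^sub>R x)) sequentially"
  using s(2) AE_tame
 proof eventually_elim
  case (elim \<eta>)
  have "eventually (\<lambda>n. 2 * exp (- \<beta> * real n) \<le> exp (- (\<beta> / 2 * real n))) sequentially" using \<beta>(1) by real_asymp
  moreover have "eventually (\<lambda>n. 1 \<le> real n * a) sequentially" using a by real_asymp
  ultimately show ?case using elim(1,2)
  proof eventually_elim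
   case (elim n)
   have half: "fk W Z (V \<eta>) j 0 (indicator (cball (real n *\<^sub>R x) (1/2))) \<le> ennreal (2 * exp (- \<beta> * real n))" for j
   proof (cases "j < 16 * n ^ 4")
    case True
    have "fk W Z (V \<eta>) j 0 (indicator (cball (real n *\<^sub>R x) (1/2))) \<le> ?f n \<eta> j"
    proof (rule fk_mono)
     fix u
     have "real (R n) \<le> u \<bullet> e" if "u \<in> cball (real n *\<^sub>R x) (1/2)"
     proof -
      have "\<bar>(real n *\<^sub>R x - u) \<bullet> e\<bar> \<le> 1 / 2" using Basis_le_norm[OF e, of "real n *\<^sub>R x - u"] that by (simp add: dist_norm)
      then have "real n * a - 1 / 2 \<le> u \<bullet> e" unfolding inner_diff_left inner_scaleR_left a_def by linarith
      then show ?thesis using elim(2) unfolding R_def by linarith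
     qed
     then show "indicator (cball (real n *\<^sub>R x) (1/2)) u \<le> (indicator {x. real (R n) \<le> x \<bullet> e} u :: ennreal)"
      by (auto simp: indicator_def)
    qed
    also have "\<dots> \<le> (\<Sum>j<16 * n ^ 4. ?f n \<eta> j)" using True by (intro member_le_sum) auto
    also have "\<dots> = ennreal (exp (- \<beta> * real n)) * ?X n \<eta>"
     by (simp add: mult.assoc[symmetric] ennreal_mult[symmetric] exp_add[symmetric])
    also have "\<dots> \<le> ennreal (exp (- \<beta> * real n)) * 1" by (intro mult_left_mono elim(3)) simp
    also have "\<dots> \<le> ennreal (2 * exp (- \<beta> * real n))" by (simp add: ennreal_leI)
    finally show ?thesis .
   next
    case False
    have m: "V \<eta> \<in> borel_measurable borel" by (rule tame_measurable) fact
    have "fk W Z (V \<eta>) j 0 (indicator (cball (real n *\<^sub>R x) (1/2))) \<le> fk W Z (V \<eta>) (16 * n ^ 4 + (j - 16 * n ^ 4)) 0 (\<lambda>_. 1)"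
     using False by (simp add: fk_mono indicator_def)
    also have "\<dots> = fk W Z (V \<eta>) (16 * n ^ 4) 0 (\<lambda>z. fk W Z (V \<eta>) (j - 16 * n ^ 4) z (\<lambda>_. 1))"
     by (rule fk_markov[OF bm.grid m]) simp
    also have "\<dots> \<le> fk W Z (V \<eta>) (16 * n ^ 4) 0 (\<lambda>_. 1)" by (rule fk_mono) (rule fk_le[OF bm.grid], simp)
    also have "\<dots> \<le> ennreal (exp (- \<theta>' * real n))" by (rule elim(4))
    also have "\<dots> \<le> ennreal (2 * exp (- \<beta> * real n))"
    proof (rule ennreal_leI)
     have "\<beta> * real n \<le> \<theta>' * real n" using \<beta>(3) s(1) by (intro mult_right_mono) auto
     then have "exp (- \<theta>' * real n) \<le> exp (- \<beta> * real n)" by simp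
     then show "exp (- \<theta>' * real n) \<le> 2 * exp (- \<beta> * real n)" using exp_ge_zero[of "- \<beta> * real n"] by linarith
    qed
    finally show ?thesis .
   qed
   have "bm.conn (V \<eta>) 0 (real n *\<^sub>R x) \<le> ennreal (2 * exp (- \<beta> * real n))" unfolding bm.conn_def
   proof (rule SUP_least)
    fix j
    have "bm.hop (V \<eta>) j 0 (real n *\<^sub>R x) \<le> fk W Z (V \<eta>) j 0 (indicator (cball (real n *\<^sub>R x) (1/2)))"
     by (rule bm.hop_le_fk) simp
    then show "bm.hop (V \<eta>) j 0 (real n *\<^sub>R x) \<le> ennreal (2 * exp (- \<beta> * real n))" using half by (rule order_trans)
   qed
   then have "exp (- passage \<eta> (real n *\<^sub>R x)) \<le> 2 * exp (- \<beta> * real n)"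
    unfolding conn_eq[OF \<open>tame \<eta>\<close>] by (simp add: ennreal_le_iff)
   then have "exp (- passage \<eta> (real n *\<^sub>R x)) \<le> exp (- (\<beta> / 2 * real n))" using elim(1) by linarith
   then show ?case by simp
  qed
 qed
 have "\<beta> / 4 \<le> lyap x"
 proof (rule ccontr)
  assume "\<not> \<beta> / 4 \<le> lyap x"
  then have "AE \<eta> in P. eventually (\<lambda>r. passage \<eta> (r *\<^sub>R x) \<le> \<beta> / 4 * r) at_top"
   by (intro passage_eventually_le[OF x]) simp
  with lower have "AE \<eta> in P. False"
  proof eventually_elim
   case (elim \<eta>)
   from elim(1) eventually_compose_filterlim[OF elim(2) filterlim_real_sequentially] eventually_gt_at_top[of 0]
   have "eventually (\<lambda>n::nat. False) sequentially"
   proof eventually_elim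
    case (elim n)
    have "0 < \<beta> * real n" using \<beta>(1) elim(3) by simp
    then show ?case using elim(1,2) by linarith
   qed
   then show ?case by simp
  qed
  then show False using env.AE_False by simp
 qed
 then show ?thesis using \<beta>(1) by linarith
qed

lemma lyap_pos: "x \<noteq> 0 \<Longrightarrow> 0 < lyap x"
proof -
 assume "x \<noteq> 0"
 then obtain e where e: "e \<in> Basis" "x \<bullet> e \<noteq> 0" using euclidean_all_zero_iff by blast
 show ?thesis
 proof (cases "0 < x \<bullet> e")
  case True
  then show ?thesis by (rule lyap_pos_halfspace[OF e(1)])
 next
  case False
  then have "0 < (- x) \<bullet> e" using e by simp
  then show ?thesis using lyap_pos_halfspace[OF e(1), of "- x"] by (simp add: lyap_uminus)
 qed
qed

text \<open>The bridge from a neighbourhood of \<open>y\<close> to \<open>y'\<close> costs \<open>q\<close>; changing the starting point turns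
 the value at \<open>0\<close> into an infimum over the unit ball.\<close>

lemma fk_le_conn:
 assumes c: "bm.hop_const c" and v: "v \<in> borel_measurable borel" and S: "0 \<le> S" and M: "0 \<le> M" and m: "1 \<le> m" and t: "0 \<le> t"
  and b0: "\<And>u. u \<in> cball 0 (M + 1) \<Longrightarrow> v u \<le> ennreal S" and b1: "\<And>u. u \<in> cball y' (2 * real m + c) \<Longrightarrow> v u \<le> ennreal S"
  and d: "dist y y' + (M + 1) \<le> real m" and less: "bm.conn v 0 y' < ennreal t"
 shows "ennreal (exp (- (real m * (c + S)))) * fk W Z v (Suc i) 0 (indicator (cball y (M + 1)))
  \<le> ennreal (exp (M + 1 + S) * t + 2 * exp (M + 1) * osc_tail DIM('a) M)"
proof -
 let ?q = "exp (- (real m * (c + S)))" and ?f = "indicator (cball y (M + 1)) :: 'a \<Rightarrow> ennreal" and ?g = "indicator (cball y' (1/2)) :: 'a \<Rightarrow> ennreal"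
 let ?t = "2 * exp (M + 1) * osc_tail DIM('a) M"
 have q: "?q \<le> 1" "0 \<le> ?t" using c S by (auto simp: bm.hop_const_def osc_tail_def)
 have "bm.hop v (Suc i + m) 0 y' < ennreal t" using bm.hop_le_conn less by (rule le_less_trans)
 then obtain z where z: "z \<in> ball 0 1" "fk W Z v (Suc i + m) z ?g < ennreal t"
  unfolding bm.hop_def INF_less_iff by blast
 have "ennreal ?q * ?f x \<le> fk W Z v m x ?g" for x
 proof (cases "x \<in> cball y (M + 1)")
  case True
  have xy: "dist x y' \<le> real m" using True d dist_triangle[of x y' y] by (simp add: dist_commute)
  have "ennreal ?q \<le> bm.hop v m x y'"
  proof (rule bm.hop_constD[OF c v m xy S])
   fix u assume "u \<in> cball x (real m + c)"
   then show "v u \<le> ennreal S" using xy dist_triangle[of y' u x] by (intro b1) (simp add: dist_commute)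
  qed
  also have "\<dots> \<le> fk W Z v m x ?g" by (rule bm.hop_le_fk) simp
  finally show ?thesis using True by simp
 qed simp
 then have "fk W Z v (Suc i) z (\<lambda>x. ennreal ?q * ?f x) \<le> fk W Z v (Suc i) z (\<lambda>x. fk W Z v m x ?g)" by (rule fk_mono)
 also have "\<dots> = fk W Z v (Suc i + m) z ?g" by (rule fk_markov[OF bm.grid v, symmetric]) simp
 finally have 1: "ennreal ?q * fk W Z v (Suc i) z ?f \<le> ennreal t"
  using z(2) unfolding fk_cmult[OF bm.grid v indicator_cball_measurable] by simp
 have "fk W Z v (Suc i) 0 ?f \<le> ennreal (exp (M + 1 + S)) * fk W Z v (Suc i) z ?f + ennreal ?t"
  by (rule bm.fk_change_start[OF v _ _ S M _ b0]) (use z(1) in \<open>auto simp: indicator_def\<close>)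
 then have "ennreal ?q * fk W Z v (Suc i) 0 ?f \<le> ennreal ?q * (ennreal (exp (M + 1 + S)) * fk W Z v (Suc i) z ?f + ennreal ?t)"
  by (rule mult_left_mono) simp
 also have "\<dots> = ennreal (exp (M + 1 + S)) * (ennreal ?q * fk W Z v (Suc i) z ?f) + ennreal ?q * ennreal ?t"
  by (simp add: distrib_left mult_ac)
 also have "\<dots> \<le> ennreal (exp (M + 1 + S)) * ennreal t + 1 * ennreal ?t"
  using q by (intro add_mono mult_left_mono mult_right_mono 1) auto
 also have "\<dots> = ennreal (exp (M + 1 + S) * t + ?t)" using q t by (simp add: ennreal_mult)
 finally show ?thesis .
qed

end

section \<open>The quenched upper bound for the travel weight, and the norm\<close>

text \<open>The oscillation allowance \<open>k powr (3/4)\<close> has failure probability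
  \<open>exp\<close> of order \<open>- k powr (3/2)\<close>, and the bridge over that distance in a
  potential of height \<open>k powr (1/8)\<close> costs \<open>exp\<close> of order
  \<open>k powr (7/8)\<close>. Both are negligible against the gap between \<open>c\<close> and
  \<open>c'\<close>, as are the polynomial factors; the survival term is \<open>exp\<close> of order
  \<open>- k\<^sup>2\<close>.\<close>

lemma travel_asymptotics:
 fixes c c' \<theta> a b :: real
 assumes "0 \<le> c" "c < c'" "0 < \<theta>" "0 \<le> a" "0 \<le> b" "1 \<le> d"
 shows "eventually (\<lambda>k. 16 * real k ^ 8 * (exp ((real k powr (3/4) + a) * (b + real k powr (1/8)))
   * (exp (real k powr (3/4) + 1 + real k powr (1/8)) * (2 * exp (- c' * real k)) + 2 * exp (real k powr (3/4) + 1) * osc_tail d (real k powr (3/4))))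
  + exp (- \<theta> * (real k)\<^sup>2) + 16 * real k ^ 8 * osc_tail d (real k powr (3/4)) \<le> exp (- c * real k)) sequentially"
proof -
 define \<kappa> where "\<kappa> = 1 / (32 * (real d)\<^sup>2)"
 define D where "D = 65536 * real d"
 have pos: "0 < \<kappa>" "0 < D" using assms(6) by (auto simp: \<kappa>_def D_def)
 have "osc_tail d M = D * exp (- \<kappa> * M\<^sup>2)" for M by (simp add: osc_tail_def D_def \<kappa>_def)
 then show ?thesis using assms(1-5) pos by simp real_asymp
qed

context lacoin_bm
begin

lemma travel_eventually_le:
 assumes x: "x \<noteq> 0" and c: "0 \<le> c" "c < lyap x"
 shows "AE \<eta> in P. eventually (\<lambda>r. travel_weight W Z (V \<eta>) (r *\<^sub>R x) \<le> exp (- c * r)) at_top"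
proof -
 define c' where "c' = (c + lyap x) / 2"
 have c': "c < c'" "c' < lyap x" using c by (auto simp: c'_def)
 obtain b where b: "bm.hop_const b" using bm.hop_const_exists by blast
 then have b0: "0 < b" by (simp add: bm.hop_const_def)
 obtain \<theta> where \<theta>: "0 < \<theta>" "AE \<eta> in P. eventually (\<lambda>k. fk W Z (V \<eta>) (16 * k ^ 4) 0 (\<lambda>_. 1) \<le> ennreal (exp (- \<theta> * real k))) sequentially"
  by (rule survival_eventually)
 \<comment> \<open>The potential must be controlled within \<open>2 * real m + b\<close> of
   \<open>real k *\<^sub>R x\<close>, where \<open>real m\<close> is at most
   \<open>k + norm x + 2\<close>; for \<open>k \<ge> 1\<close> all this lies in the ball of radius
   \<open>L * real k\<close>.\<close>
 define L where "L = 3 * norm x + 7 + b"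
 have L: "0 < L" using b0 by (simp add: L_def add_nonneg_pos)
 \<comment> \<open>\<open>?A\<close> is the right-hand side of \<open>fk_le_conn\<close> at the
   chosen scales, and \<open>?G\<close> dominates the reciprocal of the bridge price on its
   left-hand side.\<close>
 let ?A = "\<lambda>k::nat. exp (real k powr (3/4) + 1 + real k powr (1/8)) * (2 * exp (- c' * real k)) + 2 * exp (real k powr (3/4) + 1) * osc_tail DIM('a) (real k powr (3/4))"
 let ?G = "\<lambda>k::nat. exp ((real k powr (3/4) + (norm x + 2)) * (b + real k powr (1/8)))"
 have o0: "0 \<le> osc_tail DIM('a) M" for M by (simp add: osc_tail_def)
 show ?thesis using AE_tame env.potential_growth[OF L] passage_eventually_ge[OF x c'(2)] \<theta>(2)
 proof eventually_elim
  case (elim \<eta>)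
  have v: "V \<eta> \<in> borel_measurable borel" by (rule tame_measurable) fact
  have sq: "filterlim (\<lambda>k::nat. k\<^sup>2) sequentially sequentially" by (rule filterlim_subseq) (auto simp: strict_mono_def power_strict_mono)
  have "eventually (\<lambda>k. 16 * real k ^ 8 * (?G k * ?A k) + exp (- \<theta> * (real k)\<^sup>2) + 16 * real k ^ 8 * osc_tail DIM('a) (real k powr (3/4)) \<le> exp (- c * real k)) sequentially"
   by (rule travel_asymptotics) (use c c' \<theta>(1) b0 DIM_positive[where 'a = 'a] in auto)
  moreover have "eventually (\<lambda>k. real k powr (3/4) + 1 < (real k - 1) * norm x) sequentially"
   using x by (simp add: flip: zero_less_norm_iff) real_asymp
  \<comment> \<open>The bound is uniform over the unit interval of \<open>r\<close> below
    \<open>k\<close>; the real limit then follows with \<open>k\<close> the ceiling of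
    \<open>r\<close>.\<close>
  ultimately have "eventually (\<lambda>k. \<forall>r. real k - 1 < r \<longrightarrow> r \<le> real k \<longrightarrow> travel_weight W Z (V \<eta>) (r *\<^sub>R x) \<le> exp (- c * real k)) sequentially"
   using elim(2,3) eventually_compose_filterlim[OF elim(4) sq] eventually_ge_at_top[of 1]
  proof eventually_elim
   case (elim k)
   define M where "M = real k powr (3/4)"
   define S where "S = real k powr (1/8)"
   \<comment> \<open>The survival horizon at scale \<open>k\<^sup>2\<close> instead of
     \<open>k\<close>: survival then contributes \<open>exp (- \<theta> * (real k)\<^sup>2)\<close>,
     while the number of time steps stays polynomial.\<close>
   define N where "N = 16 * (k\<^sup>2) ^ 4"
   define m where "m = nat \<lceil>M + 1 + norm x\<rceil>"
   have M: "0 \<le> M" "M \<le> real k" using elim(6) powr_mono[of "3/4" 1 "real k"] by (auto simp: M_def)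
   have S: "0 \<le> S" by (simp add: S_def)
   have m: "1 \<le> m" "norm x + (M + 1) \<le> real m" "real m \<le> M + (norm x + 2)" using M(1) norm_ge_zero[of x] unfolding m_def by linarith+
   have N: "real N = 16 * real k ^ 8" by (simp add: N_def)
   show ?case
   proof (intro allI impI)
    fix r assume r: "real k - 1 < r" "r \<le> real k"
    let ?f = "indicator (cball (r *\<^sub>R x) (M + 1)) :: 'a \<Rightarrow> ennreal" and ?q = "exp (- (real m * (b + S)))"
    have "(real k - 1) * norm x \<le> r * norm x" using r(1) by (intro mult_right_mono) auto
    then have far: "M + 1 < norm (r *\<^sub>R x)" using elim(2,6) r(1) by (simp add: M_def)
    have dist: "dist (r *\<^sub>R x) (real k *\<^sub>R x) \<le> norm x"
    proof -
     have "dist (r *\<^sub>R x) (real k *\<^sub>R x) = \<bar>r - real k\<bar> * norm x" by (simp add: dist_norm flip: scaleR_diff_left)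
     also have "\<dots> \<le> 1 * norm x" using r by (intro mult_right_mono) auto
     finally show ?thesis by simp
    qed
    have each: "fk W Z (V \<eta>) j 0 ?f \<le> ennreal (?G k * ?A k)" for j
    proof (cases j)
     \<comment> \<open>The change of start works at positive times only; at time 0 the path sits at
       the origin, which is outside the enlarged target.\<close>
     case 0
     have "fk W Z (V \<eta>) 0 0 ?f = (\<integral>\<^sup>+w. 0 \<partial>W)"
      unfolding fk_def by (intro nn_integral_cong) (use far in \<open>auto simp: bm.Z_0\<close>)
     then show ?thesis using 0 by simp
    next
     case (Suc i)
     have "3 * real k \<le> L * real k" by (rule mult_right_mono) (use b0 in \<open>auto simp: L_def\<close>)
     then have "M + 1 \<le> L * real k" using M(2) elim(6) by linarith
     then have b2: "V \<eta> u \<le> ennreal S" if "u \<in> cball 0 (M + 1)" for u using elim(3) that unfolding S_def by auto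
     have b1: "V \<eta> u \<le> ennreal S" if u: "u \<in> cball (real k *\<^sub>R x) (2 * real m + b)" for u
     proof -
      have "norm u \<le> norm (real k *\<^sub>R x) + dist (real k *\<^sub>R x) u" by (metis dist_norm norm_triangle_sub dist_commute)
      also have "\<dots> \<le> real k * norm x + (2 * (M + (norm x + 2)) + b)" using u m(3) by simp
      also have "\<dots> \<le> real k * norm x + 2 * real k + (2 * norm x + 4 + b) * real k"
       using M(2) elim(6) b0 mult_left_mono[of 1 "real k" "2 * norm x + 4 + b"] by simp
      also have "\<dots> \<le> L * real k" by (simp add: L_def algebra_simps)
      finally show "V \<eta> u \<le> ennreal S" using elim(3) by (simp add: S_def)
     qed
     have "exp (- passage \<eta> (real k *\<^sub>R x)) \<le> exp (- c' * real k)" using elim(4) by simp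
     \<comment> \<open>The factor 2 makes the bound strict, so that \<open>fk_le_conn\<close> can
       pick a start whose weight is below it.\<close>
     also have "\<dots> < 2 * exp (- c' * real k)" by simp
     finally have conn: "bm.conn (V \<eta>) 0 (real k *\<^sub>R x) < ennreal (2 * exp (- c' * real k))"
      unfolding conn_eq[OF \<open>tame \<eta>\<close>] by (simp add: ennreal_less_iff)
     have "ennreal ?q * fk W Z (V \<eta>) (Suc i) 0 ?f \<le> ennreal (?A k)"
      unfolding S_def[symmetric] M_def[symmetric]
      by (rule fk_le_conn[OF b v S M(1) m(1) _ b2 b1 _ conn]) (use m(2) dist in auto)
     moreover obtain X where X: "fk W Z (V \<eta>) (Suc i) 0 ?f = ennreal X" "0 \<le> X"
     proof -
      have "fk W Z (V \<eta>) (Suc i) 0 ?f \<le> 1" by (rule bm.fk_indicator_le_1)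
      then show thesis using that by (cases "fk W Z (V \<eta>) (Suc i) 0 ?f") (auto simp: top_unique)
     qed
     ultimately have "ennreal (?q * X) \<le> ennreal (?A k)" by (simp add: ennreal_mult)
     then have "?q * X \<le> ?A k" using o0 by (subst (asm) ennreal_le_iff) auto
     then have "exp (real m * (b + S)) * (?q * X) \<le> exp (real m * (b + S)) * ?A k" by (rule mult_left_mono) simp
     then have "X \<le> exp (real m * (b + S)) * ?A k" by (simp add: mult.assoc[symmetric] exp_add[symmetric])
     also have "\<dots> \<le> ?G k * ?A k"
     proof (rule mult_right_mono)
      show "exp (real m * (b + S)) \<le> ?G k" unfolding exp_le_cancel_iff S_def[symmetric] M_def[symmetric]
       by (rule mult_right_mono) (use m(3) S b0 in auto)
     qed (use o0 in auto)
     finally show ?thesis unfolding Suc X(1) by (rule ennreal_leI)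
    qed
    have "ennreal (travel_weight W Z (V \<eta>) (r *\<^sub>R x))
     \<le> (\<Sum>j<N. fk W Z (V \<eta>) j 0 ?f) + fk W Z (V \<eta>) N 0 (\<lambda>_. 1) + ennreal (real N * osc_tail DIM('a) M)"
     by (rule bm.travel_weight_le[OF v M(1)])
    also have "\<dots> \<le> (\<Sum>j<N. ennreal (?G k * ?A k)) + ennreal (exp (- \<theta> * real (k\<^sup>2))) + ennreal (real N * osc_tail DIM('a) M)"
     unfolding N_def by (intro add_mono sum_mono each elim(5) order_refl)
    also have "\<dots> = ennreal (16 * real k ^ 8 * (?G k * ?A k) + exp (- \<theta> * (real k)\<^sup>2) + 16 * real k ^ 8 * osc_tail DIM('a) (real k powr (3/4)))"
     unfolding N[symmetric] M_def[symmetric] using o0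
     by (simp add: ennreal_of_nat_eq_real_of_nat ennreal_mult ennreal_plus mult_nonneg_nonneg)
    also have "\<dots> \<le> ennreal (exp (- c * real k))" by (rule ennreal_leI[OF elim(1)])
    finally show "travel_weight W Z (V \<eta>) (r *\<^sub>R x) \<le> exp (- c * real k)" by simp
   qed
  qed
  from eventually_compose_filterlim[OF this filterlim_nat_ceiling] eventually_gt_at_top[of 0]
  show ?case
  proof eventually_elim
   case (elim r)
   have k: "real (nat \<lceil>r\<rceil>) - 1 < r" "r \<le> real (nat \<lceil>r\<rceil>)" using elim(2) by linarith+
   then have "travel_weight W Z (V \<eta>) (r *\<^sub>R x) \<le> exp (- c * real (nat \<lceil>r\<rceil>))" using elim(1) by blast
   also have "\<dots> \<le> exp (- c * r)" using k(2) c(1) by (simp add: mult_left_mono)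
   finally show ?case .
  qed
 qed
qed

lemma travel_rate:
 assumes x: "x \<noteq> 0"
 shows "AE \<eta> in P. eventually (\<lambda>r. 0 < travel_weight W Z (V \<eta>) (r *\<^sub>R x)) at_top \<and>
   ((\<lambda>r. - ln (travel_weight W Z (V \<eta>) (r *\<^sub>R x)) / r) \<longlongrightarrow> lyap x) at_top"
proof -
 let ?t = "\<lambda>\<eta> r. travel_weight W Z (V \<eta>) (r *\<^sub>R x)"
 have "AE \<eta> in P. \<forall>n. eventually (\<lambda>r. passage \<eta> (r *\<^sub>R x) \<le> (lyap x + 1 / real (Suc n)) * r) at_top"
  unfolding AE_all_countable by (intro allI passage_eventually_le[OF x]) simp
 \<comment> \<open>\<open>travel_eventually_le\<close> takes nonnegative rates; truncation at 0
   keeps the rate below \<open>lyap x\<close> because the exponent is positive.\<close>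
 moreover have "AE \<eta> in P. \<forall>n. eventually (\<lambda>r. ?t \<eta> r \<le> exp (- max 0 (lyap x - 1 / real (Suc n)) * r)) at_top"
  unfolding AE_all_countable by (intro allI travel_eventually_le[OF x]) (use lyap_pos[OF x] in auto)
 ultimately show ?thesis using AE_tame
 proof eventually_elim
  case (elim \<eta>)
  have low: "exp (- passage \<eta> (r *\<^sub>R x)) \<le> ?t \<eta> r" for r
  proof -
   have "ennreal (exp (- passage \<eta> (r *\<^sub>R x))) \<le> ennreal (?t \<eta> r)"
    using bm.conn_le_travel_weight[OF tame_measurable[OF elim(3)], of "r *\<^sub>R x"] unfolding conn_eq[OF elim(3)] .
   moreover have "0 \<le> ?t \<eta> r"
    unfolding travel_weight_def by (intro integral_nonneg_AE) (auto simp: exp_neg_nonneg)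
   ultimately show ?thesis by (simp add: ennreal_le_iff)
  qed
  then have pos: "0 < ?t \<eta> r" for r by (rule less_le_trans[OF exp_gt_zero])
  have "((\<lambda>r. - ln (?t \<eta> r) / r) \<longlongrightarrow> lyap x) at_top"
  proof (rule tendstoI)
   fix e :: real assume "0 < e"
   then obtain n where n: "1 / real (Suc n) < e" using nat_approx_posE by blast
   from elim(1)[rule_format, of n] elim(2)[rule_format, of n] eventually_gt_at_top[of 0]
   show "eventually (\<lambda>r. dist (- ln (?t \<eta> r) / r) (lyap x) < e) at_top"
   proof eventually_elim
    case (elim r)
    define h where "h = 1 / real (Suc n)"
    have "- passage \<eta> (r *\<^sub>R x) \<le> ln (?t \<eta> r)" using low[of r] pos[of r] by (simp add: ln_ge_iff)
    then have 1: "- ln (?t \<eta> r) / r \<le> lyap x + h" using elim(1,3) unfolding h_def[symmetric] by (simp add: field_simps)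
    have "ln (?t \<eta> r) \<le> - max 0 (lyap x - h) * r" using elim(2) pos[of r] unfolding h_def[symmetric] by (metis ln_exp ln_mono exp_gt_zero)
    moreover have "(lyap x - h) * r \<le> max 0 (lyap x - h) * r" using elim(3) by (intro mult_right_mono) auto
    ultimately have "(lyap x - h) * r \<le> - ln (?t \<eta> r)" by linarith
    then have "lyap x - h \<le> - ln (?t \<eta> r) / r" using elim(3) by (simp add: field_simps)
    then show ?case using 1 n unfolding h_def[symmetric] dist_real_def by linarith
   qed
  qed
  then show ?case using pos by simp
 qed
qed

text \<open>Both exponents are almost sure limits of the same travel weights along one ray, with
  \<open>r\<close> replaced by \<open>r * c\<close>. The limit over real \<open>r\<close> is what
  covers irrational factors.\<close>

lemma lyap_scale_pos:
 assumes c: "0 < c" shows "lyap (c *\<^sub>R x) = c * lyap x"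
proof (cases "x = 0")
 case False
 then have cx: "c *\<^sub>R x \<noteq> 0" using c by simp
 have "AE \<eta> in P. lyap (c *\<^sub>R x) = c * lyap x" using travel_rate[OF False] travel_rate[OF cx]
 proof eventually_elim
  case (elim \<eta>)
  let ?t = "\<lambda>r. travel_weight W Z (V \<eta>) (r *\<^sub>R x)"
  have "filterlim (\<lambda>r. r * c) at_top at_top" using c by real_asymp
  from filterlim_compose[OF conjunct2[OF elim(1)] this]
  have "((\<lambda>r. c * (- ln (?t (r * c)) / (r * c))) \<longlongrightarrow> c * lyap x) at_top" by (intro tendsto_mult tendsto_const)
  then have "((\<lambda>r. - ln (?t (r * c)) / r) \<longlongrightarrow> c * lyap x) at_top" using c by simp
  with conjunct2[OF elim(2)] show ?case by (intro tendsto_unique) auto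
 qed
 then show ?thesis by simp
qed (simp add: lyap_0)

lemma lyap_norm: "is_norm lyap" unfolding is_norm_def
proof (intro conjI allI)
 show "lyap x = 0 \<longleftrightarrow> x = 0" for x using lyap_pos[of x] lyap_0 by (metis less_irrefl)
 show "lyap (c *\<^sub>R x) = \<bar>c\<bar> * lyap x" for c x
 proof (cases c "0::real" rule: linorder_cases)
  case less
  then have "lyap ((- c) *\<^sub>R x) = - c * lyap x" by (intro lyap_scale_pos) simp
  then show ?thesis using less lyap_uminus[of "c *\<^sub>R x"] by simp
 qed (auto simp: lyap_0 lyap_scale_pos)
qed (auto intro: lyap_nonneg lyap_triangle)

lemma lyap_exponent: "is_lyapunov_exponent P W Z (lacoin \<gamma>) lyap" unfolding is_lyapunov_exponent_def
proof
 fix x :: 'a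
 show "AE \<eta> in P. ((\<lambda>r. neg_log (travel_weight W Z (\<lambda>z. lacoin \<gamma> z \<eta>) (r *\<^sub>R x)) / ereal r) \<longlongrightarrow> ereal (lyap x)) at_top"
 proof (cases "x = 0")
  case True
  have "travel_weight W Z v 0 = 1" for v
  proof -
   have "travel_weight W Z v 0 = (LINT w|W. 1)" unfolding travel_weight_def
   proof (rule Bochner_Integration.integral_cong[OF refl])
    fix w assume w: "w \<in> space W"
    have h: "hitting_time Z 0 w = 0"
    proof (rule antisym)
     show "hitting_time Z 0 w \<le> 0" using bm.hitting_time_le[of 0 w 0] bm.Z_0[OF w] by (simp add: zero_ereal_def)
     show "0 \<le> hitting_time Z 0 w" unfolding hitting_time_def by (rule INF_greatest) simp
    qed
    have "(\<integral>\<^sup>+ s\<in>{s. 0 \<le> s \<and> ereal s \<le> hitting_time Z 0 w}. v (Z s w) \<partial>lborel) = (\<integral>\<^sup>+ s. 0 \<partial>(lborel :: real measure))"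
    proof (rule nn_integral_cong_AE)
     show "AE s in lborel. v (Z s w) * indicator {s. 0 \<le> s \<and> ereal s \<le> hitting_time Z 0 w} s = 0"
      using AE_lborel_singleton[of "0::real"] by eventually_elim (auto simp: h indicator_def)
    qed
    then show "exp_neg (\<integral>\<^sup>+ s\<in>{s. 0 \<le> s \<and> ereal s \<le> hitting_time Z 0 w}. v (Z s w) \<partial>lborel) * indicator {w. hitting_time Z 0 w < \<infinity>} w = 1"
     by (simp add: h)
   qed
   then show ?thesis by (simp add: bm.prob_space)
  qed
  then show ?thesis by (simp add: True lyap_0 neg_log_def zero_ereal_def[symmetric])
 next
  case False
  from travel_rate[OF False] show ?thesis
  proof eventually_elim
   case (elim \<eta>)
   have "((\<lambda>r. ereal (- ln (travel_weight W Z (V \<eta>) (r *\<^sub>R x)) / r)) \<longlongrightarrow> ereal (lyap x)) at_top"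
    using elim by (simp only: tendsto_ereal)
   moreover have "eventually (\<lambda>r. ereal (- ln (travel_weight W Z (V \<eta>) (r *\<^sub>R x)) / r) = neg_log (travel_weight W Z (V \<eta>) (r *\<^sub>R x)) / ereal r) at_top"
    using conjunct1[OF elim] eventually_gt_at_top[of 0] by eventually_elim (simp add: neg_log_def)
   ultimately show ?case by (rule Lim_transform_eventually)
  qed
 qed
qed

end

section \<open>Rearrangements, Lorentz spaces and the supremum over a ball\<close>

lemma powr_integral_unit:
 assumes "0 < (b::real)" shows "(\<integral>\<^sup>+s\<in>{0<..<1}. ennreal (s powr (b - 1)) \<partial>lborel) < \<infinity>"
proof -
 have "(\<integral>\<^sup>+s\<in>{0<..<1}. ennreal (s powr (b - 1)) \<partial>lborel) \<le> (\<integral>\<^sup>+s\<in>{0..1}. ennreal (s powr (b - 1)) \<partial>lborel)"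
  by (intro nn_integral_mono) (auto simp: indicator_def)
 also have "\<dots> = ennreal (1 powr (b - 1 + 1) / (b - 1 + 1))"
  by (rule nn_integral_has_integral_lebesgue'[OF _ has_integral_powr_from_0]) (use assms in auto)
 finally show ?thesis by (auto intro: le_less_trans)
qed

context prob_space
begin

text \<open>The generalised inverse of the survival function of \<open>\<bar>f\<bar>\<close>, which
  is its non-increasing rearrangement.\<close>

definition quantile :: "('a \<Rightarrow> real) \<Rightarrow> real \<Rightarrow> real" where
 "quantile f s = Inf {t. 0 \<le> t \<and> prob {x \<in> space M. t < \<bar>f x\<bar>} \<le> s}"

context
 fixes f :: "'a \<Rightarrow> real" and C :: real
 assumes f [measurable]: "f \<in> borel_measurable M" and C: "1 \<le> C"
  and tail: "\<And>t. 0 \<le> t \<Longrightarrow> prob {x \<in> space M. t < \<bar>f x\<bar>} \<le> C * exp (- t)"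
begin

abbreviation survival :: "real \<Rightarrow> real" where "survival t \<equiv> prob {x \<in> space M. t < \<bar>f x\<bar>}"

lemma survival_log: "0 < s \<Longrightarrow> s < 1 \<Longrightarrow> survival (ln (C / s)) \<le> s"
 using tail[of "ln (C / s)"] C by (simp add: exp_minus field_simps)

lemma survival_bdd: "bdd_below {t. 0 \<le> t \<and> survival t \<le> s}" by (rule bdd_belowI[of _ 0]) auto

text \<open>The Galois connection between the survival function and its generalised inverse. The
  direction from left to right rests on right-continuity of the survival function, the other one is
  the definition.\<close>

lemma quantile_le_iff:
 assumes s: "0 < s" "s < 1" and t: "0 \<le> t"
 shows "quantile f s \<le> t \<longleftrightarrow> survival t \<le> s"
proof
 assume "survival t \<le> s"
 then show "quantile f s \<le> t" unfolding quantile_def using t by (intro cInf_lower survival_bdd) auto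
next
 assume q: "quantile f s \<le> t"
 have "ln (C / s) \<in> {t. 0 \<le> t \<and> survival t \<le> s}" using survival_log[OF s] s C by (simp add: le_divide_eq)
 then have ne: "{t. 0 \<le> t \<and> survival t \<le> s} \<noteq> {}" by blast
 have le: "survival u \<le> s" if tu: "t < u" for u
 proof -
  obtain v where v: "0 \<le> v" "survival v \<le> s" "v < u"
   using cInf_lessD[OF ne, of u] le_less_trans[OF q tu] unfolding quantile_def by auto
  have "survival u \<le> survival v" by (rule finite_measure_mono) (use v in auto)
  then show ?thesis using v by linarith
 qed
 have "(\<lambda>n. survival (t + 1 / real (Suc n))) \<longlonglongrightarrow> prob (\<Union>n. {x \<in> space M. t + 1 / real (Suc n) < \<bar>f x\<bar>})"
 proof (rule finite_Lim_measure_incseq)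
  show "incseq (\<lambda>n. {x \<in> space M. t + 1 / real (Suc n) < \<bar>f x\<bar>})"
   by (rule incseq_SucI) (auto intro: le_less_trans[rotated] simp: frac_le)
 qed auto
 also have "(\<Union>n. {x \<in> space M. t + 1 / real (Suc n) < \<bar>f x\<bar>}) = {x \<in> space M. t < \<bar>f x\<bar>}"
 proof (intro equalityI subsetI)
  fix x assume x: "x \<in> {x \<in> space M. t < \<bar>f x\<bar>}"
  then obtain n where "1 / real (Suc n) < \<bar>f x\<bar> - t" using nat_approx_posE[of "\<bar>f x\<bar> - t"] by auto
  then show "x \<in> (\<Union>n. {x \<in> space M. t + 1 / real (Suc n) < \<bar>f x\<bar>})" using x by (auto simp: algebra_simps)
 next
  fix x assume "x \<in> (\<Union>n. {x \<in> space M. t + 1 / real (Suc n) < \<bar>f x\<bar>})"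
  then obtain n where "x \<in> space M" "t + 1 / real (Suc n) < \<bar>f x\<bar>" by blast
  moreover have "t < t + 1 / real (Suc n)" by simp
  ultimately show "x \<in> {x \<in> space M. t < \<bar>f x\<bar>}" using less_trans by blast
 qed
 finally show "survival t \<le> s" by (rule LIMSEQ_le_const2) (use le in \<open>auto simp del: of_nat_Suc\<close>)
qed

lemma quantile_nonneg: assumes "0 < s" "s < 1" shows "0 \<le> quantile f s"
proof -
 have "ln (C / s) \<in> {t. 0 \<le> t \<and> survival t \<le> s}" using survival_log[OF assms] assms C by (simp add: le_divide_eq)
 then show ?thesis unfolding quantile_def by (intro cInf_greatest) auto
qed

lemma quantile_antimono: "0 < s \<Longrightarrow> s \<le> s' \<Longrightarrow> s' < 1 \<Longrightarrow> quantile f s' \<le> quantile f s"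
 using quantile_le_iff[of s' "quantile f s"] quantile_le_iff[of s "quantile f s"] quantile_nonneg[of s] by auto

lemma quantile_level:
 "0 \<le> t \<Longrightarrow> {s \<in> {0<..<1}. quantile f s \<le> t} = {s \<in> {0<..<1}. survival t \<le> s}" using quantile_le_iff by auto

lemma quantile_measurable: "quantile f \<in> borel_measurable (restrict_space lborel {0<..<1})"
proof (rule borel_measurableI_le)
 fix t :: real
 have "{s \<in> {0<..<1}. quantile f s \<le> t} \<in> sets borel"
 proof (cases "0 \<le> t")
  case True
  then show ?thesis unfolding quantile_level[OF True] by measurable
 next
  case False
  have "quantile f s > t" if "s \<in> {0<..<1}" for s using quantile_nonneg[of s] that False by auto
  then have "{s \<in> {0<..<1}. quantile f s \<le> t} = {}" by (auto simp: not_less[symmetric])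
  then show ?thesis by (simp only: sets.empty_sets)
 qed
 then show "{s \<in> space (restrict_space lborel {0<..<1}). quantile f s \<le> t} \<in> sets (restrict_space lborel {0<..<1})"
  by (auto simp: sets_restrict_space_iff space_restrict_space)
qed

text \<open>By the Galois connection the set where the quantile is at most \<open>t\<close> has
  length 1 minus the survival function at \<open>t\<close>, so the two distribution functions
  agree.\<close>

lemma quantile_distr: "distr (restrict_space lborel {0<..<1}) borel (quantile f) = distr M borel (\<lambda>x. \<bar>f x\<bar>)"
proof (rule cdf_unique)
 let ?U = "restrict_space lborel {0<..<1::real}"
 interpret U: prob_space ?U by (rule prob_spaceI) (simp add: space_restrict_space emeasure_restrict_space)
 note [measurable] = quantile_measurable
 show "real_distribution (distr ?U borel (quantile f))" by (auto intro!: real_distribution.intro U.prob_space_distr simp: real_distribution_axioms_def)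
 show "real_distribution (distr M borel (\<lambda>x. \<bar>f x\<bar>))" by (auto intro!: real_distribution.intro prob_space_distr simp: real_distribution_axioms_def)
 show "cdf (distr ?U borel (quantile f)) = cdf (distr M borel (\<lambda>x. \<bar>f x\<bar>))"
 proof
  fix t :: real
  have 1: "cdf (distr ?U borel (quantile f)) t = measure lborel {s \<in> {0<..<1}. quantile f s \<le> t}"
   unfolding cdf_def2
   by (subst measure_distr) (auto simp: space_restrict_space measure_restrict_space intro!: arg_cong[where f = "measure lborel"])
  have 2: "cdf (distr M borel (\<lambda>x. \<bar>f x\<bar>)) t = prob {x \<in> space M. \<bar>f x\<bar> \<le> t}"
   unfolding cdf_def2 by (subst measure_distr) (auto intro!: arg_cong[where f = prob])
  show "cdf (distr ?U borel (quantile f)) t = cdf (distr M borel (\<lambda>x. \<bar>f x\<bar>)) t"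
  proof (cases "0 \<le> t")
   case True
   have p: "survival t = 1 - prob {x \<in> space M. \<bar>f x\<bar> \<le> t}"
    by (subst prob_compl[symmetric]) (auto intro!: arg_cong[where f = prob])
   have "measure lborel {s \<in> {0<..<1}. survival t \<le> s} = 1 - survival t"
   proof (cases "survival t = 0")
    case True
    then have "{s \<in> {0<..<1}. survival t \<le> s} = {0<..<1}" by auto
    then show ?thesis using True by simp
   next
    case False
    then have "0 < survival t" using measure_nonneg[of M "{x \<in> space M. t < \<bar>f x\<bar>}"] by linarith
    then have "{s \<in> {0<..<1}. survival t \<le> s} = {survival t..<1}" by auto
    then show ?thesis using prob_le_1[of "{x \<in> space M. t < \<bar>f x\<bar>}"] by simp
   qed
   then show ?thesis unfolding 1 2 quantile_level[OF True] using p by simp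
  next
   case False
   have "quantile f s > t" if "s \<in> {0<..<1}" for s using quantile_nonneg[of s] that False by auto
   then have "{s \<in> {0<..<1}. quantile f s \<le> t} = {}" by (auto simp: not_less[symmetric])
   moreover have "{x \<in> space M. \<bar>f x\<bar> \<le> t} = {}" using False by auto
   ultimately show ?thesis unfolding 1 2 by (simp only: measure_empty)
  qed
 qed
qed

text \<open>The quantile exceeds \<open>t\<close> exactly where \<open>s\<close> is strictly below
  the survival function at \<open>t\<close>, and this persists slightly to the right of
  \<open>s\<close>; from above, monotonicity suffices.\<close>

lemma quantile_right_continuous:
 assumes s: "s \<in> {0<..<1}" shows "continuous (at_right s) (quantile f)" unfolding continuous_within
proof (rule tendstoI)
 fix e :: real assume e: "0 < e"
 define t where "t = max 0 (quantile f s - e / 2)"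
 have up: "eventually (\<lambda>s'. s < s' \<and> s' < 1) (at_right s)" using eventually_at_right_real[of s 1] s by auto
 have "eventually (\<lambda>s'. t - e / 2 < quantile f s') (at_right s)"
 proof (cases "quantile f s \<le> e / 2")
  case True
  show ?thesis using up
  proof eventually_elim
   case (elim s')
   then show ?case using quantile_nonneg[of s'] s True e by (auto simp: t_def)
  qed
 next
  case False
  then have t: "0 \<le> t" "t < quantile f s" using e by (auto simp: t_def)
  then have "s < survival t" using quantile_le_iff[of s t] s by auto
  then have "eventually (\<lambda>s'. s' < survival t) (at_right s)"
   by (rule eventually_mono[OF eventually_at_right_real]) simp
  with up show ?thesis
  proof eventually_elim
   case (elim s')
   then have "t < quantile f s'" using quantile_le_iff[of s' t] s t by (auto simp: not_le[symmetric])
   then show ?case using e by linarith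
  qed
 qed
 with up show "eventually (\<lambda>s'. dist (quantile f s') (quantile f s) < e) (at_right s)"
 proof eventually_elim
  case (elim s')
  have "quantile f s' \<le> quantile f s" by (rule quantile_antimono) (use elim s in auto)
  then show ?case using elim(2) unfolding t_def dist_real_def by linarith
 qed
qed

text \<open>An exponential tail lets the quantile grow only like \<open>ln (C / s)\<close> at 0.
  With \<open>b\<close> half of \<open>1 / real d\<close>, the logarithm is absorbed into
  \<open>s powr (- b)\<close>, which leaves the integrable power
  \<open>s powr (b - 1)\<close>.\<close>

lemma lorentz_of_exponential_tail:
 assumes d: "1 \<le> d" shows "f \<in> lorentz M d"
proof -
 have "decreasing_rearrangement M f (quantile f)" unfolding decreasing_rearrangement_def
  by (auto simp: quantile_nonneg quantile_right_continuous quantile_distr monotone_on_def intro: quantile_antimono)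
 moreover have "(\<integral>\<^sup>+ s\<in>{0<..<1}. ennreal (quantile f s * s powr (1 / real d - 1)) \<partial>lborel) < \<infinity>"
 proof -
  define b where "b = 1 / (2 * real d)"
  have b: "0 < b" "1 / real d = 2 * b" using d by (auto simp: b_def)
  have "(\<integral>\<^sup>+ s\<in>{0<..<1}. ennreal (quantile f s * s powr (1 / real d - 1)) \<partial>lborel)
   \<le> (\<integral>\<^sup>+ s. ennreal (ln C + 1 / b) * (ennreal (s powr (b - 1)) * indicator {0<..<1} s) \<partial>lborel)"
  proof (rule nn_integral_mono)
   fix s :: real
   show "ennreal (quantile f s * s powr (1 / real d - 1)) * indicator {0<..<1} s \<le> ennreal (ln C + 1 / b) * (ennreal (s powr (b - 1)) * indicator {0<..<1} s)"
   proof (cases "s \<in> {0<..<1}")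
    case True
    have "quantile f s \<le> ln (C / s)"
     using quantile_le_iff[of s "ln (C / s)"] survival_log[of s] True C by (simp add: le_divide_eq)
    also have "\<dots> = ln C - ln s" using C True by (simp add: ln_div)
    also have "- ln s \<le> 1 / b * s powr (- b)"
    proof -
     have "ln (s powr (- b)) \<le> s powr (- b) - 1" by (rule ln_le_minus_one) (use True in auto)
     then have "- ln s * b \<le> s powr (- b)" using True by (simp add: ln_powr mult.commute)
     then show ?thesis using b(1) by (simp add: field_simps)
    qed
    then have "ln C - ln s \<le> ln C * 1 + 1 / b * s powr (- b)" by simp
    also have "\<dots> \<le> ln C * s powr (- b) + 1 / b * s powr (- b)"
    proof -
     have "s powr 0 \<le> s powr (- b)" using True b(1) by (intro powr_mono') auto
     then show ?thesis using C True by (intro add_right_mono mult_left_mono) auto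
    qed
    finally have "quantile f s * s powr (2 * b - 1) \<le> ((ln C + 1 / b) * s powr (- b)) * s powr (2 * b - 1)"
     by (intro mult_right_mono) (auto simp: distrib_right)
    also have "\<dots> = (ln C + 1 / b) * s powr (b - 1)" by (simp add: mult.assoc powr_add[symmetric])
    finally have "ennreal (quantile f s * s powr (2 * b - 1)) \<le> ennreal ((ln C + 1 / b) * s powr (b - 1))" by (rule ennreal_leI)
    also have "\<dots> = ennreal (ln C + 1 / b) * ennreal (s powr (b - 1))" by (rule ennreal_mult) (use C b in auto)
    finally show ?thesis using True by (simp only: b(2)) simp
   qed simp
  qed
  also have "\<dots> = ennreal (ln C + 1 / b) * (\<integral>\<^sup>+ s\<in>{0<..<1}. ennreal (s powr (b - 1)) \<partial>lborel)" by (rule nn_integral_cmult) measurable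
  also have "\<dots> < \<infinity>" using powr_integral_unit[OF b(1)] by (simp add: ennreal_mult_less_top)
  finally show ?thesis .
 qed
 ultimately show ?thesis unfolding lorentz_def by auto
qed

end

end

context lacoin_env
begin

lemma sup_lacoin_measurable: "(\<lambda>\<eta>. SUP x\<in>ball 0 1. lacoin \<gamma> x \<eta>) \<in> borel_measurable P"
proof -
 obtain D :: "'a set" where D: "countable D" "\<And>x r z. z \<in> ball x r \<Longrightarrow> \<exists>X. (\<forall>k. X k \<in> ball x r \<inter> D) \<and> X \<longlonglongrightarrow> z"
  using countable_dense_limits by blast
 have "(SUP x\<in>ball 0 1. lacoin \<gamma> x \<eta>) = (SUP x\<in>ball 0 1 \<inter> D. lacoin \<gamma> x \<eta>)" for \<eta>
 proof (rule antisym)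
  show "(SUP x\<in>ball 0 1. lacoin \<gamma> x \<eta>) \<le> (SUP x\<in>ball 0 1 \<inter> D. lacoin \<gamma> x \<eta>)"
  proof (rule SUP_least)
   fix x :: 'a assume "x \<in> ball 0 1"
   from D(2)[OF this] obtain X where X: "\<And>k. X k \<in> ball 0 1 \<inter> D" "X \<longlonglongrightarrow> x" by blast
   have "lacoin \<gamma> x \<eta> \<le> liminf (\<lambda>k. lacoin \<gamma> (X k) \<eta>)" using lsc_lacoin X(2) unfolding lsc_def by blast
   also have "\<dots> \<le> (SUP x\<in>ball 0 1 \<inter> D. lacoin \<gamma> x \<eta>)"
    by (rule Liminf_le) (use X(1) in \<open>auto intro!: always_eventually SUP_upper\<close>)
   finally show "lacoin \<gamma> x \<eta> \<le> (SUP x\<in>ball 0 1 \<inter> D. lacoin \<gamma> x \<eta>)" .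
  qed
 qed (rule SUP_subset_mono, auto)
 moreover have "(\<lambda>\<eta>. SUP x\<in>ball 0 1 \<inter> D. lacoin \<gamma> x \<eta>) \<in> borel_measurable P"
  by (rule borel_measurable_SUP) (use D(1) in \<open>auto intro!: borel_measurable_lacoin simp: measurable_cong_sets[OF refl sets_P[symmetric]]\<close>)
 ultimately show ?thesis by simp
qed

lemma sup_lacoin_le: "\<eta> \<in> configs \<Longrightarrow> (SUP x\<in>ball 0 1. lacoin \<gamma> x \<eta>) \<le> far_field 1 0 \<eta>"
 by (rule SUP_least) (rule lacoin_le_far_field, auto)

lemma sup_lacoin_finite: "AE \<eta> in P. (SUP x\<in>ball 0 1. lacoin \<gamma> x \<eta>) < \<infinity>"
proof -
 have "(\<integral>\<^sup>+\<eta>. far_field 1 0 \<eta> \<partial>P) \<noteq> \<infinity>" using far_field_mean[of 1 0] by (auto simp: top_unique)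
 from nn_integral_PInf_AE[OF far_field_measurable this] AE_space show ?thesis
 proof eventually_elim
  case (elim \<eta>)
  then show ?case using sup_lacoin_le[of \<eta>] by (auto simp: less_top intro: le_less_trans)
 qed
qed

lemma sup_lacoin_lorentz: "(\<lambda>\<eta>. enn2real (SUP x\<in>ball 0 1. lacoin \<gamma> x \<eta>)) \<in> lorentz P DIM('a)"
proof (rule lorentz_of_exponential_tail)
 show "(\<lambda>\<eta>. enn2real (SUP x\<in>ball 0 1. lacoin \<gamma> x \<eta>)) \<in> borel_measurable P"
  using sup_lacoin_measurable by measurable
 show "1 \<le> exp (far_mean 1 0)" using far_mean_nonneg[of 1 0] by simp
 fix t :: real assume t: "0 \<le> t"
 have "prob {\<eta> \<in> space P. t < \<bar>enn2real (SUP x\<in>ball 0 1. lacoin \<gamma> x \<eta>)\<bar>} \<le> prob {\<eta> \<in> space P. ennreal t < far_field 1 0 \<eta>}"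
 proof (rule finite_measure_mono)
  show "{\<eta> \<in> space P. t < \<bar>enn2real (SUP x\<in>ball 0 1. lacoin \<gamma> x \<eta>)\<bar>} \<subseteq> {\<eta> \<in> space P. ennreal t < far_field 1 0 \<eta>}"
  proof clarify
   fix \<eta> assume w: "\<eta> \<in> space P" "t < \<bar>enn2real (SUP x\<in>ball 0 1. lacoin \<gamma> x \<eta>)\<bar>"
   then have "ennreal t < (SUP x\<in>ball 0 1. lacoin \<gamma> x \<eta>)"
    using t by (cases "SUP x\<in>ball 0 1. lacoin \<gamma> x \<eta>") (auto simp: ennreal_less_iff)
   also have "\<dots> \<le> far_field 1 0 \<eta>" using w(1) by (intro sup_lacoin_le) simp
   finally show "ennreal t < far_field 1 0 \<eta>" .
  qed
 qed measurable
 also have "\<dots> \<le> exp (far_mean 1 0 - t)" using far_field_tail[of 1 t 0] t by (simp add: emeasure_eq_measure)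
 finally show "prob {\<eta> \<in> space P. t < \<bar>enn2real (SUP x\<in>ball 0 1. lacoin \<gamma> x \<eta>)\<bar>} \<le> exp (far_mean 1 0) * exp (- t)"
  by (simp add: exp_diff exp_minus divide_inverse)
qed (use DIM_positive[where 'a = 'a] in linarith)

end

section \<open>Regions of thick potential\<close>

context lacoin_env
begin

lemma occupied_ball:
 assumes p: "(y, r) \<in> \<eta>" "y \<in> cell z" "1 \<le> r" "r < 2"
 shows "ball y 1 \<subseteq> {x. 2 powr (- \<gamma>) \<le> lacoin \<gamma> x \<eta>} \<inter> ball z (real DIM('a) + 2)"
proof
 fix x assume x: "x \<in> ball y 1"
 have "2 powr (- \<gamma>) \<le> r powr (- \<gamma>)" using p \<gamma>_pos by (intro powr_mono2') auto
 then have "ennreal (2 powr (- \<gamma>)) \<le> ennreal (r powr (- \<gamma>))" by (rule ennreal_leI)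
 also have "\<dots> \<le> lacoin \<gamma> x \<eta>" by (rule lacoin_ge_point[OF p(1)]) (use x p in auto)
 finally have "ennreal (2 powr (- \<gamma>)) \<le> lacoin \<gamma> x \<eta>" .
 moreover have "dist z x < real DIM('a) + 2"
  using cell_near[OF p(2)] dist_triangle[of z x y] x by (simp add: dist_norm)
 ultimately show "x \<in> {x. 2 powr (- \<gamma>) \<le> lacoin \<gamma> x \<eta>} \<inter> ball z (real DIM('a) + 2)" by simp
qed

lemma power_geometric_summable:
 assumes "0 \<le> q" "q < (1::real)" shows "summable (\<lambda>m. real m ^ d * q ^ m)"
proof (cases "q = 0")
 case True
 then show ?thesis by (intro summable_finite[of "{0}"]) auto
next
 case False
 then have q: "0 < q" using assms by simp
 show ?thesis
 proof (rule summable_comparison_test_bigo)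
  show "summable (\<lambda>m. norm (sqrt q ^ m))" using q assms by (simp add: summable_geometric)
  have "(\<lambda>m. real m powr real d * exp (ln q * real m)) \<in> O(\<lambda>m. exp (ln (sqrt q) * real m))"
   using q assms by (simp add: ln_sqrt) real_asymp
  moreover have "eventually (\<lambda>m. real m powr real d * exp (ln q * real m) = real m ^ d * q ^ m) sequentially"
   using eventually_gt_at_top[of 0] by eventually_elim (use q in \<open>simp add: powr_realpow exp_of_nat2_mult\<close>)
  moreover have "exp (ln (sqrt q) * real m) = sqrt q ^ m" for m using q by (simp add: exp_of_nat2_mult)
  ultimately show "(\<lambda>m. real m ^ d * q ^ m) \<in> O(\<lambda>m. sqrt q ^ m)" by (simp only: landau_o.big.in_cong)
 qed
qed

text \<open>Walk along a coordinate axis to the first lattice cell that holds a point with radius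
  between 1 and 2; the unit ball around that point has potential at least
  \<open>2 powr (- \<gamma>)\<close>. Occupation of different cells is independent, so the distance
  walked has a geometric tail and all moments.\<close>

lemma thick_points:
 "\<exists>\<rho>>0. \<exists>\<epsilon>>0. \<exists>u :: ('a \<times> real) set \<Rightarrow> 'a. u \<in> borel_measurable P \<and>
   (AE \<eta> in P. emeasure lborel ({x. lacoin \<gamma> x \<eta> > ennreal \<epsilon>} \<inter> ball (u \<eta>) \<rho>) > ennreal \<epsilon>) \<and>
   integrable P (\<lambda>\<eta>. norm (u \<eta>) ^ DIM('a))"
proof -
 obtain e :: 'a where e: "e \<in> Basis" using nonempty_Basis by blast
 define c where "c j = cell (real j *\<^sub>R e)" for j
 define occ where "occ j \<eta> \<longleftrightarrow> npoints (c j \<times> {1..<2}) \<eta> \<noteq> 0" for j and \<eta> :: "('a \<times> real) set"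
 define n where "n \<eta> = (LEAST j. occ j \<eta>)" for \<eta>
 \<comment> \<open>The factor of \<open>annealed_cells\<close> for \<open>\<epsilon> = 1\<close> and
   the window from 1 to 2. Its integrand equals 1 on \<open>N m\<close>, hence the geometric
   bound.\<close>
 define q where "q = exp (- 1) + (1 - exp (- 1)) * exp (- (1 powr (- \<delta>) - 2 powr (- \<delta>)))"
 have cm: "c j \<times> {1..<2::real} \<in> sets borel" for j by (auto simp: c_def borel_prod[symmetric])
 have occ_m [measurable]: "Measurable.pred P (occ j)" for j
 proof -
  note [measurable] = measurable_npoints_P[OF cm]
  show ?thesis unfolding occ_def[abs_def] by measurable
 qed
 have n_m [measurable]: "n \<in> measurable P (count_space UNIV)" unfolding n_def[abs_def] by measurable
 have q: "0 \<le> q" "q < 1"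
 proof -
  have "2 powr (- \<delta>) < 1 powr (- \<delta>)" using \<delta>_pos by (intro powr_less_mono2_neg) auto
  then have "(1 - exp (- 1)) * exp (- (1 powr (- \<delta>) - 2 powr (- \<delta>))) < (1 - exp (- 1)) * 1"
   by (intro mult_strict_left_mono) auto
  then have "q < exp (- 1) + (1 - exp (- 1)) * 1" unfolding q_def by (rule add_strict_left_mono)
  then show "q < 1" by simp
  show "0 \<le> q" unfolding q_def by (intro add_nonneg_nonneg mult_nonneg_nonneg) auto
 qed
 define N where "N m = {\<eta> \<in> space P. \<forall>j<m. \<not> occ j \<eta>}" for m
 define N' where "N' = {\<eta> \<in> space P. \<forall>j. \<not> occ j \<eta>}"
 have Nm: "N m \<in> events" "N' \<in> events" for m unfolding N_def N'_def by measurable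
 have none: "emeasure P (N m) \<le> ennreal (q ^ m)" for m
 proof -
  have "emeasure P (N m) = (\<integral>\<^sup>+\<eta>. indicator (N m) \<eta> \<partial>P)" by (rule nn_integral_indicator[symmetric, OF Nm(1)])
  also have "\<dots> \<le> (\<integral>\<^sup>+\<eta>. ennreal (exp_neg (\<Sum>j<m. if npoints (cell (real j *\<^sub>R e) \<times> {1..<2}) \<eta> = 0 then 0 else ennreal 1)) \<partial>P)"
   by (intro nn_integral_mono) (auto simp: N_def indicator_def occ_def c_def)
  also have "\<dots> = ennreal (q ^ card {..<m})"
   unfolding q_def by (rule annealed_cells) (use e in \<open>auto simp: cell_def\<close>)
  finally show ?thesis by simp
 qed
 have "AE \<eta> in P. \<exists>j. occ j \<eta>"
 proof -
  have "emeasure P N' \<le> ennreal (q ^ m)" for m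
  proof -
   have "emeasure P N' \<le> emeasure P (N m)" by (rule emeasure_mono[OF _ Nm(1)]) (auto simp: N_def N'_def)
   then show ?thesis using none[of m] by (rule order_trans)
  qed
  moreover have "(\<lambda>m. ennreal (q ^ m)) \<longlonglongrightarrow> ennreal 0" by (intro tendsto_ennrealI LIMSEQ_realpow_zero q)
  ultimately have "emeasure P N' \<le> ennreal 0" by (intro LIMSEQ_le_const) auto
  then have "emeasure P N' = 0" by simp
  then show ?thesis by (rule AE_I[OF _ _ Nm(2), rotated]) (auto simp: N'_def)
 qed
 then have thick: "AE \<eta> in P. emeasure lborel ({x. lacoin \<gamma> x \<eta> > ennreal \<epsilon>} \<inter> ball (real (n \<eta>) *\<^sub>R e) (real DIM('a) + 2)) > ennreal \<epsilon>"
  if \<epsilon>: "0 < \<epsilon>" "\<epsilon> < 2 powr (- \<gamma>)" "\<epsilon> < unit_ball_vol (real DIM('a))" for \<epsilon> using AE_space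
 proof eventually_elim
  case (elim \<eta>)
  then have "occ (n \<eta>) \<eta>" unfolding n_def by (auto intro: LeastI)
  then obtain y r where yr: "(y, r) \<in> \<eta>" "y \<in> cell (real (n \<eta>) *\<^sub>R e)" "1 \<le> r" "r < 2"
   using npoints_pos[of "c (n \<eta>) \<times> {1..<2}" \<eta>] by (auto simp: occ_def c_def)
  have "ennreal \<epsilon> < ennreal (unit_ball_vol (real DIM('a)))" using \<epsilon> by (simp add: ennreal_less_iff)
  also have "\<dots> = emeasure lborel (ball y 1)" by (simp add: emeasure_ball)
  also have "\<dots> \<le> emeasure lborel ({x. lacoin \<gamma> x \<eta> > ennreal \<epsilon>} \<inter> ball (real (n \<eta>) *\<^sub>R e) (real DIM('a) + 2))"
  proof (rule emeasure_mono)
   have "ennreal \<epsilon> < ennreal (2 powr (- \<gamma>))" using \<epsilon> by (simp add: ennreal_less_iff)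
   then show "ball y 1 \<subseteq> {x. lacoin \<gamma> x \<eta> > ennreal \<epsilon>} \<inter> ball (real (n \<eta>) *\<^sub>R e) (real DIM('a) + 2)"
    using occupied_ball[OF yr] by (auto intro: less_le_trans)
   have [measurable]: "(\<lambda>x. lacoin \<gamma> x \<eta>) \<in> borel_measurable borel"
    by (rule borel_measurable_lacoin) (use elim(2) in auto)
   show "{x. lacoin \<gamma> x \<eta> > ennreal \<epsilon>} \<inter> ball (real (n \<eta>) *\<^sub>R e) (real DIM('a) + 2) \<in> sets lborel" by measurable
  qed
  finally show ?case .
 qed
 have "(\<integral>\<^sup>+\<eta>. ennreal (real (n \<eta>) ^ DIM('a)) \<partial>P) < \<infinity>"
 proof -
  let ?d = "DIM('a)"
  have "(\<integral>\<^sup>+\<eta>. ennreal (real (n \<eta>) ^ ?d) \<partial>P) \<le> (\<integral>\<^sup>+\<eta>. (\<Sum>m. ennreal (real m ^ ?d) * indicator (N m) \<eta>) \<partial>P)"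
  proof (rule nn_integral_mono)
   fix \<eta> assume "\<eta> \<in> space P"
   then have "\<eta> \<in> N (n \<eta>)" by (auto simp: N_def n_def dest: not_less_Least)
   then show "ennreal (real (n \<eta>) ^ ?d) \<le> (\<Sum>m. ennreal (real m ^ ?d) * indicator (N m) \<eta>)"
    using sum_le_suminf[of "\<lambda>m. ennreal (real m ^ ?d) * indicator (N m) \<eta>" "{n \<eta>}"] by simp
  qed
  also have "\<dots> = (\<Sum>m. ennreal (real m ^ ?d) * emeasure P (N m))"
   using Nm(1) by (subst nn_integral_suminf) (auto simp: nn_integral_cmult_indicator)
  also have "\<dots> \<le> (\<Sum>m. ennreal (real m ^ ?d * q ^ m))"
   using none q by (intro suminf_le) (auto simp: ennreal_mult intro!: mult_left_mono)
  also have "\<dots> = ennreal (\<Sum>m. real m ^ ?d * q ^ m)"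
   by (rule suminf_ennreal2) (use q power_geometric_summable in auto)
  finally show ?thesis by (auto intro: le_less_trans)
 qed
 then have int: "integrable P (\<lambda>\<eta>. norm (real (n \<eta>) *\<^sub>R e) ^ DIM('a))"
  using e by (intro integrableI_bounded) auto
 define \<epsilon> where "\<epsilon> = min (2 powr (- \<gamma>)) (unit_ball_vol (real DIM('a))) / 2"
 have \<epsilon>: "0 < \<epsilon>" "\<epsilon> < 2 powr (- \<gamma>)" "\<epsilon> < unit_ball_vol (real DIM('a))"
 proof -
  have "0 < min (2 powr (- \<gamma>)) (unit_ball_vol (real DIM('a)))" by simp
  then show "0 < \<epsilon>" "\<epsilon> < 2 powr (- \<gamma>)" "\<epsilon> < unit_ball_vol (real DIM('a))" unfolding \<epsilon>_def by linarith+
 qed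
 have "(\<lambda>\<eta>. real (n \<eta>) *\<^sub>R e) \<in> borel_measurable P" by measurable
 moreover have "0 < real DIM('a) + 2" by linarith
 ultimately show ?thesis using thick[OF \<epsilon>] int \<epsilon>(1)
  by (intro exI[of _ "real DIM('a) + 2"] conjI exI[of _ \<epsilon>] exI[of _ "\<lambda>\<eta>. real (n \<eta>) *\<^sub>R e"])
qed

end

section \<open>Bump functions and the principal eigenvalue\<close>

text \<open>\<open>flat 1\<close> is the classical smooth cutoff; carrying a polynomial in
  \<open>1 / t\<close> makes the family closed under differentiation.\<close>

definition flat :: "real poly \<Rightarrow> real \<Rightarrow> real" where
 "flat p t = (if 0 < t then poly p (1 / t) * exp (- 1 / t) else 0)"

lemma poly_times_exp: "((\<lambda>y::real. poly p y * exp (- y)) \<longlongrightarrow> 0) at_top"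
proof -
 have "((\<lambda>y. \<Sum>i\<le>degree p. coeff p i * (y ^ i / exp y)) \<longlongrightarrow> (\<Sum>i\<le>degree p. coeff p i * 0)) at_top"
  by (intro tendsto_sum tendsto_mult tendsto_const tendsto_power_div_exp_0)
 then show ?thesis by (simp add: poly_altdef sum_distrib_right exp_minus divide_inverse mult.assoc)
qed

text \<open>Away from 0 this is the product rule, where the inner derivative of \<open>1 / t\<close>
  produces the factor \<open>[:0, 0, 1:]\<close>. At 0 the exponential beats the polynomial, so the
  difference quotients tend to 0 from both sides.\<close>

lemma flat_deriv: "(flat p has_real_derivative flat ([:0, 0, 1:] * (p - pderiv p)) t) (at t)"
proof (cases t "0::real" rule: linorder_cases)
 case greater
 have "((\<lambda>t. poly p (1 / t) * exp (- 1 / t)) has_real_derivative flat ([:0, 0, 1:] * (p - pderiv p)) t) (at t)"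
  using greater by (auto intro!: derivative_eq_intros simp: flat_def field_simps power2_eq_square)
 then show ?thesis
  by (rule has_field_derivative_transform_within_open[where S = "{0<..}"]) (use greater in \<open>auto simp: flat_def\<close>)
next
 case less
 have "((\<lambda>t. 0) has_real_derivative flat ([:0, 0, 1:] * (p - pderiv p)) t) (at t)"
  using less by (simp add: flat_def)
 then show ?thesis
  by (rule has_field_derivative_transform_within_open[where S = "{..<0}"]) (use less in \<open>auto simp: flat_def\<close>)
next
 case equal
 have "((\<lambda>h. flat p h / h) \<longlongrightarrow> 0) (at_right 0)"
 proof (rule Lim_transform_eventually)
  have "filterlim (\<lambda>h::real. 1 / h) at_top (at_right 0)" by real_asymp
  from filterlim_compose[OF poly_times_exp[of "[:0, 1:] * p"] this]
  show "((\<lambda>h. poly ([:0, 1:] * p) (1 / h) * exp (- (1 / h))) \<longlongrightarrow> 0) (at_right 0)" .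
  show "eventually (\<lambda>h. poly ([:0, 1:] * p) (1 / h) * exp (- (1 / h)) = flat p h / h) (at_right 0)"
   using eventually_at_right_less[of "0::real"] by eventually_elim (simp add: flat_def)
 qed
 moreover have "((\<lambda>h. flat p h / h) \<longlongrightarrow> 0) (at_left 0)"
 proof (rule Lim_transform_eventually)
  show "((\<lambda>_. 0::real) \<longlongrightarrow> 0) (at_left (0::real))" by simp
  show "eventually (\<lambda>h. 0 = flat p h / h) (at_left 0)" unfolding eventually_at_filter by (auto simp: flat_def)
 qed
 ultimately have "((\<lambda>h. (flat p (0 + h) - flat p 0) / h) \<longlongrightarrow> 0) (at 0)"
  by (simp add: filterlim_at_split flat_def)
 then show ?thesis using equal by (simp add: DERIV_def flat_def)
qed

text \<open>An algebra of functions containing the bumps and closed under partial derivatives.\<close>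

inductive_set bump_algebra :: "'a::euclidean_space \<Rightarrow> real \<Rightarrow> ('a \<Rightarrow> real) set" for z a where
 flat: "(\<lambda>x. flat p (1 - a * ((x - z) \<bullet> (x - z)))) \<in> bump_algebra z a"
| const: "(\<lambda>x. c) \<in> bump_algebra z a"
| linear: "(\<lambda>x. (x - z) \<bullet> b) \<in> bump_algebra z a"
| plus: "f \<in> bump_algebra z a \<Longrightarrow> g \<in> bump_algebra z a \<Longrightarrow> (\<lambda>x. f x + g x) \<in> bump_algebra z a"
| times: "f \<in> bump_algebra z a \<Longrightarrow> g \<in> bump_algebra z a \<Longrightarrow> (\<lambda>x. f x * g x) \<in> bump_algebra z a"

lemma flat_norm_deriv:
 "((\<lambda>x. flat p (1 - a * ((x - z) \<bullet> (x - z)))) has_derivative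
  (\<lambda>b. flat ([:0, 0, 1:] * (p - pderiv p)) (1 - a * ((x - z) \<bullet> (x - z))) * ((- 2 * a) * ((x - z) \<bullet> b)))) (at x)"
proof -
 have "((\<lambda>x. 1 - a * ((x - z) \<bullet> (x - z))) has_derivative (\<lambda>b. (- 2 * a) * ((x - z) \<bullet> b))) (at x)"
  by (auto intro!: derivative_eq_intros simp: inner_commute)
 from has_derivative_compose[OF this flat_deriv[THEN has_field_derivative_imp_has_derivative], of p]
 show ?thesis by simp
qed

lemma bump_algebra_deriv:
 "f \<in> bump_algebra z a \<Longrightarrow> \<exists>f'. (\<forall>x. (f has_derivative f' x) (at x)) \<and> (\<forall>b. (\<lambda>x. f' x b) \<in> bump_algebra z a)"
proof (induction rule: bump_algebra.induct)
 case (flat p)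
 show ?case by (rule exI, rule conjI, rule allI, rule flat_norm_deriv) (intro allI bump_algebra.intros)
next
 case (const c)
 show ?case by (rule exI[of _ "\<lambda>x b. 0"]) (auto intro: bump_algebra.intros)
next
 case (linear b)
 show ?case by (rule exI[of _ "\<lambda>x h. h \<bullet> b"]) (auto intro!: derivative_eq_intros bump_algebra.intros)
next
 case (plus f g)
 then obtain f' g' where "\<forall>x. (f has_derivative f' x) (at x)" "\<forall>b. (\<lambda>x. f' x b) \<in> bump_algebra z a"
  "\<forall>x. (g has_derivative g' x) (at x)" "\<forall>b. (\<lambda>x. g' x b) \<in> bump_algebra z a" by blast
 then show ?case
  by (intro exI[of _ "\<lambda>x b. f' x b + g' x b"]) (auto intro: bump_algebra.intros has_derivative_add)
next
 case (times f g)
 then obtain f' g' where d: "\<forall>x. (f has_derivative f' x) (at x)" "\<forall>b. (\<lambda>x. f' x b) \<in> bump_algebra z a"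
  "\<forall>x. (g has_derivative g' x) (at x)" "\<forall>b. (\<lambda>x. g' x b) \<in> bump_algebra z a" by blast
 have "((\<lambda>x. f x * g x) has_derivative (\<lambda>b. f x * g' x b + f' x b * g x)) (at x)" for x
  using has_derivative_mult[OF d(1)[rule_format] d(3)[rule_format]] .
 moreover have "(\<lambda>x. f x * g' x b + f' x b * g x) \<in> bump_algebra z a" for b
  by (rule bump_algebra.plus[OF bump_algebra.times[OF times.hyps(1) d(4)[rule_format]] bump_algebra.times[OF d(2)[rule_format] times.hyps(2)]])
 ultimately show ?case by (intro exI[of _ "\<lambda>x b. f x * g' x b + f' x b * g x"]) blast
qed

lemma bump_algebra_smooth: "f \<in> bump_algebra z a \<Longrightarrow> continuously_differentiable k f"
proof (induction k arbitrary: f)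
 case 0
 obtain f' where "\<forall>x. (f has_derivative f' x) (at x)" using bump_algebra_deriv[OF 0] by blast
 then have "\<forall>x. isCont f x" using has_derivative_continuous by blast
 then show ?case by (simp add: continuous_on_eq_continuous_at)
next
 case (Suc k)
 obtain f' where f': "\<forall>x. (f has_derivative f' x) (at x)" "\<forall>b. (\<lambda>x. f' x b) \<in> bump_algebra z a"
  using bump_algebra_deriv[OF Suc.prems] by blast
 have "frechet_derivative f (at x) = f' x" for x using f'(1) by (simp add: frechet_derivative_at[symmetric])
 then show ?case using f' Suc.IH by (auto simp: differentiable_def)
qed

text \<open>This function is the derivative of \<open>flat 1\<close>; the bound comes from
  \<open>y\<^sup>2 \<le> 2 * exp y\<close> with \<open>y = 1 / t\<close>.\<close>

lemma flat_square_le: "\<bar>flat [:0, 0, 1:] t\<bar> \<le> 2"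
proof (cases "0 < t")
 case True
 define y where "y = 1 / t"
 have "0 \<le> y" using True by (simp add: y_def)
 then have "y\<^sup>2 \<le> 2 * exp y" using exp_lower_Taylor_quadratic[of y] by linarith
 then have "y\<^sup>2 * exp (- y) \<le> 2 * exp y * exp (- y)" by (rule mult_right_mono) simp
 then have "(1 / t)\<^sup>2 * exp (- (1 / t)) \<le> 2" unfolding y_def[symmetric] mult.assoc exp_minus_inverse by simp
 then show ?thesis using True by (simp add: flat_def power2_eq_square)
qed (simp add: flat_def)

lemma gradient_cmult_flat:
 "norm (gradient (\<lambda>x. c * flat 1 (1 - a * ((x - z) \<bullet> (x - z)))) x) \<le> 4 * \<bar>c\<bar> * \<bar>a\<bar> * norm (x - z)"
proof -
 let ?k = "c * flat [:0, 0, 1:] (1 - a * ((x - z) \<bullet> (x - z))) * (- 2 * a)"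
 have "((\<lambda>x. c * flat 1 (1 - a * ((x - z) \<bullet> (x - z)))) has_derivative (\<lambda>b. ?k * ((x - z) \<bullet> b))) (at x)"
  using has_derivative_mult_right[OF flat_norm_deriv[of 1 a z x], of c] by (simp add: mult.assoc)
 from frechet_derivative_at[OF this]
 have "gradient (\<lambda>x. c * flat 1 (1 - a * ((x - z) \<bullet> (x - z)))) x = (\<Sum>b\<in>Basis. (?k * ((x - z) \<bullet> b)) *\<^sub>R b)"
  unfolding gradient_def by (simp add: fun_eq_iff)
 also have "\<dots> = ?k *\<^sub>R (x - z)"
  unfolding scaleR_scaleR[symmetric] scaleR_sum_right[symmetric] euclidean_representation ..
 finally have "norm (gradient (\<lambda>x. c * flat 1 (1 - a * ((x - z) \<bullet> (x - z)))) x) = \<bar>?k\<bar> * norm (x - z)" by simp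
 moreover have "\<bar>?k\<bar> \<le> 4 * \<bar>c\<bar> * \<bar>a\<bar>"
 proof -
  have "\<bar>c\<bar> * \<bar>flat [:0, 0, 1:] (1 - a * ((x - z) \<bullet> (x - z)))\<bar> * (2 * \<bar>a\<bar>) \<le> \<bar>c\<bar> * 2 * (2 * \<bar>a\<bar>)"
   by (intro mult_right_mono mult_left_mono flat_square_le) auto
  then show ?thesis by (simp add: abs_mult)
 qed
 ultimately show ?thesis by (simp add: mult_right_mono)
qed

text \<open>The test function is a normalised bump supported in the ball. Its gradient is of order
  \<open>1 / \<rho>\<close>, and its mass is bounded below on the ball of half the radius, whose
  volume accounts for \<open>2 ^ DIM('a)\<close>.\<close>

lemma principal_eigenvalue_le:
 fixes z :: "'a::euclidean_space"
 assumes \<rho>: "0 < \<rho>" and \<epsilon>: "0 \<le> \<epsilon>" and v: "\<And>x. x \<in> cball z \<rho> \<Longrightarrow> v x \<le> ennreal \<epsilon>"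
 shows "principal_eigenvalue v \<le> ennreal (8 * exp 3 * 2 ^ DIM('a) / \<rho>\<^sup>2 + \<epsilon>)"
proof -
 define a where "a = 1 / \<rho>\<^sup>2"
 define h where "h x = flat 1 (1 - a * ((x - z) \<bullet> (x - z)))" for x
 have a: "0 < a" using \<rho> by (simp add: a_def)
 have h_range: "0 \<le> h x" "h x \<le> 1" for x by (auto simp: h_def flat_def)
 have h_out: "h x = 0" if "x \<notin> cball z \<rho>" for x
 proof -
  have "\<rho>\<^sup>2 \<le> (norm (x - z))\<^sup>2" using that \<rho> by (intro power_mono) (auto simp: dist_norm norm_minus_commute)
  then show ?thesis using \<rho> by (simp add: h_def flat_def a_def power2_norm_eq_inner field_simps)
 qed
 \<comment> \<open>On the half ball the argument of \<open>flat\<close> is at least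
   \<open>3 / 4\<close>; the weaker bound \<open>2 / 3\<close> gives the round constant
   \<open>exp (- 3)\<close> after squaring.\<close>
 have h_in: "exp (- 3) \<le> (h x)\<^sup>2" if "x \<in> cball z (\<rho> / 2)" for x
 proof -
  have "(norm (x - z))\<^sup>2 \<le> (\<rho> / 2)\<^sup>2" using that by (intro power_mono) (auto simp: dist_norm norm_minus_commute)
  then have "4 * ((x - z) \<bullet> (x - z)) \<le> \<rho>\<^sup>2" by (simp add: power2_norm_eq_inner power_divide)
  then have "3 * ((x - z) \<bullet> (x - z)) \<le> \<rho>\<^sup>2" using inner_ge_zero[of "x - z"] by linarith
  then have t: "2 / 3 \<le> 1 - a * ((x - z) \<bullet> (x - z))" using \<rho> by (simp add: a_def field_simps)
  then have "1 / (1 - a * ((x - z) \<bullet> (x - z))) \<le> 1 / (2 / 3)" by (intro divide_left_mono) auto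
  then have "exp (- (3 / 2)) \<le> h x" using t by (simp add: h_def flat_def)
  then have "(exp (- (3 / 2)))\<^sup>2 \<le> (h x)\<^sup>2" by (intro power_mono) auto
  then show ?thesis by (simp add: power2_eq_square exp_add[symmetric])
 qed
 have h_alg: "(\<lambda>x. c * h x) \<in> bump_algebra z a" for c unfolding h_def by (intro bump_algebra.intros)
 have "continuous_on UNIV h" using bump_algebra_smooth[OF h_alg[of 1], of 0] by simp
 then have hm [measurable]: "h \<in> borel_measurable borel" by (rule borel_measurable_continuous_onI)
 define B where "B = measure lborel (cball z \<rho>)"
 have fin: "emeasure lborel (cball z r) < \<infinity>" for r using emeasure_lborel_cball_finite[of z r] by simp
 have B: "emeasure lborel (cball z \<rho>) = ennreal B" "0 < B"
  using \<rho> fin[of \<rho>] by (auto simp: B_def content_cball_pos intro!: emeasure_eq_ennreal_measure)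
 have int_cball: "integrable lborel (indicator (cball z r) :: 'a \<Rightarrow> real)" for r
  by (rule integrable_real_indicator) (use fin in auto)
 have int: "integrable lborel (\<lambda>x. (h x)\<^sup>2)"
 proof (rule Bochner_Integration.integrable_bound)
  show "integrable lborel (indicator (cball z \<rho>) :: 'a \<Rightarrow> real)" by (rule int_cball)
  show "AE x in lborel. norm ((h x)\<^sup>2) \<le> norm (indicator (cball z \<rho>) x :: real)"
   using h_range h_out by (intro AE_I2) (auto simp: indicator_def power_le_one)
 qed simp
 define I where "I = (LINT x|lborel. (h x)\<^sup>2)"
 have I: "exp (- 3) * (B / 2 ^ DIM('a)) \<le> I"
 proof -
  have "measure lborel (cball z (\<rho> / 2)) = B / 2 ^ DIM('a)"
   using \<rho> by (simp add: B_def content_cball power_divide)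
  then have "exp (- 3) * (B / 2 ^ DIM('a)) = (LINT x|lborel. exp (- 3) * indicator (cball z (\<rho> / 2)) x)" by simp
  also have "\<dots> \<le> I"
   unfolding I_def by (rule integral_mono[OF integrable_mult_right[OF int_cball] int]) (use h_in in \<open>auto simp: indicator_def\<close>)
  finally show ?thesis .
 qed
 have I0: "0 < I" using I B(2) by (meson divide_pos_pos exp_gt_zero less_le_trans mult_pos_pos zero_less_numeral zero_less_power)
 define c where "c = 1 / sqrt I"
 have c: "c\<^sup>2 = 1 / I" "0 < c" using I0 by (auto simp: c_def power_divide)
 define \<phi> where "\<phi> x = c * h x" for x
 have "{x. \<phi> x \<noteq> 0} \<subseteq> cball z \<rho>" using h_out unfolding \<phi>_def by force
 then have "compact (closure {x. \<phi> x \<noteq> 0})" unfolding compact_closure using bounded_cball bounded_subset by blast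
 then have "\<phi> \<in> test_functions"
  unfolding test_functions_def \<phi>_def[abs_def] using bump_algebra_smooth[OF h_alg[of c]] by simp
 moreover have nrm: "(LINT x|lborel. (\<phi> x)\<^sup>2) = 1"
  using I0 by (simp add: \<phi>_def power_mult_distrib c I_def[symmetric])
 ultimately have "principal_eigenvalue v \<le> (\<integral>\<^sup>+ x. ennreal ((norm (gradient \<phi> x))\<^sup>2 / 2) + v x * ennreal ((\<phi> x)\<^sup>2) \<partial>lborel)"
  unfolding principal_eigenvalue_def by (intro INF_lower) simp
 also have "\<dots> \<le> (\<integral>\<^sup>+ x. ennreal (8 * c\<^sup>2 / \<rho>\<^sup>2) * indicator (cball z \<rho>) x + ennreal \<epsilon> * ennreal ((\<phi> x)\<^sup>2) \<partial>lborel)"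
 proof (intro nn_integral_mono add_mono)
  fix x :: 'a
  show "ennreal ((norm (gradient \<phi> x))\<^sup>2 / 2) \<le> ennreal (8 * c\<^sup>2 / \<rho>\<^sup>2) * indicator (cball z \<rho>) x"
  proof (cases "x \<in> cball z \<rho>")
   case True
   have "norm (gradient \<phi> x) \<le> 4 * \<bar>c\<bar> * \<bar>a\<bar> * norm (x - z)"
    unfolding \<phi>_def[abs_def] h_def by (rule gradient_cmult_flat)
   also have "\<dots> \<le> 4 * \<bar>c\<bar> * \<bar>a\<bar> * \<rho>" using True by (intro mult_left_mono) (auto simp: dist_norm norm_minus_commute)
   also have "\<dots> = 4 * c / \<rho>" using c(2) \<rho> by (simp add: a_def power2_eq_square)
   finally have "(norm (gradient \<phi> x))\<^sup>2 \<le> (4 * c / \<rho>)\<^sup>2" by (intro power_mono) auto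
   then show ?thesis using True by (simp add: power_divide power_mult_distrib ennreal_leI)
  next
   case False
   have "\<forall>y\<in>- cball z \<rho>. \<phi> y = 0" using h_out by (simp add: \<phi>_def)
   then have "(\<phi> has_derivative (\<lambda>_. 0)) (at x)"
    by (intro has_derivative_transform_within_open[OF has_derivative_const, where s = "- cball z \<rho>"]) (use False in auto)
   then have "gradient \<phi> x = 0" unfolding gradient_def using frechet_derivative_at by (metis (no_types, lifting) scaleR_zero_left sum.neutral)
   then show ?thesis using False by simp
  qed
  show "v x * ennreal ((\<phi> x)\<^sup>2) \<le> ennreal \<epsilon> * ennreal ((\<phi> x)\<^sup>2)"
   by (cases "x \<in> cball z \<rho>") (auto intro!: mult_right_mono v simp: h_out \<phi>_def)
 qed
 also have "\<dots> = ennreal (8 * c\<^sup>2 / \<rho>\<^sup>2) * ennreal B + ennreal \<epsilon> * (\<integral>\<^sup>+ x. ennreal ((\<phi> x)\<^sup>2) \<partial>lborel)"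
  unfolding \<phi>_def by (subst nn_integral_add) (auto simp: nn_integral_cmult B(1))
 also have "(\<integral>\<^sup>+ x. ennreal ((\<phi> x)\<^sup>2) \<partial>lborel) = ennreal (LINT x|lborel. (\<phi> x)\<^sup>2)"
  by (rule nn_integral_eq_integral) (use int in \<open>auto simp: \<phi>_def power_mult_distrib\<close>)
 also have "ennreal (8 * c\<^sup>2 / \<rho>\<^sup>2) * ennreal B + ennreal \<epsilon> * ennreal (LINT x|lborel. (\<phi> x)\<^sup>2) = ennreal (8 * (c\<^sup>2 * B) / \<rho>\<^sup>2 + \<epsilon>)"
  unfolding nrm using B(2) \<epsilon> by (simp add: ennreal_mult[symmetric] ennreal_plus[symmetric] del: ennreal_plus)
 also have "\<dots> \<le> ennreal (8 * exp 3 * 2 ^ DIM('a) / \<rho>\<^sup>2 + \<epsilon>)"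
 proof (intro ennreal_leI add_right_mono divide_right_mono)
  have "c\<^sup>2 * B \<le> exp 3 * 2 ^ DIM('a)" using I I0 unfolding c(1) by (simp add: exp_minus field_simps)
  then show "8 * (c\<^sup>2 * B) \<le> 8 * exp 3 * 2 ^ DIM('a)" by simp
 qed simp
 finally show ?thesis .
qed

section \<open>Large quiet balls\<close>

context lacoin_env
begin

text \<open>Emptiness of the first \<open>K\<close> shells and smallness of the field of the others
  depend on disjoint sets of points, hence are independent. The first has positive probability by
  the Poisson law, the second by the tail bound.\<close>

lemma quiet_prob:
 assumes \<rho>: "0 < \<rho>" and \<epsilon>: "0 < \<epsilon>"
 obtains K where "0 < prob {\<eta> \<in> space P. (\<forall>n<K. npoints (shell \<rho> n) \<eta> = 0) \<and> far_field \<rho> K \<eta> \<le> ennreal \<epsilon>}"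
proof -
 \<comment> \<open>The tail bound \<open>exp (far_mean \<rho> K - \<epsilon>)\<close> says something
   at level \<epsilon> only if it is below 1.\<close>
 obtain K where K: "far_mean \<rho> K < \<epsilon>" using far_mean_small[OF less_imp_le[OF \<rho>] \<epsilon>] by blast
 let ?N = "\<lambda>n. npoints (shell \<rho> n)" and ?M = "\<lambda>I. PiM I (\<lambda>_. count_space UNIV) :: (nat \<Rightarrow> enat) measure"
 let ?X = "{\<eta> \<in> configs. \<forall>n<K. ?N n \<eta> = 0}" and ?Y = "{\<eta> \<in> configs. far_field \<rho> K \<eta> \<le> ennreal \<epsilon>}"
 let ?f = "\<lambda>I \<eta>. \<lambda>n\<in>I. ?N n \<eta>"
 define D where "D = (\<Union>n<K. shell \<rho> n)"
 have D: "D \<in> sets borel" unfolding D_def by auto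
 define C where "C = {v \<in> space (?M {..<K}). \<forall>n\<in>{..<K}. v n = 0}"
 define C' where "C' = {v \<in> space (?M {K..}). (\<Sum>n. if n < K then 0 else ennreal (weight K n) * ennreal_of_enat (v n)) \<le> ennreal \<epsilon>}"
 have C: "C \<in> sets (?M {..<K})" unfolding C_def by (rule sets.sets_Collect_finite_All) measurable
 have C': "C' \<in> sets (?M {K..})"
 proof -
  have [measurable]: "(\<lambda>v. if n < K then 0 else ennreal (weight K n) * ennreal_of_enat (v n)) \<in> borel_measurable (?M {K..})" for n
   by (cases "n < K") auto
  show ?thesis unfolding C'_def by measurable
 qed
 have near: "?f {..<K} -` C \<inter> configs = ?X" by (auto simp: C_def space_PiM)
 have far: "?f {K..} -` C' \<inter> configs = ?Y"
 proof -
  have "(\<Sum>n. if n < K then 0 else ennreal (weight K n) * ennreal_of_enat (?f {K..} \<eta> n)) = far_field \<rho> K \<eta>" for \<eta>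
   unfolding far_field_def by (rule suminf_cong) (simp add: weight_def)
  then show ?thesis by (auto simp: C'_def space_PiM)
 qed
 have "range (shell \<rho>) \<subseteq> sets borel" by auto
 from indep_npoints[OF this shells_disjoint]
 have "indep_var (?M {..<K}) (?f {..<K}) (?M {K..}) (?f {K..})" by (rule indep_var_restrict) auto
 from indep_varD[OF this C C']
 have "prob ((?f {..<K} -` C \<inter> configs) \<inter> (?f {K..} -` C' \<inter> configs)) = prob (?f {..<K} -` C \<inter> configs) * prob (?f {K..} -` C' \<inter> configs)"
  by (simp add: vimage_def Int_def conj_ac)
 then have eq: "prob (?X \<inter> ?Y) = prob ?X * prob ?Y" unfolding near far .
 have "emeasure \<Lambda> D \<le> (\<Sum>n<K. emeasure \<Lambda> (shell \<rho> n))"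
  unfolding D_def by (rule emeasure_subadditive_finite) (auto simp only: sets_intensity intro!: shell_measurable)
 also have "\<dots> < \<infinity>" using shell_finite \<rho> by (simp add: less_top)
 finally have "prob {\<eta> \<in> space P. npoints D \<eta> = enat 0} = exp (- measure \<Lambda> D)"
  by (subst prob_npoints[OF D]) auto
 moreover have "npoints D \<eta> = enat 0 \<longleftrightarrow> (\<forall>n<K. ?N n \<eta> = 0)" for \<eta>
 proof -
  have "npoints A \<eta> = 0 \<longleftrightarrow> \<eta> \<inter> A = {}" for A :: "('a \<times> real) set" by (auto simp: npoints_def zero_enat_def)
  then show ?thesis unfolding D_def zero_enat_def[symmetric] by simp blast
 qed
 ultimately have "0 < prob ?X" by simp
 moreover have "0 < prob ?Y"
 proof -
  have "prob {\<eta> \<in> space P. ennreal \<epsilon> < far_field \<rho> K \<eta>} \<le> exp (far_mean \<rho> K - \<epsilon>)"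
   using far_field_tail[of \<rho> \<epsilon> K] \<rho> \<epsilon> by (simp add: emeasure_eq_measure)
  also have "\<dots> < 1" using K by simp
  also have "{\<eta> \<in> space P. ennreal \<epsilon> < far_field \<rho> K \<eta>} = space P - ?Y" by auto
  finally have "prob (space P - ?Y) < 1" .
  moreover have "?Y \<in> events" by (simp only: space_P[symmetric]) measurable
  ultimately show ?thesis using prob_compl by (simp only: space_P)
 qed
 moreover have "{\<eta> \<in> space P. (\<forall>n<K. ?N n \<eta> = 0) \<and> far_field \<rho> K \<eta> \<le> ennreal \<epsilon>} = ?X \<inter> ?Y" by auto
 ultimately show thesis by (intro that[of K]) (simp only: eq mult_pos_pos)
qed

lemma quiet_ball:
 assumes \<rho>: "0 < \<rho>" and \<epsilon>: "0 < \<epsilon>"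
 shows "AE \<eta> in P. \<exists>z. \<forall>x\<in>cball z \<rho>. lacoin \<gamma> x \<eta> \<le> ennreal \<epsilon>"
proof -
 obtain K where K: "0 < prob {\<eta> \<in> space P. (\<forall>n<K. npoints (shell \<rho> n) \<eta> = 0) \<and> far_field \<rho> K \<eta> \<le> ennreal \<epsilon>}"
  by (rule quiet_prob[OF assms])
 define E where "E = {\<eta> \<in> space P. (\<forall>n<K. npoints (shell \<rho> n) \<eta> = 0) \<and> far_field \<rho> K \<eta> \<le> ennreal \<epsilon>}"
 have E: "E \<in> events"
 proof -
  note [measurable] = measurable_npoints_P[OF shell_measurable]
  show ?thesis unfolding E_def by measurable
 qed
 obtain e :: 'a where e: "e \<in> Basis" using nonempty_Basis by blast
 then have "e \<noteq> 0" by auto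
 then interpret T: ergodic_map P "move 1 e" by (rule move_ergodic)
 \<comment> \<open>A union over all forward shifts contains its preimage by construction, and it has
   at least the probability of \<open>E\<close>; the zero-one law leaves only probability 1.\<close>
 define A where "A = (\<Union>n. (move 1 e ^^ n) -` E \<inter> space P)"
 have A: "A \<in> events" unfolding A_def by (intro sets.countable_UN image_subsetI measurable_sets[OF T.measurable_T_pow E])
 have "prob A = 0 \<or> prob A = 1"
 proof (rule T.zero_one[OF A])
  show "AE \<eta> in P. move 1 e \<eta> \<in> A \<longrightarrow> \<eta> \<in> A"
  proof (rule AE_I2, rule impI)
   fix \<eta> assume w: "\<eta> \<in> space P" "move 1 e \<eta> \<in> A"
   then obtain n where "(move 1 e ^^ n) (move 1 e \<eta>) \<in> E" unfolding A_def by auto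
   then have "(move 1 e ^^ Suc n) \<eta> \<in> E" by (simp add: funpow_swap1)
   then show "\<eta> \<in> A" using w(1) unfolding A_def by blast
  qed
 qed
 moreover have "prob E \<le> prob A"
 proof (rule finite_measure_mono[OF _ A])
  have "(move 1 e ^^ 0) -` E \<inter> space P \<subseteq> A" unfolding A_def by blast
  then show "E \<subseteq> A" unfolding E_def by auto
 qed
 ultimately have "prob A = 1" using K by (simp add: E_def)
 then have "AE \<eta> in P. \<eta> \<in> A" using A by (simp add: AE_in_set_eq_1)
 then show ?thesis
 proof eventually_elim
  case (elim \<eta>)
  then obtain n where n: "move 1 (real n *\<^sub>R e) \<eta> \<in> E" unfolding A_def by (auto simp: move_funpow)
  have "lacoin \<gamma> x \<eta> \<le> ennreal \<epsilon>" if "x \<in> cball (real n *\<^sub>R e) \<rho>" for x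
  proof -
   have "lacoin \<gamma> x \<eta> = lacoin \<gamma> (x - real n *\<^sub>R e) (move 1 (real n *\<^sub>R e) \<eta>)" by (simp add: lacoin_move)
   also have "\<dots> \<le> far_field \<rho> K (move 1 (real n *\<^sub>R e) \<eta>)"
    by (rule lacoin_le_far_field) (use n that in \<open>auto simp: E_def dist_norm norm_minus_commute\<close>)
   also have "\<dots> \<le> ennreal \<epsilon>" using n by (simp add: E_def)
   finally show ?thesis .
  qed
  then show ?case by blast
 qed
qed

lemma principal_eigenvalue_zero: "AE \<eta> in P. principal_eigenvalue (\<lambda>x. lacoin \<gamma> x \<eta>) = 0"
proof -
 have "AE \<eta> in P. \<forall>k::nat. \<exists>z. \<forall>x\<in>cball z (real (Suc k)). lacoin \<gamma> x \<eta> \<le> ennreal (1 / real (Suc k))"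
  unfolding AE_all_countable by (intro allI quiet_ball) auto
 then show ?thesis
 proof eventually_elim
  case (elim \<eta>)
  have "principal_eigenvalue (\<lambda>x. lacoin \<gamma> x \<eta>) \<le> ennreal (8 * exp 3 * 2 ^ DIM('a) / (real (Suc k))\<^sup>2 + 1 / real (Suc k))" for k
  proof -
   obtain z where "\<And>x. x \<in> cball z (real (Suc k)) \<Longrightarrow> lacoin \<gamma> x \<eta> \<le> ennreal (1 / real (Suc k))" using elim by blast
   then show ?thesis by (intro principal_eigenvalue_le) auto
  qed
  moreover have "(\<lambda>k. ennreal (8 * exp 3 * 2 ^ DIM('a) / (real (Suc k))\<^sup>2 + 1 / real (Suc k))) \<longlonglongrightarrow> ennreal 0"
   by (rule tendsto_ennrealI) real_asymp
  ultimately have "principal_eigenvalue (\<lambda>x. lacoin \<gamma> x \<eta>) \<le> ennreal 0" by (intro LIMSEQ_le_const) auto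
  then show ?case by simp
 qed
qed

end

lemma lacoin_inf_zero: "(INF \<eta>\<in>configs. lacoin \<gamma> (0 :: 'a::euclidean_space) \<eta>) = 0"
proof -
 have "({} :: ('a \<times> real) set) \<in> configs" by (simp add: configs_def)
 from INF_lower[OF this, of "lacoin \<gamma> 0"] show ?thesis by (simp add: lacoin_def nn_integral_count_space_finite)
qed

theorem proposition4p3:
  fixes \<delta> \<gamma> :: real
    and \<nu> :: "real measure"
    and P :: "((real ^ 'n) \<times> real) set measure"
    and W :: "'w measure"
    and Z :: "real \<Rightarrow> 'w \<Rightarrow> real ^ 'n"
  assumes "\<delta> > 0" and "\<gamma> > 0" and "\<gamma> + \<delta> - real CARD('n) > 0"
    and "radius_law \<delta> \<nu>"
    and "poisson_process (lborel \<Otimes>\<^sub>M \<nu>) P"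
    and "brownian_motion W Z"
  shows
    "((AE \<omega> in P. (SUP x\<in>ball 0 1. lacoin \<gamma> x \<omega>) < \<infinity>) \<and>
      (\<lambda>\<omega>. enn2real (SUP x\<in>ball 0 1. lacoin \<gamma> x \<omega>)) \<in> lorentz P CARD('n)) \<and>
     (\<exists>\<rho>>0. \<exists>\<epsilon>>0. \<exists>u :: ((real ^ 'n) \<times> real) set \<Rightarrow> real ^ 'n.
        u \<in> borel_measurable P \<and>
        (AE \<omega> in P. emeasure lborel ({x. lacoin \<gamma> x \<omega> > ennreal \<epsilon>} \<inter> ball (u \<omega>) \<rho>) > ennreal \<epsilon>) \<and>
        integrable P (\<lambda>\<omega>. norm (u \<omega>) ^ CARD('n))) \<and>
     ((AE \<omega> in P. principal_eigenvalue (\<lambda>x. lacoin \<gamma> x \<omega>) = 0) \<and>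
      (INF \<omega>\<in>configs. lacoin \<gamma> (0 :: real ^ 'n) \<omega>) = 0) \<and>
     (\<exists>\<alpha>. is_lyapunov_exponent P W Z (lacoin \<gamma>) \<alpha> \<and> is_norm \<alpha>)"
proof -
  interpret radii: prob_space \<nu> using assms(4) by (simp add: radius_law_def)
  interpret lacoin_bm \<nu> P \<delta> \<gamma> W Z
  proof unfold_locales
    show "sets \<nu> = sets borel" using assms(4) by (simp add: radius_law_def)
    show "measure \<nu> {r..} = r powr (- \<delta>)" if "1 \<le> r" for r using assms(4) that by (simp add: radius_law_def)
    show "0 < \<gamma> + \<delta> - real DIM(real ^ 'n)" using assms(3) by simp
  qed (fact assms)+
  have D: "DIM(real ^ 'n) = CARD('n)" by simp
  show ?thesis
    using env.sup_lacoin_finite env.sup_lacoin_lorentz env.thick_points env.principal_eigenvalue_zero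
      lacoin_inf_zero lyap_exponent lyap_norm unfolding D by blast
qed

end
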